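(* Let $(Z,d,\mu)$ and $Q$ be as in the context. Let $0 < s_0,\,s_1 < 1$, $Q/(Q+s_0) < p_0 \leq \infty$, $Q/(Q+s_1) < p_1 \leq \infty$, $0 < q_0,\,q_1 \leq \infty$, with $\min(p_0,p_1) < \infty$ and $\min(q_0,q_1) < \infty$. For $0 < \theta < 1$ define $s,p,q$ by \[ \frac1p = \frac{1-\theta}{p_0} + \frac{\theta}{p_1},\quad \frac1q = \frac{1-\theta}{q_0} + \frac{\theta}{q_1},\quad s = (1-\theta)s_0 + \theta s_1. \] Then \[ \big[\dot{\mathcal B}^{s_0}_{p_0,q_0}(Z), \dot{\mathcal B}^{s_1}_{p_1,q_1}(Z)\big]_\theta = \dot{\mathcal B}^{s}_{p,q}(Z) \] with equivalent quasi-norms.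
   Context: $(Z,d,\mu)$ is a (bounded or unbounded) metric measure space, $\mu$ Borel regular, every ball has positive finite measure, and $\mu$ is doubling: $\mu(B(\xi,2r)) \le c\,\mu(B(\xi,r))$ for all $\xi\in Z$, $r>0$. Fix constants $C\ge1$, $Q>0$ with $\mu(B(\xi,\lambda r)) \le C\lambda^Q\mu(B(\xi,r))$ for all $\xi\in Z$, $r>0$, $\lambda\ge1$. Hyperbolic filling: for each $n\in\mathbb Z$ let $(\xi_x)_{x\in X_n}$ be a maximal set of points of $Z$ with pairwise distances at least $2^{-n-1}$; $X=\bigsqcup_n X_n$, $|x|:=n$ for $x\in X_n$, $B(x):=B(\xi_x,2^{-n})$. Distinct $x,x'\in X$ are neighbors, $x\sim x'$, iff $B(x)\cap B(x')\ne\emptyset$ and $||x|-|x'||\le1$. For $u:X\to\mathbb C$, $|du(x)| := \big(\sum_{x'\sim x}|u(x')-u(x)|^2\big)^{1/2}$. For $0<s<\infty$, $0<p,q\le\infty$, $\mathcal I^s_{p,q}(X)$ is the space of $u:X\to\mathbb C$ with $\|u\|_{\mathcal I^s_{p,q}(X)} := \big(\sum_{k\in\mathbb Z}2^{ksq}\|\sum_{x\in X_k}|u(x)|\chi_{B(x)}\|_{L^p(Z)}^q\big)^{1/q}<\infty$ (usual modification for $p$ or $q=\infty$). For $f\in L^1_{\rm loc}(Z)$ (locally integrable, i.e. integrable on bounded sets), $Pf(x):=\frac{1}{\mu(B(x))}\int_{B(x)}f\,d\mu$. For $0<s<\infty$, $Q/(Q+s)<p\le\infty$, $0<q\le\infty$,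 the Besov space $\dot{\mathcal B}^s_{p,q}(Z)$ consists of $f\in L^1_{\rm loc}(Z)$ with $\|f\|_{\dot{\mathcal B}^s_{p,q}(Z)}:=\|\,|d(Pf)|\,\|_{\mathcal I^s_{p,q}(X)}<\infty$, taken modulo functions that are a.e. constant. $[\cdot,\cdot]_\theta$ denotes the complex interpolation method, extended to analytically convex (A-convex) quasi-Banach spaces in the sense of Kalton et al. *)

theory Defs
  imports "HOL-Analysis.Analysis" "HOL-Probability.Probability"
begin

definition epowr :: "ennreal \<Rightarrow> real \<Rightarrow> ennreal" where
  "epowr x a = (if x = \<infinity> then \<infinity> else ennreal (enn2real x powr a))"

definition doubling_mms :: "'z::metric_space measure \<Rightarrow> real \<Rightarrow> bool" where
  "doubling_mms M c \<longleftrightarrow> sets M = sets borel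
     \<and> (\<forall>\<xi> r. r > 0 \<longrightarrow> 0 < emeasure M (ball \<xi> r) \<and> emeasure M (ball \<xi> r) < \<infinity>)
     \<and> (\<forall>\<xi> r. r > 0 \<longrightarrow> emeasure M (ball \<xi> (2*r)) \<le> ennreal c * emeasure M (ball \<xi> r))"

definition dim_const :: "'z::metric_space measure \<Rightarrow> real \<Rightarrow> real \<Rightarrow> bool" where
  "dim_const M C Q \<longleftrightarrow> C \<ge> 1 \<and> Q > 0 \<and>
     (\<forall>\<xi> r l. r > 0 \<longrightarrow> l \<ge> 1 \<longrightarrow>
        emeasure M (ball \<xi> (l*r)) \<le> ennreal (C * l powr Q) * emeasure M (ball \<xi> r))"

definition separated :: "real \<Rightarrow> 'z::metric_space set \<Rightarrow> bool" where
  "separated \<delta> Y \<longleftrightarrow> (\<forall>\<xi>\<in>Y. \<forall>\<eta>\<in>Y. \<xi> \<noteq> \<eta> \<longrightarrow> dist \<xi> \<eta> \<ge> \<delta>)"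

text \<open>Xs n is a maximal set of points with pairwise distances at least 2^(-n-1).
  A vertex of the filling X is a pair (n, xi) with xi in Xs n; |(n,xi)| = n.\<close>
definition hyp_filling :: "(int \<Rightarrow> 'z::metric_space set) \<Rightarrow> bool" where
  "hyp_filling Xs \<longleftrightarrow> (\<forall>n. separated (2 powr (- real_of_int n - 1)) (Xs n) \<and>
      (\<forall>Y. Xs n \<subseteq> Y \<longrightarrow> separated (2 powr (- real_of_int n - 1)) Y \<longrightarrow> Y = Xs n))"

definition vertices :: "(int \<Rightarrow> 'z::metric_space set) \<Rightarrow> (int \<times> 'z) set" where
  "vertices Xs = {(n, \<xi>). \<xi> \<in> Xs n}"

definition Bx :: "int \<times> 'z::metric_space \<Rightarrow> 'z set" where
  "Bx x = ball (snd x) (2 powr (- real_of_int (fst x)))"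

definition neighbors :: "(int \<Rightarrow> 'z::metric_space set) \<Rightarrow> int \<times> 'z \<Rightarrow> (int \<times> 'z) set" where
  "neighbors Xs x = {x'. x' \<in> vertices Xs \<and> x' \<noteq> x \<and> Bx x \<inter> Bx x' \<noteq> {}
                        \<and> \<bar>fst x - fst x'\<bar> \<le> 1}"

text \<open>|du(x)|  (the neighbor sets are finite under doubling)\<close>
definition absd :: "(int \<Rightarrow> 'z::metric_space set) \<Rightarrow> (int \<times> 'z \<Rightarrow> complex) \<Rightarrow> int \<times> 'z \<Rightarrow> real" where
  "absd Xs u x = sqrt (\<Sum>x'\<in>neighbors Xs x. (cmod (u x' - u x))\<^sup>2)"

definition Lp_qnorm :: "'z measure \<Rightarrow> ennreal \<Rightarrow> ('z \<Rightarrow> real) \<Rightarrow> ennreal" where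
  "Lp_qnorm M p g = (if p = \<infinity> then esssup M (\<lambda>\<zeta>. ennreal (g \<zeta>))
     else epowr (\<integral>\<^sup>+ \<zeta>. ennreal (g \<zeta> powr enn2real p) \<partial>M) (1 / enn2real p))"

text \<open>The function  sum over x in X_k of |u(x)| chi_B(x) (a locally finite sum).\<close>
definition layer :: "(int \<Rightarrow> 'z::metric_space set) \<Rightarrow> (int \<times> 'z \<Rightarrow> real) \<Rightarrow> int \<Rightarrow> 'z \<Rightarrow> real" where
  "layer Xs u k \<zeta> = (\<Sum>\<xi>\<in>{\<xi>\<in>Xs k. \<zeta> \<in> Bx (k, \<xi>)}. \<bar>u (k, \<xi>)\<bar>)"

definition I_qnorm :: "'z::metric_space measure \<Rightarrow> (int \<Rightarrow> 'z set) \<Rightarrow> real \<Rightarrow> ennreal \<Rightarrow> ennreal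
     \<Rightarrow> (int \<times> 'z \<Rightarrow> real) \<Rightarrow> ennreal" where
  "I_qnorm M Xs s p q u = (if q = \<infinity>
      then (SUP k. ennreal (2 powr (real_of_int k * s)) * Lp_qnorm M p (layer Xs u k))
      else epowr (\<integral>\<^sup>+ k. epowr (ennreal (2 powr (real_of_int k * s)) * Lp_qnorm M p (layer Xs u k))
                                  (enn2real q) \<partial>count_space UNIV) (1 / enn2real q))"

definition loc_int :: "'z::metric_space measure \<Rightarrow> ('z \<Rightarrow> complex) \<Rightarrow> bool" where
  "loc_int M f \<longleftrightarrow> f \<in> borel_measurable M \<and>
     (\<forall>B. B \<in> sets M \<longrightarrow> bounded B \<longrightarrow> set_integrable M B f)"

definition Pavg :: "'z::metric_space measure \<Rightarrow> ('z \<Rightarrow> complex) \<Rightarrow> int \<times> 'z \<Rightarrow> complex" where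
  "Pavg M f x = (LINT \<zeta>:Bx x|M. f \<zeta>) / complex_of_real (measure M (Bx x))"

text \<open>Besov quasi-norm ||f||_{B^s_{p,q}} (infinity if f not in the space).\<close>
definition besov_qnorm :: "'z::metric_space measure \<Rightarrow> (int \<Rightarrow> 'z set) \<Rightarrow> real \<Rightarrow> ennreal \<Rightarrow> ennreal
     \<Rightarrow> ('z \<Rightarrow> complex) \<Rightarrow> ennreal" where
  "besov_qnorm M Xs s p q f = I_qnorm M Xs s p q (absd Xs (Pavg M f))"

text \<open>Ambient space: locally integrable functions modulo a.e. constants; the two
  spaces are given by quasi-norms n0, n1 (value infinity outside the space).\<close>

definition ae_const :: "'z measure \<Rightarrow> ('z \<Rightarrow> complex) \<Rightarrow> bool" where
  "ae_const M g \<longleftrightarrow> (\<exists>c. AE \<zeta> in M. g \<zeta> = c)"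

definition sum_qnorm :: "'z::metric_space measure \<Rightarrow> (('z \<Rightarrow> complex) \<Rightarrow> ennreal) \<Rightarrow> (('z \<Rightarrow> complex) \<Rightarrow> ennreal)
     \<Rightarrow> ('z \<Rightarrow> complex) \<Rightarrow> ennreal" where
  "sum_qnorm M n0 n1 f = (INF g \<in> {g. loc_int M (fst g) \<and> loc_int M (snd g) \<and>
        (\<forall>\<zeta>. f \<zeta> = fst g \<zeta> + snd g \<zeta>)}. n0 (fst g) + n1 (snd g))"

definition strip :: "complex set" where
  "strip = {z. 0 < Re z \<and> Re z < 1}"

definition cstrip :: "complex set" where
  "cstrip = {z. 0 \<le> Re z \<and> Re z \<le> 1}"

definition qanalytic_on :: "(('z::metric_space \<Rightarrow> complex) \<Rightarrow> ennreal) \<Rightarrow> (complex \<Rightarrow> 'z \<Rightarrow> complex)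
     \<Rightarrow> complex set \<Rightarrow> bool" where
  "qanalytic_on N F U \<longleftrightarrow> (\<forall>z0\<in>U. \<exists>r>0. \<exists>a::nat \<Rightarrow> 'z \<Rightarrow> complex. (\<forall>k. N (a k) < \<infinity>) \<and>
      ball z0 r \<subseteq> U \<and>
      ((\<lambda>m. SUP z \<in> ball z0 r. N (\<lambda>\<zeta>. F z \<zeta> - (\<Sum>k<m. (z - z0)^k * a k \<zeta>))) \<longlonglongrightarrow> 0))"

definition qcontinuous_on :: "(('z::metric_space \<Rightarrow> complex) \<Rightarrow> ennreal) \<Rightarrow> ('b::topological_space \<Rightarrow> 'z \<Rightarrow> complex)
     \<Rightarrow> 'b set \<Rightarrow> bool" where
  "qcontinuous_on N F U \<longleftrightarrow> (\<forall>z\<in>U. ((\<lambda>w. N (\<lambda>\<zeta>. F w \<zeta> - F z \<zeta>)) \<longlongrightarrow> 0) (at z within U))"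

definition admissible :: "'z::metric_space measure \<Rightarrow> (('z \<Rightarrow> complex) \<Rightarrow> ennreal) \<Rightarrow> (('z \<Rightarrow> complex) \<Rightarrow> ennreal)
     \<Rightarrow> (complex \<Rightarrow> 'z \<Rightarrow> complex) \<Rightarrow> bool" where
  "admissible M n0 n1 F \<longleftrightarrow>
     (\<forall>z\<in>cstrip. loc_int M (F z)) \<and>
     (SUP z \<in> cstrip. sum_qnorm M n0 n1 (F z)) < \<infinity> \<and>
     qcontinuous_on (sum_qnorm M n0 n1) F cstrip \<and>
     qanalytic_on (sum_qnorm M n0 n1) F strip \<and>
     (SUP t. n0 (F (\<i> * complex_of_real t))) < \<infinity> \<and>
     (SUP t. n1 (F (1 + \<i> * complex_of_real t))) < \<infinity> \<and>
     qcontinuous_on n0 (\<lambda>t::real. F (\<i> * complex_of_real t)) UNIV \<and>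
     qcontinuous_on n1 (\<lambda>t::real. F (1 + \<i> * complex_of_real t)) UNIV"

definition adm_qnorm :: "(('z::metric_space \<Rightarrow> complex) \<Rightarrow> ennreal) \<Rightarrow> (('z \<Rightarrow> complex) \<Rightarrow> ennreal)
     \<Rightarrow> (complex \<Rightarrow> 'z \<Rightarrow> complex) \<Rightarrow> ennreal" where
  "adm_qnorm n0 n1 F = max (SUP t. n0 (F (\<i> * complex_of_real t)))
                           (SUP t. n1 (F (1 + \<i> * complex_of_real t)))"

text \<open>Quasi-norm of f in [X0,X1]_theta (infinity if f is not in that space);
  f(theta) is taken modulo a.e. constants.\<close>
definition cinterp_qnorm :: "'z::metric_space measure \<Rightarrow> (('z \<Rightarrow> complex) \<Rightarrow> ennreal) \<Rightarrow> (('z \<Rightarrow> complex) \<Rightarrow> ennreal)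
     \<Rightarrow> real \<Rightarrow> ('z \<Rightarrow> complex) \<Rightarrow> ennreal" where
  "cinterp_qnorm M n0 n1 \<theta> f = (INF F \<in> {F. admissible M n0 n1 F \<and>
        ae_const M (\<lambda>\<zeta>. F (complex_of_real \<theta>) \<zeta> - f \<zeta>)}. adm_qnorm n0 n1 F)"

end

theory Submission
  imports Defs "HOL-Complex_Analysis.Complex_Analysis" "HOL-Real_Asymp.Real_Asymp"
begin

text \<open>Assign to a function \<open>f\<close> the differences of its ball averages along the edges of the filling. Up to
  constants this identifies each Besov space with a retract of a weighted mixed sequence space on
  the edges: a synthesis operator, built from a partition of unity and converging modulo constants,
  recovers \<open>f\<close> a.e. from these differences, and its kernel decays geometrically in the levels in both
  directions as soon as \<open>Q * (1 / p - 1) < s < 1\<close>.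

  For one inclusion, the edge differences of an admissible family are bounded scalar holomorphic functions
  on the strip, and a three lines inequality for mixed sequence quasi-norms applies. It rests on the
  maximum principle for \<open>\<Sum>k\<^sub>e \<bar>f\<^sub>e\<bar>\<^sup>r\<close> with arbitrary \<open>r > 0\<close>, hence needs no duality. For the other inclusion,
  Calderon's factorization \<open>\<bar>a\<bar> = m0 powr (1 - \<theta>) * m1 powr \<theta>\<close> of the edge differences gives the family
  \<open>sgn a * m0 powr (1 - z) * m1 powr z\<close>, whose synthesis is admissible. Factoring \<open>\<bar>a\<bar> * v\<close> in place of \<open>\<bar>a\<bar>\<close>,
  with a weight \<open>v\<close> that tends to infinity along the edges, and dividing both factors by \<open>v\<close>
  gives continuity in quasi-norm up to the boundary even when one of the exponents is infinite.\<close>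

section \<open>Weighted mixed sequence quasi-norms\<close>

text \<open>The admissible exponents are decided by two ranges of levels. The synthesis functions
  are only Lipschitz, so an edge acts on averages \<open>j\<close> levels finer with a gain
  \<open>2^(-j)\<close>, to be weighed against \<open>2^(j*s)\<close>; this asks for
  \<open>s < 1\<close>, and so does the flattening of the smoothings \<open>Tn n f\<close> on
  bounded sets as \<open>n\<close> tends to minus infinity. An edge \<open>j\<close> levels finer
  than a ball acts on it through its integral; for \<open>p < 1\<close> the passage from sums of
  masses to sums of p-th powers loses a volume ratio of order \<open>2^(j*Q*(1/p - 1))\<close>,
  which \<open>2^(-j*s)\<close> has to beat. The quasi-norms vanish on constants, hence synthesis is
  recentred at a base ball and reconstruction is an identity up to a constant. Admissible families
  must be continuous in the endpoint quasi-norms along both boundary lines. With an infinite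
  endpoint exponent, continuity of each coefficient does not give this, because finitely supported
  families are not dense. The intermediate exponents are finite, however, and a convergent series of
  positive terms tolerates a weight that tends to infinity.\<close>

text \<open>\<open>bl a w I u K\<close> says that the weighted \<open>\<ell>\<close>-quasi-norm of exponent \<open>1 / a\<close> of \<open>u\<close> on \<open>I\<close> is at most \<open>K\<close>.
  Parametrizing by the inverse exponent lets \<open>a = 0\<close> stand for the supremum norm and makes
  interpolation of exponents affine.\<close>

definition bl :: "real \<Rightarrow> ('i \<Rightarrow> real) \<Rightarrow> 'i set \<Rightarrow> ('i \<Rightarrow> real) \<Rightarrow> real \<Rightarrow> bool" where
  "bl a w I u K \<longleftrightarrow> 0 \<le> K \<and> (if a = 0 then \<forall>i\<in>I. \<bar>u i\<bar> \<le> K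
     else \<forall>J. finite J \<longrightarrow> J \<subseteq> I \<longrightarrow> (\<Sum>i\<in>J. w i * \<bar>u i\<bar> powr (1/a)) \<le> K powr (1/a))"

text \<open>The inner quasi-norms enter only through some upper bounds \<open>U n\<close>, so that
  no supremum or infinite sum has to be formed; estimates are passed on by exhibiting new level
  bounds.\<close>

definition mixed :: "(int \<Rightarrow> 'i set) \<Rightarrow> ('i \<Rightarrow> real) \<Rightarrow> real \<Rightarrow> real \<Rightarrow> real \<Rightarrow> ('i \<Rightarrow> real) \<Rightarrow> real \<Rightarrow> bool" where
  "mixed I w a b s u K \<longleftrightarrow> (\<exists>U. (\<forall>n. bl a w (I n) u (U n)) \<and>
      bl b (\<lambda>_. 1) UNIV (\<lambda>n. 2 powr (of_int n * s) * U n) K)"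

lemma bl_nonneg: "bl a w I u K \<Longrightarrow> 0 \<le> K"
  by (simp add: bl_def)

lemma bl_zeroD: "bl 0 w I u K \<Longrightarrow> i \<in> I \<Longrightarrow> \<bar>u i\<bar> \<le> K"
  by (simp add: bl_def)

lemma bl_posD: "bl a w I u K \<Longrightarrow> a \<noteq> 0 \<Longrightarrow> finite J \<Longrightarrow> J \<subseteq> I \<Longrightarrow>
   (\<Sum>i\<in>J. w i * \<bar>u i\<bar> powr (1/a)) \<le> K powr (1/a)"
  by (simp add: bl_def)

lemma bl_mono:
  assumes "bl a w I u K" "0 \<le> a" "J \<subseteq> I" "K \<le> L" "\<And>i. i \<in> J \<Longrightarrow> 0 \<le> w i" "\<And>i. i \<in> J \<Longrightarrow> \<bar>v i\<bar> \<le> \<bar>u i\<bar>"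
  shows "bl a w J v L"
proof (cases "a = 0")
  case True
  have "\<forall>i\<in>J. \<bar>v i\<bar> \<le> L"
  proof
    fix i assume "i \<in> J"
    then have "\<bar>v i\<bar> \<le> \<bar>u i\<bar>" "\<bar>u i\<bar> \<le> K" using assms True by (auto simp: bl_def)
    then show "\<bar>v i\<bar> \<le> L" using assms by linarith
  qed
  then show ?thesis using True assms by (auto simp: bl_def)
next
  case False
  have "(\<Sum>i\<in>H. w i * \<bar>v i\<bar> powr (1/a)) \<le> L powr (1/a)" if H: "finite H" "H \<subseteq> J" for H
  proof -
    have "(\<Sum>i\<in>H. w i * \<bar>v i\<bar> powr (1/a)) \<le> (\<Sum>i\<in>H. w i * \<bar>u i\<bar> powr (1/a))"
      using H assms by (intro sum_mono mult_left_mono powr_mono2) auto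
    also have "\<dots> \<le> K powr (1/a)" using H assms False by (intro bl_posD[OF assms(1)]) auto
    also have "\<dots> \<le> L powr (1/a)" using assms by (intro powr_mono2) (auto simp: bl_def)
    finally show ?thesis .
  qed
  then show ?thesis using False assms by (auto simp: bl_def)
qed

lemma bl_scale:
  assumes "bl a w I u K" "0 \<le> c"
  shows "bl a w I (\<lambda>i. c * u i) (c * K)"
proof (cases "a = 0")
  case True
  then show ?thesis using assms by (auto simp: bl_def abs_mult intro: mult_left_mono)
next
  case False
  have "(\<Sum>i\<in>J. w i * \<bar>c * u i\<bar> powr (1/a)) \<le> (c * K) powr (1/a)" if J: "finite J" "J \<subseteq> I" for J
  proof -
    have "(\<Sum>i\<in>J. w i * \<bar>c * u i\<bar> powr (1/a)) = c powr (1/a) * (\<Sum>i\<in>J. w i * \<bar>u i\<bar> powr (1/a))"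
      using assms by (simp add: sum_distrib_left abs_mult powr_mult mult_ac)
    also have "\<dots> \<le> c powr (1/a) * K powr (1/a)"
      using bl_posD[OF assms(1) False J] by (intro mult_left_mono) auto
    finally show ?thesis using assms by (simp add: powr_mult bl_def)
  qed
  then show ?thesis using False assms by (auto simp: bl_def)
qed

text \<open>The supremum of \<^term>\<open>t ^ j * u j\<close> controls the sum, which makes the geometric
  triangle inequality uniform in the exponent, without convexity.\<close>

lemma bl_geometric_sum:
  assumes a: "0 \<le> a" and t: "0 < t" "t < 1"
  shows "\<exists>c>0. \<forall>(w::'i \<Rightarrow> real) I u T. (\<forall>i\<in>I. 0 < w i) \<longrightarrow> (\<forall>j. bl a w I (u j) (t ^ j * T)) \<longrightarrow>
       (\<forall>i\<in>I. summable (\<lambda>j. \<bar>u j i\<bar>)) \<and> bl a w I (\<lambda>i. \<Sum>j. \<bar>u j i\<bar>) (c * T)"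
proof (cases "a = 0")
  case True
  show ?thesis
  proof (intro exI[of _ "1 / (1 - t)"] conjI[of "0 < _"] allI impI)
    show "1 / (1 - t) > 0" using t by simp
    fix w :: "'i \<Rightarrow> real" and I and u :: "nat \<Rightarrow> 'i \<Rightarrow> real" and T
    assume "\<forall>i\<in>I. 0 < w i" and "\<forall>j. bl a w I (u j) (t ^ j * T)"
    then have w: "\<And>i. i \<in> I \<Longrightarrow> 0 < w i" and B: "\<And>j. bl a w I (u j) (t ^ j * T)" by auto
    have T0: "0 \<le> T" using bl_nonneg[OF B[of 0]] by simp
    have le: "\<bar>u j i\<bar> \<le> t ^ j * T" if "i \<in> I" for i j using B[of j] that True by (simp add: bl_def)
    have s: "summable (\<lambda>j. t ^ j * T)" using t by (intro summable_mult2 summable_geometric) auto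
    have su: "summable (\<lambda>j. \<bar>u j i\<bar>)" if "i \<in> I" for i
      by (rule summable_comparison_test[OF _ s]) (use le[OF that] in auto)
    have "\<bar>\<Sum>j. \<bar>u j i\<bar>\<bar> \<le> 1 / (1 - t) * T" if i: "i \<in> I" for i
    proof -
      have "(\<Sum>j. \<bar>u j i\<bar>) \<le> (\<Sum>j. t ^ j * T)" by (rule suminf_le[OF le[OF i] su[OF i] s])
      also have "\<dots> = 1 / (1 - t) * T" using t by (subst suminf_mult2[symmetric]) (auto simp: suminf_geometric)
      finally show ?thesis by (simp add: suminf_nonneg su i)
    qed
    then show "(\<forall>i\<in>I. summable (\<lambda>j. \<bar>u j i\<bar>)) \<and> bl a w I (\<lambda>i. \<Sum>j. \<bar>u j i\<bar>) (1 / (1 - t) * T)"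
      using su True T0 t by (auto simp: bl_def)
  qed
next
  case False
  then have a0: "a > 0" using a by simp
  define p where "p = 1 / a"
  have p: "p > 0" using a0 by (simp add: p_def)
  \<comment> \<open>The decay \<open>t ^ j\<close> is split into two factors \<open>r ^ j\<close>:
    one is summed over \<open>j\<close> in the triangle inequality, the other makes the sum of the
    p-th powers in \<open>g\<close> converge.\<close>
  define r where "r = sqrt t"
  have r: "0 < r" "r < 1" "r * r = t" using t by (auto simp: r_def)
  define c where "c = (1 / (1 - r)) * (1 / (1 - r powr p)) powr a"
  have rp: "0 < r powr p" "r powr p < 1" using r p powr01_less_one[of r p] by auto
  have c0: "c > 0" unfolding c_def using r rp by (intro mult_pos_pos divide_pos_pos) auto
  show ?thesis
  proof (intro exI[of _ c] conjI[of "0 < _"] allI impI)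
    show "c > 0" by (rule c0)
    fix w :: "'i \<Rightarrow> real" and I and u :: "nat \<Rightarrow> 'i \<Rightarrow> real" and T
    assume "\<forall>i\<in>I. 0 < w i" and "\<forall>j. bl a w I (u j) (t ^ j * T)"
    then have w: "\<And>i. i \<in> I \<Longrightarrow> 0 < w i" and B: "\<And>j. bl a w I (u j) (t ^ j * T)" by auto
    have T0: "0 \<le> T" using bl_nonneg[OF B[of 0]] by simp
    have tj: "(t ^ j * T) powr p = (r powr p) ^ j * (r powr p) ^ j * T powr p" for j
    proof -
      have "(t ^ j) powr p = (t powr p) ^ j" using t by (simp add: powr_power powr_realpow[symmetric] powr_powr mult.commute)
      moreover have "t powr p = r powr p * r powr p" using r by (simp add: powr_mult[symmetric])
      ultimately show ?thesis using T0 t by (simp add: powr_mult power_mult_distrib)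
    qed
    have one: "w i * \<bar>u j i\<bar> powr p \<le> (r powr p) ^ j * (r powr p) ^ j * T powr p" if "i \<in> I" for i j
      using bl_posD[OF B[of j] False, of "{i}"] that by (simp add: p_def[symmetric] tj)
    \<comment> \<open>Obtained from the singleton \<open>{i}\<close>; the bound depends on
      \<open>w i\<close> and serves for the convergence of the series at \<open>i\<close>.\<close>
    have bd: "\<bar>u j i\<bar> \<le> r ^ j * (r ^ j * ((T powr p / w i) powr a))" if "i \<in> I" for i j
    proof -
      have "\<bar>u j i\<bar> powr p \<le> ((r powr p) ^ j * (r powr p) ^ j * T powr p) / w i"
        using one[OF that, of j] w[OF that] by (simp add: field_simps)
      then have "(\<bar>u j i\<bar> powr p) powr a \<le> (((r powr p) ^ j * (r powr p) ^ j * T powr p) / w i) powr a"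
        using a by (intro powr_mono2) auto
      also have "((r powr p) ^ j * (r powr p) ^ j * T powr p) / w i
          = ((r powr p) ^ j * (r powr p) ^ j) * (T powr p / w i)" by simp
      also have "\<dots> powr a = ((r powr p) ^ j) powr a * (((r powr p) ^ j) powr a) * (T powr p / w i) powr a"
        using r w[OF that] by (simp only: powr_mult zero_le_power powr_ge_zero mult_nonneg_nonneg divide_nonneg_nonneg less_imp_le mult.assoc)
      also have "((r powr p) ^ j) powr a = r ^ j"
        using r a0 by (simp add: powr_powr powr_realpow[symmetric] p_def mult.commute)
      finally show ?thesis using a0 by (simp add: powr_powr p_def)
    qed
    have srr: "summable (\<lambda>j. r ^ j)" using r by (intro summable_geometric) auto
    have su: "summable (\<lambda>j. \<bar>u j i\<bar>)" if i: "i \<in> I" for i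
    proof (rule summable_comparison_test')
      show "summable (\<lambda>j. r ^ j * ((T powr p / w i) powr a))" using srr by (intro summable_mult2)
      fix j :: nat assume "j \<ge> 0"
      have "r ^ j * (r ^ j * ((T powr p / w i) powr a)) \<le> r ^ j * (1 * ((T powr p / w i) powr a))"
        using r by (intro mult_left_mono mult_right_mono power_le_one) auto
      then show "norm \<bar>u j i\<bar> \<le> r ^ j * ((T powr p / w i) powr a)" using bd[OF i, of j] by simp
    qed
    \<comment> \<open>The sum of \<open>g i j\<close> over \<open>j\<close> dominates each of its
      terms, so its power \<open>a\<close> dominates the supremum of
      \<open>\<bar>u j i\<bar> / r ^ j\<close>; at the same time it is additive in p-th powers and
      can be summed against \<open>w\<close>.\<close>
    define g where "g i j = (\<bar>u j i\<bar> / r ^ j) powr p" for i j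
    have g_le: "w i * g i j \<le> (r powr p) ^ j * T powr p" if "i \<in> I" for i j
    proof -
      have "(r ^ j) powr p = (r powr p) ^ j" using r by (simp add: powr_power powr_realpow[symmetric] powr_powr mult.commute)
      then have "w i * g i j = w i * \<bar>u j i\<bar> powr p / (r powr p) ^ j"
        using r by (simp add: g_def powr_divide)
      also have "\<dots> \<le> (r powr p) ^ j * T powr p"
        using one[OF that, of j] r by (simp add: field_simps)
      finally show ?thesis .
    qed
    have srp: "summable (\<lambda>j. (r powr p) ^ j)" using rp by (intro summable_geometric) auto
    have sg: "summable (\<lambda>j. g i j)" if i: "i \<in> I" for i
    proof (rule summable_comparison_test')
      show "summable (\<lambda>j. (r powr p) ^ j * (T powr p / w i))" using srp by (intro summable_mult2)
      fix j :: nat assume "j \<ge> 0"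
      show "norm (g i j) \<le> (r powr p) ^ j * (T powr p / w i)"
        using g_le[OF i, of j] w[OF i] by (simp add: g_def field_simps)
    qed
    have g0: "g i j \<ge> 0" for i j by (simp add: g_def)
    have sumle: "(\<Sum>j. \<bar>u j i\<bar>) powr p \<le> (1 / (1 - r)) powr p * (\<Sum>j. g i j)" if i: "i \<in> I" for i
    proof -
      define S where "S = (\<Sum>j. g i j)"
      have S0: "S \<ge> 0" unfolding S_def by (intro suminf_nonneg sg i g0)
      have "g i j \<le> S" for j
        using sum_le_suminf[OF sg[OF i], of "{j}"] g0 by (simp add: S_def)
      then have "g i j powr a \<le> S powr a" for j using g0 a by (intro powr_mono2) auto
      moreover have "g i j powr a = \<bar>u j i\<bar> / r ^ j" for j using a0 r by (simp add: g_def powr_powr p_def)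
      ultimately have "\<bar>u j i\<bar> \<le> r ^ j * S powr a" for j using r by (simp add: field_simps)
      then have "(\<Sum>j. \<bar>u j i\<bar>) \<le> (\<Sum>j. r ^ j * S powr a)" using su[OF i] srr by (intro suminf_le summable_mult2) auto
      also have "\<dots> = 1 / (1 - r) * S powr a" using r by (subst suminf_mult2[symmetric]) (auto simp: suminf_geometric)
      finally have "(\<Sum>j. \<bar>u j i\<bar>) powr p \<le> (1 / (1 - r) * S powr a) powr p"
        using p su[OF i] by (intro powr_mono2 suminf_nonneg) auto
      also have "\<dots> = (1 / (1 - r)) powr p * S" using S0 a0 r by (simp add: powr_mult powr_powr p_def powr_divide)
      finally show ?thesis by (simp add: S_def)
    qed
    have "(\<Sum>i\<in>J. w i * \<bar>\<Sum>j. \<bar>u j i\<bar>\<bar> powr (1/a)) \<le> (c * T) powr (1/a)" if J: "finite J" "J \<subseteq> I" for J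
    proof -
      have "(\<Sum>i\<in>J. w i * \<bar>\<Sum>j. \<bar>u j i\<bar>\<bar> powr (1/a)) \<le> (\<Sum>i\<in>J. w i * ((1 / (1 - r)) powr p * (\<Sum>j. g i j)))"
        using J w sumle su unfolding p_def[symmetric]
        by (intro sum_mono mult_left_mono) (auto simp: suminf_nonneg subset_iff less_imp_le)
      also have "\<dots> = (1 / (1 - r)) powr p * (\<Sum>i\<in>J. \<Sum>j. w i * g i j)"
        using J sg by (auto simp: sum_distrib_left suminf_mult subset_iff intro!: sum.cong)
      also have "(\<Sum>i\<in>J. \<Sum>j. w i * g i j) = (\<Sum>j. \<Sum>i\<in>J. w i * g i j)"
        using J sg by (intro suminf_sum[symmetric]) (auto intro!: summable_mult)
      also have "\<dots> \<le> (\<Sum>j. (r powr p) ^ j * T powr p)"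
      proof (rule suminf_le)
        fix j
        have "(\<Sum>i\<in>J. w i * g i j) = (\<Sum>i\<in>J. w i * \<bar>u j i\<bar> powr p) / (r powr p) ^ j"
        proof -
          have "(r ^ j) powr p = (r powr p) ^ j" using r by (simp add: powr_power powr_realpow[symmetric] powr_powr mult.commute)
          then show ?thesis using r by (simp add: g_def powr_divide sum_divide_distrib)
        qed
        also have "\<dots> \<le> (r powr p) ^ j * T powr p"
          using bl_posD[OF B[of j] False J] rp unfolding p_def[symmetric] tj by (simp add: field_simps)
        finally show "(\<Sum>i\<in>J. w i * g i j) \<le> (r powr p) ^ j * T powr p" .
      qed (use J sg srp in \<open>auto intro!: summable_sum summable_mult summable_mult2\<close>)
      also have "\<dots> = 1 / (1 - r powr p) * T powr p" using rp by (subst suminf_mult2[symmetric]) (auto simp: suminf_geometric)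
      finally have "(\<Sum>i\<in>J. w i * \<bar>\<Sum>j. \<bar>u j i\<bar>\<bar> powr (1/a)) \<le> (1 / (1 - r)) powr p * (1 / (1 - r powr p) * T powr p)"
        using r by (simp add: mult_left_mono)
      also have "\<dots> = (c * T) powr (1/a)"
      proof -
        have "((1 / (1 - r powr p)) powr a) powr p = 1 / (1 - r powr p)"
          using a0 rp by (simp add: powr_powr p_def)
        moreover have "(c * T) powr p = (1 / (1 - r)) powr p * ((1 / (1 - r powr p)) powr a) powr p * T powr p"
          using r rp T0 by (simp only: c_def powr_mult powr_ge_zero mult_nonneg_nonneg divide_nonneg_nonneg zero_le_one diff_ge_0_iff_ge less_imp_le)
        ultimately show ?thesis by (simp add: p_def[symmetric] mult_ac)
      qed
      finally show ?thesis .
    qed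
    then show "(\<forall>i\<in>I. summable (\<lambda>j. \<bar>u j i\<bar>)) \<and> bl a w I (\<lambda>i. \<Sum>j. \<bar>u j i\<bar>) (c * T)"
      using su False T0 c0 by (auto simp: bl_def)
  qed
qed

lemma bl_zero: "0 \<le> K \<Longrightarrow> bl a w I (\<lambda>_. 0) K"
  by (simp add: bl_def)

text \<open>Singletons test the bound: every coordinate is a bounded functional whose norm is a
  power of the weight of the index.\<close>

lemma bl_pointwise:
  assumes "bl a w I u K" "0 \<le> a" "i \<in> I" "0 < w i"
  shows "\<bar>u i\<bar> \<le> w i powr (-a) * K"
proof (cases "a = 0")
  case True
  then show ?thesis using assms by (simp add: bl_def)
next
  case False
  then have a: "a > 0" using assms by simp
  have "w i * \<bar>u i\<bar> powr (1/a) \<le> K powr (1/a)" using bl_posD[OF assms(1) False, of "{i}"] assms by simp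
  then have "(w i * \<bar>u i\<bar> powr (1/a)) powr a \<le> (K powr (1/a)) powr a"
    using assms a by (intro powr_mono2) auto
  then have "w i powr a * \<bar>u i\<bar> \<le> K" using assms a bl_nonneg[OF assms(1)] by (simp add: powr_mult powr_powr)
  then show ?thesis using assms by (simp add: powr_minus field_simps)
qed

lemma bl_shift:
  fixes u :: "int \<Rightarrow> real"
  assumes "bl a (\<lambda>_. 1) UNIV u K"
  shows "bl a (\<lambda>_. 1) UNIV (\<lambda>n. u (n + j)) K"
proof (cases "a = 0")
  case True
  then show ?thesis using assms by (auto simp: bl_def)
next
  case False
  have "(\<Sum>n\<in>J. \<bar>u (n + j)\<bar> powr (1/a)) \<le> K powr (1/a)" if "finite J" for J
  proof -
    have "(\<Sum>n\<in>J. \<bar>u (n + j)\<bar> powr (1/a)) = (\<Sum>n\<in>(\<lambda>n. n + j) ` J. \<bar>u n\<bar> powr (1/a))"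
      by (subst sum.reindex) (auto simp: inj_on_def)
    also have "\<dots> \<le> K powr (1/a)" using bl_posD[OF assms False, of "(\<lambda>n. n + j) ` J"] that by simp
    finally show ?thesis .
  qed
  then show ?thesis using assms False by (auto simp: bl_def)
qed

lemma mixed_nonneg: "mixed I w a b s u K \<Longrightarrow> 0 \<le> K"
  by (auto simp: mixed_def bl_nonneg)

lemma mixed_mono:
  assumes "mixed I w a b s u K" "0 \<le> a" "0 \<le> b" "K \<le> L" "\<And>n i. i \<in> I n \<Longrightarrow> 0 \<le> w i"
    "\<And>n i. i \<in> I n \<Longrightarrow> \<bar>v i\<bar> \<le> \<bar>u i\<bar>"
  shows "mixed I w a b s v L"
proof -
  obtain U where U: "\<And>n. bl a w (I n) u (U n)" "bl b (\<lambda>_. 1) UNIV (\<lambda>n. 2 powr (of_int n * s) * U n) K"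
    using assms(1) by (auto simp: mixed_def)
  show ?thesis unfolding mixed_def
  proof (intro exI conjI allI)
    show "bl a w (I n) v (U n)" for n by (rule bl_mono[OF U(1)]) (use assms in auto)
    show "bl b (\<lambda>_. 1) UNIV (\<lambda>n. 2 powr (of_int n * s) * U n) L"
      by (rule bl_mono[OF U(2)]) (use assms in auto)
  qed
qed

lemma mixed_scale:
  assumes "mixed I w a b s u K" "0 \<le> c"
  shows "mixed I w a b s (\<lambda>i. c * u i) (c * K)"
proof -
  obtain U where U: "\<And>n. bl a w (I n) u (U n)" "bl b (\<lambda>_. 1) UNIV (\<lambda>n. 2 powr (of_int n * s) * U n) K"
    using assms(1) by (auto simp: mixed_def)
  have "bl b (\<lambda>_. 1) UNIV (\<lambda>n. c * (2 powr (of_int n * s) * U n)) (c * K)" by (rule bl_scale[OF U(2) assms(2)])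
  then have "bl b (\<lambda>_. 1) UNIV (\<lambda>n. 2 powr (of_int n * s) * (c * U n)) (c * K)" by (simp add: mult_ac)
  then show ?thesis unfolding mixed_def using bl_scale[OF U(1) assms(2)] by (intro exI[of _ "\<lambda>n. c * U n"]) auto
qed

lemma mixed_pointwise:
  assumes "mixed I w a b s u K" "0 \<le> a" "0 \<le> b" "i \<in> I n" "0 < w i"
  shows "\<bar>u i\<bar> \<le> w i powr (-a) * 2 powr (- (of_int n * s)) * K"
proof -
  obtain U where U: "\<And>n. bl a w (I n) u (U n)" "bl b (\<lambda>_. 1) UNIV (\<lambda>n. 2 powr (of_int n * s) * U n) K"
    using assms(1) by (auto simp: mixed_def)
  have "\<bar>2 powr (of_int n * s) * U n\<bar> \<le> 1 powr (-b) * K" by (rule bl_pointwise[OF U(2)]) (use assms in auto)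
  then have "U n \<le> 2 powr (- (of_int n * s)) * K"
    using bl_nonneg[OF U(1)] by (simp add: powr_minus field_simps)
  then have "w i powr (-a) * U n \<le> w i powr (-a) * (2 powr (- (of_int n * s)) * K)" by (intro mult_left_mono) auto
  then show ?thesis using bl_pointwise[OF U(1)[of n] assms(2,4,5)] by (simp add: mult.assoc)
qed

text \<open>The geometric triangle inequality is applied twice. Across the levels it turns the
  bounds \<open>V j n\<close> into one sequence \<open>T n\<close> with
  \<open>V j n \<le> r ^ j * T n\<close>, and this is the hypothesis of the same inequality inside
  each level.\<close>

lemma mixed_geometric_sum:
  assumes ab: "0 \<le> a" "0 \<le> b" and t: "0 < t" "t < 1"
  shows "\<exists>c>0. \<forall>I (w::'i \<Rightarrow> real) s v V K. (\<forall>n. \<forall>i\<in>I n. 0 < w i) \<longrightarrow> (\<forall>j n. bl a w (I n) (v j) (V j n)) \<longrightarrow>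
       (\<forall>j. bl b (\<lambda>_. 1) UNIV (\<lambda>n. 2 powr (of_int n * s) * V j n) (t ^ j * K)) \<longrightarrow>
       (\<forall>n. \<forall>i\<in>I n. summable (\<lambda>j. \<bar>v j i\<bar>)) \<and> mixed I w a b s (\<lambda>i. \<Sum>j. \<bar>v j i\<bar>) (c * K)"
proof -
  define r where "r = sqrt t"
  have r: "0 < r" "r < 1" "r * r = t" using t by (auto simp: r_def)
  obtain c1 where c1: "c1 > 0" "\<forall>(w::'i \<Rightarrow> real) I u T. (\<forall>i\<in>I. 0 < w i) \<longrightarrow> (\<forall>j. bl a w I (u j) (r ^ j * T)) \<longrightarrow>
       (\<forall>i\<in>I. summable (\<lambda>j. \<bar>u j i\<bar>)) \<and> bl a w I (\<lambda>i. \<Sum>j. \<bar>u j i\<bar>) (c1 * T)"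
    using bl_geometric_sum[OF ab(1) r(1,2)] by (elim exE conjE) (rule that)
  obtain c2 where c2: "c2 > 0" "\<forall>(w::int \<Rightarrow> real) I u T. (\<forall>i\<in>I. 0 < w i) \<longrightarrow> (\<forall>j. bl b w I (u j) (r ^ j * T)) \<longrightarrow>
       (\<forall>i\<in>I. summable (\<lambda>j. \<bar>u j i\<bar>)) \<and> bl b w I (\<lambda>i. \<Sum>j. \<bar>u j i\<bar>) (c2 * T)"
    using bl_geometric_sum[OF ab(2) r(1,2)] by (elim exE conjE) (rule that)
  show ?thesis
  proof (intro exI[of _ "c1 * c2"] conjI[of "0 < _"] allI impI)
    show "c1 * c2 > 0" using c1 c2 by simp
    fix I and w :: "'i \<Rightarrow> real" and s :: real and v :: "nat \<Rightarrow> 'i \<Rightarrow> real" and V :: "nat \<Rightarrow> int \<Rightarrow> real" and K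
    assume "\<forall>n. \<forall>i\<in>I n. 0 < w i" "\<forall>j n. bl a w (I n) (v j) (V j n)"
      "\<forall>j. bl b (\<lambda>_. 1) UNIV (\<lambda>n. 2 powr (of_int n * s) * V j n) (t ^ j * K)"
    then have w: "\<And>n i. i \<in> I n \<Longrightarrow> 0 < w i" and A: "\<And>j n. bl a w (I n) (v j) (V j n)"
      and B: "\<And>j. bl b (\<lambda>_. 1) UNIV (\<lambda>n. 2 powr (of_int n * s) * V j n) (t ^ j * K)" by auto
    have V0: "0 \<le> V j n" for j n using bl_nonneg[OF A] .
    \<comment> \<open>Half of the decay is taken out before summing over \<open>j\<close>, so that a
      single sum dominates all \<open>x j n\<close> and a factor \<open>r ^ j\<close> remains for
      the inner inequality.\<close>
    define x where "x j n = 2 powr (of_int n * s) * V j n / r ^ j" for j and n :: int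
    have x0: "0 \<le> x j n" for j n using V0 r by (simp add: x_def)
    have bxj: "bl b (\<lambda>_. 1) UNIV (x j) (r ^ j * K)" for j
    proof -
      have "(1 / r ^ j) * (t ^ j * K) = r ^ j * K" using r(1) by (simp add: r(3)[symmetric] power_mult_distrib)
      then show ?thesis using bl_scale[OF B[of j], of "1 / r ^ j"] r by (simp add: x_def[abs_def])
    qed
    have "(\<forall>n\<in>UNIV. summable (\<lambda>j. \<bar>x j n\<bar>)) \<and> bl b (\<lambda>_. 1) UNIV (\<lambda>n. \<Sum>j. \<bar>x j n\<bar>) (c2 * K)"
      by (rule c2(2)[rule_format]) (use bxj in auto)
    then have sx: "summable (\<lambda>j. x j n)" and bx: "bl b (\<lambda>_. 1) UNIV (\<lambda>n. \<Sum>j. x j n) (c2 * K)" for n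
      using x0 by auto
    define T where "T n = 2 powr (- (of_int n * s)) * (\<Sum>j. x j n)" for n
    have VT: "V j n \<le> r ^ j * T n" for j n
    proof -
      have "x j n \<le> (\<Sum>j. x j n)" using sum_le_suminf[OF sx, of "{j}"] x0 by simp
      then show ?thesis using r by (simp add: x_def T_def powr_minus field_simps)
    qed
    have P: "(\<forall>i\<in>I n. summable (\<lambda>j. \<bar>v j i\<bar>)) \<and> bl a w (I n) (\<lambda>i. \<Sum>j. \<bar>v j i\<bar>) (c1 * T n)" for n
      by (rule c1(2)[rule_format]) (use w in \<open>auto intro!: bl_mono[OF A _ _ VT] ab simp: less_imp_le\<close>)
    have "bl b (\<lambda>_. 1) UNIV (\<lambda>n. c1 * (\<Sum>j. x j n)) (c1 * (c2 * K))" using bl_scale[OF bx] c1 by simp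
    moreover have "c1 * (\<Sum>j. x j n) = 2 powr (of_int n * s) * (c1 * T n)" for n
      by (simp add: T_def powr_minus)
    ultimately have "bl b (\<lambda>_. 1) UNIV (\<lambda>n. 2 powr (of_int n * s) * (c1 * T n)) (c1 * c2 * K)" by (simp add: mult.assoc)
    then show "(\<forall>n. \<forall>i\<in>I n. summable (\<lambda>j. \<bar>v j i\<bar>)) \<and> mixed I w a b s (\<lambda>i. \<Sum>j. \<bar>v j i\<bar>) (c1 * c2 * K)"
      using P unfolding mixed_def by (intro conjI exI[of _ "\<lambda>n. c1 * T n"]) auto
  qed
qed

text \<open>The quasi-triangle inequality is the geometric one for the sequence
  \<open>u, v, 0, 0, ...\<close>, which treats exponents above and below 1 alike.\<close>

lemma mixed_add:
  assumes ab: "0 \<le> a" "0 \<le> b"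
  shows "\<exists>c>0. \<forall>I (w::'i \<Rightarrow> real) s u v K L. (\<forall>n. \<forall>i\<in>I n. 0 < w i) \<longrightarrow> mixed I w a b s u K \<longrightarrow> mixed I w a b s v L \<longrightarrow>
       mixed I w a b s (\<lambda>i. \<bar>u i\<bar> + \<bar>v i\<bar>) (c * (K + L))"
proof -
  have h: "0 < (1/2::real)" "(1/2::real) < 1" by auto
  obtain c where c: "c > 0" "\<forall>I (w::'i \<Rightarrow> real) s v V K. (\<forall>n. \<forall>i\<in>I n. 0 < w i) \<longrightarrow> (\<forall>j n. bl a w (I n) (v j) (V j n)) \<longrightarrow>
       (\<forall>j. bl b (\<lambda>_. 1) UNIV (\<lambda>n. 2 powr (of_int n * s) * V j n) ((1/2) ^ j * K)) \<longrightarrow>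
       (\<forall>n. \<forall>i\<in>I n. summable (\<lambda>j. \<bar>v j i\<bar>)) \<and> mixed I w a b s (\<lambda>i. \<Sum>j. \<bar>v j i\<bar>) (c * K)"
    using mixed_geometric_sum[OF ab h] by (elim exE conjE) (rule that)
  show ?thesis
  proof (intro exI[of _ "2 * c"] conjI[of "0 < _"] allI impI)
    show "2 * c > 0" using c by simp
    fix I and w :: "'i \<Rightarrow> real" and s :: real and u v :: "'i \<Rightarrow> real" and K L
    assume w: "\<forall>n. \<forall>i\<in>I n. 0 < w i" and u: "mixed I w a b s u K" and v: "mixed I w a b s v L"
    obtain U where U: "\<And>n. bl a w (I n) u (U n)" "bl b (\<lambda>_. 1) UNIV (\<lambda>n. 2 powr (of_int n * s) * U n) K"
      using u by (auto simp: mixed_def)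
    obtain V where V: "\<And>n. bl a w (I n) v (V n)" "bl b (\<lambda>_. 1) UNIV (\<lambda>n. 2 powr (of_int n * s) * V n) L"
      using v by (auto simp: mixed_def)
    have KL: "0 \<le> K" "0 \<le> L" using U V bl_nonneg by blast+
    define f where "f = (\<lambda>j::nat. if j = 0 then u else if j = 1 then v else (\<lambda>_. 0))"
    define F where "F = (\<lambda>j::nat. if j = 0 then U else if j = 1 then V else (\<lambda>_. 0))"
    \<comment> \<open>The factor 2 compensates the weight 1/2 that the term with index 1 has to
      satisfy.\<close>
    have "(\<forall>n. \<forall>i\<in>I n. summable (\<lambda>j. \<bar>f j i\<bar>)) \<and> mixed I w a b s (\<lambda>i. \<Sum>j. \<bar>f j i\<bar>) (c * (2 * (K + L)))"
    proof (rule c(2)[rule_format, where V = F])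
      show "bl a w (I n) (f j) (F j n)" for j n using U V by (auto simp: f_def F_def bl_zero)
      show "bl b (\<lambda>_. 1) UNIV (\<lambda>n. 2 powr (of_int n * s) * F j n) ((1/2) ^ j * (2 * (K + L)))" for j
        using KL by (auto simp: F_def bl_zero intro: bl_mono[OF U(2)] bl_mono[OF V(2)] ab)
    qed (use w in auto)
    moreover have "(\<Sum>j. \<bar>f j i\<bar>) = \<bar>u i\<bar> + \<bar>v i\<bar>" for i
      by (subst suminf_finite[of "{0,1}"]) (auto simp: f_def)
    ultimately show "mixed I w a b s (\<lambda>i. \<bar>u i\<bar> + \<bar>v i\<bar>) (2 * c * (K + L))" by (simp add: mult_ac)
  qed
qed

section \<open>Estimates between different index sets\<close>

text \<open>A sum of at most \<open>N\<close> terms is at most \<open>N\<close> times its largest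
  one, a comparison that works for every exponent.\<close>

lemma sum_powr_le_card:
  fixes u :: "'i \<Rightarrow> real"
  assumes "finite R" "card R \<le> N" "0 \<le> p"
  shows "(\<Sum>i\<in>R. \<bar>u i\<bar>) powr p \<le> real N powr p * (\<Sum>i\<in>R. \<bar>u i\<bar> powr p)"
proof (cases "R = {}")
  case False
  define m where "m = Max ((\<lambda>i. \<bar>u i\<bar>) ` R)"
  have "m \<in> (\<lambda>i. \<bar>u i\<bar>) ` R" unfolding m_def using False assms by (intro Max_in) auto
  then obtain j where j: "j \<in> R" "m = \<bar>u j\<bar>" by auto
  have "(\<Sum>i\<in>R. \<bar>u i\<bar>) \<le> (\<Sum>i\<in>R. m)" unfolding m_def using assms by (intro sum_mono Max_ge) auto
  also have "\<dots> \<le> real N * m" using assms j by (simp add: mult_right_mono)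
  finally have "(\<Sum>i\<in>R. \<bar>u i\<bar>) powr p \<le> (real N * m) powr p" using assms by (intro powr_mono2) (auto intro: sum_nonneg)
  also have "\<dots> = real N powr p * \<bar>u j\<bar> powr p" using j by (simp add: powr_mult)
  also have "\<dots> \<le> real N powr p * (\<Sum>i\<in>R. \<bar>u i\<bar> powr p)"
    using j assms by (intro mult_left_mono member_le_sum) auto
  finally show ?thesis .
qed auto

text \<open>Double counting: after exchanging the sums, \<open>d i\<close> bounds the total of
  \<open>g k i\<close> over the \<open>k\<close> incident to \<open>i\<close>.\<close>

lemma sum_incidence_le:
  fixes f :: "'i \<Rightarrow> real" and g :: "'k \<Rightarrow> 'i \<Rightarrow> real"
  assumes J: "finite J" "\<And>k. k \<in> J \<Longrightarrow> finite (R k)" "\<And>k. k \<in> J \<Longrightarrow> R k \<subseteq> I"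
    and f: "\<And>i. i \<in> I \<Longrightarrow> 0 \<le> f i"
    and D: "\<And>i. i \<in> I \<Longrightarrow> (\<Sum>k\<in>{k\<in>J. i \<in> R k}. g k i) \<le> d i"
    and S: "(\<Sum>i\<in>(\<Union>k\<in>J. R k). d i * f i) \<le> S"
  shows "(\<Sum>k\<in>J. \<Sum>i\<in>R k. g k i * f i) \<le> S"
proof -
  let ?A = "\<Union>k\<in>J. R k"
  have fA: "finite ?A" using J by auto
  have "(\<Sum>k\<in>J. \<Sum>i\<in>R k. g k i * f i) = (\<Sum>k\<in>J. \<Sum>i\<in>{i\<in>?A. i \<in> R k}. g k i * f i)"
    by (intro sum.cong refl) auto
  also have "\<dots> = (\<Sum>i\<in>?A. \<Sum>k\<in>{k\<in>J. i \<in> R k}. g k i * f i)" by (rule sum.swap_restrict[OF J(1) fA])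
  also have "\<dots> = (\<Sum>i\<in>?A. (\<Sum>k\<in>{k\<in>J. i \<in> R k}. g k i) * f i)" by (simp add: sum_distrib_right)
  also have "\<dots> \<le> (\<Sum>i\<in>?A. d i * f i)" using J(3) f D by (intro sum_mono mult_right_mono) blast+
  finally show ?thesis using S by simp
qed

text \<open>Each \<open>v k\<close> depends on at most \<open>N\<close> entries, so powers of sums
  and sums of powers are comparable for all exponents, and the incidence bound \<open>D\<close>
  exchanges the weights. It applies whenever boundedly many indices interact with each
  \<open>k\<close>, in particular for edges coarser than a vertex.\<close>

lemma bl_transfer:
  assumes a: "0 \<le> a" and bl: "bl a w I u K" and w: "\<And>i. i \<in> I \<Longrightarrow> 0 \<le> w i" "\<And>k. k \<in> I' \<Longrightarrow> 0 \<le> w' k"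
    and R: "\<And>k. k \<in> I' \<Longrightarrow> finite (R k)" "\<And>k. k \<in> I' \<Longrightarrow> R k \<subseteq> I" "\<And>k. k \<in> I' \<Longrightarrow> card (R k) \<le> N"
    and v: "\<And>k. k \<in> I' \<Longrightarrow> \<bar>v k\<bar> \<le> c * (\<Sum>i\<in>R k. \<bar>u i\<bar>)"
    and D: "\<And>J i. finite J \<Longrightarrow> J \<subseteq> I' \<Longrightarrow> i \<in> I \<Longrightarrow> (\<Sum>k\<in>{k\<in>J. i \<in> R k}. w' k) \<le> D * w i"
    and c: "0 \<le> c" and D0: "0 < D"
  shows "bl a w' I' v (c * real N * D powr a * K)"
proof (cases "a = 0")
  case True
  have "\<bar>v k\<bar> \<le> c * real N * D powr a * K" if k: "k \<in> I'" for k
  proof -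
    have "(\<Sum>i\<in>R k. \<bar>u i\<bar>) \<le> (\<Sum>i\<in>R k. K)" using R(2)[OF k] bl_zeroD[OF bl[unfolded True]] by (intro sum_mono) blast
    also have "\<dots> \<le> real N * K" using R(3)[OF k] bl_nonneg[OF bl] by (simp add: mult_right_mono)
    finally have "c * (\<Sum>i\<in>R k. \<bar>u i\<bar>) \<le> c * (real N * K)" using c by (intro mult_left_mono)
    then show ?thesis using v[OF k] True D0 by (simp add: mult_ac)
  qed
  then show ?thesis using True c bl_nonneg[OF bl] by (auto simp: bl_def)
next
  case False
  define p where "p = 1/a"
  have p: "p > 0" using a False by (simp add: p_def)
  have "(\<Sum>k\<in>J. w' k * \<bar>v k\<bar> powr p) \<le> (c * real N * D powr a * K) powr p" if J: "finite J" "J \<subseteq> I'" for J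
  proof -
    have "(\<Sum>k\<in>J. w' k * \<bar>v k\<bar> powr p) \<le> (\<Sum>k\<in>J. w' k * (c powr p * (real N powr p * (\<Sum>i\<in>R k. \<bar>u i\<bar> powr p))))"
    proof (intro sum_mono mult_left_mono)
      fix k assume "k \<in> J"
      then have k: "k \<in> I'" using J by auto
      have "\<bar>v k\<bar> powr p \<le> (c * (\<Sum>i\<in>R k. \<bar>u i\<bar>)) powr p" using v[OF k] p by (intro powr_mono2) auto
      also have "\<dots> = c powr p * (\<Sum>i\<in>R k. \<bar>u i\<bar>) powr p" using c by (simp add: powr_mult sum_nonneg)
      also have "\<dots> \<le> c powr p * (real N powr p * (\<Sum>i\<in>R k. \<bar>u i\<bar> powr p))"
        using R k p by (intro mult_left_mono sum_powr_le_card) auto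
      finally show "\<bar>v k\<bar> powr p \<le> c powr p * (real N powr p * (\<Sum>i\<in>R k. \<bar>u i\<bar> powr p))" .
      show "0 \<le> w' k" using w k by auto
    qed
    also have "\<dots> = c powr p * real N powr p * (\<Sum>k\<in>J. \<Sum>i\<in>R k. w' k * \<bar>u i\<bar> powr p)"
      by (simp add: sum_distrib_left mult_ac)
    also have "\<dots> \<le> c powr p * real N powr p * (D * K powr p)"
    proof (intro mult_left_mono sum_incidence_le[where I = I and d = "\<lambda>i. D * w i"])
      have "(\<Sum>i\<in>(\<Union>k\<in>J. R k). D * w i * \<bar>u i\<bar> powr p) = D * (\<Sum>i\<in>(\<Union>k\<in>J. R k). w i * \<bar>u i\<bar> powr p)"
        by (simp add: sum_distrib_left mult_ac)
      also have "\<dots> \<le> D * K powr p" unfolding p_def using J R D0 by (intro mult_left_mono bl_posD[OF bl False]) auto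
      finally show "(\<Sum>i\<in>(\<Union>k\<in>J. R k). D * w i * \<bar>u i\<bar> powr p) \<le> D * K powr p" .
    qed (use J R D in auto)
    also have "\<dots> = (c * real N * D powr a * K) powr p"
    proof -
      have "(D powr a) powr p = D" using D0 False by (simp add: powr_powr p_def)
      then show ?thesis using c bl_nonneg[OF bl] by (simp add: powr_mult)
    qed
    finally show ?thesis .
  qed
  then show ?thesis using False c bl_nonneg[OF bl] by (auto simp: bl_def p_def)
qed

text \<open>After division by the total every term lies between 0 and 1, where passing to a power
  \<open>p \<le> 1\<close> does not decrease it.\<close>

lemma sum_powr_subadditive:
  fixes u :: "'i \<Rightarrow> real"
  assumes "finite R" "0 \<le> p" "p \<le> 1"
  shows "(\<Sum>i\<in>R. \<bar>u i\<bar>) powr p \<le> (\<Sum>i\<in>R. \<bar>u i\<bar> powr p)"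
proof -
  define S where "S = (\<Sum>i\<in>R. \<bar>u i\<bar>)"
  show ?thesis
  proof (cases "S = 0")
    case True
    then show ?thesis unfolding S_def[symmetric] by (simp add: sum_nonneg)
  next
    case False
    then have S: "S > 0" unfolding S_def using sum_nonneg[of R "\<lambda>i. \<bar>u i\<bar>"] by (simp add: order_less_le)
    have "\<bar>u i\<bar> / S \<le> (\<bar>u i\<bar> / S) powr p" if "i \<in> R" for i
    proof -
      have "\<bar>u i\<bar> \<le> S" unfolding S_def using assms that by (intro member_le_sum) auto
      then have "(\<bar>u i\<bar> / S) powr 1 \<le> (\<bar>u i\<bar> / S) powr p" using S assms by (intro powr_mono') auto
      then show ?thesis using S by simp
    qed
    then have "(\<Sum>i\<in>R. \<bar>u i\<bar> / S) \<le> (\<Sum>i\<in>R. (\<bar>u i\<bar> / S) powr p)" by (rule sum_mono)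
    moreover have "(\<Sum>i\<in>R. \<bar>u i\<bar> / S) = 1" using S by (simp add: sum_divide_distrib[symmetric] S_def[symmetric])
    moreover have "(\<Sum>i\<in>R. (\<bar>u i\<bar> / S) powr p) = (\<Sum>i\<in>R. \<bar>u i\<bar> powr p) / S powr p"
      using S by (simp add: powr_divide sum_divide_distrib)
    ultimately show ?thesis using S by (simp add: S_def[symmetric])
  qed
qed

lemma convex_on_powr_nonneg:
  fixes p :: real
  assumes "1 \<le> p"
  shows "convex_on {0..} (\<lambda>x. x powr p)"
proof (rule convex_onI)
  fix t x y :: real
  assume t: "0 < t" "t < 1" and xy: "x \<in> {0..}" "y \<in> {0..}"
  \<comment> \<open>For the endpoint 0, where one of the two terms disappears and the other one
    carries a power of its coefficient.\<close>
  have le: "t powr p \<le> t" "(1 - t) powr p \<le> 1 - t"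
    using powr_mono'[of 1 p t] powr_mono'[of 1 p "1 - t"] t assms by auto
  show "((1 - t) *\<^sub>R x + t *\<^sub>R y) powr p \<le> (1 - t) * x powr p + t * y powr p"
  proof (cases "x = 0 \<or> y = 0")
    case True
    then show ?thesis using le t xy assms
      by (auto simp: powr_mult intro!: mult_right_mono)
  next
    case False
    then show ?thesis using convex_onD[OF powr_convex[OF assms], of t x y] t xy by simp
  qed
qed simp

text \<open>Jensen's inequality after normalizing the masses to a probability; undoing the
  normalization leaves the total mass to the power \<open>p - 1\<close>.\<close>

lemma sum_powr_convex:
  fixes u m :: "'i \<Rightarrow> real"
  assumes R: "finite R" and p: "1 \<le> p" and u: "\<And>i. i \<in> R \<Longrightarrow> 0 \<le> u i" and m: "\<And>i. i \<in> R \<Longrightarrow> 0 \<le> m i"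
    and M: "(\<Sum>i\<in>R. m i) \<le> D" "0 < D"
  shows "(\<Sum>i\<in>R. m i * u i) powr p \<le> D powr (p - 1) * (\<Sum>i\<in>R. m i * u i powr p)"
proof -
  define S where "S = (\<Sum>i\<in>R. m i)"
  show ?thesis
  proof (cases "S = 0")
    case True
    then have "m i = 0" if "i \<in> R" for i
      using R m that unfolding S_def by (simp add: sum_nonneg_eq_0_iff)
    then show ?thesis by simp
  next
    case False
    then have S: "S > 0" using m sum_nonneg[of R m] unfolding S_def by simp
    have cv: "convex_on {0..} (\<lambda>x::real. x powr p)"
      using p by (rule convex_on_powr_nonneg)
    have "(\<Sum>i\<in>R. (m i / S) *\<^sub>R u i) powr p \<le> (\<Sum>i\<in>R. (m i / S) * u i powr p)"
    proof (rule convex_on_sum[OF R _ cv])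
      show "R \<noteq> {}" using S by (auto simp: S_def)
      show "(\<Sum>i\<in>R. m i / S) = 1" using S by (simp add: sum_divide_distrib[symmetric] S_def[symmetric])
    qed (use m u S in auto)
    moreover have "(\<Sum>i\<in>R. (m i / S) *\<^sub>R u i) = (\<Sum>i\<in>R. m i * u i) / S"
      "(\<Sum>i\<in>R. (m i / S) * u i powr p) = (\<Sum>i\<in>R. m i * u i powr p) / S"
      by (simp_all add: sum_divide_distrib)
    ultimately have "((\<Sum>i\<in>R. m i * u i) / S) powr p \<le> (\<Sum>i\<in>R. m i * u i powr p) / S" by simp
    then have "(\<Sum>i\<in>R. m i * u i) powr p / S powr p \<le> (\<Sum>i\<in>R. m i * u i powr p) / S"
      using S m u by (simp add: powr_divide sum_nonneg)
    then have "(\<Sum>i\<in>R. m i * u i) powr p \<le> (S powr p / S) * (\<Sum>i\<in>R. m i * u i powr p)"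
      using S by (simp add: field_simps)
    also have "S powr p / S = S powr (p - 1)" using S by (simp add: powr_diff)
    also have "S powr (p - 1) * (\<Sum>i\<in>R. m i * u i powr p) \<le> D powr (p - 1) * (\<Sum>i\<in>R. m i * u i powr p)"
      using S M p m u unfolding S_def by (intro mult_right_mono powr_mono2 sum_nonneg) auto
    finally show ?thesis .
  qed
qed

text \<open>The loss \<^term>\<open>L powr max 0 (a - 1)\<close> is what forces the condition \<open>p > Q / (Q + s)\<close>
  for exponents \<open>p = 1 / a < 1\<close>.\<close>

lemma bl_average:
  assumes a: "0 \<le> a" and bl: "bl a w I u K" and w: "\<And>i. i \<in> I \<Longrightarrow> 0 < w i" "\<And>k. k \<in> I' \<Longrightarrow> 0 < w' k"
    and R: "\<And>k. k \<in> I' \<Longrightarrow> finite (R k)" "\<And>k. k \<in> I' \<Longrightarrow> R k \<subseteq> I"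
    and v: "\<And>k. k \<in> I' \<Longrightarrow> \<bar>v k\<bar> \<le> (\<Sum>i\<in>R k. \<bar>u i\<bar> * w i / w' k)"
    and D: "\<And>k. k \<in> I' \<Longrightarrow> (\<Sum>i\<in>R k. w i) \<le> D * w' k" "1 \<le> D"
    and N: "\<And>J i. finite J \<Longrightarrow> J \<subseteq> I' \<Longrightarrow> i \<in> I \<Longrightarrow> card {k\<in>J. i \<in> R k} \<le> N"
    and L: "\<And>k i. k \<in> I' \<Longrightarrow> i \<in> R k \<Longrightarrow> w' k \<le> L * w i" "1 \<le> L"
  shows "bl a w' I' v (D * real (Suc N) powr a * L powr max 0 (a - 1) * K)"
proof (cases "a = 0")
  case True
  have "\<bar>v k\<bar> \<le> D * real (Suc N) powr a * L powr max 0 (a - 1) * K" if k: "k \<in> I'" for k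
  proof -
    have "(\<Sum>i\<in>R k. \<bar>u i\<bar> * w i / w' k) \<le> (\<Sum>i\<in>R k. K * w i / w' k)"
      using R k bl_zeroD[OF bl[unfolded True]] w by (intro sum_mono divide_right_mono mult_right_mono) (auto simp: less_imp_le subset_iff)
    also have "\<dots> = K * (\<Sum>i\<in>R k. w i) / w' k" by (simp add: sum_distrib_left sum_divide_distrib)
    also have "\<dots> \<le> K * (D * w' k) / w' k" using D(1)[OF k] bl_nonneg[OF bl] w(2)[OF k] by (intro divide_right_mono mult_left_mono) auto
    also have "\<dots> = D * K" using w(2)[OF k] by simp
    finally show ?thesis using v[OF k] True L by simp
  qed
  then show ?thesis using True D L bl_nonneg[OF bl] by (auto simp: bl_def)
next
  case False
  define p where "p = 1/a"
  have a0: "a > 0" using a False by simp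
  have p: "p > 0" using a0 by (simp add: p_def)
  \<comment> \<open>For \<open>p \<ge> 1\<close> Jensen's inequality costs a power of the mass bound
    \<open>D\<close>. For \<open>p < 1\<close> there is only subadditivity, and its cost is the
    power \<open>1 - p\<close> of the largest weight ratio \<open>L\<close>; raised to the power
    \<open>a = 1/p\<close> it becomes \<open>L powr (a - 1)\<close>.\<close>
  define B where "B = (if a \<le> 1 then D powr (p - 1) else L powr (1 - p))"
  have key: "w' k * \<bar>v k\<bar> powr p \<le> B * (\<Sum>i\<in>R k. w i * \<bar>u i\<bar> powr p)" if k: "k \<in> I'" for k
  proof -
    have vp: "\<bar>v k\<bar> powr p \<le> (\<Sum>i\<in>R k. \<bar>u i\<bar> * w i / w' k) powr p" using v[OF k] p by (intro powr_mono2) auto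
    show ?thesis
    proof (cases "a \<le> 1")
      case True
      then have p1: "1 \<le> p" using a0 by (simp add: p_def)
      have "(\<Sum>i\<in>R k. (w i / w' k) * \<bar>u i\<bar>) powr p \<le> D powr (p - 1) * (\<Sum>i\<in>R k. (w i / w' k) * \<bar>u i\<bar> powr p)"
      proof (rule sum_powr_convex)
        show "(\<Sum>i\<in>R k. w i / w' k) \<le> D" using D(1)[OF k] w(2)[OF k] by (simp add: sum_divide_distrib[symmetric] field_simps)
      qed (use R k w D p1 in \<open>auto simp: subset_iff less_imp_le\<close>)
      also have "\<dots> = D powr (p - 1) * (\<Sum>i\<in>R k. w i * \<bar>u i\<bar> powr p) / w' k"
        by (simp add: sum_divide_distrib sum_distrib_left)
      finally have "\<bar>v k\<bar> powr p \<le> D powr (p - 1) * (\<Sum>i\<in>R k. w i * \<bar>u i\<bar> powr p) / w' k"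
        using vp by (simp add: mult.commute)
      then show ?thesis using True w(2)[OF k] by (simp add: B_def field_simps)
    next
      case False
      then have p1: "p \<le> 1" using a0 by (simp add: p_def)
      have "(\<Sum>i\<in>R k. \<bar>\<bar>u i\<bar> * w i / w' k\<bar>) powr p \<le> (\<Sum>i\<in>R k. \<bar>\<bar>u i\<bar> * w i / w' k\<bar> powr p)"
        by (rule sum_powr_subadditive) (use R k p p1 in auto)
      moreover have "(\<Sum>i\<in>R k. \<bar>\<bar>u i\<bar> * w i / w' k\<bar>) = (\<Sum>i\<in>R k. \<bar>u i\<bar> * w i / w' k)"
        using R k w by (intro sum.cong refl abs_of_nonneg) (auto simp: less_imp_le subset_iff)
      ultimately have "w' k * \<bar>v k\<bar> powr p \<le> w' k * (\<Sum>i\<in>R k. \<bar>\<bar>u i\<bar> * w i / w' k\<bar> powr p)"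
        using vp w(2)[OF k] by (intro mult_left_mono) auto
      also have "\<dots> = (\<Sum>i\<in>R k. w' k * \<bar>\<bar>u i\<bar> * w i / w' k\<bar> powr p)" by (simp add: sum_distrib_left)
      also have "\<dots> \<le> (\<Sum>i\<in>R k. L powr (1 - p) * (w i * \<bar>u i\<bar> powr p))"
      proof (rule sum_mono)
        fix i assume i: "i \<in> R k"
        have wi: "w i > 0" "w' k > 0" using w R(2)[OF k] i k by blast+
        have "w' k * \<bar>\<bar>u i\<bar> * w i / w' k\<bar> powr p = w i powr p * (w' k / w' k powr p) * \<bar>u i\<bar> powr p"
          using wi by (simp add: abs_mult powr_divide powr_mult)
        also have "w' k / w' k powr p = w' k powr (1 - p)" using wi by (simp add: powr_diff)
        also have "w i powr p * w' k powr (1 - p) * \<bar>u i\<bar> powr p \<le> w i powr p * (L * w i) powr (1 - p) * \<bar>u i\<bar> powr p"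
          using L(1)[OF k i] wi p1 by (intro mult_right_mono mult_left_mono powr_mono2) auto
        also have "\<dots> = L powr (1 - p) * ((w i powr p * w i powr (1 - p)) * \<bar>u i\<bar> powr p)"
          using wi L by (simp add: powr_mult)
        also have "w i powr p * w i powr (1 - p) = w i" using wi by (simp add: powr_add[symmetric])
        finally show "w' k * \<bar>\<bar>u i\<bar> * w i / w' k\<bar> powr p \<le> L powr (1 - p) * (w i * \<bar>u i\<bar> powr p)" by simp
      qed
      finally show ?thesis using False by (simp add: B_def sum_distrib_left)
    qed
  qed
  have B0: "0 \<le> B" by (simp add: B_def)
  have fin: "B * (real (Suc N) * K powr p) \<le> (D * real (Suc N) powr a * L powr max 0 (a - 1) * K) powr p"
  proof -
    have "(D * real (Suc N) powr a * L powr max 0 (a - 1) * K) powr p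
        = D powr p * (real (Suc N) powr a) powr p * (L powr max 0 (a - 1)) powr p * K powr p"
      using D L bl_nonneg[OF bl] by (simp only: powr_mult powr_ge_zero mult_nonneg_nonneg)
    also have "(real (Suc N) powr a) powr p = real (Suc N)" using a0 by (simp only: powr_powr p_def) simp
    also have "(L powr max 0 (a - 1)) powr p = L powr (max 0 (a - 1) * p)" by (simp add: powr_powr)
    finally have eq: "(D * real (Suc N) powr a * L powr max 0 (a - 1) * K) powr p
       = D powr p * real (Suc N) * L powr (max 0 (a - 1) * p) * K powr p" .
    have "B \<le> D powr p * L powr (max 0 (a - 1) * p)"
    proof (cases "a \<le> 1")
      case True
      have "D powr (p - 1) \<le> D powr p" using D by (intro powr_mono) auto
      then show ?thesis using True L by (simp add: B_def max_def)
    next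
      case False
      have "(a - 1) * p = 1 - p" using a0 by (simp add: p_def field_simps)
      moreover have "1 \<le> D powr p" using D p by (simp add: ge_one_powr_ge_zero)
      ultimately show ?thesis using False L by (simp add: B_def max_def)
    qed
    then have "B * (real (Suc N) * K powr p) \<le> (D powr p * L powr (max 0 (a - 1) * p)) * (real (Suc N) * K powr p)"
      by (intro mult_right_mono) auto
    then show ?thesis unfolding eq by (simp add: mult_ac)
  qed
  have "(\<Sum>k\<in>J. w' k * \<bar>v k\<bar> powr p) \<le> (D * real (Suc N) powr a * L powr max 0 (a - 1) * K) powr p"
    if J: "finite J" "J \<subseteq> I'" for J
  proof -
    have "(\<Sum>k\<in>J. w' k * \<bar>v k\<bar> powr p) \<le> (\<Sum>k\<in>J. B * (\<Sum>i\<in>R k. 1 * (w i * \<bar>u i\<bar> powr p)))"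
      using J key by (intro sum_mono) auto
    also have "\<dots> = B * (\<Sum>k\<in>J. \<Sum>i\<in>R k. 1 * (w i * \<bar>u i\<bar> powr p))" by (simp add: sum_distrib_left)
    also have "\<dots> \<le> B * (real (Suc N) * K powr p)"
    proof (intro mult_left_mono sum_incidence_le[where I = I and d = "\<lambda>i. real (Suc N)"])
      have "(\<Sum>i\<in>(\<Union>k\<in>J. R k). real (Suc N) * (w i * \<bar>u i\<bar> powr p)) = real (Suc N) * (\<Sum>i\<in>(\<Union>k\<in>J. R k). w i * \<bar>u i\<bar> powr p)"
        by (simp add: sum_distrib_left mult_ac)
      also have "\<dots> \<le> real (Suc N) * K powr p" unfolding p_def using J R by (intro mult_left_mono bl_posD[OF bl False]) auto
      finally show "(\<Sum>i\<in>(\<Union>k\<in>J. R k). real (Suc N) * (w i * \<bar>u i\<bar> powr p)) \<le> real (Suc N) * K powr p" .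
      show "(\<Sum>k\<in>{k \<in> J. i \<in> R k}. 1) \<le> real (Suc N)" if "i \<in> I" for i using N[OF J that] by simp
    qed (use J R w B0 in \<open>auto simp: less_imp_le\<close>)
    also note fin
    finally show ?thesis .
  qed
  then show ?thesis using False D L bl_nonneg[OF bl] by (auto simp: bl_def p_def)
qed

section \<open>Densities, factorization and weights tending to infinity\<close>

text \<open>Multiplying the weight by a density \<open>g\<close> while dividing the family by
  \<open>g powr a\<close> is an isometry in exponent \<open>1 / a\<close>. It moves estimates to a
  probability weight, where different exponents can be compared.\<close>

lemma bl_change_weight:
  assumes a: "0 \<le> a" and bl: "bl a w I u K" and g: "\<And>i. i \<in> I \<Longrightarrow> 0 < g i" and c: "0 < c"
  shows "bl a (\<lambda>i. w i * g i) I (\<lambda>i. u i / (g i powr a * c)) (K / c)"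
proof (cases "a = 0")
  case True
  have "\<bar>u i / (g i powr a * c)\<bar> \<le> K / c" if "i \<in> I" for i
    using bl_zeroD[OF bl[unfolded True] that] g[OF that] c True by (simp add: abs_mult divide_right_mono)
  then show ?thesis using True c bl_nonneg[OF bl] by (simp add: bl_def)
next
  case False
  have "(\<Sum>i\<in>J. w i * g i * \<bar>u i / (g i powr a * c)\<bar> powr (1/a)) \<le> (K / c) powr (1/a)" if J: "finite J" "J \<subseteq> I" for J
  proof -
    have "(\<Sum>i\<in>J. w i * g i * \<bar>u i / (g i powr a * c)\<bar> powr (1/a)) = (\<Sum>i\<in>J. w i * \<bar>u i\<bar> powr (1/a) / c powr (1/a))"
    proof (rule sum.cong[OF refl])
      fix i assume "i \<in> J"
      then have "g i > 0" using g J by auto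
      then show "w i * g i * \<bar>u i / (g i powr a * c)\<bar> powr (1/a) = w i * \<bar>u i\<bar> powr (1/a) / c powr (1/a)"
        using False c by (simp add: abs_mult powr_divide powr_mult powr_powr)
    qed
    also have "\<dots> = (\<Sum>i\<in>J. w i * \<bar>u i\<bar> powr (1/a)) / c powr (1/a)" by (simp add: sum_divide_distrib)
    also have "\<dots> \<le> K powr (1/a) / c powr (1/a)" using bl_posD[OF bl False J] by (intro divide_right_mono) auto
    also have "\<dots> = (K / c) powr (1/a)" using c bl_nonneg[OF bl] by (simp add: powr_divide)
    finally show ?thesis .
  qed
  then show ?thesis using False c bl_nonneg[OF bl] by (auto simp: bl_def)
qed

text \<open>One density of total mass at most 1 yields extremal families for all exponents
  simultaneously, namely its powers. Interpolating exponents thereby reduces to interpolating powers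
  of a fixed function.\<close>

lemma bl_density:
  assumes a: "0 \<le> a" and c: "0 \<le> c" and g: "\<And>i. i \<in> I \<Longrightarrow> 0 \<le> g i"
    and s: "\<And>J. finite J \<Longrightarrow> J \<subseteq> I \<Longrightarrow> (\<Sum>i\<in>J. w i * g i) \<le> 1"
  shows "bl a w I (\<lambda>i. g i powr a * c) c"
proof (cases "a = 0")
  case True
  then show ?thesis using c by (auto simp: bl_def)
next
  case False
  have "(\<Sum>i\<in>J. w i * \<bar>g i powr a * c\<bar> powr (1/a)) \<le> c powr (1/a)" if J: "finite J" "J \<subseteq> I" for J
  proof -
    have "(\<Sum>i\<in>J. w i * \<bar>g i powr a * c\<bar> powr (1/a)) = (\<Sum>i\<in>J. c powr (1/a) * (w i * g i))"
    proof (rule sum.cong[OF refl])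
      fix i assume "i \<in> J"
      then have "g i \<ge> 0" using g J by auto
      then show "w i * \<bar>g i powr a * c\<bar> powr (1/a) = c powr (1/a) * (w i * g i)"
        using False c by (simp add: abs_mult powr_mult powr_powr)
    qed
    also have "\<dots> \<le> c powr (1/a)" using s[OF J] by (simp add: sum_distrib_left[symmetric] mult_left_le)
    finally show ?thesis .
  qed
  then show ?thesis using False c by (auto simp: bl_def)
qed

text \<open>On a probability weight power means increase with the exponent, so one small
  \<open>r\<close> may replace any endpoint exponent, the supremum norm included.\<close>

lemma bl_power_mean:
  assumes bl: "bl a m J u T" and a: "0 \<le> a" and J: "finite J" "\<And>i. i \<in> J \<Longrightarrow> 0 \<le> m i" "(\<Sum>i\<in>J. m i) = 1"
    and r: "0 < r" "r * a \<le> 1"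
  shows "(\<Sum>i\<in>J. m i * \<bar>u i\<bar> powr r) \<le> T powr r"
proof (cases "a = 0")
  case True
  have "(\<Sum>i\<in>J. m i * \<bar>u i\<bar> powr r) \<le> (\<Sum>i\<in>J. m i * T powr r)"
    using bl_zeroD[OF bl[unfolded True]] J r by (intro sum_mono mult_left_mono powr_mono2) auto
  then show ?thesis using J by (simp add: sum_distrib_right[symmetric])
next
  case False
  then have a0: "a > 0" using a by simp
  have T0: "T \<ge> 0" using bl_nonneg[OF bl] .
  define x where "x = (\<Sum>i\<in>J. m i * \<bar>u i\<bar> powr r)"
  have x0: "x \<ge> 0" unfolding x_def using J by (intro sum_nonneg) auto
  define p where "p = 1 / (a * r)"
  have p: "p \<ge> 1" using r a0 by (simp add: p_def mult.commute)
  have "x powr p \<le> 1 powr (p - 1) * (\<Sum>i\<in>J. m i * (\<bar>u i\<bar> powr r) powr p)"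
    unfolding x_def using J p by (intro sum_powr_convex) auto
  also have "\<dots> = (\<Sum>i\<in>J. m i * \<bar>u i\<bar> powr (1/a))" using r a0 by (simp add: powr_powr p_def)
  also have "\<dots> \<le> T powr (1/a)" using bl_posD[OF bl False J(1)] by simp
  finally have "(x powr p) powr (a * r) \<le> (T powr (1/a)) powr (a * r)" using a0 r by (intro powr_mono2) auto
  then show ?thesis using a0 r x0 T0 by (simp add: powr_powr p_def x_def[symmetric])
qed

lemma mixed_zero: "0 \<le> K \<Longrightarrow> mixed I w a b s (\<lambda>_. 0) K"
  unfolding mixed_def by (rule exI[of _ "\<lambda>_. 0"]) (simp add: bl_zero)

text \<open>The exponents of the weighted geometric mean are affine in \<theta>; the convention
  \<open>0 powr 0 = 0\<close> keeps the identity valid where \<open>G\<close> or \<open>H\<close>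
  vanishes.\<close>

lemma factor_product:
  fixes G H K :: real
  assumes "0 \<le> G" "0 \<le> H" "0 < K" and a: "a = (1 - \<theta>) * a0 + \<theta> * a1" and b: "b = (1 - \<theta>) * b0 + \<theta> * b1"
    and s: "s = (1 - \<theta>) * s0 + \<theta> * s1"
  shows "(G powr a0 * (H powr b0 * 2 powr (- (of_int n * s0)) * K)) powr (1 - \<theta>) *
    (G powr a1 * (H powr b1 * 2 powr (- (of_int n * s1)) * K)) powr \<theta> = G powr a * (H powr b * 2 powr (- (of_int n * s)) * K)"
proof -
  have "(G powr a0 * (H powr b0 * 2 powr (- (of_int n * s0)) * K)) powr (1 - \<theta>) *
    (G powr a1 * (H powr b1 * 2 powr (- (of_int n * s1)) * K)) powr \<theta>
    = (G powr a0) powr (1 - \<theta>) * ((H powr b0) powr (1 - \<theta>) * (2 powr (- (of_int n * s0))) powr (1 - \<theta>) * K powr (1 - \<theta>))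
     * ((G powr a1) powr \<theta> * ((H powr b1) powr \<theta> * (2 powr (- (of_int n * s1))) powr \<theta> * K powr \<theta>))"
    using assms(3) by (simp only: powr_mult powr_ge_zero mult_nonneg_nonneg less_imp_le)
  also have "\<dots> = (G powr ((1 - \<theta>) * a0) * G powr (\<theta> * a1)) * (H powr ((1 - \<theta>) * b0) * H powr (\<theta> * b1))
     * (2 powr (- ((1 - \<theta>) * (of_int n * s0))) * 2 powr (- (\<theta> * (of_int n * s1)))) * (K powr (1 - \<theta>) * K powr \<theta>)"
    by (simp add: powr_powr mult_ac)
  also have "\<dots> = G powr a * H powr b * 2 powr (- (of_int n * s)) * K"
  proof -
    have "2 powr (- ((1 - \<theta>) * (of_int n * s0))) * 2 powr (- (\<theta> * (of_int n * s1))) = 2 powr (- (of_int n * s))"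
      by (simp add: powr_add[symmetric] s algebra_simps)
    moreover have "K powr (1 - \<theta>) * K powr \<theta> = K" using assms(3) by (simp add: powr_add[symmetric])
    moreover have "G powr a = G powr ((1 - \<theta>) * a0) * G powr (\<theta> * a1)" "H powr b = H powr ((1 - \<theta>) * b0) * H powr (\<theta> * b1)"
      using a b by (simp_all add: powr_add)
    ultimately show ?thesis by (simp only:)
  qed
  finally show ?thesis by (simp only: mult.assoc)
qed

text \<open>The normalized powers \<open>g\<close> inside a level and \<open>h\<close> across the
  levels are densities of mass at most 1. Their powers \<open>a'\<close> and \<open>b'\<close> are
  extremal for every pair of exponents, and as all three parameters are affine in \<theta>, the two
  endpoint families multiply to the given one. Forming \<open>g\<close> and \<open>h\<close> takes
  finite intermediate exponents, that is \<open>a\<close> and \<open>b\<close> positive.\<close>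

lemma mixed_factorization:
  fixes a0 a1 b0 b1 s0 s1 \<theta> :: real
  assumes th: "0 < \<theta>" "\<theta> < 1" and nn: "0 \<le> a0" "0 \<le> a1" "0 \<le> b0" "0 \<le> b1"
    and a: "a = (1 - \<theta>) * a0 + \<theta> * a1" "0 < a" and b: "b = (1 - \<theta>) * b0 + \<theta> * b1" "0 < b"
    and s: "s = (1 - \<theta>) * s0 + \<theta> * s1"
    and w: "\<And>n i. i \<in> I n \<Longrightarrow> 0 < w i" and lvl: "\<And>n i. i \<in> I n \<Longrightarrow> lvl i = n"
    and u: "mixed I w a b s u K"
  obtains m0 m1 where "\<And>i. 0 \<le> m0 i" "\<And>i. 0 \<le> m1 i"
    "\<And>n i. i \<in> I n \<Longrightarrow> \<bar>u i\<bar> = m0 i powr (1 - \<theta>) * m1 i powr \<theta>"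
    "mixed I w a0 b0 s0 m0 K" "mixed I w a1 b1 s1 m1 K"
proof (cases "K = 0")
  case True
  have "u i = 0" if "i \<in> I n" for n i
    using mixed_pointwise[OF u _ _ that w[OF that]] a b True by simp
  then show thesis using True mixed_zero[of 0] by (intro that[of "\<lambda>_. 0" "\<lambda>_. 0"]) auto
next
  case False
  then have K: "K > 0" using mixed_nonneg[OF u] by simp
  obtain U where U: "\<And>n. bl a w (I n) u (U n)" "bl b (\<lambda>_. 1) UNIV (\<lambda>n. 2 powr (of_int n * s) * U n) K"
    using u by (auto simp: mixed_def)
  have U0: "0 \<le> U n" for n using bl_nonneg[OF U(1)] .
  \<comment> \<open>Where \<open>U\<close> vanishes the division gives 0, in agreement with
    \<open>u\<close> vanishing on that level.\<close>
  define g where "g i = (\<bar>u i\<bar> / U (lvl i)) powr (1/a)" for i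
  define h where "h n = (2 powr (of_int n * s) * U n / K) powr (1/b)" for n
  define m where "m a' b' s' i = g i powr a' * (h (lvl i) powr b' * 2 powr (- (of_int (lvl i) * s')) * K)" for a' b' s' :: real and i
  have sg: "(\<Sum>i\<in>J. w i * g i) \<le> 1" if J: "finite J" "J \<subseteq> I n" for J n
  proof (cases "U n = 0")
    case True
    then have "g i = 0" if "i \<in> J" for i using lvl J that by (auto simp: g_def)
    then show ?thesis by simp
  next
    case False
    then have Un: "U n > 0" using U0[of n] by simp
    have "(\<Sum>i\<in>J. w i * g i) = (\<Sum>i\<in>J. w i * \<bar>u i\<bar> powr (1/a)) / U n powr (1/a)"
      using J lvl Un by (auto simp: g_def powr_divide sum_divide_distrib intro!: sum.cong)
    also have "\<dots> \<le> 1" using bl_posD[OF U(1) _ J] a Un by simp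
    finally show ?thesis .
  qed
  have sh: "(\<Sum>n\<in>J. 1 * h n) \<le> 1" if J: "finite J" for J
  proof -
    have "(\<Sum>n\<in>J. 1 * h n) = (\<Sum>n\<in>J. 1 * \<bar>2 powr (of_int n * s) * U n\<bar> powr (1/b)) / K powr (1/b)"
      using K U0 by (simp add: h_def powr_divide sum_divide_distrib)
    also have "\<dots> \<le> 1" using bl_posD[OF U(2) _ J] b K by simp
    finally show ?thesis .
  qed
  have mx: "mixed I w a' b' s' (m a' b' s') K" if "0 \<le> a'" "0 \<le> b'" for a' b' s'
    unfolding mixed_def
  proof (intro exI[of _ "\<lambda>n. h n powr b' * 2 powr (- (of_int n * s')) * K"] conjI allI)
    fix n
    have "bl a' w (I n) (\<lambda>i. g i powr a' * (h n powr b' * 2 powr (- (of_int n * s')) * K)) (h n powr b' * 2 powr (- (of_int n * s')) * K)"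
      using that K sg by (intro bl_density) (auto simp: g_def)
    then show "bl a' w (I n) (m a' b' s') (h n powr b' * 2 powr (- (of_int n * s')) * K)"
      by (rule bl_mono) (use that w lvl in \<open>auto simp: m_def less_imp_le\<close>)
  next
    have "bl b' (\<lambda>_. 1) UNIV (\<lambda>n. h n powr b' * K) K"
      using that K sh by (intro bl_density) (auto simp: h_def)
    moreover have "2 powr (of_int n * s') * (h n powr b' * 2 powr (- (of_int n * s')) * K) = h n powr b' * K" for n
      proof -
      have "2 powr (of_int n * s') * 2 powr (- (of_int n * s')) = (1::real)" by (simp add: powr_add[symmetric])
      then show ?thesis by (metis mult.assoc mult.commute mult.right_neutral)
    qed
    ultimately show "bl b' (\<lambda>_. 1) UNIV (\<lambda>n. 2 powr (of_int n * s') * (h n powr b' * 2 powr (- (of_int n * s')) * K)) K" by (simp only:)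
  qed
  show thesis
  proof (rule that[of "m a0 b0 s0" "m a1 b1 s1"])
    fix n i assume i: "i \<in> I n"
    have "\<bar>u i\<bar> = 0" if "U n = 0" using bl_pointwise[OF U(1) _ i w[OF i]] a that by simp
    moreover have "\<bar>u i\<bar> = m a0 b0 s0 i powr (1 - \<theta>) * m a1 b1 s1 i powr \<theta>" if "U n \<noteq> 0"
    proof -
      have Un: "U n > 0" using that U0[of n] by simp
      define G where "G = g i"
      define H where "H = h n"
      have G0: "G \<ge> 0" "H > 0" using Un K by (auto simp: G_def H_def g_def h_def)
      have "m a0 b0 s0 i powr (1 - \<theta>) * m a1 b1 s1 i powr \<theta> = G powr a * (H powr b * 2 powr (- (of_int n * s)) * K)"
        unfolding m_def lvl[OF i] G_def[symmetric] H_def[symmetric]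
        by (rule factor_product[OF G0(1) less_imp_le[OF G0(2)] K a(1) b(1) s])
      also have "G powr a = \<bar>u i\<bar> / U n" using Un a(2) lvl[OF i] by (simp add: G_def g_def powr_powr)
      also have "H powr b = 2 powr (of_int n * s) * U n / K"
      proof -
        have "(x powr (1/b)) powr b = x" if "0 \<le> x" for x using b(2) that by (simp add: powr_powr)
        from this[of "2 powr (of_int n * s) * U n / K"] show ?thesis unfolding H_def h_def using Un K by simp
      qed
      also have "\<bar>u i\<bar> / U n * (2 powr (of_int n * s) * U n / K * 2 powr (- (of_int n * s)) * K)
          = \<bar>u i\<bar> * (2 powr (of_int n * s) * 2 powr (- (of_int n * s)))" using Un K by simp
      also have "\<dots> = \<bar>u i\<bar>" by (simp add: powr_add[symmetric])
      finally show ?thesis by simp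
    qed
    ultimately show "\<bar>u i\<bar> = m a0 b0 s0 i powr (1 - \<theta>) * m a1 b1 s1 i powr \<theta>"
    proof (cases "U n = 0")
      case True
      then have "\<bar>u i\<bar> = 0" and "g i = 0" using \<open>U n = 0 \<Longrightarrow> \<bar>u i\<bar> = 0\<close> by (auto simp: g_def)
      then show ?thesis using th by (simp add: m_def)
    qed simp
  qed (use mx nn K in \<open>auto simp: m_def\<close>)
qed

text \<open>A convergent positive series stays convergent after multiplication by a suitable weight
  tending to infinity. The weight counts how many of the sets \<open>J j\<close> miss an index; the
  mass outside \<open>J j\<close> is at most \<open>R * (1/2) ^ Suc j\<close>, so the extra mass is
  at most \<open>R\<close> again.\<close>

lemma summable_weight:
  fixes x :: "'i \<Rightarrow> real"
  assumes I: "countable I" and x: "\<And>i. i \<in> I \<Longrightarrow> 0 \<le> x i"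
    and R: "\<And>J. finite J \<Longrightarrow> J \<subseteq> I \<Longrightarrow> (\<Sum>i\<in>J. x i) \<le> R"
  shows "\<exists>v :: 'i \<Rightarrow> real. (\<forall>i. 1 \<le> v i) \<and> (\<forall>k. finite {i\<in>I. v i < k}) \<and>
    (\<forall>J. finite J \<longrightarrow> J \<subseteq> I \<longrightarrow> (\<Sum>i\<in>J. x i * v i) \<le> 2 * R)"
proof -
  have R0: "0 \<le> R" using R[of "{}"] by simp
  have "\<exists>J. finite J \<and> J \<subseteq> I \<and> (\<forall>H. finite H \<longrightarrow> H \<subseteq> I - J \<longrightarrow> (\<Sum>i\<in>H. x i) \<le> R * (1/2) ^ Suc j)" for j
  proof (cases "R = 0")
    case True
    then show ?thesis using R by (intro exI[of _ "{}"]) auto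
  next
    case False
    define S where "S = (SUP J\<in>{J. finite J \<and> J \<subseteq> I}. \<Sum>i\<in>J. x i)"
    have bdd: "bdd_above ((\<lambda>J. \<Sum>i\<in>J. x i) ` {J. finite J \<and> J \<subseteq> I})" using R by (intro bdd_aboveI2[of _ _ R]) auto
    have "S - R * (1/2) ^ Suc j < S" using False R0 by simp
    then obtain J where J: "finite J" "J \<subseteq> I" "S - R * (1/2) ^ Suc j < (\<Sum>i\<in>J. x i)"
      unfolding S_def by (subst (asm) less_cSUP_iff) (use bdd in auto)
    have "(\<Sum>i\<in>H. x i) \<le> R * (1/2) ^ Suc j" if H: "finite H" "H \<subseteq> I - J" for H
    proof -
      have "(\<Sum>i\<in>H \<union> J. x i) \<le> S" unfolding S_def using H J by (intro cSUP_upper bdd) auto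
      moreover have "(\<Sum>i\<in>H \<union> J. x i) = (\<Sum>i\<in>H. x i) + (\<Sum>i\<in>J. x i)" using H J by (intro sum.union_disjoint) auto
      ultimately show ?thesis using J by linarith
    qed
    then show ?thesis using J by blast
  qed
  then obtain J0 where J0: "\<And>j. finite (J0 j)" "\<And>j. J0 j \<subseteq> I"
    "\<And>j H. finite H \<Longrightarrow> H \<subseteq> I - J0 j \<Longrightarrow> (\<Sum>i\<in>H. x i) \<le> R * (1/2) ^ Suc j" by metis
  \<comment> \<open>The first \<open>j\<close> indices of an enumeration are added so that every
    index is missed only finitely often, even where \<open>x\<close> vanishes; otherwise the count
    could be infinite.\<close>
  define J where "J j = J0 j \<union> {i\<in>I. to_nat_on I i < j}" for j
  have fe: "finite {i\<in>I. to_nat_on I i < j}" for j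
    by (rule inj_on_finite[of "to_nat_on I" _ "{..<j}"]) (use I inj_on_to_nat_on in \<open>auto intro: inj_on_subset\<close>)
  have J: "finite (J j)" for j using fe J0 by (simp add: J_def)
  define m where "m i = {j. i \<notin> J j}" for i
  define v where "v i = (if i \<in> I then 1 + real (card (m i)) else 1)" for i
  have fm: "m i \<subseteq> {..to_nat_on I i}" if "i \<in> I" for i using that by (fastforce simp: m_def J_def)
  have finm: "finite (m i)" if "i \<in> I" for i using fm[OF that] finite_subset by blast
  show ?thesis
  proof (intro exI[of _ v] conjI allI impI)
    show "1 \<le> v i" for i by (simp add: v_def)
    show "finite {i\<in>I. v i < k}" for k
    proof (rule finite_subset)
      \<comment> \<open>An index outside all of these finitely many finite sets is missed more than
        \<open>k\<close> times.\<close>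
      show "{i\<in>I. v i < k} \<subseteq> (\<Union>j\<le>nat \<lceil>k\<rceil>. J j)"
      proof
        fix i assume i: "i \<in> {i\<in>I. v i < k}"
        show "i \<in> (\<Union>j\<le>nat \<lceil>k\<rceil>. J j)"
        proof (rule ccontr)
          assume "i \<notin> (\<Union>j\<le>nat \<lceil>k\<rceil>. J j)"
          then have "{..nat \<lceil>k\<rceil>} \<subseteq> m i" by (auto simp: m_def)
          then have "card {..nat \<lceil>k\<rceil>} \<le> card (m i)" using finm i by (intro card_mono) auto
          then have "Suc (nat \<lceil>k\<rceil>) \<le> card (m i)" by simp
          moreover have "1 + real (card (m i)) < k" using i by (auto simp: v_def)
          moreover have "k \<le> real (nat \<lceil>k\<rceil>)" by (rule real_nat_ceiling_ge)
          ultimately show False by linarith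
        qed
      qed
    qed (use J in auto)
    fix H assume H: "finite H" "H \<subseteq> I"
    define N where "N = Suc (Max (insert 0 (to_nat_on I ` H)))"
    have mN: "m i \<subseteq> {..<N}" if "i \<in> H" for i
    proof -
      have "to_nat_on I i \<le> Max (insert 0 (to_nat_on I ` H))" using that H by (intro Max_ge) auto
      moreover have "m i \<subseteq> {..to_nat_on I i}" using fm that H by auto
      ultimately show ?thesis by (auto simp: N_def)
    qed
    have "(\<Sum>i\<in>H. x i * real (card (m i))) = (\<Sum>i\<in>H. \<Sum>j\<in>{j\<in>{..<N}. i \<notin> J j}. x i)"
    proof (rule sum.cong[OF refl])
      fix i assume "i \<in> H"
      then have "m i = {j\<in>{..<N}. i \<notin> J j}" using mN by (auto simp: m_def)
      then show "x i * real (card (m i)) = (\<Sum>j\<in>{j\<in>{..<N}. i \<notin> J j}. x i)" by simp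
    qed
    also have "\<dots> = (\<Sum>j\<in>{..<N}. \<Sum>i\<in>{i\<in>H. i \<notin> J j}. x i)" using H by (intro sum.swap_restrict) auto
    also have "\<dots> \<le> (\<Sum>j\<in>{..<N}. R * (1/2) ^ Suc j)"
      using H by (intro sum_mono J0(3)) (auto simp: J_def)
    also have "\<dots> = R * (\<Sum>j\<in>{..<N}. (1/2) ^ Suc j)" by (simp only: sum_distrib_left)
    also have "(\<Sum>j\<in>{..<N}. (1/2::real) ^ Suc j) = (\<Sum>j\<in>{..<N}. (1/2) ^ j) / 2" by (simp add: sum_divide_distrib)
    also have "\<dots> = 1 - (1/2) ^ N" by (subst geometric_sum) auto
    also have "R * (1 - (1/2) ^ N) \<le> R" using R0 by (simp add: mult_left_le)
    finally have *: "(\<Sum>i\<in>H. x i * real (card (m i))) \<le> R" .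
    have "(\<Sum>i\<in>H. x i * v i) = (\<Sum>i\<in>H. x i) + (\<Sum>i\<in>H. x i * real (card (m i)))"
      using H by (auto simp: v_def algebra_simps sum.distrib[symmetric] intro!: sum.cong)
    then show "(\<Sum>i\<in>H. x i * v i) \<le> 2 * R" using R[OF H] * by linarith
  qed
qed

text \<open>Both the entries inside each level and the levels themselves receive a weight tending to
  infinity. The product is below a given bound at finitely many levels only and, within each of
  them, at finitely many indices.\<close>

lemma mixed_weight:
  assumes a: "0 < a" and b: "0 < b" and I: "\<And>n. countable (I n)"
    and w: "\<And>n i. i \<in> I n \<Longrightarrow> 0 < w i" and lvl: "\<And>n i. i \<in> I n \<Longrightarrow> lvl i = n"
    and u: "mixed I w a b s u K"
  obtains v where "\<And>i. 1 \<le> v i" "\<And>k::real. finite {i\<in>(\<Union>n. I n). v i < k}"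
    "mixed I w a b s (\<lambda>i. u i * v i) (2 powr (a + b) * K)"
proof -
  obtain U where U: "\<And>n. bl a w (I n) u (U n)" "bl b (\<lambda>_. 1) UNIV (\<lambda>n. 2 powr (of_int n * s) * U n) K"
    using u by (auto simp: mixed_def)
  have U0: "0 \<le> U n" for n using bl_nonneg[OF U(1)] .
  define P :: "int \<Rightarrow> ('a \<Rightarrow> real) \<Rightarrow> bool" where
    "P n v \<longleftrightarrow> (\<forall>i. 1 \<le> v i) \<and> (\<forall>k. finite {i\<in>I n. v i < k}) \<and> (\<forall>J. finite J \<longrightarrow> J \<subseteq> I n \<longrightarrow>
     (\<Sum>i\<in>J. (w i * \<bar>u i\<bar> powr (1/a)) * v i) \<le> 2 * U n powr (1/a))" for n v
  have "\<forall>n. \<exists>v. P n v"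
  proof
    fix n
    have "0 \<le> w i * \<bar>u i\<bar> powr (1/a)" if "i \<in> I n" for i using w[OF that] by simp
    moreover have "(\<Sum>i\<in>J. w i * \<bar>u i\<bar> powr (1/a)) \<le> U n powr (1/a)" if "finite J" "J \<subseteq> I n" for J
      using bl_posD[OF U(1) _ that] a by simp
    ultimately show "\<exists>v. P n v" unfolding P_def by (rule summable_weight[OF I])
  qed
  from choice[OF this] obtain v where "\<forall>n. P n (v n)" by (rule exE)
  then have v: "\<And>n i. 1 \<le> v n i" "\<And>n k. finite {i\<in>I n. v n i < k}"
    "\<And>n J. finite J \<Longrightarrow> J \<subseteq> I n \<Longrightarrow> (\<Sum>i\<in>J. (w i * \<bar>u i\<bar> powr (1/a)) * v n i) \<le> 2 * U n powr (1/a)"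
    unfolding P_def by simp_all
  have "\<exists>v::int \<Rightarrow> real. (\<forall>n. 1 \<le> v n) \<and> (\<forall>k. finite {n\<in>UNIV. v n < k}) \<and> (\<forall>J. finite J \<longrightarrow> J \<subseteq> UNIV \<longrightarrow>
     (\<Sum>n\<in>J. (\<bar>2 powr (of_int n * s) * U n\<bar> powr (1/b)) * v n) \<le> 2 * K powr (1/b))"
  proof (rule summable_weight)
    show "(\<Sum>n\<in>J. \<bar>2 powr (of_int n * s) * U n\<bar> powr (1/b)) \<le> K powr (1/b)" if "finite J" "J \<subseteq> UNIV" for J
      using bl_posD[OF U(2) _ that] b by simp
  qed auto
  then obtain v' :: "int \<Rightarrow> real" where v': "\<And>n. 1 \<le> v' n" "\<And>k. finite {n\<in>UNIV. v' n < k}"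
    "\<And>J. finite J \<Longrightarrow> J \<subseteq> UNIV \<Longrightarrow> (\<Sum>n\<in>J. (\<bar>2 powr (of_int n * s) * U n\<bar> powr (1/b)) * v' n) \<le> 2 * K powr (1/b)"
    by blast
  \<comment> \<open>The powers \<open>a\<close> and \<open>b\<close> undo the exponents
    \<open>1 / a\<close> and \<open>1 / b\<close>; the doubling of the two sums turns into the
    factors \<open>2 powr a\<close> and \<open>2 powr b\<close>.\<close>
  define z where "z i = v' (lvl i) powr b * v (lvl i) i powr a" for i
  have ge: "1 \<le> v n i powr a" "1 \<le> v' n powr b" for n i using a b v v' by (auto intro!: ge_one_powr_ge_zero)
  show thesis
  proof (rule that)
    show "1 \<le> z i" for i using mult_mono[OF ge(2) ge(1)[of "lvl i" i], of "lvl i"] by (simp add: z_def)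
    show "finite {i\<in>(\<Union>n. I n). z i < k}" for k
    proof (rule finite_subset)
      show "{i\<in>(\<Union>n. I n). z i < k} \<subseteq> (\<Union>n\<in>{n\<in>UNIV. v' n < k powr (1/b)}. {i\<in>I n. v n i < k powr (1/a)})"
      proof
        fix i assume "i \<in> {i\<in>(\<Union>n. I n). z i < k}"
        then obtain n where i: "i \<in> I n" "z i < k" by auto
        have z: "z i = v' n powr b * v n i powr a" using lvl[OF i(1)] by (simp add: z_def)
        have "1 * v n i powr a \<le> z i" "v' n powr b * 1 \<le> z i" unfolding z by (intro mult_right_mono mult_left_mono ge; simp)+
        then have l: "v n i powr a < k" "v' n powr b < k" using i by auto
        have "(v n i powr a) powr (1/a) < k powr (1/a)" "(v' n powr b) powr (1/b) < k powr (1/b)"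
          using l a b by (auto intro!: powr_less_mono2)
        then have "v n i < k powr (1/a)" "v' n < k powr (1/b)"
          using a b v(1)[of n i] v'(1)[of n] by (auto simp: powr_powr)
        then show "i \<in> (\<Union>n\<in>{n\<in>UNIV. v' n < k powr (1/b)}. {i\<in>I n. v n i < k powr (1/a)})" using i by auto
      qed
    qed (use v v' in auto)
    show "mixed I w a b s (\<lambda>i. u i * z i) (2 powr (a + b) * K)"
      unfolding mixed_def
    proof (intro exI[of _ "\<lambda>n. v' n powr b * (2 powr a * U n)"] conjI allI)
      fix n
      have "(\<Sum>i\<in>J. w i * \<bar>u i * v n i powr a\<bar> powr (1/a)) \<le> (2 powr a * U n) powr (1/a)" if J: "finite J" "J \<subseteq> I n" for J
      proof -
        have "(\<Sum>i\<in>J. w i * \<bar>u i * v n i powr a\<bar> powr (1/a)) = (\<Sum>i\<in>J. (w i * \<bar>u i\<bar> powr (1/a)) * v n i)"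
        proof (rule sum.cong[OF refl])
          fix i show "w i * \<bar>u i * v n i powr a\<bar> powr (1/a) = (w i * \<bar>u i\<bar> powr (1/a)) * v n i"
            using a v(1)[of n i] by (simp add: abs_mult powr_mult powr_powr)
        qed
        also have "\<dots> \<le> 2 * U n powr (1/a)" using v(3)[OF J] .
        also have "\<dots> = (2 powr a * U n) powr (1/a)" using a U0 by (simp add: powr_mult powr_powr)
        finally show ?thesis .
      qed
      then have "bl a w (I n) (\<lambda>i. u i * v n i powr a) (2 powr a * U n)" using a U0 by (auto simp: bl_def)
      from bl_scale[OF this, of "v' n powr b"]
      have "bl a w (I n) (\<lambda>i. v' n powr b * (u i * v n i powr a)) (v' n powr b * (2 powr a * U n))" by simp
      then show "bl a w (I n) (\<lambda>i. u i * z i) (v' n powr b * (2 powr a * U n))"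
        by (rule bl_mono) (use a w lvl in \<open>auto simp: z_def mult_ac less_imp_le\<close>)
    next
      have "(\<Sum>n\<in>J. 1 * \<bar>2 powr (of_int n * s) * (v' n powr b * (2 powr a * U n))\<bar> powr (1/b)) \<le> (2 powr (a + b) * K) powr (1/b)"
        if J: "finite J" for J
      proof -
        have "(\<Sum>n\<in>J. 1 * \<bar>2 powr (of_int n * s) * (v' n powr b * (2 powr a * U n))\<bar> powr (1/b))
            = (\<Sum>n\<in>J. (2 powr a) powr (1/b) * ((\<bar>2 powr (of_int n * s) * U n\<bar> powr (1/b)) * v' n))"
        proof (rule sum.cong[OF refl])
          fix n
          have "\<bar>2 powr (of_int n * s) * (v' n powr b * (2 powr a * U n))\<bar> = 2 powr a * (\<bar>2 powr (of_int n * s) * U n\<bar> * v' n powr b)"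
            by (simp add: abs_mult)
          also have "\<dots> powr (1/b) = (2 powr a) powr (1/b) * ((\<bar>2 powr (of_int n * s) * U n\<bar> powr (1/b)) * (v' n powr b) powr (1/b))"
            by (simp only: powr_mult powr_ge_zero abs_ge_zero mult_nonneg_nonneg)
          also have "(v' n powr b) powr (1/b) = v' n" using b v'(1)[of n] by (simp add: powr_powr)
          finally show "1 * \<bar>2 powr (of_int n * s) * (v' n powr b * (2 powr a * U n))\<bar> powr (1/b)
             = (2 powr a) powr (1/b) * ((\<bar>2 powr (of_int n * s) * U n\<bar> powr (1/b)) * v' n)" by simp
        qed
        also have "\<dots> = (2 powr a) powr (1/b) * (\<Sum>n\<in>J. (\<bar>2 powr (of_int n * s) * U n\<bar> powr (1/b)) * v' n)" by (simp only: sum_distrib_left)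
        also have "\<dots> \<le> (2 powr a) powr (1/b) * (2 * K powr (1/b))" using v'(3)[OF J] by (intro mult_left_mono) auto
        also have "\<dots> = (2 powr (a + b) * K) powr (1/b)"
        proof -
          have "(2 powr (a + b) * K) powr (1/b) = (2 powr a) powr (1/b) * ((2 powr b) powr (1/b) * K powr (1/b))"
            using bl_nonneg[OF U(2)] by (simp only: powr_add powr_mult powr_ge_zero mult_nonneg_nonneg mult.assoc)
          then show ?thesis using b by (simp add: powr_powr)
        qed
        finally show ?thesis .
      qed
      then show "bl b (\<lambda>_. 1) UNIV (\<lambda>n. 2 powr (of_int n * s) * (v' n powr b * (2 powr a * U n))) (2 powr (a + b) * K)"
        using b bl_nonneg[OF U(2)] by (auto simp: bl_def)
    qed
  qed
qed

section \<open>A three lines inequality\<close>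

text \<open>A non-vanishing function on a ball has a holomorphic logarithm \<open>l\<close>;
  subtracting the constant \<open>\<i> * Im (l z0)\<close> rotates its power to a positive value at
  the centre without changing moduli.\<close>

lemma powr_norm_branch:
  assumes hol: "f holomorphic_on ball z0 e" and nz: "\<And>z. z \<in> ball z0 e \<Longrightarrow> f z \<noteq> 0" and e: "0 < e"
  shows "\<exists>g. g holomorphic_on ball z0 e \<and> (\<forall>z\<in>ball z0 e. cmod (g z) = cmod (f z) powr r) \<and>
    g z0 = of_real (cmod (f z0) powr r)"
proof -
  obtain l where l: "l holomorphic_on ball z0 e" "\<And>z. z \<in> ball z0 e \<Longrightarrow> f z = exp (l z)"
    using contractible_imp_holomorphic_log[OF hol convex_imp_contractible[OF convex_ball] nz] by blast
  define g where "g z = exp (of_real r * (l z - \<i> * of_real (Im (l z0))))" for z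
  show ?thesis
  proof (intro exI[of _ g] conjI ballI)
    show "g holomorphic_on ball z0 e" unfolding g_def by (intro holomorphic_intros l)
    fix z assume "z \<in> ball z0 e"
    then show "cmod (g z) = cmod (f z) powr r" by (simp add: g_def l(2) powr_def)
  next
    have "of_real r * (l z0 - \<i> * of_real (Im (l z0))) = complex_of_real (r * Re (l z0))" by (simp add: complex_eq_iff)
    then have "g z0 = of_real (exp (r * Re (l z0)))" unfolding g_def by (simp only: exp_of_real)
    then show "g z0 = of_real (cmod (f z0) powr r)" using l(2)[of z0] e by (simp add: powr_def)
  qed
qed

text \<open>Near an interior maximum the non-vanishing terms have holomorphic \<open>r\<close>-th powers, and rotating
  them to be positive at the maximum turns the sum into the modulus of one holomorphic function.\<close>

lemma sum_powr_norm_local_max: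
  fixes f :: "'e \<Rightarrow> complex \<Rightarrow> complex"
  assumes E: "finite E" and k: "\<And>e. e \<in> E \<Longrightarrow> 0 \<le> k e" and hol: "\<And>e. e \<in> E \<Longrightarrow> f e holomorphic_on S"
    and S: "open S" "z0 \<in> S" and r: "0 < r"
    and mx: "\<And>z. z \<in> S \<Longrightarrow> (\<Sum>e\<in>E. k e * cmod (f e z) powr r) \<le> (\<Sum>e\<in>E. k e * cmod (f e z0) powr r)"
  shows "\<exists>d>0. ball z0 d \<subseteq> S \<and>
    (\<forall>z\<in>ball z0 d. (\<Sum>e\<in>E. k e * cmod (f e z) powr r) = (\<Sum>e\<in>E. k e * cmod (f e z0) powr r))"
proof -
  define \<Phi> where "\<Phi> z = (\<Sum>e\<in>E. k e * cmod (f e z) powr r)" for z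
  \<comment> \<open>Terms that vanish at \<open>z0\<close> have no branch of the power there.
    Leaving them out keeps the value at \<open>z0\<close> and can only lower the sum elsewhere, so
    \<open>cmod (H z) \<le> \<Phi> z\<close> holds with equality at \<open>z0\<close>.\<close>
  define E' where "E' = {e\<in>E. f e z0 \<noteq> 0}"
  have fE': "finite E'" using E by (simp add: E'_def)
  have "\<exists>d>0. ball z0 d \<subseteq> S \<and> (\<forall>z\<in>ball z0 d. f e z \<noteq> 0)" if "e \<in> E'" for e
  proof -
    have "continuous_on S (f e)" using hol that by (auto simp: E'_def intro: holomorphic_on_imp_continuous_on)
    then have "open (f e -` (-{0}) \<inter> S)" using S by (subst (asm) continuous_on_open_vimage) auto
    moreover have "z0 \<in> f e -` (-{0}) \<inter> S" using that S by (auto simp: E'_def)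
    ultimately obtain d where "d > 0" "ball z0 d \<subseteq> f e -` (-{0}) \<inter> S" using open_contains_ball by blast
    then show ?thesis by blast
  qed
  then obtain dd where dd: "\<And>e. e \<in> E' \<Longrightarrow> dd e > 0 \<and> ball z0 (dd e) \<subseteq> S \<and> (\<forall>z\<in>ball z0 (dd e). f e z \<noteq> 0)"
    using bchoice[of E' "\<lambda>e d. d > 0 \<and> ball z0 d \<subseteq> S \<and> (\<forall>z\<in>ball z0 d. f e z \<noteq> 0)"] by blast
  obtain d0 where d0: "d0 > 0" "ball z0 d0 \<subseteq> S" using S open_contains_ball by blast
  define d where "d = Min (insert d0 (dd ` E'))"
  have d: "d > 0" unfolding d_def using fE' d0 dd by (subst Min_gr_iff) auto
  have "d \<le> d0" and dle: "\<And>e. e \<in> E' \<Longrightarrow> d \<le> dd e" unfolding d_def using fE' by (auto intro: Min_le)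
  then have dS: "ball z0 d \<subseteq> S" using d0 by auto
  have nz: "f e z \<noteq> 0" if "e \<in> E'" "z \<in> ball z0 d" for e z
    using dd[OF that(1)] dle[OF that(1)] that(2) by auto
  have "\<exists>g. g holomorphic_on ball z0 d \<and> (\<forall>z\<in>ball z0 d. cmod (g z) = cmod (f e z) powr r) \<and> g z0 = of_real (cmod (f e z0) powr r)"
    if e: "e \<in> E'" for e
  proof -
    have "f e holomorphic_on ball z0 d" using hol dS e by (auto simp: E'_def intro: holomorphic_on_subset)
    then show ?thesis using nz[OF e] d by (rule powr_norm_branch)
  qed
  then obtain g where g: "\<And>e. e \<in> E' \<Longrightarrow> g e holomorphic_on ball z0 d"
    "\<And>e z. e \<in> E' \<Longrightarrow> z \<in> ball z0 d \<Longrightarrow> cmod (g e z) = cmod (f e z) powr r"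
    "\<And>e. e \<in> E' \<Longrightarrow> g e z0 = of_real (cmod (f e z0) powr r)" using bchoice[of E' "\<lambda>e g. g holomorphic_on ball z0 d \<and> (\<forall>z\<in>ball z0 d. cmod (g z) = cmod (f e z) powr r)
        \<and> g z0 = of_real (cmod (f e z0) powr r)"] by blast
  define H where "H z = (\<Sum>e\<in>E'. of_real (k e) * g e z)" for z
  have holH: "H holomorphic_on ball z0 d" unfolding H_def by (intro holomorphic_intros g)
  have HP: "cmod (H z) \<le> \<Phi> z" if z: "z \<in> ball z0 d" for z
  proof -
    have "cmod (H z) \<le> (\<Sum>e\<in>E'. cmod (of_real (k e) * g e z))" unfolding H_def by (rule norm_sum)
    also have "\<dots> = (\<Sum>e\<in>E'. k e * cmod (f e z) powr r)"
      using g(2) z k by (intro sum.cong) (auto simp: norm_mult E'_def)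
    also have "\<dots> \<le> \<Phi> z" unfolding \<Phi>_def using E k by (intro sum_mono2) (auto simp: E'_def)
    finally show ?thesis .
  qed
  have "H z0 = of_real (\<Phi> z0)"
  proof -
    have "H z0 = (\<Sum>e\<in>E'. of_real (k e * cmod (f e z0) powr r))" unfolding H_def using g(3) by (intro sum.cong) auto
    also have "\<dots> = of_real (\<Sum>e\<in>E'. k e * cmod (f e z0) powr r)" by simp
    also have "(\<Sum>e\<in>E'. k e * cmod (f e z0) powr r) = \<Phi> z0"
      unfolding \<Phi>_def using E by (intro sum.mono_neutral_left) (auto simp: E'_def)
    finally show ?thesis .
  qed
  moreover have P0: "0 \<le> \<Phi> z" for z unfolding \<Phi>_def using k by (intro sum_nonneg) auto
  ultimately have H0: "cmod (H z0) = \<Phi> z0" by simp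
  have mxP: "\<Phi> z \<le> \<Phi> z0" if "z \<in> ball z0 d" for z using mx dS that unfolding \<Phi>_def by blast
  have "H constant_on ball z0 d"
  proof (rule maximum_modulus_principle[OF holH open_ball connected_ball open_ball order_refl])
    show "z0 \<in> ball z0 d" using d by simp
    show "cmod (H z) \<le> cmod (H z0)" if "z \<in> ball z0 d" for z using HP[OF that] mxP[OF that] H0 by simp
  qed
  then have Hc: "H z = H z0" if "z \<in> ball z0 d" for z using that d by (auto simp: constant_on_def)
  \<comment> \<open>The circle \<open>\<Phi> z0 = cmod (H z0) = cmod (H z) \<le> \<Phi> z \<le>
    \<Phi> z0\<close> closes.\<close>
  have "\<Phi> z = \<Phi> z0" if "z \<in> ball z0 d" for z using HP[OF that] mxP[OF that] H0 Hc[OF that] by simp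
  then show ?thesis using d dS unfolding \<Phi>_def by blast
qed

text \<open>The set of maximum points in the rectangle is compact. Its point with largest real part
  cannot be interior, because the sum is constant near an interior maximum and the set would then
  extend further to the right.\<close>

lemma sum_powr_norm_max_rectangle:
  fixes f :: "'e \<Rightarrow> complex \<Rightarrow> complex"
  assumes E: "finite E" and k: "\<And>e. e \<in> E \<Longrightarrow> 0 \<le> k e" and hol: "\<And>e. e \<in> E \<Longrightarrow> f e holomorphic_on box u v"
    and cont: "\<And>e. e \<in> E \<Longrightarrow> continuous_on (cbox u v) (f e)" and r: "0 < r"
    and bd: "\<And>z. z \<in> cbox u v - box u v \<Longrightarrow> (\<Sum>e\<in>E. k e * cmod (f e z) powr r) \<le> B"
    and z: "z \<in> cbox u v"
  shows "(\<Sum>e\<in>E. k e * cmod (f e z) powr r) \<le> B"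
proof -
  define \<Phi> where "\<Phi> z = (\<Sum>e\<in>E. k e * cmod (f e z) powr r)" for z
  have cP: "continuous_on (cbox u v) \<Phi>" unfolding \<Phi>_def using cont r
    by (intro continuous_intros continuous_on_powr') auto
  obtain m where m: "m \<in> cbox u v" "\<And>y. y \<in> cbox u v \<Longrightarrow> \<Phi> y \<le> \<Phi> m"
    using continuous_attains_sup[OF compact_cbox _ cP] z by blast
  define A where "A = {y \<in> cbox u v. \<Phi> y = \<Phi> m}"
  have cA: "compact A"
  proof -
    have "A = cbox u v \<inter> \<Phi> -` {\<Phi> m}" by (auto simp: A_def)
    moreover have "closed (cbox u v \<inter> \<Phi> -` {\<Phi> m})" by (rule continuous_closed_preimage[OF cP closed_cbox]) auto
    ultimately show ?thesis by (metis bounded_cbox bounded_Int compact_eq_bounded_closed)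
  qed
  have neA: "A \<noteq> {}" using m by (auto simp: A_def)
  have "continuous_on A Re" by (intro continuous_intros)
  from continuous_attains_sup[OF cA neA this] obtain x where x: "x \<in> A" "\<And>y. y \<in> A \<Longrightarrow> Re y \<le> Re x" by blast
  have "x \<notin> box u v"
  proof
    assume xb: "x \<in> box u v"
    have le: "(\<Sum>e\<in>E. k e * cmod (f e y) powr r) \<le> (\<Sum>e\<in>E. k e * cmod (f e x) powr r)" if "y \<in> box u v" for y
      using m(2)[of y] x that box_subset_cbox[of u v] unfolding \<Phi>_def A_def by auto
    have "\<exists>d>0. ball x d \<subseteq> box u v \<and> (\<forall>y\<in>ball x d. (\<Sum>e\<in>E. k e * cmod (f e y) powr r) = (\<Sum>e\<in>E. k e * cmod (f e x) powr r))"
      using E k hol open_box xb r le by (rule sum_powr_norm_local_max[where k = k and f = f])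
    then obtain d where d: "d > 0" "ball x d \<subseteq> box u v" "\<forall>y\<in>ball x d. \<Phi> y = \<Phi> x"
      unfolding \<Phi>_def by blast
    have "x + of_real (d/2) \<in> ball x d" using d by (simp add: dist_norm)
    then have "x + of_real (d/2) \<in> cbox u v" "\<Phi> (x + of_real (d/2)) = \<Phi> x" using d box_subset_cbox[of u v] by blast+
    then have "x + of_real (d/2) \<in> A" using x by (simp add: A_def)
    then show False using x(2)[of "x + of_real (d/2)"] d by simp
  qed
  then have "\<Phi> x \<le> B" using bd[of x] x unfolding A_def \<Phi>_def by blast
  moreover have "\<Phi> z \<le> \<Phi> x" using m(2)[OF z] x by (simp add: A_def)
  ultimately show ?thesis unfolding \<Phi>_def by simp
qed

text \<open>The factor \<open>exp (\<epsilon> * (z\<^sup>2 - 1))\<close> has modulus at most 1 on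
  the closed strip and decays vertically, which allows the maximum principle on rectangles; the
  bound \<open>T\<close> disappears in the limit.\<close>

lemma three_lines_sum_powr:
  fixes f :: "'e \<Rightarrow> complex \<Rightarrow> complex"
  assumes E: "finite E" and k: "\<And>e. e \<in> E \<Longrightarrow> 0 \<le> k e" and hol: "\<And>e. e \<in> E \<Longrightarrow> f e holomorphic_on strip"
    and cont: "\<And>e. e \<in> E \<Longrightarrow> continuous_on cstrip (f e)" and r: "0 < r"
    and bdd: "\<And>e z. e \<in> E \<Longrightarrow> z \<in> cstrip \<Longrightarrow> cmod (f e z) \<le> T"
    and bd0: "\<And>t. (\<Sum>e\<in>E. k e * cmod (f e (\<i> * of_real t)) powr r) \<le> B"
    and bd1: "\<And>t. (\<Sum>e\<in>E. k e * cmod (f e (1 + \<i> * of_real t)) powr r) \<le> B"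
    and th: "0 < \<theta>" "\<theta> < 1"
  shows "(\<Sum>e\<in>E. k e * cmod (f e (of_real \<theta>)) powr r) \<le> B"
proof -
  have B0: "0 \<le> B" using bd0[of 0] k sum_nonneg[of E "\<lambda>e. k e * cmod (f e (\<i> * of_real 0)) powr r"] by simp
  define D where "D = (\<Sum>e\<in>E. k e * \<bar>T\<bar> powr r)"
  have D0: "0 \<le> D" unfolding D_def using k by (intro sum_nonneg) auto
  define \<Phi> where "\<Phi> z = (\<Sum>e\<in>E. k e * cmod (f e z) powr r)" for z
  have PD: "\<Phi> z \<le> D" if "z \<in> cstrip" for z unfolding \<Phi>_def D_def
    using k bdd[OF _ that] r by (intro sum_mono mult_left_mono powr_mono2) (force intro: order_trans)+
  have main: "\<Phi> (of_real \<theta>) \<le> exp (r / x) * (B + exp (- (r * x)) * D)" if x: "x > 0" for x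
  proof -
    \<comment> \<open>Coupling the damping to the height \<open>x\<close> leaves a single limit: the
      horizontal sides contribute \<open>exp (- (r * x))\<close>, while undoing the factor at
      \<theta> costs at most \<open>exp (r / x)\<close>.\<close>
    define \<epsilon> where "\<epsilon> = 1 / x"
    have eps: "\<epsilon> > 0" using x by (simp add: \<epsilon>_def)
    define g where "g e z = f e z * exp (of_real \<epsilon> * (z\<^sup>2 - 1))" for e z
    have ng: "cmod (exp (of_real \<epsilon> * (z\<^sup>2 - 1))) powr r = exp (\<epsilon> * r * ((Re z)\<^sup>2 - (Im z)\<^sup>2 - 1))" for z
      by (simp add: norm_exp_eq_Re Re_power2 powr_def mult_ac)
    have G: "(\<Sum>e\<in>E. k e * cmod (g e z) powr r) = exp (\<epsilon> * r * ((Re z)\<^sup>2 - (Im z)\<^sup>2 - 1)) * \<Phi> z" for z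
      unfolding g_def \<Phi>_def sum_distrib_left by (intro sum.cong refl) (simp only: norm_mult powr_mult norm_ge_zero ng mult_ac)
    have P0: "0 \<le> \<Phi> z" for z unfolding \<Phi>_def using k by (intro sum_nonneg) auto
    define u v where "u = Complex 0 (- x)" and "v = Complex 1 x"
    have sub: "cbox u v \<subseteq> cstrip" "box u v \<subseteq> strip"
      by (auto simp: u_def v_def in_cbox_complex_iff in_box_complex_iff cstrip_def strip_def)
    have "(\<Sum>e\<in>E. k e * cmod (g e (of_real \<theta>)) powr r) \<le> B + exp (- (r * x)) * D"
    proof (rule sum_powr_norm_max_rectangle[OF E k _ _ r])
      show "g e holomorphic_on box u v" if "e \<in> E" for e
        unfolding g_def using hol[OF that] sub by (intro holomorphic_intros) (auto intro: holomorphic_on_subset)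
      show "continuous_on (cbox u v) (g e)" if "e \<in> E" for e
        unfolding g_def using cont[OF that] sub by (intro continuous_intros) (auto intro: continuous_on_subset)
      show "of_real \<theta> \<in> cbox u v" using th x by (simp add: u_def v_def in_cbox_complex_iff)
      fix z assume z: "z \<in> cbox u v - box u v"
      then have zs: "z \<in> cstrip" using sub by auto
      from z have re: "0 \<le> Re z" "Re z \<le> 1" and "Re z = 0 \<or> Re z = 1 \<or> \<bar>Im z\<bar> = x"
        by (auto simp: u_def v_def in_cbox_complex_iff in_box_complex_iff)
      then consider "Re z = 0" | "Re z = 1" | "\<bar>Im z\<bar> = x" by blast
      then have "exp (\<epsilon> * r * ((Re z)\<^sup>2 - (Im z)\<^sup>2 - 1)) * \<Phi> z \<le> B \<or> exp (\<epsilon> * r * ((Re z)\<^sup>2 - (Im z)\<^sup>2 - 1)) * \<Phi> z \<le> exp (- (r * x)) * D"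
      proof cases
        case 1
        then have "z = \<i> * of_real (Im z)" by (simp add: complex_eq_iff)
        then have "\<Phi> z \<le> B" using bd0[of "Im z"] unfolding \<Phi>_def by simp
        moreover have "exp (\<epsilon> * r * ((Re z)\<^sup>2 - (Im z)\<^sup>2 - 1)) \<le> 1"
          using 1 eps r order_trans[of "-1" 0 "(Im z)\<^sup>2"] by (auto intro!: mult_nonneg_nonpos)
        ultimately have "exp (\<epsilon> * r * ((Re z)\<^sup>2 - (Im z)\<^sup>2 - 1)) * \<Phi> z \<le> 1 * B" using P0 by (intro mult_mono) auto
        then show ?thesis by simp
      next
        case 2
        then have "z = 1 + \<i> * of_real (Im z)" by (simp add: complex_eq_iff)
        then have "\<Phi> z \<le> B" using bd1[of "Im z"] unfolding \<Phi>_def by simp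
        moreover have "exp (\<epsilon> * r * ((Re z)\<^sup>2 - (Im z)\<^sup>2 - 1)) \<le> 1"
          using 2 eps r by simp
        ultimately have "exp (\<epsilon> * r * ((Re z)\<^sup>2 - (Im z)\<^sup>2 - 1)) * \<Phi> z \<le> 1 * B" using P0 by (intro mult_mono) auto
        then show ?thesis by simp
      next
        case 3
        have "(Re z)\<^sup>2 \<le> 1" using re by (simp add: power_le_one)
        moreover have "(Im z)\<^sup>2 = x\<^sup>2" using 3 by (metis power2_abs)
        ultimately have "\<epsilon> * r * ((Re z)\<^sup>2 - (Im z)\<^sup>2 - 1) \<le> \<epsilon> * r * (- x\<^sup>2)"
          using eps r by (intro mult_left_mono) auto
        also have "\<dots> = - (r * x)" using x by (simp add: \<epsilon>_def power2_eq_square)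
        finally have "exp (\<epsilon> * r * ((Re z)\<^sup>2 - (Im z)\<^sup>2 - 1)) \<le> exp (- (r * x))" by simp
        then have "exp (\<epsilon> * r * ((Re z)\<^sup>2 - (Im z)\<^sup>2 - 1)) * \<Phi> z \<le> exp (- (r * x)) * D"
          using PD[OF zs] P0 by (intro mult_mono) auto
        then show ?thesis by simp
      qed
      moreover have "0 \<le> exp (- (r * x)) * D" using D0 by simp
      ultimately show "(\<Sum>e\<in>E. k e * cmod (g e z) powr r) \<le> B + exp (- (r * x)) * D" unfolding G using B0 by linarith
    qed
    then have "exp (\<epsilon> * r * (\<theta>\<^sup>2 - 1)) * \<Phi> (of_real \<theta>) \<le> B + exp (- (r * x)) * D" unfolding G by simp
    moreover have "exp (- (r / x)) \<le> exp (\<epsilon> * r * (\<theta>\<^sup>2 - 1))"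
    proof -
      have "\<epsilon> * r * (-1) \<le> \<epsilon> * r * (\<theta>\<^sup>2 - 1)" using eps r by (intro mult_left_mono) auto
      then show ?thesis by (simp add: \<epsilon>_def)
    qed
    then have "exp (- (r / x)) * \<Phi> (of_real \<theta>) \<le> exp (\<epsilon> * r * (\<theta>\<^sup>2 - 1)) * \<Phi> (of_real \<theta>)"
      using P0 by (rule mult_right_mono)
    ultimately have "exp (- (r / x)) * \<Phi> (of_real \<theta>) \<le> B + exp (- (r * x)) * D" by linarith
    then have "exp (r / x) * (exp (- (r / x)) * \<Phi> (of_real \<theta>)) \<le> exp (r / x) * (B + exp (- (r * x)) * D)"
      by (intro mult_left_mono) auto
    moreover have "exp (r / x) * (exp (- (r / x)) * \<Phi> (of_real \<theta>)) = \<Phi> (of_real \<theta>)"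
      by (simp add: mult.assoc[symmetric] exp_add[symmetric])
    ultimately show ?thesis by simp
  qed
  have "((\<lambda>x. exp (r / x) * (B + exp (- (r * x)) * D)) \<longlongrightarrow> B) at_top"
    using r by real_asymp
  then have "\<Phi> (of_real \<theta>) \<le> B"
    by (rule tendsto_lowerbound) (auto intro!: eventually_mono[OF eventually_gt_at_top[of 0]] main)
  then show ?thesis unfolding \<Phi>_def .
qed

text \<open>Normalizing the values at \<theta> produces densities \<open>g\<close> and
  \<open>h\<close> and a probability weight \<open>k\<close> on \<open>E\<close>. Each
  \<open>u e\<close> is divided by the holomorphic geometric mean of the two extremal families. On
  either boundary line the k-weighted sum of r-th powers of the quotients is then at most
  \<open>(K / N) powr r\<close>, by change of weight and power means. At \<theta> all quotients have
  modulus 1, so the three lines inequality reads \<open>1 \<le> (K / N) powr r\<close>.\<close>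

lemma mixed_stein_finite:
  fixes a0 a1 b0 b1 s0 s1 \<theta> :: real and u :: "'i \<Rightarrow> complex \<Rightarrow> complex"
  assumes th: "0 < \<theta>" "\<theta> < 1" and nn: "0 \<le> a0" "0 \<le> a1" "0 \<le> b0" "0 \<le> b1"
    and a: "a = (1 - \<theta>) * a0 + \<theta> * a1" "0 < a" and b: "b = (1 - \<theta>) * b0 + \<theta> * b1" "0 < b"
    and s: "s = (1 - \<theta>) * s0 + \<theta> * s1"
    and w: "\<And>n i. i \<in> I n \<Longrightarrow> 0 < w i"
    and E: "finite E" "\<And>e. e \<in> E \<Longrightarrow> e \<in> I (lvl e)" "\<And>e. e \<in> E \<Longrightarrow> u e (of_real \<theta>) \<noteq> 0"
    and hol: "\<And>e. e \<in> E \<Longrightarrow> u e holomorphic_on strip"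
    and cont: "\<And>e. e \<in> E \<Longrightarrow> continuous_on cstrip (u e)"
    and bdd: "\<And>e. e \<in> E \<Longrightarrow> \<exists>T. \<forall>z\<in>cstrip. cmod (u e z) \<le> T"
    and B0: "\<And>t. mixed I w a0 b0 s0 (\<lambda>i. cmod (u i (\<i> * of_real t))) K"
    and B1: "\<And>t. mixed I w a1 b1 s1 (\<lambda>i. cmod (u i (1 + \<i> * of_real t))) K"
  shows "(\<Sum>n\<in>lvl ` E. (2 powr (of_int n * s) * (\<Sum>e\<in>{e\<in>E. lvl e = n}. w e * cmod (u e (of_real \<theta>)) powr (1/a)) powr a) powr (1/b)) \<le> K powr (1/b)"
proof (cases "E = {}")
  case False
  define L where "L = lvl ` E"
  define En where "En n = {e\<in>E. lvl e = n}" for n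
  define be where "be e = cmod (u e (of_real \<theta>))" for e
  define A where "A n = (\<Sum>e\<in>En n. w e * be e powr (1/a)) powr a" for n
  define N where "N = (\<Sum>n\<in>L. (2 powr (of_int n * s) * A n) powr (1/b)) powr b"
  have fin: "finite L" "finite (En n)" for n using E by (auto simp: L_def En_def)
  have wE: "0 < w e" "0 < be e" if "e \<in> E" for e using w E that by (auto simp: be_def)
  have sA: "0 < (\<Sum>e\<in>En n. w e * be e powr (1/a))" if "n \<in> L" for n
  proof (rule sum_pos)
    show "En n \<noteq> {}" using that by (auto simp: En_def L_def)
    fix e assume "e \<in> En n"
    then have "e \<in> E" by (simp add: En_def)
    from wE[OF this] show "0 < w e * be e powr (1/a)" by simp
  qed (rule fin)
  then have A0: "0 < A n" if "n \<in> L" for n using that by (fastforce simp: A_def)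
  have Ap: "A n powr (1/a) = (\<Sum>e\<in>En n. w e * be e powr (1/a))" if "n \<in> L" for n
    using sA[OF that] a(2) by (simp add: A_def powr_powr)
  have sN: "0 < (\<Sum>n\<in>L. (2 powr (of_int n * s) * A n) powr (1/b))"
  proof (rule sum_pos)
    show "L \<noteq> {}" using False by (simp add: L_def)
    show "0 < (2 powr (of_int n * s) * A n) powr (1/b)" if "n \<in> L" for n using A0[OF that] by simp
  qed (rule fin)
  then have N0: "0 < N" by (simp add: N_def)
  have Np: "N powr (1/b) = (\<Sum>n\<in>L. (2 powr (of_int n * s) * A n) powr (1/b))"
    using sN b(2) by (simp add: N_def powr_powr)
  \<comment> \<open>The densities of the factorization again, now of mass exactly 1 because finite
    sums of positive terms are normalized by their own value.\<close>
  define g where "g e = (be e / A (lvl e)) powr (1/a)" for e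
  define h where "h n = (2 powr (of_int n * s) * A n / N) powr (1/b)" for n
  have g0: "0 < g e" if "e \<in> E" for e
  proof -
    have "lvl e \<in> L" using that by (simp add: L_def)
    then show ?thesis using A0[of "lvl e"] wE(2)[OF that] by (simp add: g_def)
  qed
  have h0: "0 < h n" if "n \<in> L" for n using A0[OF that] N0 by (simp add: h_def)
  have sg: "(\<Sum>e\<in>En n. w e * g e) = 1" if n: "n \<in> L" for n
  proof -
    have "(\<Sum>e\<in>En n. w e * g e) = (\<Sum>e\<in>En n. w e * be e powr (1/a) / A n powr (1/a))"
    proof (rule sum.cong[OF refl])
      fix e assume "e \<in> En n"
      then have "lvl e = n" "e \<in> E" by (auto simp: En_def)
      then show "w e * g e = w e * be e powr (1/a) / A n powr (1/a)" using A0[OF n] wE(2) by (simp add: g_def powr_divide)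
    qed
    also have "\<dots> = 1" using sA[OF n] by (simp add: sum_divide_distrib[symmetric] Ap[OF n])
    finally show ?thesis .
  qed
  have sh: "(\<Sum>n\<in>L. 1 * h n) = 1"
  proof -
    have "(\<Sum>n\<in>L. 1 * h n) = (\<Sum>n\<in>L. (2 powr (of_int n * s) * A n) powr (1/b) / N powr (1/b))"
    proof (rule sum.cong[OF refl])
      fix n assume "n \<in> L"
      then show "1 * h n = (2 powr (of_int n * s) * A n) powr (1/b) / N powr (1/b)" using A0[of n] N0 by (simp add: h_def powr_divide)
    qed
    also have "\<dots> = 1" using sN by (simp add: sum_divide_distrib[symmetric] Np)
    finally show ?thesis .
  qed
  define k where "k e = w e * g e * h (lvl e)" for e
  have k0: "0 < k e" if "e \<in> E" for e using wE(1)[OF that] g0[OF that] h0[of "lvl e"] that by (simp add: k_def L_def)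
  define c where "c b' s' n = h n powr b' * 2 powr (- (of_int n * s')) * N" for b' s' :: real and n
  have c0: "0 < c b' s' n" if "n \<in> L" for b' s' n using h0[OF that] N0 by (simp add: c_def)
  define m where "m a' b' s' e = g e powr a' * c b' s' (lvl e)" for a' b' s' :: real and e
  have m0: "0 < m a' b' s' e" if "e \<in> E" for a' b' s' e using g0[OF that] c0[of "lvl e"] that by (simp add: m_def L_def)
  have split: "(\<Sum>e\<in>E. F e) = (\<Sum>n\<in>L. \<Sum>e\<in>En n. F e)" for F :: "'i \<Rightarrow> real"
    unfolding L_def En_def using E by (intro sum.image_gen) auto
  \<comment> \<open>Below all four endpoint exponents, finite or infinite, so that one power mean
    serves inside the levels, across the levels and on both lines.\<close>
  define r where "r = 1 / (1 + a0 + a1 + b0 + b1)"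
  have den: "0 < 1 + a0 + a1 + b0 + b1" using nn by linarith
  have r: "0 < r" using den by (simp add: r_def)
  have rle: "r * a0 \<le> 1" "r * a1 \<le> 1" "r * b0 \<le> 1" "r * b1 \<le> 1" using den nn by (simp_all add: r_def)
  \<comment> \<open>The weight is changed to \<open>w * g\<close> inside a level and to
    \<open>h\<close> across the levels; the scalars \<open>c b' s' n\<close> link the two steps, and
    of all normalizations only \<open>K / N\<close> remains.\<close>
  have side: "(\<Sum>e\<in>E. k e * \<bar>y e / m a' b' s' e\<bar> powr r) \<le> (K / N) powr r"
    if mx: "mixed I w a' b' s' y K" and nn': "0 \<le> a'" "0 \<le> b'" "r * a' \<le> 1" "r * b' \<le> 1" for y a' b' s'
  proof -
    obtain U where U: "\<And>n. bl a' w (I n) y (U n)" "bl b' (\<lambda>_. 1) UNIV (\<lambda>n. 2 powr (of_int n * s') * U n) K"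
      using mx by (auto simp: mixed_def)
    have inner: "(\<Sum>e\<in>En n. w e * g e * \<bar>y e / m a' b' s' e\<bar> powr r) \<le> (U n / c b' s' n) powr r" if n: "n \<in> L" for n
    proof -
      have "bl a' w (En n) y (U n)"
        by (rule bl_mono[OF U(1)[of n]]) (use nn' E wE in \<open>auto simp: En_def less_imp_le\<close>)
      then have "bl a' (\<lambda>e. w e * g e) (En n) (\<lambda>e. y e / (g e powr a' * c b' s' n)) (U n / c b' s' n)"
        by (rule bl_change_weight[OF nn'(1)]) (use g0 c0[OF n] in \<open>auto simp: En_def\<close>)
      then have "(\<Sum>e\<in>En n. w e * g e * \<bar>y e / (g e powr a' * c b' s' n)\<bar> powr r) \<le> (U n / c b' s' n) powr r"
        by (rule bl_power_mean[OF _ nn'(1) fin(2) _ sg[OF n] r nn'(3)]) (use g0 wE in \<open>auto simp: En_def less_imp_le\<close>)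
      moreover have "(\<Sum>e\<in>En n. w e * g e * \<bar>y e / m a' b' s' e\<bar> powr r)
         = (\<Sum>e\<in>En n. w e * g e * \<bar>y e / (g e powr a' * c b' s' n)\<bar> powr r)"
        by (rule sum.cong[OF refl]) (simp add: En_def m_def)
      ultimately show ?thesis by simp
    qed
    have "bl b' (\<lambda>_. 1) L (\<lambda>n. 2 powr (of_int n * s') * U n) K"
      by (rule bl_mono[OF U(2)]) (use nn' in auto)
    then have "bl b' (\<lambda>n. 1 * h n) L (\<lambda>n. 2 powr (of_int n * s') * U n / (h n powr b' * N)) (K / N)"
      by (rule bl_change_weight[OF nn'(2)]) (use h0 N0 in auto)
    then have outer: "(\<Sum>n\<in>L. 1 * h n * \<bar>2 powr (of_int n * s') * U n / (h n powr b' * N)\<bar> powr r) \<le> (K / N) powr r"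
      by (rule bl_power_mean[OF _ nn'(2) fin(1) _ sh r nn'(4)]) (use h0 in \<open>auto simp: less_imp_le\<close>)
    have "(\<Sum>e\<in>E. k e * \<bar>y e / m a' b' s' e\<bar> powr r) = (\<Sum>n\<in>L. h n * (\<Sum>e\<in>En n. w e * g e * \<bar>y e / m a' b' s' e\<bar> powr r))"
      unfolding split sum_distrib_left by (intro sum.cong refl) (simp add: k_def En_def mult_ac)
    also have "\<dots> \<le> (\<Sum>n\<in>L. h n * (U n / c b' s' n) powr r)"
      using inner h0 by (intro sum_mono mult_left_mono) (auto simp: less_imp_le)
    also have "\<dots> = (\<Sum>n\<in>L. 1 * h n * \<bar>2 powr (of_int n * s') * U n / (h n powr b' * N)\<bar> powr r)"
    proof (rule sum.cong[OF refl])
      fix n assume n: "n \<in> L"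
      have "2 powr (of_int n * s') * U n / (h n powr b' * N) = U n / c b' s' n"
        by (simp add: c_def powr_minus divide_inverse mult_ac)
      moreover have "0 \<le> U n / c b' s' n" using bl_nonneg[OF U(1)] c0[OF n] by (simp add: less_imp_le)
      ultimately show "h n * (U n / c b' s' n) powr r = 1 * h n * \<bar>2 powr (of_int n * s') * U n / (h n powr b' * N)\<bar> powr r" by (simp only: abs_of_nonneg mult_1)
    qed
    also note outer
    finally show ?thesis .
  qed
  define v where "v e z = u e z * exp (- ((1 - z) * of_real (ln (m a0 b0 s0 e)) + z * of_real (ln (m a1 b1 s1 e))))" for e z
  have nv: "cmod (v e z) = cmod (u e z) * (m a0 b0 s0 e powr (- (1 - Re z)) * m a1 b1 s1 e powr (- Re z))" if "e \<in> E" for e z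
    using m0[OF that, of a0 b0 s0] m0[OF that, of a1 b1 s1] by (simp add: v_def norm_mult norm_exp_eq_Re powr_def exp_add[symmetric] algebra_simps)
  define T where "T e = (SOME T. \<forall>z\<in>cstrip. cmod (u e z) \<le> T)" for e
  have T: "cmod (u e z) \<le> T e" if "e \<in> E" "z \<in> cstrip" for e z
    using someI_ex[OF bdd[OF that(1)]] that(2) by (simp add: T_def)
  \<comment> \<open>A qualitative bound on the strip; its size does not enter the estimate.\<close>
  define R where "R e = T e * (exp (\<bar>ln (m a0 b0 s0 e)\<bar>) * exp (\<bar>ln (m a1 b1 s1 e)\<bar>))" for e
  have vR: "cmod (v e z) \<le> R e" if e: "e \<in> E" and z: "z \<in> cstrip" for e z
  proof -
    have x: "0 \<le> Re z" "Re z \<le> 1" using z by (auto simp: cstrip_def)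
    have *: "q powr (- x) \<le> exp \<bar>ln q\<bar>" if "0 < q" "0 \<le> x" "x \<le> 1" for q x :: real
    proof -
      have "- x * ln q \<le> x * \<bar>ln q\<bar>" using that(2) mult_left_mono[of "- ln q" "\<bar>ln q\<bar>" x] by simp
      also have "\<dots> \<le> 1 * \<bar>ln q\<bar>" using that by (intro mult_right_mono) auto
      finally show ?thesis using that by (simp add: powr_def)
    qed
    show ?thesis unfolding nv[OF e] R_def
      using T[OF e z] *[OF m0[OF e], of "1 - Re z"] *[OF m0[OF e], of "Re z"] x
      by (intro mult_mono) (auto intro: order_trans[OF norm_ge_zero])
  qed
  have RM: "cmod (v e z) \<le> (\<Sum>e\<in>E. \<bar>R e\<bar>)" if e: "e \<in> E" and z: "z \<in> cstrip" for e z
  proof -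
    have "\<bar>R e\<bar> \<le> (\<Sum>e\<in>E. \<bar>R e\<bar>)" using e E(1) by (intro member_le_sum) auto
    then show ?thesis using vR[OF e z] by linarith
  qed
  have "(\<Sum>e\<in>E. k e * cmod (v e (of_real \<theta>)) powr r) \<le> (K / N) powr r"
  proof (rule three_lines_sum_powr[OF E(1) _ _ _ r RM _ _ th])
    show "0 \<le> k e" if "e \<in> E" for e using k0[OF that] by simp
    show "v e holomorphic_on strip" if "e \<in> E" for e unfolding v_def by (intro holomorphic_intros hol that)
    show "continuous_on cstrip (v e)" if "e \<in> E" for e unfolding v_def by (intro continuous_intros cont that)
    fix t
    have "(\<Sum>e\<in>E. k e * cmod (v e (\<i> * of_real t)) powr r)
       = (\<Sum>e\<in>E. k e * \<bar>cmod (u e (\<i> * of_real t)) / m a0 b0 s0 e\<bar> powr r)"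
    proof (rule sum.cong[OF refl])
      fix e assume e: "e \<in> E"
      have "cmod (v e (\<i> * of_real t)) = \<bar>cmod (u e (\<i> * of_real t)) / m a0 b0 s0 e\<bar>"
        using m0[OF e, of a0 b0 s0] m0[OF e, of a1 b1 s1] by (simp add: nv[OF e] powr_minus divide_inverse abs_mult)
      then show "k e * cmod (v e (\<i> * of_real t)) powr r = k e * \<bar>cmod (u e (\<i> * of_real t)) / m a0 b0 s0 e\<bar> powr r" by simp
    qed
    then show "(\<Sum>e\<in>E. k e * cmod (v e (\<i> * of_real t)) powr r) \<le> (K / N) powr r"
      using side[OF B0[of t] nn(1,3) rle(1,3)] by simp
    have "(\<Sum>e\<in>E. k e * cmod (v e (1 + \<i> * of_real t)) powr r)
       = (\<Sum>e\<in>E. k e * \<bar>cmod (u e (1 + \<i> * of_real t)) / m a1 b1 s1 e\<bar> powr r)"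
    proof (rule sum.cong[OF refl])
      fix e assume e: "e \<in> E"
      have "cmod (v e (1 + \<i> * of_real t)) = \<bar>cmod (u e (1 + \<i> * of_real t)) / m a1 b1 s1 e\<bar>"
        using m0[OF e, of a0 b0 s0] m0[OF e, of a1 b1 s1] by (simp add: nv[OF e] powr_minus divide_inverse abs_mult)
      then show "k e * cmod (v e (1 + \<i> * of_real t)) powr r = k e * \<bar>cmod (u e (1 + \<i> * of_real t)) / m a1 b1 s1 e\<bar> powr r" by simp
    qed
    then show "(\<Sum>e\<in>E. k e * cmod (v e (1 + \<i> * of_real t)) powr r) \<le> (K / N) powr r"
      using side[OF B1[of t] nn(2,4) rle(2,4)] by simp
  qed
  moreover have "cmod (v e (of_real \<theta>)) = 1" if e: "e \<in> E" for e
  proof -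
    have L: "lvl e \<in> L" using e by (simp add: L_def)
    have "m a0 b0 s0 e powr (1 - \<theta>) * m a1 b1 s1 e powr \<theta> = g e powr a * (h (lvl e) powr b * 2 powr (- (of_int (lvl e) * s)) * N)"
      unfolding m_def c_def using g0[OF e] h0[OF L] N0 a(1) b(1) s by (intro factor_product) auto
    also have "g e powr a = be e / A (lvl e)"
    proof -
      have "0 \<le> be e / A (lvl e)" using wE(2)[OF e] A0[OF L] by simp
      moreover have "0 \<le> x \<Longrightarrow> (x powr (1/a)) powr a = x" for x using a(2) by (simp add: powr_powr)
      ultimately have "((be e / A (lvl e)) powr (1/a)) powr a = be e / A (lvl e)" by blast
      then show ?thesis by (simp add: g_def)
    qed
    also have "h (lvl e) powr b = 2 powr (of_int (lvl e) * s) * A (lvl e) / N"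
    proof -
      have "0 \<le> x \<Longrightarrow> (x powr (1/b)) powr b = x" for x using b(2) by (simp add: powr_powr)
      moreover have "0 \<le> 2 powr (of_int (lvl e) * s) * A (lvl e) / N" using A0[OF L] N0 by simp
      ultimately show ?thesis unfolding h_def by blast
    qed
    also have "be e / A (lvl e) * (2 powr (of_int (lvl e) * s) * A (lvl e) / N * 2 powr (- (of_int (lvl e) * s)) * N)
       = be e * (2 powr (of_int (lvl e) * s) * 2 powr (- (of_int (lvl e) * s)))"
      using A0[OF L] N0 by simp
    also have "\<dots> = be e" by (simp add: powr_add[symmetric])
    finally have "m a0 b0 s0 e powr (1 - \<theta>) * m a1 b1 s1 e powr \<theta> = be e" .
    moreover have "cmod (v e (of_real \<theta>)) = be e / (m a0 b0 s0 e powr (1 - \<theta>) * m a1 b1 s1 e powr \<theta>)"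
      unfolding nv[OF e] Re_complex_of_real powr_minus be_def by (simp add: divide_inverse)
    ultimately show ?thesis using wE(2)[OF e] by simp
  qed
  ultimately have "(\<Sum>e\<in>E. k e) \<le> (K / N) powr r" by simp
  moreover have "(\<Sum>e\<in>E. k e) = 1"
  proof -
    have "(\<Sum>e\<in>E. k e) = (\<Sum>n\<in>L. h n * (\<Sum>e\<in>En n. w e * g e))"
      unfolding split sum_distrib_left by (intro sum.cong refl) (simp add: k_def En_def mult_ac)
    also have "\<dots> = (\<Sum>n\<in>L. 1 * h n)" using sg by simp
    finally show ?thesis using sh by simp
  qed
  ultimately have one: "1 \<le> (K / N) powr r" by simp
  have K0: "0 \<le> K" using mixed_nonneg[OF B0[of 0]] .
  have "N \<le> K"
  proof (rule ccontr)
    assume "\<not> N \<le> K"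
    then have "K / N < 1" "0 \<le> K / N" using N0 K0 by auto
    then have "(K / N) powr r < 1 powr r" using r by (intro powr_less_mono2) auto
    then show False using one by simp
  qed
  then have "N powr (1/b) \<le> K powr (1/b)" using N0 b(2) by (intro powr_mono2) auto
  then show ?thesis unfolding Np A_def L_def En_def be_def .
qed simp

text \<open>Finite families suffice: the level suprema \<open>S n\<close> are approximated within a
  factor 2 by finite sums, which is the origin of \<open>2 powr a\<close>.\<close>

lemma mixed_stein:
  fixes a0 a1 b0 b1 s0 s1 \<theta> :: real and u :: "'i \<Rightarrow> complex \<Rightarrow> complex"
  assumes th: "0 < \<theta>" "\<theta> < 1" and nn: "0 \<le> a0" "0 \<le> a1" "0 \<le> b0" "0 \<le> b1"
    and a: "a = (1 - \<theta>) * a0 + \<theta> * a1" "0 < a" and b: "b = (1 - \<theta>) * b0 + \<theta> * b1" "0 < b"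
    and s: "s = (1 - \<theta>) * s0 + \<theta> * s1"
    and w: "\<And>n i. i \<in> I n \<Longrightarrow> 0 < w i" and lvl: "\<And>n i. i \<in> I n \<Longrightarrow> lvl i = n"
    and hol: "\<And>n i. i \<in> I n \<Longrightarrow> u i holomorphic_on strip"
    and cont: "\<And>n i. i \<in> I n \<Longrightarrow> continuous_on cstrip (u i)"
    and bdd: "\<And>n i. i \<in> I n \<Longrightarrow> \<exists>T. \<forall>z\<in>cstrip. cmod (u i z) \<le> T"
    and B0: "\<And>t. mixed I w a0 b0 s0 (\<lambda>i. cmod (u i (\<i> * of_real t))) K"
    and B1: "\<And>t. mixed I w a1 b1 s1 (\<lambda>i. cmod (u i (1 + \<i> * of_real t))) K"
  shows "mixed I w a b s (\<lambda>i. cmod (u i (of_real \<theta>))) (2 powr a * K)"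
proof -
  define be where "be i = cmod (u i (of_real \<theta>))" for i
  define X where "X i = w i * be i powr (1/a)" for i
  have K0: "0 \<le> K" using mixed_nonneg[OF B0[of 0]] .
  have X0: "0 \<le> X i" if "i \<in> I n" for i n using w[OF that] by (simp add: X_def)
  have fin: "(\<Sum>n\<in>L. (2 powr (of_int n * s) * (\<Sum>i\<in>J n. X i) powr a) powr (1/b)) \<le> K powr (1/b)"
    if L: "finite L" and J: "\<And>n. finite (J n)" "\<And>n. J n \<subseteq> I n" for L J
  proof -
    \<comment> \<open>Indices with value 0 at \<theta> are discarded, because the densities of the
      finite version are divisors and have to be positive.\<close>
    define E where "E = (\<Union>n\<in>L. {i\<in>J n. u i (of_real \<theta>) \<noteq> 0})"
    have E: "(\<Sum>n\<in>lvl ` E. (2 powr (of_int n * s) * (\<Sum>e\<in>{e\<in>E. lvl e = n}. w e * cmod (u e (of_real \<theta>)) powr (1/a)) powr a) powr (1/b)) \<le> K powr (1/b)"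
    proof (rule mixed_stein_finite[where I = I, OF th nn a b s w])
      show "finite E" using L J by (auto simp: E_def)
      fix e assume "e \<in> E"
      then obtain n where n: "e \<in> J n" "u e (of_real \<theta>) \<noteq> 0" by (auto simp: E_def)
      then have e: "e \<in> I n" using J by auto
      show "e \<in> I (lvl e)" using e lvl[OF e] by simp
      show "u e (of_real \<theta>) \<noteq> 0" by fact
      show "u e holomorphic_on strip" "continuous_on cstrip (u e)" "\<exists>T. \<forall>z\<in>cstrip. cmod (u e z) \<le> T"
        using hol[OF e] cont[OF e] bdd[OF e] by auto
    qed (use B0 B1 in auto)
    have lE: "{e\<in>E. lvl e = n} = {i\<in>J n. u i (of_real \<theta>) \<noteq> 0}" if n: "n \<in> L" for n
    proof
      show "{e\<in>E. lvl e = n} \<subseteq> {i\<in>J n. u i (of_real \<theta>) \<noteq> 0}"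
      proof
        fix e assume "e \<in> {e\<in>E. lvl e = n}"
        then obtain m where m: "m \<in> L" "e \<in> J m" "u e (of_real \<theta>) \<noteq> 0" "lvl e = n" by (auto simp: E_def)
        then have "lvl e = m" using J(2)[of m] lvl by blast
        then show "e \<in> {i\<in>J n. u i (of_real \<theta>) \<noteq> 0}" using m by simp
      qed
      show "{i\<in>J n. u i (of_real \<theta>) \<noteq> 0} \<subseteq> {e\<in>E. lvl e = n}"
        using J(2)[of n] lvl n unfolding E_def by blast
    qed
    have sJ: "(\<Sum>e\<in>{e\<in>E. lvl e = n}. w e * cmod (u e (of_real \<theta>)) powr (1/a)) = (\<Sum>i\<in>J n. X i)" if n: "n \<in> L" for n
      unfolding lE[OF n] X_def be_def using J by (intro sum.mono_neutral_left) auto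
    have "lvl ` E \<subseteq> L" using J(2) lvl by (fastforce simp: E_def)
    then have "(\<Sum>n\<in>lvl ` E. (2 powr (of_int n * s) * (\<Sum>e\<in>{e\<in>E. lvl e = n}. w e * cmod (u e (of_real \<theta>)) powr (1/a)) powr a) powr (1/b))
       = (\<Sum>n\<in>L. (2 powr (of_int n * s) * (\<Sum>e\<in>{e\<in>E. lvl e = n}. w e * cmod (u e (of_real \<theta>)) powr (1/a)) powr a) powr (1/b))"
    proof (intro sum.mono_neutral_left L ballI)
      fix n assume "n \<in> L - lvl ` E"
      then have "{e\<in>E. lvl e = n} = {}" by auto
      then have "(\<Sum>e\<in>{e\<in>E. lvl e = n}. w e * cmod (u e (of_real \<theta>)) powr (1/a)) = 0" by (simp only: sum.empty)
      then show "(2 powr (of_int n * s) * (\<Sum>e\<in>{e\<in>E. lvl e = n}. w e * cmod (u e (of_real \<theta>)) powr (1/a)) powr a) powr (1/b) = 0"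
        by simp
    qed
    also have "\<dots> = (\<Sum>n\<in>L. (2 powr (of_int n * s) * (\<Sum>i\<in>J n. X i) powr a) powr (1/b))"
      by (intro sum.cong refl) (simp only: sJ)
    finally show ?thesis using E by simp
  qed
  define S where "S n = (SUP J\<in>{J. finite J \<and> J \<subseteq> I n}. \<Sum>i\<in>J. X i)" for n
  \<comment> \<open>Testing with a single level shows that the level suprema are finite.\<close>
  have bddJ: "(\<Sum>i\<in>J. X i) \<le> (2 powr (- (of_int n * s)) * K) powr (1/a)" if J: "finite J" "J \<subseteq> I n" for J n
  proof -
    have x0: "0 \<le> (\<Sum>i\<in>J. X i)" using J X0 by (intro sum_nonneg) auto
    have "(\<Sum>k\<in>{n}. (2 powr (of_int k * s) * (\<Sum>i\<in>(if k = n then J else {}). X i) powr a) powr (1/b)) \<le> K powr (1/b)"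
      using J by (intro fin) auto
    then have "(2 powr (of_int n * s) * (\<Sum>i\<in>J. X i) powr a) powr (1/b) \<le> K powr (1/b)" by simp
    then have "((2 powr (of_int n * s) * (\<Sum>i\<in>J. X i) powr a) powr (1/b)) powr b \<le> (K powr (1/b)) powr b"
      by (rule powr_mono2[OF less_imp_le[OF b(2)] powr_ge_zero])
    then have "2 powr (of_int n * s) * (\<Sum>i\<in>J. X i) powr a \<le> K" using b(2) K0 by (simp add: powr_powr abs_mult)
    then have "(\<Sum>i\<in>J. X i) powr a \<le> 2 powr (- (of_int n * s)) * K" by (simp add: powr_minus field_simps)
    then have "((\<Sum>i\<in>J. X i) powr a) powr (1/a) \<le> (2 powr (- (of_int n * s)) * K) powr (1/a)"
      using a(2) by (intro powr_mono2) auto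
    then show ?thesis using a(2) x0 by (simp add: powr_powr)
  qed
  have bdd': "bdd_above ((\<lambda>J. \<Sum>i\<in>J. X i) ` {J. finite J \<and> J \<subseteq> I n})" for n
    using bddJ by (intro bdd_aboveI2[of _ _ "(2 powr (- (of_int n * s)) * K) powr (1/a)"]) auto
  have SJ: "(\<Sum>i\<in>J. X i) \<le> S n" if "finite J" "J \<subseteq> I n" for J n
    unfolding S_def using that by (intro cSUP_upper bdd') auto
  have S0: "0 \<le> S n" for n using SJ[of "{}"] by simp
  have "\<forall>n. \<exists>J. finite J \<and> J \<subseteq> I n \<and> S n \<le> 2 * (\<Sum>i\<in>J. X i)"
  proof
    fix n
    show "\<exists>J. finite J \<and> J \<subseteq> I n \<and> S n \<le> 2 * (\<Sum>i\<in>J. X i)"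
    proof (cases "S n = 0")
      case True
      then show ?thesis by (intro exI[of _ "{}"]) simp
    next
      case False
      then have "S n / 2 < S n" using S0[of n] by simp
      then obtain J where "finite J" "J \<subseteq> I n" "S n / 2 < (\<Sum>i\<in>J. X i)"
        unfolding S_def by (subst (asm) less_cSUP_iff) (use bdd' in auto)
      then show ?thesis by (intro exI[of _ J]) auto
    qed
  qed
  from choice[OF this] obtain J where "\<forall>n. finite (J n) \<and> J n \<subseteq> I n \<and> S n \<le> 2 * (\<Sum>i\<in>J n. X i)" by (rule exE)
  then have J: "\<And>n. finite (J n)" "\<And>n. J n \<subseteq> I n" "\<And>n. S n \<le> 2 * (\<Sum>i\<in>J n. X i)" by auto
  show ?thesis unfolding mixed_def be_def[symmetric]
  proof (intro exI[of _ "\<lambda>n. S n powr a"] conjI allI)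
    fix n
    have "(\<Sum>i\<in>J. w i * \<bar>be i\<bar> powr (1/a)) \<le> (S n powr a) powr (1/a)" if "finite J" "J \<subseteq> I n" for J
      using SJ[OF that] S0[of n] a(2) by (simp add: X_def powr_powr be_def)
    then show "bl a w (I n) be (S n powr a)" using a(2) by (simp add: bl_def)
  next
    have "(\<Sum>n\<in>L. 1 * \<bar>2 powr (of_int n * s) * S n powr a\<bar> powr (1/b)) \<le> (2 powr a * K) powr (1/b)" if L: "finite L" for L
    proof -
      have "(\<Sum>n\<in>L. 1 * \<bar>2 powr (of_int n * s) * S n powr a\<bar> powr (1/b))
        \<le> (\<Sum>n\<in>L. (2 powr a) powr (1/b) * (2 powr (of_int n * s) * (\<Sum>i\<in>J n. X i) powr a) powr (1/b))"
      proof (rule sum_mono)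
        fix n
        have x0: "0 \<le> (\<Sum>i\<in>J n. X i)" using J(2)[of n] X0 by (intro sum_nonneg) blast
        have "S n powr a \<le> (2 * (\<Sum>i\<in>J n. X i)) powr a" using J(3) S0 a(2) by (intro powr_mono2) auto
        also have "\<dots> = 2 powr a * (\<Sum>i\<in>J n. X i) powr a" using x0 by (simp add: powr_mult)
        finally have "2 powr (of_int n * s) * S n powr a \<le> 2 powr (of_int n * s) * (2 powr a * (\<Sum>i\<in>J n. X i) powr a)"
          by (intro mult_left_mono) auto
        then have "(2 powr (of_int n * s) * S n powr a) powr (1/b) \<le> (2 powr a * (2 powr (of_int n * s) * (\<Sum>i\<in>J n. X i) powr a)) powr (1/b)"
          using b(2) by (intro powr_mono2) (simp_all add: mult_ac)
        also have "\<dots> = (2 powr a) powr (1/b) * (2 powr (of_int n * s) * (\<Sum>i\<in>J n. X i) powr a) powr (1/b)"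
          by (rule powr_mult)
        finally show "1 * \<bar>2 powr (of_int n * s) * S n powr a\<bar> powr (1/b)
           \<le> (2 powr a) powr (1/b) * (2 powr (of_int n * s) * (\<Sum>i\<in>J n. X i) powr a) powr (1/b)" by simp
      qed
      also have "\<dots> = (2 powr a) powr (1/b) * (\<Sum>n\<in>L. (2 powr (of_int n * s) * (\<Sum>i\<in>J n. X i) powr a) powr (1/b))"
        by (simp only: sum_distrib_left)
      also have "\<dots> \<le> (2 powr a) powr (1/b) * K powr (1/b)" using L J by (intro mult_left_mono fin) auto
      also have "\<dots> = (2 powr a * K) powr (1/b)" using K0 by (simp add: powr_mult)
      finally show ?thesis .
    qed
    then show "bl b (\<lambda>_. 1) UNIV (\<lambda>n. 2 powr (of_int n * s) * S n powr a) (2 powr a * K)"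
      using b(2) K0 by (simp add: bl_def)
  qed
qed

section \<open>Hyperbolic fillings\<close>

abbreviation rad :: "int \<Rightarrow> real" where "rad n \<equiv> 2 powr (- real_of_int n)"

lemma rad_Suc: "rad (n + 1) = rad n / 2" "rad (n - 1) = 2 * rad n"
  by (simp_all add: powr_diff powr_minus powr_add field_simps)

lemma rad_mono: "m \<le> n \<Longrightarrow> rad n \<le> rad m"
  by simp

lemma rad_add: "rad (n + int j) = (1/2) ^ j * rad n" "rad (n - int j) = 2 ^ j * rad n"
  by (simp_all add: powr_add powr_diff powr_minus powr_realpow power_one_over field_simps)

locale filling =
  fixes M :: "'z::metric_space measure" and cd C Q :: real and Xs :: "int \<Rightarrow> 'z set"
  assumes mms: "doubling_mms M cd" and dimc: "dim_const M C Q" and fill: "hyp_filling Xs"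
begin

section \<open>Volumes, coverings and counting\<close>

definition vol :: "'z \<Rightarrow> real \<Rightarrow> real" where "vol x r = measure M (ball x r)"

abbreviation wt :: "int \<times> 'z \<Rightarrow> real" where "wt v \<equiv> vol (snd v) (rad (fst v))"

lemma sets_M[measurable_cong, simp]: "sets M = sets borel"
  using mms by (simp add: doubling_mms_def)

lemma space_M[simp]: "space M = UNIV"
  using sets_eq_imp_space_eq[OF sets_M] by simp

lemma C1: "1 \<le> C" and Q0: "0 < Q" using dimc by (auto simp: dim_const_def)

lemma ball_sets: "ball x r \<in> sets M" by simp

lemma emeasure_ball: "emeasure M (ball x r) = ennreal (vol x r)"
proof (cases "r > 0")
  case True
  then have "emeasure M (ball x r) \<noteq> top" using mms by (auto simp: doubling_mms_def less_top)
  then show ?thesis by (simp add: vol_def emeasure_eq_ennreal_measure)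
next
  case False
  then have "ball x r = {}" by simp
  then show ?thesis by (simp only: vol_def emeasure_empty measure_empty ennreal_0)
qed

lemma vol_pos:
  assumes "0 < r"
  shows "0 < vol x r"
proof -
  have "0 < emeasure M (ball x r)" using mms assms unfolding doubling_mms_def by blast
  then show ?thesis by (simp add: emeasure_ball)
qed

lemma vol_nonneg: "0 \<le> vol x r" by (simp add: vol_def)

lemma wt_pos: "0 < wt v" by (simp add: vol_pos)

lemma wt_eq: "wt v = measure M (Bx v)" by (simp add: vol_def Bx_def)

lemma ball_fmeasurable: "ball x r \<in> fmeasurable M"
  by (simp add: fmeasurable_def emeasure_ball)

lemma vol_mono: "ball x r \<subseteq> ball y t \<Longrightarrow> vol x r \<le> vol y t"
  unfolding vol_def by (intro measure_mono_fmeasurable ball_fmeasurable) auto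

lemma ball_subset: "dist x y + r \<le> t \<Longrightarrow> ball x r \<subseteq> ball (y::'z) t"
proof
  fix z assume "dist x y + r \<le> t" "z \<in> ball x r"
  then show "z \<in> ball y t" using dist_triangle[of y z x] by (simp add: dist_commute)
qed

lemma vol_scale:
  assumes "0 < r" "r \<le> t"
  shows "vol x t \<le> C * (t / r) powr Q * vol x r"
proof -
  have "1 \<le> t / r" using assms by simp
  then have "emeasure M (ball x ((t / r) * r)) \<le> ennreal (C * (t / r) powr Q) * emeasure M (ball x r)"
    using dimc assms(1) unfolding dim_const_def by blast
  then have "ennreal (vol x t) \<le> ennreal (C * (t / r) powr Q * vol x r)"
    using assms C1 by (simp add: emeasure_ball ennreal_mult' vol_nonneg)
  then show ?thesis using C1 vol_nonneg by (simp add: ennreal_le_iff)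
qed

lemma vol_compare:
  assumes "0 < r" "dist x y + t \<le> R" "r \<le> R"
  shows "vol x t \<le> C * (R / r) powr Q * vol y r"
proof -
  have "vol x t \<le> vol y R" by (intro vol_mono ball_subset assms)
  also have "\<dots> \<le> C * (R / r) powr Q * vol y r" by (rule vol_scale) (use assms in auto)
  finally show ?thesis .
qed

lemma Xs_separated:
  assumes "\<xi> \<in> Xs n" "\<eta> \<in> Xs n" "\<xi> \<noteq> \<eta>"
  shows "rad n / 2 \<le> dist \<xi> \<eta>"
proof -
  have "2 powr (- real_of_int n - 1) \<le> dist \<xi> \<eta>" using fill assms by (simp add: hyp_filling_def separated_def)
  then show ?thesis by (simp add: powr_diff)
qed

text \<open>By maximality of \<open>Xs n\<close>. The covering radius is only half of the radius of
  \<open>Bx\<close>, and this margin later keeps the denominators of the partition of unity away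
  from 0.\<close>

lemma Xs_cover: "\<exists>\<xi>\<in>Xs n. dist \<zeta> \<xi> < rad n / 2"
proof (rule ccontr)
  assume no: "\<not> (\<exists>\<xi>\<in>Xs n. dist \<zeta> \<xi> < rad n / 2)"
  have e: "2 powr (- real_of_int n - 1) = rad n / 2" by (simp add: powr_diff)
  have "separated (2 powr (- real_of_int n - 1)) (insert \<zeta> (Xs n))"
    unfolding separated_def e using no Xs_separated by (auto simp: dist_commute not_less)
  moreover have "Xs n \<subseteq> insert \<zeta> (Xs n)" by auto
  ultimately have "insert \<zeta> (Xs n) = Xs n" using fill unfolding hyp_filling_def by blast
  then have "\<zeta> \<in> Xs n" by auto
  then show False using no by auto
qed

text \<open>Points of level \<open>n\<close> are at least \<open>rad n / 2\<close> apart, so balls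
  of half that radius are disjoint.\<close>

lemma sum_vol_disjoint:
  assumes J: "finite J" "J \<subseteq> Xs n" and A: "A \<in> fmeasurable M" "\<And>\<xi>. \<xi> \<in> J \<Longrightarrow> ball \<xi> (rad n / 4) \<subseteq> A"
  shows "(\<Sum>\<xi>\<in>J. vol \<xi> (rad n / 4)) \<le> measure M A"
proof -
  have "disjoint_family_on (\<lambda>\<xi>. ball \<xi> (rad n / 4)) J"
  proof (unfold disjoint_family_on_def, intro ballI impI)
    fix \<xi> \<eta> assume x: "\<xi> \<in> J" "\<eta> \<in> J" "\<xi> \<noteq> \<eta>"
    then have d: "rad n / 2 \<le> dist \<xi> \<eta>" using J by (intro Xs_separated) auto
    show "ball \<xi> (rad n / 4) \<inter> ball \<eta> (rad n / 4) = {}"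
    proof (rule ccontr)
      assume "ball \<xi> (rad n / 4) \<inter> ball \<eta> (rad n / 4) \<noteq> {}"
      then obtain z where "dist \<xi> z < rad n / 4" "dist \<eta> z < rad n / 4" by auto
      then show False using d dist_triangle2[of \<xi> \<eta> z] by linarith
    qed
  qed
  then have "(\<Sum>\<xi>\<in>J. vol \<xi> (rad n / 4)) = measure M (\<Union>\<xi>\<in>J. ball \<xi> (rad n / 4))"
    unfolding vol_def using J ball_fmeasurable
    by (intro measure_finite_Union[symmetric]) (auto simp: fmeasurable_def less_top)
  also have "\<dots> \<le> measure M A" using A J by (intro measure_mono_fmeasurable) auto
  finally show ?thesis .
qed

lemma sum_vol_le:
  assumes J: "finite J" "J \<subseteq> Xs n" and R: "rad n \<le> R" "\<And>\<xi>. \<xi> \<in> J \<Longrightarrow> dist \<zeta> \<xi> < R"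
  shows "(\<Sum>\<xi>\<in>J. vol \<xi> (rad n)) \<le> C * 4 powr Q * vol \<zeta> (2 * R)"
proof -
  have "(\<Sum>\<xi>\<in>J. vol \<xi> (rad n)) \<le> (\<Sum>\<xi>\<in>J. C * 4 powr Q * vol \<xi> (rad n / 4))"
    using vol_scale[of "rad n / 4" "rad n"] by (intro sum_mono) simp
  also have "\<dots> = C * 4 powr Q * (\<Sum>\<xi>\<in>J. vol \<xi> (rad n / 4))" by (simp add: sum_distrib_left)
  also have "\<dots> \<le> C * 4 powr Q * measure M (ball \<zeta> (2 * R))"
  proof (intro mult_left_mono sum_vol_disjoint J ball_fmeasurable)
    fix \<xi> assume "\<xi> \<in> J"
    then show "ball \<xi> (rad n / 4) \<subseteq> ball \<zeta> (2 * R)" using R(2)[of \<xi>] R(1) powr_gt_zero[of "2::real" "- real_of_int n"] dist_commute[of \<xi> \<zeta>]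
      by (intro ball_subset) linarith
  qed (use C1 in auto)
  finally show ?thesis by (simp add: vol_def)
qed

definition Nc :: "real \<Rightarrow> nat" where "Nc T = nat \<lceil>C * (12 * T) powr Q\<rceil>"

text \<open>Volume counting with the disjoint balls of radius \<open>rad n / 4\<close>. The ball of
  radius \<open>2 * T * rad n\<close> about \<zeta> lies in the ball of radius
  \<open>3 * T * rad n\<close> about each point, and the ratio \<open>3 * T / (1/4) = 12 * T\<close>
  explains \<open>Nc\<close>.\<close>

lemma card_near_le':
  assumes J: "finite J" "J \<subseteq> Xs n" and T: "1 \<le> T" "\<And>\<xi>. \<xi> \<in> J \<Longrightarrow> dist \<zeta> \<xi> < T * rad n"
  shows "card J \<le> Nc T"
proof -
  have r0: "0 < rad n" by simp
  have Tr: "rad n \<le> T * rad n" using T by simp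
  define V where "V = vol \<zeta> (2 * T * rad n)"
  have V0: "V > 0" unfolding V_def using T r0 by (intro vol_pos) auto
  have one: "V \<le> C * (12 * T) powr Q * vol \<xi> (rad n / 4)" if "\<xi> \<in> J" for \<xi>
  proof -
    have "V \<le> C * ((3 * T * rad n) / (rad n / 4)) powr Q * vol \<xi> (rad n / 4)"
      unfolding V_def using T(2)[OF that] T(1) Tr r0 by (intro vol_compare) auto
    then show ?thesis using r0 by simp
  qed
  have "real (card J) * V = (\<Sum>\<xi>\<in>J. V)" by simp
  also have "\<dots> \<le> (\<Sum>\<xi>\<in>J. C * (12 * T) powr Q * vol \<xi> (rad n / 4))" by (intro sum_mono one)
  also have "\<dots> = C * (12 * T) powr Q * (\<Sum>\<xi>\<in>J. vol \<xi> (rad n / 4))" by (simp add: sum_distrib_left)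
  also have "\<dots> \<le> C * (12 * T) powr Q * measure M (ball \<zeta> (2 * T * rad n))"
  proof (intro mult_left_mono sum_vol_disjoint J ball_fmeasurable)
    fix \<xi> assume "\<xi> \<in> J"
    then show "ball \<xi> (rad n / 4) \<subseteq> ball \<zeta> (2 * T * rad n)" using T(2)[of \<xi>] Tr r0 dist_commute[of \<xi> \<zeta>]
      by (intro ball_subset) linarith
  qed (use C1 in auto)
  finally have "real (card J) \<le> C * (12 * T) powr Q" using V0 by (simp add: V_def vol_def)
  then show ?thesis unfolding Nc_def by linarith
qed

lemma near_Xs:
  assumes T: "1 \<le> T"
  shows "finite {\<xi>\<in>Xs n. dist \<zeta> \<xi> < T * rad n}" "card {\<xi>\<in>Xs n. dist \<zeta> \<xi> < T * rad n} \<le> Nc T"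
proof -
  show f: "finite {\<xi>\<in>Xs n. dist \<zeta> \<xi> < T * rad n}"
    by (rule finite_if_finite_subsets_card_bdd[of _ "Nc T", THEN conjunct1]) (use card_near_le'[OF _ _ T] in blast)
  show "card {\<xi>\<in>Xs n. dist \<zeta> \<xi> < T * rad n} \<le> Nc T" by (rule card_near_le'[OF f _ T]) auto
qed

lemma finite_near_Xs: "finite {\<xi>\<in>Xs n. dist \<zeta> \<xi> < R}"
proof (rule finite_subset[OF _ near_Xs(1)[of "max 1 (R / rad n)"]])
  have "R = (R / rad n) * rad n" by simp
  also have "\<dots> \<le> max 1 (R / rad n) * rad n" by (intro mult_right_mono) auto
  finally show "{\<xi>\<in>Xs n. dist \<zeta> \<xi> < R} \<subseteq> {\<xi>\<in>Xs n. dist \<zeta> \<xi> < max 1 (R / rad n) * rad n}" by auto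
qed simp

lemma countable_Xs: "countable (Xs n)"
proof -
  fix z :: 'z
  have "Xs n \<subseteq> (\<Union>k::nat. {\<xi>\<in>Xs n. dist z \<xi> < real k})"
    using reals_Archimedean2 by auto
  then show ?thesis by (rule countable_subset) (intro countable_UN countableI_type countable_finite finite_near_Xs)
qed

lemma countable_vertices: "countable (vertices Xs)"
proof -
  have "vertices Xs = (\<Union>n. Pair n ` Xs n)" by (auto simp: vertices_def)
  then show ?thesis using countable_Xs by auto
qed

section \<open>A Lipschitz partition of unity on each level\<close>

definition act :: "int \<Rightarrow> 'z \<Rightarrow> 'z set" where "act n \<zeta> = {\<xi>\<in>Xs n. \<zeta> \<in> Bx (n, \<xi>)}"

lemma act_eq: "act n \<zeta> = {\<xi>\<in>Xs n. dist \<zeta> \<xi> < 1 * rad n}"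
  by (auto simp: act_def Bx_def dist_commute)

lemma finite_act[simp]: "finite (act n \<zeta>)" and card_act: "card (act n \<zeta>) \<le> Nc 1"
  unfolding act_eq using near_Xs[of 1] by auto

text \<open>A tent over \<open>Bx v\<close>, at least 1/2 on the concentric half ball; the half
  balls of one level cover the space.\<close>

definition phi :: "int \<times> 'z \<Rightarrow> 'z \<Rightarrow> real" where
  "phi v \<zeta> = max 0 (1 - dist \<zeta> (snd v) / rad (fst v))"

definition den :: "int \<Rightarrow> 'z \<Rightarrow> real" where "den n \<zeta> = (\<Sum>\<xi>\<in>act n \<zeta>. phi (n, \<xi>) \<zeta>)"

definition psi :: "int \<times> 'z \<Rightarrow> 'z \<Rightarrow> real" where "psi v \<zeta> = phi v \<zeta> / den (fst v) \<zeta>"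

lemma phi_nonneg: "0 \<le> phi v \<zeta>" and phi_le_1: "phi v \<zeta> \<le> 1"
  by (auto simp: phi_def)

lemma phi_outside: "\<zeta> \<notin> Bx v \<Longrightarrow> phi v \<zeta> = 0"
  by (auto simp: phi_def Bx_def dist_commute field_simps)

lemma phi_lipschitz: "\<bar>phi v \<zeta> - phi v \<eta>\<bar> \<le> dist \<zeta> \<eta> / rad (fst v)"
proof -
  have "\<bar>phi v \<zeta> - phi v \<eta>\<bar> \<le> \<bar>dist \<zeta> (snd v) / rad (fst v) - dist \<eta> (snd v) / rad (fst v)\<bar>"
  proof -
    have "\<bar>max 0 (1 - a) - max 0 (1 - b)\<bar> \<le> \<bar>a - b\<bar>" for a b :: real by (auto simp: max_def abs_if)
    then show ?thesis unfolding phi_def .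
  qed
  also have "\<dots> = \<bar>dist \<zeta> (snd v) - dist \<eta> (snd v)\<bar> / rad (fst v)" by (simp add: diff_divide_distrib[symmetric])
  also have "\<dots> \<le> dist \<zeta> \<eta> / rad (fst v)"
    using dist_triangle[of \<zeta> "snd v" \<eta>] dist_triangle[of \<eta> "snd v" \<zeta>] dist_commute[of \<zeta> \<eta>] by (intro divide_right_mono) auto
  finally show ?thesis .
qed

lemma den_ge: "1/2 \<le> den n \<zeta>"
proof -
  obtain \<xi> where x: "\<xi> \<in> Xs n" "dist \<zeta> \<xi> < rad n / 2" using Xs_cover by blast
  then have "dist \<zeta> \<xi> < 1 * rad n" using powr_gt_zero[of "2::real" "- real_of_int n"] by linarith
  then have "\<xi> \<in> act n \<zeta>" using x by (simp add: act_eq)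
  moreover have "1/2 \<le> phi (n, \<xi>) \<zeta>"
  proof -
    have "dist \<zeta> \<xi> / rad n \<le> 1/2" using x by (simp add: field_simps)
    then have "1/2 \<le> 1 - dist \<zeta> \<xi> / rad n" by linarith
    then show ?thesis unfolding phi_def fst_conv snd_conv by linarith
  qed
  moreover have "phi (n, \<xi>) \<zeta> \<le> den n \<zeta>" if "\<xi> \<in> act n \<zeta>"
    unfolding den_def using that by (intro member_le_sum) (auto simp: phi_nonneg)
  ultimately show ?thesis by linarith
qed

lemma phi_le_den: "fst v = n \<Longrightarrow> v \<in> vertices Xs \<Longrightarrow> phi v \<zeta> \<le> den n \<zeta>"
proof (cases "\<zeta> \<in> Bx v")
  assume v: "fst v = n" "v \<in> vertices Xs"
  case True
  then have "snd v \<in> act n \<zeta>" using v by (auto simp: act_def vertices_def)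
  then have "phi (n, snd v) \<zeta> \<le> den n \<zeta>" unfolding den_def by (intro member_le_sum) (auto simp: phi_nonneg)
  then show ?thesis using v by auto
next
  case False
  then show ?thesis using den_ge[of n \<zeta>] by (simp add: phi_outside)
qed

lemma psi_nonneg: "0 \<le> psi v \<zeta>"
  using den_ge[of "fst v" \<zeta>] by (simp add: psi_def phi_nonneg)

lemma psi_le_1: "v \<in> vertices Xs \<Longrightarrow> psi v \<zeta> \<le> 1"
  using den_ge[of "fst v" \<zeta>] phi_le_den[OF refl, of v \<zeta>] by (simp add: psi_def)

lemma psi_outside: "\<zeta> \<notin> Bx v \<Longrightarrow> psi v \<zeta> = 0"
  by (simp add: psi_def phi_outside)

lemma sum_psi: "(\<Sum>\<xi>\<in>act n \<zeta>. psi (n, \<xi>) \<zeta>) = 1"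
  using den_ge[of n \<zeta>] by (simp add: psi_def sum_divide_distrib[symmetric] den_def[symmetric])

text \<open>At most \<open>2 * Nc 1\<close> tents are active at one of the two points, and each
  contributes its own Lipschitz constant.\<close>

lemma den_lipschitz: "\<bar>den n \<zeta> - den n \<eta>\<bar> \<le> 2 * real (Nc 1) * (dist \<zeta> \<eta> / rad n)"
proof -
  let ?A = "act n \<zeta> \<union> act n \<eta>"
  have e: "den n x = (\<Sum>\<xi>\<in>?A. phi (n, \<xi>) x)" if "x = \<zeta> \<or> x = \<eta>" for x
    unfolding den_def
  proof (intro sum.mono_neutral_left ballI)
    show "phi (n, \<xi>) x = 0" if "\<xi> \<in> ?A - act n x" for \<xi>
      using that by (intro phi_outside) (auto simp: act_def)
  qed (use that in auto)
  have "\<bar>den n \<zeta> - den n \<eta>\<bar> = \<bar>\<Sum>\<xi>\<in>?A. phi (n, \<xi>) \<zeta> - phi (n, \<xi>) \<eta>\<bar>" by (simp add: e sum_subtractf)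
  also have "\<dots> \<le> (\<Sum>\<xi>\<in>?A. \<bar>phi (n, \<xi>) \<zeta> - phi (n, \<xi>) \<eta>\<bar>)" by (rule sum_abs)
  also have "\<dots> \<le> (\<Sum>\<xi>\<in>?A. dist \<zeta> \<eta> / rad n)" using phi_lipschitz[of "(n, _)"] by (intro sum_mono) simp
  also have "\<dots> = real (card ?A) * (dist \<zeta> \<eta> / rad n)" by simp
  also have "\<dots> \<le> 2 * real (Nc 1) * (dist \<zeta> \<eta> / rad n)"
  proof (intro mult_right_mono)
    have "card ?A \<le> card (act n \<zeta>) + card (act n \<eta>)" by (rule card_Un_le)
    also have "\<dots> \<le> Nc 1 + Nc 1" by (intro add_mono card_act)
    finally show "real (card ?A) \<le> 2 * real (Nc 1)" by linarith
  qed auto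
  finally show ?thesis .
qed

text \<open>The summand 2 is the Lipschitz constant of a tent divided by the lower bound 1/2 of
  \<open>den\<close>; \<open>4 * Nc 1\<close> arises in the same way from the variation of the
  denominator.\<close>

definition Lc :: real where "Lc = 2 + 4 * real (Nc 1)"

lemma Lc_ge: "2 \<le> Lc" by (simp add: Lc_def)

lemma psi_lipschitz:
  assumes v: "v \<in> vertices Xs"
  shows "\<bar>psi v \<zeta> - psi v \<eta>\<bar> \<le> Lc * (dist \<zeta> \<eta> / rad (fst v))"
proof -
  let ?n = "fst v"
  define d where "d = dist \<zeta> \<eta> / rad ?n"
  have d0: "0 \<le> d" by (simp add: d_def)
  have D: "1/2 \<le> den ?n \<zeta>" "1/2 \<le> den ?n \<eta>" by (rule den_ge)+
  have "psi v \<zeta> - psi v \<eta> = (phi v \<zeta> - phi v \<eta>) / den ?n \<zeta> + psi v \<eta> * ((den ?n \<eta> - den ?n \<zeta>) / den ?n \<zeta>)"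
    using D by (simp add: psi_def field_simps)
  then have "\<bar>psi v \<zeta> - psi v \<eta>\<bar> \<le> \<bar>(phi v \<zeta> - phi v \<eta>) / den ?n \<zeta>\<bar> + \<bar>psi v \<eta> * ((den ?n \<eta> - den ?n \<zeta>) / den ?n \<zeta>)\<bar>"
    by linarith
  also have "\<bar>(phi v \<zeta> - phi v \<eta>) / den ?n \<zeta>\<bar> \<le> d / (1/2)"
    unfolding abs_divide using phi_lipschitz[of v \<zeta> \<eta>] D by (intro frac_le) (auto simp: d_def)
  also have "\<bar>psi v \<eta> * ((den ?n \<eta> - den ?n \<zeta>) / den ?n \<zeta>)\<bar> \<le> 1 * ((2 * real (Nc 1) * d) / (1/2))"
    unfolding abs_mult abs_divide
    using den_lipschitz[of ?n \<eta> \<zeta>] D psi_nonneg[of v \<eta>] psi_le_1[OF v, of \<eta>] d0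
    by (intro mult_mono frac_le) (auto simp: d_def dist_commute)
  finally show ?thesis by (simp add: Lc_def d_def algebra_simps)
qed

lemma lipschitz_measurable:
  fixes f :: "'z \<Rightarrow> real"
  assumes "\<And>x y. \<bar>f x - f y\<bar> \<le> L * dist x y"
  shows "f \<in> borel_measurable M"
proof -
  have "0 \<le> L \<or> (\<forall>x y. f x = f y)"
  proof (cases "\<exists>x y. f x \<noteq> f y")
    case True
    then obtain x y where "f x \<noteq> f y" by blast
    then have "0 < L * dist x y" using assms[of x y] by linarith
    then show ?thesis by (auto simp: zero_less_mult_iff)
  qed auto
  then have "continuous_on UNIV f"
  proof
    assume "0 \<le> L"
    then have "L-lipschitz_on UNIV f" using assms by (intro lipschitz_onI) (auto simp: dist_real_def)
    then show ?thesis by (rule lipschitz_on_continuous_on)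
  next
    assume "\<forall>x y. f x = f y"
    then have "f = (\<lambda>_. f undefined)" by auto
    then show ?thesis by (metis continuous_on_const)
  qed
  then have "f \<in> borel_measurable borel" by (rule borel_measurable_continuous_onI)
  then show ?thesis by (simp cong: measurable_cong_sets)
qed

lemma psi_measurable: "v \<in> vertices Xs \<Longrightarrow> psi v \<in> borel_measurable M"
  by (rule lipschitz_measurable[of _ "Lc / rad (fst v)"]) (use psi_lipschitz[of v] in simp)

end

section \<open>Density of Lipschitz functions in L1 of a finite Borel measure\<close>

definition L1_lipschitz_approx :: "'z::metric_space measure \<Rightarrow> ('z \<Rightarrow> complex) \<Rightarrow> bool" where
  "L1_lipschitz_approx N f \<longleftrightarrow> integrable N f \<and>
     (\<forall>\<epsilon>>0. \<exists>g L. (\<forall>x y. cmod (g x - g y) \<le> L * dist x y) \<and> integrable N g \<and> (\<integral>x. cmod (f x - g x) \<partial>N) < \<epsilon>)"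

text \<open>Dominated convergence brings some \<open>s i\<close> close to \<open>f\<close> in L1,
  and the approximant of that \<open>s i\<close> serves for \<open>f\<close>.\<close>

lemma L1_lipschitz_approx_limit:
  assumes s: "\<And>i. L1_lipschitz_approx N (s i)" and lim: "\<And>x. x \<in> space N \<Longrightarrow> (\<lambda>i. s i x) \<longlonglongrightarrow> f x"
    and w: "integrable N w" and bd: "\<And>i x. x \<in> space N \<Longrightarrow> cmod (s i x) \<le> w x"
  shows "L1_lipschitz_approx N f"
proof -
  have si: "integrable N (s i)" for i using s by (simp add: L1_lipschitz_approx_def)
  have fm: "f \<in> borel_measurable N" by (rule borel_measurable_LIMSEQ_metric[OF borel_measurable_integrable[OF si] lim])
  have fw: "cmod (f x) \<le> w x" if "x \<in> space N" for x
    using tendsto_norm[OF lim[OF that]] by (rule LIMSEQ_le_const2) (use bd that in auto)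
  have fi: "integrable N f" by (rule Bochner_Integration.integrable_bound[OF w fm]) (use order_trans[OF fw abs_ge_self] in \<open>auto intro!: AE_I2\<close>)
  have "(\<lambda>i. \<integral>x. cmod (f x - s i x) \<partial>N) \<longlonglongrightarrow> (\<integral>x. 0 \<partial>N)"
  proof (rule integral_dominated_convergence[where w = "\<lambda>x. 2 * w x"])
    show "AE x in N. (\<lambda>i. cmod (f x - s i x)) \<longlonglongrightarrow> 0"
    proof (rule AE_I2)
      fix x assume "x \<in> space N"
      from tendsto_norm[OF tendsto_diff[OF tendsto_const lim[OF this], of "f x"]]
      show "(\<lambda>i. cmod (f x - s i x)) \<longlonglongrightarrow> 0" by simp
    qed
    show "AE x in N. norm (cmod (f x - s i x)) \<le> 2 * w x" for i
    proof (rule AE_I2)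
      fix x assume "x \<in> space N"
      then show "norm (cmod (f x - s i x)) \<le> 2 * w x" using fw[of x] bd[of x i] norm_triangle_ineq4[of "f x" "s i x"] by simp
    qed
  qed (use w fm si in auto)
  then have lim0: "(\<lambda>i. \<integral>x. cmod (f x - s i x) \<partial>N) \<longlonglongrightarrow> 0" by simp
  show ?thesis unfolding L1_lipschitz_approx_def
  proof (intro conjI fi allI impI)
    fix \<epsilon> :: real assume e: "\<epsilon> > 0"
    have "eventually (\<lambda>i. (\<integral>x. cmod (f x - s i x) \<partial>N) < \<epsilon>/2) sequentially"
      using order_tendstoD(2)[OF lim0, of "\<epsilon>/2"] e by simp
    then obtain i where i: "(\<integral>x. cmod (f x - s i x) \<partial>N) < \<epsilon>/2" by (auto simp: eventually_sequentially)
    obtain g L where g: "\<forall>x y. cmod (g x - g y) \<le> L * dist x y" "integrable N g" "(\<integral>x. cmod (s i x - g x) \<partial>N) < \<epsilon>/2"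
      using s[of i] e unfolding L1_lipschitz_approx_def by (meson half_gt_zero)
    have "(\<integral>x. cmod (f x - g x) \<partial>N) \<le> (\<integral>x. cmod (f x - s i x) + cmod (s i x - g x) \<partial>N)"
    proof (rule integral_mono)
      show "cmod (f x - g x) \<le> cmod (f x - s i x) + cmod (s i x - g x)" for x
        using norm_triangle_ineq[of "f x - s i x" "s i x - g x"] by simp
    qed (use fi si g in auto)
    also have "\<dots> = (\<integral>x. cmod (f x - s i x) \<partial>N) + (\<integral>x. cmod (s i x - g x) \<partial>N)"
      using fi si g by (intro Bochner_Integration.integral_add) auto
    finally have "(\<integral>x. cmod (f x - g x) \<partial>N) < \<epsilon>" using i g by linarith
    then show "\<exists>g L. (\<forall>x y. cmod (g x - g y) \<le> L * dist x y) \<and> integrable N g \<and> (\<integral>x. cmod (f x - g x) \<partial>N) < \<epsilon>"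
      using g by blast
  qed
qed

lemma L1_lipschitz_approx_lincomb:
  assumes f: "L1_lipschitz_approx N f" and h: "L1_lipschitz_approx N h"
  shows "L1_lipschitz_approx N (\<lambda>x. c * f x + d * h x)"
proof -
  have fi: "integrable N f" "integrable N h" using f h by (auto simp: L1_lipschitz_approx_def)
  show ?thesis unfolding L1_lipschitz_approx_def
  proof (intro conjI allI impI)
    show "integrable N (\<lambda>x. c * f x + d * h x)" using fi by auto
    fix \<epsilon> :: real assume e: "\<epsilon> > 0"
    define \<delta> where "\<delta> = \<epsilon> / (2 * (1 + cmod c + cmod d))"
    have D: "0 < 1 + cmod c + cmod d" using norm_ge_zero[of c] norm_ge_zero[of d] by linarith
    have d: "\<delta> > 0" using e D by (simp add: \<delta>_def)
    obtain g L where g: "\<forall>x y. cmod (g x - g y) \<le> L * dist x y" "integrable N g" "(\<integral>x. cmod (f x - g x) \<partial>N) < \<delta>"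
      using f d unfolding L1_lipschitz_approx_def by meson
    obtain g' L' where g': "\<forall>x y. cmod (g' x - g' y) \<le> L' * dist x y" "integrable N g'" "(\<integral>x. cmod (h x - g' x) \<partial>N) < \<delta>"
      using h d unfolding L1_lipschitz_approx_def by meson
    define G where "G x = c * g x + d * g' x" for x
    have lip: "cmod (G x - G y) \<le> (cmod c * L + cmod d * L') * dist x y" for x y
    proof -
      have "G x - G y = c * (g x - g y) + d * (g' x - g' y)" by (simp add: G_def algebra_simps)
      then have "cmod (G x - G y) \<le> cmod c * cmod (g x - g y) + cmod d * cmod (g' x - g' y)"
        by (metis norm_mult norm_triangle_ineq)
      also have "\<dots> \<le> cmod c * (L * dist x y) + cmod d * (L' * dist x y)"
        using g g' by (intro add_mono mult_left_mono) auto
      finally show ?thesis by (simp add: algebra_simps)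
    qed
    have Gi: "integrable N G" unfolding G_def using g g' by auto
    have "(\<integral>x. cmod (c * f x + d * h x - G x) \<partial>N) \<le> (\<integral>x. cmod c * cmod (f x - g x) + cmod d * cmod (h x - g' x) \<partial>N)"
    proof (rule integral_mono)
      fix x
      have "c * f x + d * h x - G x = c * (f x - g x) + d * (h x - g' x)" by (simp add: G_def algebra_simps)
      then show "cmod (c * f x + d * h x - G x) \<le> cmod c * cmod (f x - g x) + cmod d * cmod (h x - g' x)"
        by (metis norm_mult norm_triangle_ineq)
    qed (use fi g g' Gi in auto)
    also have "\<dots> = cmod c * (\<integral>x. cmod (f x - g x) \<partial>N) + cmod d * (\<integral>x. cmod (h x - g' x) \<partial>N)"
      using fi g g' by (subst Bochner_Integration.integral_add) auto
    also have "\<dots> \<le> cmod c * \<delta> + cmod d * \<delta>" using g g' by (intro add_mono mult_left_mono) auto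
    also have "\<dots> \<le> (1 + cmod c + cmod d) * \<delta>" using d by (simp add: algebra_simps)
    also have "\<dots> = \<epsilon> / 2"
    proof -
      define q where "q = 1 + cmod c + cmod d"
      have "q * (\<epsilon> / (2 * q)) = \<epsilon> / 2" using D by (simp add: q_def[symmetric])
      then show ?thesis by (simp add: \<delta>_def q_def)
    qed
    finally have "(\<integral>x. cmod (c * f x + d * h x - G x) \<partial>N) < \<epsilon>" using e by linarith
    then show "\<exists>g L. (\<forall>x y. cmod (g x - g y) \<le> L * dist x y) \<and> integrable N g \<and> (\<integral>x. cmod (c * f x + d * h x - g x) \<partial>N) < \<epsilon>"
      using lip Gi by blast
  qed
qed

lemma L1_lipschitz_approx_lipschitz:
  assumes "integrable N g" "\<And>x y. cmod (g x - g y) \<le> L * dist x y"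
  shows "L1_lipschitz_approx N g"
  unfolding L1_lipschitz_approx_def using assms by (intro conjI allI impI exI[of _ g] exI[of _ L]) auto

text \<open>The indicator of a closed set is a bounded limit of truncated multiples of the distance
  to it. Closed sets are stable under intersection and generate the Borel sets, and the class is
  closed under complements and countable disjoint unions, so induction over disjoint unions covers
  all Borel sets.\<close>

lemma L1_lipschitz_approx_indicator:
  fixes N :: "'z::metric_space measure"
  assumes N: "finite_measure N" "sets N = sets borel" and A: "A \<in> sets borel"
  shows "L1_lipschitz_approx N (\<lambda>x. of_real (indicator A x))"
proof -
  interpret finite_measure N by (rule N)
  have sp: "space N = UNIV" using sets_eq_imp_space_eq[OF N(2)] by simp
  have c1: "L1_lipschitz_approx N (\<lambda>_. c)" for c
    by (rule L1_lipschitz_approx_lipschitz[of _ _ 0]) auto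
  have A': "A \<in> sigma_sets UNIV (Collect closed)"
    using A by (simp add: borel_eq_closed)
  have IS: "Int_stable (Collect (closed :: 'z set \<Rightarrow> bool))" by (auto simp: Int_stable_def)
  have sub: "Collect closed \<subseteq> Pow (UNIV :: 'z set)" by auto
  from IS sub A' show ?thesis
  proof (induction rule: sigma_sets_induct_disjoint)
    case (basic F)
    then have F: "closed F" by simp
    show ?case
    proof (cases "F = {}")
      case True
      then show ?thesis using c1[of 0] by simp
    next
      case False
      define s where "s k x = (of_real (max 0 (1 - real k * infdist x F)) :: complex)" for k :: nat and x
      have lip: "cmod (s k x - s k y) \<le> real k * dist x y" for k x y
      proof -
        have "cmod (s k x - s k y) = \<bar>max 0 (1 - real k * infdist x F) - max 0 (1 - real k * infdist y F)\<bar>"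
          unfolding s_def by (simp add: of_real_diff[symmetric] del: of_real_diff)
        also have "\<dots> \<le> \<bar>real k * infdist x F - real k * infdist y F\<bar>" by (auto simp: max_def abs_if)
        also have "\<dots> = real k * \<bar>infdist x F - infdist y F\<bar>" by (simp add: abs_mult right_diff_distrib[symmetric])
        also have "\<dots> \<le> real k * dist x y"
          using infdist_triangle_abs[of x F y] by (intro mult_left_mono) auto
        finally show ?thesis .
      qed
      have sb: "cmod (s k x) \<le> 1" for k x unfolding s_def by (simp add: infdist_nonneg)
      have sm: "s k \<in> borel_measurable N" for k
      proof -
        have "continuous_on UNIV (s k)" unfolding s_def by (intro continuous_intros)
        then show ?thesis using borel_measurable_continuous_onI measurable_cong_sets[OF N(2) refl] by blast
      qed
      have si: "integrable N (s k)" for k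
        by (rule integrable_const_bound[of _ 1]) (use sb sm in auto)
      show ?thesis
      proof (rule L1_lipschitz_approx_limit[of N s _ "\<lambda>_. 1"])
        show "L1_lipschitz_approx N (s k)" for k by (rule L1_lipschitz_approx_lipschitz[OF si lip])
        show "(\<lambda>k. s k x) \<longlonglongrightarrow> of_real (indicator F x)" if "x \<in> space N" for x
        proof (cases "x \<in> F")
          case True
          then show ?thesis by (simp add: s_def)
        next
          case False': False
          have pos: "0 < infdist x F" using False' F False by (metis in_closed_iff_infdist_zero infdist_nonneg order_le_less)
          have "eventually (\<lambda>k. s k x = 0) sequentially"
          proof (rule eventually_sequentiallyI)
            fix k assume "k \<ge> nat \<lceil>1 / infdist x F\<rceil>"
            then have "1 / infdist x F \<le> real k" by linarith
            then have "1 \<le> real k * infdist x F" using pos by (simp add: field_simps)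
            then show "s k x = 0" by (simp add: s_def)
          qed
          then show ?thesis using False' by (auto intro: tendsto_eventually)
        qed
      qed (use sb in auto)
    qed
  next
    case empty
    then show ?case using c1[of 0] by simp
  next
    case (compl B)
    have "(\<lambda>x. of_real (indicator (UNIV - B) x)) = (\<lambda>x. 1 * (1::complex) + (-1) * of_real (indicator B x))"
      by (auto simp: indicator_def)
    then show ?case using L1_lipschitz_approx_lincomb[OF c1[of 1] compl.IH, of 1 "-1"] by simp
  next
    case (union B)
    define s where "s n x = (\<Sum>i<n. of_real (indicator (B i) x) :: complex)" for n :: nat and x
    have eq: "s n x = of_real (indicator (\<Union>i<n. B i) x)" for n x
      unfolding s_def of_real_sum[symmetric] using union.hyps
      by (subst indicator_UN_disjoint) (auto intro: disjoint_family_on_mono)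
    show ?case
    proof (rule L1_lipschitz_approx_limit[of N s _ "\<lambda>_. 1"])
      show "L1_lipschitz_approx N (s n)" for n
      proof (induction n)
        case 0
        then show ?case using c1[of 0] by (simp add: s_def[abs_def])
      next
        case (Suc n)
        have "s (Suc n) = (\<lambda>x. 1 * s n x + 1 * of_real (indicator (B n) x))" by (auto simp: s_def)
        then show ?case using L1_lipschitz_approx_lincomb[OF Suc union.IH[of n], of 1 1] by simp
      qed
      show "(\<lambda>n. s n x) \<longlonglongrightarrow> of_real (indicator (\<Union>i. B i) x)" if "x \<in> space N" for x
        unfolding eq by (intro tendsto_of_real LIMSEQ_indicator_UN)
      show "cmod (s n x) \<le> 1" for n x unfolding eq by (simp add: indicator_def)
    qed auto
  qed
qed

lemma integrable_imp_L1_lipschitz_approx: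
  fixes N :: "'z::metric_space measure" and f :: "'z \<Rightarrow> complex"
  assumes N: "finite_measure N" "sets N = sets borel" and f: "integrable N f"
  shows "L1_lipschitz_approx N f"
  using f
proof (induction rule: integrable_induct)
  case (base A c)
  have "(\<lambda>x. indicator A x *\<^sub>R c) = (\<lambda>x. c * of_real (indicator A x) + 0 * of_real (indicator A x))"
    by (auto simp: indicator_def)
  then show ?case
    using L1_lipschitz_approx_lincomb[OF L1_lipschitz_approx_indicator[OF N] L1_lipschitz_approx_indicator[OF N], of A A c 0] base N
    by simp
next
  case (add f g)
  then show ?case using L1_lipschitz_approx_lincomb[of N f g 1 1] by simp
next
  case (lim f s)
  show ?case
  proof (rule L1_lipschitz_approx_limit[of N s f "\<lambda>x. 2 * cmod (f x)"])
    show "integrable N (\<lambda>x. 2 * cmod (f x))" using lim by auto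
  qed (use lim in auto)
qed

context filling
begin

section \<open>Averages and their smoothing\<close>

lemma loc_int_ball: "loc_int M f \<Longrightarrow> set_integrable M (ball x r) f"
  by (simp add: loc_int_def)

lemma loc_int_measurable: "loc_int M f \<Longrightarrow> f \<in> borel_measurable M"
  by (simp add: loc_int_def)

lemma loc_intI:
  assumes "f \<in> borel_measurable M" "\<And>r. set_integrable M (ball z r) f"
  shows "loc_int M f"
  unfolding loc_int_def
proof (intro conjI allI impI assms)
  fix B assume B: "B \<in> sets M" "bounded B"
  then obtain r where "B \<subseteq> ball z r" using bounded_subset_ballD by blast
  then show "set_integrable M B f" by (rule set_integrable_subset[OF assms(2) B(1)])
qed

lemma loc_int_add: "loc_int M f \<Longrightarrow> loc_int M g \<Longrightarrow> loc_int M (\<lambda>x. f x + g x)"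
  and loc_int_diff: "loc_int M f \<Longrightarrow> loc_int M g \<Longrightarrow> loc_int M (\<lambda>x. f x - g x)"
  and loc_int_cmult: "loc_int M f \<Longrightarrow> loc_int M (\<lambda>x. k * f x)"
  by (auto simp: loc_int_def intro: set_integral_add set_integral_diff)

lemma set_integrable_ball_bounded:
  fixes f :: "'z \<Rightarrow> complex"
  assumes f: "f \<in> borel_measurable M" and B: "\<And>x. x \<in> ball z r \<Longrightarrow> cmod (f x) \<le> B"
  shows "set_integrable M (ball z r) f"
  unfolding set_integrable_def
proof (rule Bochner_Integration.integrable_bound)
  show "integrable M (\<lambda>x. indicat_real (ball z r) x * B)"
    using emeasure_ball[of z r] by (intro integrable_mult_left) (auto intro!: integrable_real_indicator simp: less_top[symmetric])
  show "(\<lambda>x. indicat_real (ball z r) x *\<^sub>R f x) \<in> borel_measurable M"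
    by (intro borel_measurable_scaleR borel_measurable_indicator ball_sets f)
  show "AE x in M. norm (indicat_real (ball z r) x *\<^sub>R f x) \<le> norm (indicat_real (ball z r) x * B)"
  proof (rule AE_I2)
    fix x show "norm (indicat_real (ball z r) x *\<^sub>R f x) \<le> norm (indicat_real (ball z r) x * B)"
    proof (cases "x \<in> ball z r")
      case True
      then have "indicat_real (ball z r) x = 1" by simp
      moreover have "cmod (f x) \<le> \<bar>B\<bar>" using B[OF True] by linarith
      ultimately show ?thesis by (simp only: mult_1 scaleR_one real_norm_def)
    next
      case False
      then have "indicat_real (ball z r) x = 0" by simp
      then show ?thesis by (simp only: mult_zero_left scaleR_zero_left norm_zero)
    qed
  qed
qed

lemma loc_int_bounded:
  assumes "f \<in> borel_measurable M" "\<And>x. cmod (f x) \<le> B"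
  shows "loc_int M f"
  by (rule loc_intI[OF assms(1) set_integrable_ball_bounded[OF assms]])

lemma loc_int_const: "loc_int M (\<lambda>_. k)"
  by (rule loc_int_bounded[of _ "cmod k"]) auto

lemma loc_int_sum: "(\<And>i. i \<in> A \<Longrightarrow> loc_int M (f i)) \<Longrightarrow> loc_int M (\<lambda>x. \<Sum>i\<in>A. f i x)"
  by (induction A rule: infinite_finite_induct) (auto intro: loc_int_add loc_int_const)

lemma loc_int_lipschitz:
  assumes lip: "\<And>x y. cmod (g x - g y) \<le> L * dist x y"
  shows "loc_int M g"
proof -
  have re: "\<bar>Re (g x) - Re (g y)\<bar> \<le> L * dist x y" for x y
    using lip[of x y] abs_Re_le_cmod[of "g x - g y"] by simp
  have im: "\<bar>Im (g x) - Im (g y)\<bar> \<le> L * dist x y" for x y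
    using lip[of x y] abs_Im_le_cmod[of "g x - g y"] by simp
  have "(\<lambda>x. Re (g x)) \<in> borel_measurable M" "(\<lambda>x. Im (g x)) \<in> borel_measurable M"
    by (rule lipschitz_measurable[OF re], rule lipschitz_measurable[OF im])
  then have gm: "g \<in> borel_measurable M" by (simp add: borel_measurable_complex_iff)
  fix z :: 'z
  show ?thesis
  proof (rule loc_intI[OF gm set_integrable_ball_bounded[OF gm]])
    fix r x assume x: "x \<in> ball z r"
    have "cmod (g x) \<le> cmod (g z) + cmod (g x - g z)" by (rule norm_triangle_sub)
    also have "cmod (g x - g z) \<le> L * dist x z" by (rule lip)
    also have "\<dots> \<le> \<bar>L\<bar> * \<bar>r\<bar>" using x by (intro mult_mono) (auto simp: dist_commute)
    finally show "cmod (g x) \<le> cmod (g z) + \<bar>L\<bar> * \<bar>r\<bar>" by simp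
  qed
qed

lemma Bx_ball: "Bx x = ball (snd x) (rad (fst x))" by (simp add: Bx_def)

lemma Bx_sets: "Bx x \<in> sets M" by (simp add: Bx_ball)

lemma set_integrable_Bx: "loc_int M f \<Longrightarrow> set_integrable M (Bx x) f"
  by (simp add: Bx_ball loc_int_ball)

lemma Pavg_eq: "Pavg M f x = (LINT \<zeta>:Bx x|M. f \<zeta>) / of_real (wt x)"
  by (simp add: Pavg_def wt_eq)

lemma Pavg_add: "loc_int M f \<Longrightarrow> loc_int M g \<Longrightarrow> Pavg M (\<lambda>\<zeta>. f \<zeta> + g \<zeta>) x = Pavg M f x + Pavg M g x"
  by (simp add: Pavg_def set_integral_add(2) set_integrable_Bx add_divide_distrib)

lemma Pavg_diff: "loc_int M f \<Longrightarrow> loc_int M g \<Longrightarrow> Pavg M (\<lambda>\<zeta>. f \<zeta> - g \<zeta>) x = Pavg M f x - Pavg M g x"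
  by (simp add: Pavg_def set_integral_diff(2) set_integrable_Bx diff_divide_distrib)

lemma Pavg_cmult: "Pavg M (\<lambda>\<zeta>. k * f \<zeta>) x = k * Pavg M f x"
  by (simp add: Pavg_def)

lemma Pavg_const: "Pavg M (\<lambda>_. k) x = k"
proof -
  have "(LINT \<zeta>:Bx x|M. k) = of_real (wt x) * k"
    using emeasure_ball[of "snd x" "rad (fst x)"]
    by (simp add: Bx_ball vol_def set_lebesgue_integral_def scaleR_conv_of_real)
  then show ?thesis using wt_pos[of x] by (simp add: Pavg_eq)
qed

lemma Pavg_sum: "(\<And>i. i \<in> A \<Longrightarrow> loc_int M (f i)) \<Longrightarrow> Pavg M (\<lambda>\<zeta>. \<Sum>i\<in>A. f i \<zeta>) x = (\<Sum>i\<in>A. Pavg M (f i) x)"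
  by (induction A rule: infinite_finite_induct) (auto simp: Pavg_add loc_int_sum Pavg_const)

lemma Pavg_cong_AE:
  assumes "f \<in> borel_measurable M" "g \<in> borel_measurable M" "AE \<zeta> in M. f \<zeta> = g \<zeta>"
  shows "Pavg M f x = Pavg M g x"
proof -
  have "(LINT \<zeta>:Bx x|M. f \<zeta>) = (LINT \<zeta>:Bx x|M. g \<zeta>)"
    unfolding set_lebesgue_integral_def using assms Bx_sets[of x] by (intro integral_cong_AE) auto
  then show ?thesis by (simp add: Pavg_def)
qed

lemma Pavg_norm_le:
  assumes f: "loc_int M f"
  shows "ennreal (cmod (Pavg M f x) * wt x) \<le> (\<integral>\<^sup>+\<zeta>\<in>Bx x. ennreal (cmod (f \<zeta>)) \<partial>M)"
proof -
  have "cmod (Pavg M f x) * wt x = cmod (LINT \<zeta>:Bx x|M. f \<zeta>)"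
    using wt_pos[of x] by (simp add: Pavg_eq norm_divide)
  also have "ennreal \<dots> \<le> (\<integral>\<^sup>+\<zeta>. ennreal (norm (indicator (Bx x) \<zeta> *\<^sub>R f \<zeta>)) \<partial>M)"
    unfolding set_lebesgue_integral_def using set_integrable_Bx[OF f, of x]
    by (intro integral_norm_bound_ennreal) (simp add: set_integrable_def)
  also have "\<dots> = (\<integral>\<^sup>+\<zeta>\<in>Bx x. ennreal (cmod (f \<zeta>)) \<partial>M)" by (intro nn_integral_cong) (auto simp: indicator_def)
  finally show ?thesis .
qed

lemma Pavg_norm_bound:
  assumes f: "loc_int M f" and B: "\<And>\<zeta>. \<zeta> \<in> Bx x \<Longrightarrow> cmod (f \<zeta>) \<le> B" "0 \<le> B"
  shows "cmod (Pavg M f x) \<le> B"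
proof -
  have "ennreal (cmod (Pavg M f x) * wt x) \<le> (\<integral>\<^sup>+\<zeta>\<in>Bx x. ennreal (cmod (f \<zeta>)) \<partial>M)" by (rule Pavg_norm_le[OF f])
  also have "\<dots> \<le> (\<integral>\<^sup>+\<zeta>\<in>Bx x. ennreal B \<partial>M)" using B by (intro nn_integral_mono) (auto simp: indicator_def ennreal_leI)
  also have "\<dots> = ennreal (B * wt x)"
    using B emeasure_ball[of "snd x" "rad (fst x)"] by (simp add: nn_integral_cmult_indicator Bx_ball ennreal_mult vol_nonneg)
  finally show ?thesis using B wt_pos[of x] by (simp add: ennreal_le_iff mult_nonneg_nonneg less_imp_le)
qed

text \<open>A quasi-interpolation operator: averages of level \<open>n\<close> are glued by the
  partition of unity of that level. It approximates \<open>f\<close> at fine levels and flattens it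
  at coarse ones.\<close>

definition Tn :: "int \<Rightarrow> ('z \<Rightarrow> complex) \<Rightarrow> 'z \<Rightarrow> complex" where
  "Tn n f \<zeta> = (\<Sum>\<xi>\<in>act n \<zeta>. Pavg M f (n, \<xi>) * of_real (psi (n, \<xi>) \<zeta>))"

text \<open>Replaces the index set \<open>act n \<zeta>\<close>, which moves with \<zeta>, by a
  finite set common to a whole ball, so that integrals can pass through the sum.\<close>

lemma sum_act:
  fixes h :: "'z \<Rightarrow> complex"
  assumes "\<zeta> \<in> ball z R"
  shows "(\<Sum>\<xi>\<in>act n \<zeta>. h \<xi> * of_real (psi (n, \<xi>) \<zeta>)) = (\<Sum>\<xi>\<in>{\<xi>\<in>Xs n. dist z \<xi> < R + rad n}. h \<xi> * of_real (psi (n, \<xi>) \<zeta>))"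
proof (rule sum.mono_neutral_left)
  show "finite {\<xi>\<in>Xs n. dist z \<xi> < R + rad n}" by (rule finite_near_Xs)
  show "act n \<zeta> \<subseteq> {\<xi>\<in>Xs n. dist z \<xi> < R + rad n}"
  proof
    fix \<xi> assume "\<xi> \<in> act n \<zeta>"
    then show "\<xi> \<in> {\<xi>\<in>Xs n. dist z \<xi> < R + rad n}"
      using assms dist_triangle[of z \<xi> \<zeta>] by (auto simp: act_eq)
  qed
  show "\<forall>\<xi>\<in>{\<xi>\<in>Xs n. dist z \<xi> < R + rad n} - act n \<zeta>. h \<xi> * of_real (psi (n, \<xi>) \<zeta>) = 0"
    by (auto simp: act_def psi_outside)
qed

lemma Tn_local: "\<zeta> \<in> ball z R \<Longrightarrow> Tn n f \<zeta> = (\<Sum>\<xi>\<in>{\<xi>\<in>Xs n. dist z \<xi> < R + rad n}. Pavg M f (n, \<xi>) * of_real (psi (n, \<xi>) \<zeta>))"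
  unfolding Tn_def by (rule sum_act)

lemma vertexI: "\<xi> \<in> Xs n \<Longrightarrow> (n, \<xi>) \<in> vertices Xs" by (simp add: vertices_def)

lemma Tn_measurable: "Tn n f \<in> borel_measurable M"
proof -
  fix z :: 'z
  let ?s = "\<lambda>k::nat. \<lambda>\<zeta>. (\<Sum>\<xi>\<in>{\<xi>\<in>Xs n. dist z \<xi> < real k + rad n}. Pavg M f (n, \<xi>) * of_real (psi (n, \<xi>) \<zeta>))"
  show ?thesis
  proof (rule borel_measurable_LIMSEQ_metric)
    show "?s k \<in> borel_measurable M" for k
    proof (intro borel_measurable_sum borel_measurable_times borel_measurable_const)
      fix \<xi> assume "\<xi> \<in> {\<xi>\<in>Xs n. dist z \<xi> < real k + rad n}"
      then have [measurable]: "psi (n, \<xi>) \<in> borel_measurable M" by (intro psi_measurable vertexI) auto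
      show "(\<lambda>\<zeta>. complex_of_real (psi (n, \<xi>) \<zeta>)) \<in> borel_measurable M" by measurable
    qed
    show "(\<lambda>k. ?s k \<zeta>) \<longlonglongrightarrow> Tn n f \<zeta>" if "\<zeta> \<in> space M" for \<zeta>
    proof (rule tendsto_eventually)
      show "\<forall>\<^sub>F k in sequentially. ?s k \<zeta> = Tn n f \<zeta>"
      proof (rule eventually_sequentiallyI)
        fix k assume "k \<ge> nat \<lceil>dist z \<zeta> + 1\<rceil>"
        then have "\<zeta> \<in> ball z (real k)" by (simp add: mem_ball) linarith
        then show "?s k \<zeta> = Tn n f \<zeta>" using Tn_local by simp
      qed
    qed
  qed
qed

lemma Tn_diff: "loc_int M f \<Longrightarrow> loc_int M g \<Longrightarrow> Tn n (\<lambda>\<zeta>. f \<zeta> - g \<zeta>) \<zeta> = Tn n f \<zeta> - Tn n g \<zeta>"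
  by (simp add: Tn_def Pavg_diff sum_subtractf[symmetric] left_diff_distrib)

lemma nn_integral_psi_le: "v \<in> vertices Xs \<Longrightarrow> (\<integral>\<^sup>+\<zeta>. ennreal (psi v \<zeta>) \<partial>M) \<le> ennreal (wt v)"
proof -
  assume v: "v \<in> vertices Xs"
  have "(\<integral>\<^sup>+\<zeta>. ennreal (psi v \<zeta>) \<partial>M) \<le> (\<integral>\<^sup>+\<zeta>. indicator (Bx v) \<zeta> \<partial>M)"
    using psi_le_1[OF v] psi_outside[of _ v] by (intro nn_integral_mono) (auto simp: indicator_def ennreal_le_1)
  also have "\<dots> = ennreal (wt v)" using emeasure_ball by (simp add: Bx_ball)
  finally show ?thesis .
qed

text \<open>An average times its bump has integral at most that of \<open>cmod (f \<zeta>)\<close>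
  over the ball, and the balls overlap at most \<open>Nc 1\<close> times. For
  \<open>n \<ge> 0\<close> the radii are at most 1, whence the enlargement by 2. What matters is
  uniformity in \<open>n\<close>.\<close>

lemma nn_integral_Tn_le:
  assumes f: "loc_int M f" and n: "0 \<le> n"
  shows "(\<integral>\<^sup>+\<zeta>\<in>ball z R. ennreal (cmod (Tn n f \<zeta>)) \<partial>M) \<le> of_nat (Nc 1) * (\<integral>\<^sup>+\<zeta>\<in>ball z (R + 2). ennreal (cmod (f \<zeta>)) \<partial>M)"
proof -
  let ?F = "{\<xi>\<in>Xs n. dist z \<xi> < R + rad n}"
  have fF: "finite ?F" by (rule finite_near_Xs)
  have rn: "rad n \<le> 1" using rad_mono[OF n] by simp
  have m: "(\<lambda>\<zeta>. ennreal (cmod (f \<zeta>))) \<in> borel_measurable M" using loc_int_measurable[OF f] by auto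
  have "(\<integral>\<^sup>+\<zeta>\<in>ball z R. ennreal (cmod (Tn n f \<zeta>)) \<partial>M) \<le> (\<integral>\<^sup>+\<zeta>. (\<Sum>\<xi>\<in>?F. ennreal (cmod (Pavg M f (n, \<xi>))) * ennreal (psi (n, \<xi>) \<zeta>)) \<partial>M)"
  proof (rule nn_integral_mono)
    fix \<zeta>
    show "ennreal (cmod (Tn n f \<zeta>)) * indicator (ball z R) \<zeta> \<le> (\<Sum>\<xi>\<in>?F. ennreal (cmod (Pavg M f (n, \<xi>))) * ennreal (psi (n, \<xi>) \<zeta>))"
    proof (cases "\<zeta> \<in> ball z R")
      case True
      have "cmod (Tn n f \<zeta>) \<le> (\<Sum>\<xi>\<in>?F. cmod (Pavg M f (n, \<xi>)) * psi (n, \<xi>) \<zeta>)"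
        unfolding Tn_local[OF True] by (rule order_trans[OF norm_sum]) (auto simp: norm_mult psi_nonneg)
      then have "ennreal (cmod (Tn n f \<zeta>)) \<le> ennreal (\<Sum>\<xi>\<in>?F. cmod (Pavg M f (n, \<xi>)) * psi (n, \<xi>) \<zeta>)" by (rule ennreal_leI)
      also have "\<dots> = (\<Sum>\<xi>\<in>?F. ennreal (cmod (Pavg M f (n, \<xi>))) * ennreal (psi (n, \<xi>) \<zeta>))"
        by (subst sum_ennreal[symmetric]) (auto simp: psi_nonneg ennreal_mult)
      finally show ?thesis using True by simp
    qed simp
  qed
  also have "\<dots> = (\<Sum>\<xi>\<in>?F. ennreal (cmod (Pavg M f (n, \<xi>))) * (\<integral>\<^sup>+\<zeta>. ennreal (psi (n, \<xi>) \<zeta>) \<partial>M))"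
    using psi_measurable[OF vertexI] by (subst nn_integral_sum) (auto simp: nn_integral_cmult)
  also have "\<dots> \<le> (\<Sum>\<xi>\<in>?F. ennreal (cmod (Pavg M f (n, \<xi>))) * ennreal (wt (n, \<xi>)))"
    using nn_integral_psi_le[OF vertexI] by (intro sum_mono mult_left_mono) auto
  also have "\<dots> \<le> (\<Sum>\<xi>\<in>?F. (\<integral>\<^sup>+\<zeta>. ennreal (cmod (f \<zeta>)) * indicator (Bx (n, \<xi>)) \<zeta> \<partial>M))"
    using Pavg_norm_le[OF f, of "(n, _)"] by (intro sum_mono) (simp add: ennreal_mult'' vol_nonneg)
  also have "\<dots> = (\<integral>\<^sup>+\<zeta>. (\<Sum>\<xi>\<in>?F. ennreal (cmod (f \<zeta>)) * indicator (Bx (n, \<xi>)) \<zeta>) \<partial>M)"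
    by (intro nn_integral_sum[symmetric] borel_measurable_times_ennreal m borel_measurable_indicator Bx_sets)
  also have "\<dots> \<le> (\<integral>\<^sup>+\<zeta>. of_nat (Nc 1) * (ennreal (cmod (f \<zeta>)) * indicator (ball z (R + 2)) \<zeta>) \<partial>M)"
  proof (rule nn_integral_mono)
    fix \<zeta>
    have "(\<Sum>\<xi>\<in>?F. ennreal (cmod (f \<zeta>)) * indicator (Bx (n, \<xi>)) \<zeta>) = (\<Sum>\<xi>\<in>{\<xi>\<in>?F. \<zeta> \<in> Bx (n, \<xi>)}. ennreal (cmod (f \<zeta>)))"
      using fF by (intro sum.mono_neutral_cong_right) (auto simp: indicator_def)
    also have "\<dots> = of_nat (card {\<xi>\<in>?F. \<zeta> \<in> Bx (n, \<xi>)}) * ennreal (cmod (f \<zeta>))" by simp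
    also have "\<dots> \<le> of_nat (Nc 1) * (ennreal (cmod (f \<zeta>)) * indicator (ball z (R + 2)) \<zeta>)"
    proof (cases "{\<xi>\<in>?F. \<zeta> \<in> Bx (n, \<xi>)} = {}")
      case True
      then show ?thesis by (simp only: card.empty) simp
    next
      case False
      then obtain \<xi> where x: "dist z \<xi> < R + rad n" "dist \<xi> \<zeta> < rad n" by (auto simp: Bx_ball)
      then have "\<zeta> \<in> ball z (R + 2)" using dist_triangle[of z \<zeta> \<xi>] rn by simp
      moreover have "{\<xi>\<in>?F. \<zeta> \<in> Bx (n, \<xi>)} \<subseteq> act n \<zeta>" unfolding act_def by auto
      then have "card {\<xi>\<in>?F. \<zeta> \<in> Bx (n, \<xi>)} \<le> card (act n \<zeta>)" by (rule card_mono[OF finite_act])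
      then have "card {\<xi>\<in>?F. \<zeta> \<in> Bx (n, \<xi>)} \<le> Nc 1" by (rule order_trans[OF _ card_act])
      ultimately show ?thesis by (auto intro!: mult_right_mono simp: of_nat_mono)
    qed
    finally show "(\<Sum>\<xi>\<in>?F. ennreal (cmod (f \<zeta>)) * indicator (Bx (n, \<xi>)) \<zeta>) \<le> of_nat (Nc 1) * (ennreal (cmod (f \<zeta>)) * indicator (ball z (R + 2)) \<zeta>)" .
  qed
  also have "\<dots> = of_nat (Nc 1) * (\<integral>\<^sup>+\<zeta>\<in>ball z (R + 2). ennreal (cmod (f \<zeta>)) \<partial>M)"
    by (intro nn_integral_cmult borel_measurable_times_ennreal m borel_measurable_indicator ball_sets)
  finally show ?thesis .
qed

text \<open>The bumps sum to 1, so the error is a convex combination of the differences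
  \<open>Pavg M g (n, \<xi>) - g \<zeta>\<close>, each over a ball whose points are within
  \<open>2 * rad n\<close> of \<zeta>.\<close>

lemma Tn_lipschitz_error:
  assumes lip: "\<And>x y. cmod (g x - g y) \<le> L * dist x y" and L: "0 \<le> L"
  shows "cmod (Tn n g \<zeta> - g \<zeta>) \<le> L * (2 * rad n)"
proof -
  have g: "loc_int M g" by (rule loc_int_lipschitz[OF lip])
  have s1: "(\<Sum>\<xi>\<in>act n \<zeta>. complex_of_real (psi (n, \<xi>) \<zeta>)) = 1"
    using sum_psi[of n \<zeta>] by (simp add: of_real_sum[symmetric] del: of_real_sum)
  have "Tn n g \<zeta> - g \<zeta> = (\<Sum>\<xi>\<in>act n \<zeta>. (Pavg M g (n, \<xi>) - g \<zeta>) * of_real (psi (n, \<xi>) \<zeta>))"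
    by (simp add: Tn_def left_diff_distrib sum_subtractf sum_distrib_left[symmetric] s1)
  also have "cmod \<dots> \<le> (\<Sum>\<xi>\<in>act n \<zeta>. L * (2 * rad n) * psi (n, \<xi>) \<zeta>)"
  proof (rule order_trans[OF norm_sum sum_mono])
    fix \<xi> assume x: "\<xi> \<in> act n \<zeta>"
    have "Pavg M g (n, \<xi>) - g \<zeta> = Pavg M (\<lambda>\<eta>. g \<eta> - g \<zeta>) (n, \<xi>)" by (simp add: Pavg_diff[OF g loc_int_const] Pavg_const)
    also have "cmod \<dots> \<le> L * (2 * rad n)"
    proof (rule Pavg_norm_bound)
      fix \<eta> assume "\<eta> \<in> Bx (n, \<xi>)"
      then have "dist \<eta> \<zeta> \<le> 2 * rad n" using x dist_triangle2[of \<eta> \<zeta> \<xi>] by (simp add: act_eq Bx_ball dist_commute)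
      then show "cmod (g \<eta> - g \<zeta>) \<le> L * (2 * rad n)" by (rule order_trans[OF lip mult_left_mono[OF _ L]])
    qed (use L g loc_int_diff loc_int_const in auto)
    finally show "cmod ((Pavg M g (n, \<xi>) - g \<zeta>) * of_real (psi (n, \<xi>) \<zeta>)) \<le> L * (2 * rad n) * psi (n, \<xi>) \<zeta>"
      by (simp add: norm_mult psi_nonneg mult_right_mono)
  qed
  also have "\<dots> = L * (2 * rad n)" by (simp add: sum_distrib_left[symmetric] sum_psi)
  finally show ?thesis .
qed


section \<open>Edges of the filling\<close>

definition V :: "int \<Rightarrow> (int \<times> 'z) set" where "V n = {x \<in> vertices Xs. fst x = n}"

text \<open>Edges are oriented and graded by their first vertex; every edge of the filling occurs in
  both orientations.\<close>

definition Ed :: "int \<Rightarrow> ((int \<times> 'z) \<times> (int \<times> 'z)) set" where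
  "Ed n = {(x, x'). x \<in> V n \<and> x' \<in> neighbors Xs x}"

definition EE :: "((int \<times> 'z) \<times> (int \<times> 'z)) set" where "EE = (\<Union>n. Ed n)"

abbreviation lev :: "(int \<times> 'z) \<times> (int \<times> 'z) \<Rightarrow> int" where "lev e \<equiv> fst (fst e)"

abbreviation we :: "(int \<times> 'z) \<times> (int \<times> 'z) \<Rightarrow> real" where "we e \<equiv> wt (fst e)"

lemma V_iff: "x \<in> V n \<longleftrightarrow> x \<in> vertices Xs \<and> fst x = n" by (simp add: V_def)

lemma V_eq: "V n = Pair n ` Xs n" by (auto simp: V_def vertices_def)

lemma Ed_lev: "e \<in> Ed n \<Longrightarrow> lev e = n" and Ed_fst: "e \<in> Ed n \<Longrightarrow> fst e \<in> V n"
  and Ed_snd: "e \<in> Ed n \<Longrightarrow> snd e \<in> neighbors Xs (fst e)"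
  by (auto simp: Ed_def V_def)

lemma EE_Ed: "e \<in> EE \<Longrightarrow> e \<in> Ed (lev e)"
  unfolding EE_def using Ed_lev by blast

lemma neighbors_rad:
  assumes "x' \<in> neighbors Xs x"
  shows "rad (fst x) \<le> 2 * rad (fst x')" "rad (fst x') \<le> 2 * rad (fst x)"
proof -
  have "\<bar>fst x - fst x'\<bar> \<le> 1" using assms by (simp add: neighbors_def)
  then have "rad (fst x) \<le> rad (fst x' - 1)" "rad (fst x') \<le> rad (fst x - 1)" by (auto intro!: rad_mono)
  then show "rad (fst x) \<le> 2 * rad (fst x')" "rad (fst x') \<le> 2 * rad (fst x)" by (simp_all only: rad_Suc)
qed

lemma neighbors_meet:
  assumes "x' \<in> neighbors Xs x"
  obtains \<zeta> where "\<zeta> \<in> Bx x" "\<zeta> \<in> Bx x'"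
  using assms by (auto simp: neighbors_def)

lemma neighbors_dist:
  assumes "x' \<in> neighbors Xs x"
  shows "dist (snd x) (snd x') < rad (fst x) + rad (fst x')"
proof -
  obtain \<zeta> where "\<zeta> \<in> Bx x" "\<zeta> \<in> Bx x'" by (rule neighbors_meet[OF assms])
  then show ?thesis using dist_triangle2[of "snd x" "snd x'" \<zeta>] by (simp add: Bx_ball)
qed

definition Nn :: nat where "Nn = 3 * Nc 3"

lemma neighbors_subset:
  "neighbors Xs x \<subseteq> (\<Union>k\<in>{fst x - 1, fst x, fst x + 1}. Pair k ` {\<xi>\<in>Xs k. dist (snd x) \<xi> < 3 * rad k})"
proof
  fix x' assume n: "x' \<in> neighbors Xs x"
  then have "\<bar>fst x - fst x'\<bar> \<le> 1" "x' \<in> vertices Xs" by (auto simp: neighbors_def)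
  then have "fst x' \<in> {fst x - 1, fst x, fst x + 1}" "snd x' \<in> Xs (fst x')" by (auto simp: vertices_def)
  moreover have "dist (snd x) (snd x') < 3 * rad (fst x')" using neighbors_dist[OF n] neighbors_rad(1)[OF n] by linarith
  ultimately show "x' \<in> (\<Union>k\<in>{fst x - 1, fst x, fst x + 1}. Pair k ` {\<xi>\<in>Xs k. dist (snd x) \<xi> < 3 * rad k})"
    by (intro UN_I[of "fst x'"] image_eqI[of _ _ "snd x'"]) auto
qed

lemma finite_neighbors: "finite (neighbors Xs x)"
  by (rule finite_subset[OF neighbors_subset]) (auto intro!: finite_near_Xs)

lemma card_neighbors: "card (neighbors Xs x) \<le> Nn"
proof -
  let ?A = "\<lambda>k. Pair k ` {\<xi>\<in>Xs k. dist (snd x) \<xi> < 3 * rad k}"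
  have "card (neighbors Xs x) \<le> card (\<Union>k\<in>{fst x - 1, fst x, fst x + 1}. ?A k)"
    by (rule card_mono[OF _ neighbors_subset]) (auto intro!: finite_near_Xs)
  also have "\<dots> \<le> (\<Sum>k\<in>{fst x - 1, fst x, fst x + 1}. card (?A k))" by (rule card_UN_le) auto
  also have "\<dots> \<le> (\<Sum>k\<in>{fst x - 1, fst x, fst x + 1}. Nc 3)"
    using near_Xs[of 3] by (intro sum_mono order_trans[OF card_image_le]) auto
  also have "\<dots> = Nn" by (simp add: Nn_def)
  finally show ?thesis .
qed

text \<open>Neighbouring centres are closer than \<open>3 * rad (fst x')\<close>, and
  \<open>rad (fst x) \<le> 2 * rad (fst x')\<close>; together this makes 5 radii.\<close>

definition Cw :: real where "Cw = C * 5 powr Q"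

lemma wt_neighbors:
  assumes "x' \<in> neighbors Xs x"
  shows "wt x \<le> Cw * wt x'"
proof -
  have "wt x \<le> C * ((5 * rad (fst x')) / rad (fst x')) powr Q * wt x'"
    using neighbors_dist[OF assms] neighbors_rad(1)[OF assms] by (intro vol_compare) auto
  then show ?thesis by (simp add: Cw_def)
qed

lemma Cw_pos: "0 < Cw" using C1 by (simp add: Cw_def)

text \<open>The factor 8 is generous: when the inequality fails, the ball of \<open>fst e\<close>,
  and hence the support of \<open>Psi e\<close>, meets neither \<open>Bx x\<close> nor the ball of
  any neighbour of \<open>x\<close>.\<close>

definition near :: "int \<times> 'z \<Rightarrow> (int \<times> 'z) \<times> (int \<times> 'z) \<Rightarrow> bool" where
  "near x e \<longleftrightarrow> dist (snd x) (snd (fst e)) < 8 * (rad (fst x) + rad (lev e))"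

definition NR :: "int \<times> 'z \<Rightarrow> int \<Rightarrow> ((int \<times> 'z) \<times> (int \<times> 'z)) set" where
  "NR x n = {e \<in> Ed n. near x e}"

lemma NR_eq: "NR x n = (SIGMA y:Pair n ` {\<xi>\<in>Xs n. dist (snd x) \<xi> < 8 * (rad (fst x) + rad n)}. neighbors Xs y)"
  by (auto simp: NR_def Ed_def near_def V_eq)

lemma finite_NR: "finite (NR x n)"
  unfolding NR_eq by (intro finite_SigmaI finite_imageI finite_near_Xs finite_neighbors)

lemma sum_NR_le:
  fixes h :: "int \<times> 'z \<Rightarrow> real"
  assumes h: "\<And>y. 0 \<le> h y"
  shows "(\<Sum>e\<in>NR x n. h (fst e)) \<le> real Nn * (\<Sum>\<xi>\<in>{\<xi>\<in>Xs n. dist (snd x) \<xi> < 8 * (rad (fst x) + rad n)}. h (n, \<xi>))"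
proof -
  let ?F = "{\<xi>\<in>Xs n. dist (snd x) \<xi> < 8 * (rad (fst x) + rad n)}"
  have "(\<Sum>e\<in>NR x n. h (fst e)) = (\<Sum>y\<in>Pair n ` ?F. \<Sum>y'\<in>neighbors Xs y. h y)"
    unfolding NR_eq by (subst sum.Sigma) (auto intro!: finite_near_Xs finite_neighbors simp: case_prod_unfold)
  also have "\<dots> = (\<Sum>\<xi>\<in>?F. real (card (neighbors Xs (n, \<xi>))) * h (n, \<xi>))"
    by (subst sum.reindex) (auto simp: inj_on_def)
  also have "\<dots> \<le> (\<Sum>\<xi>\<in>?F. real Nn * h (n, \<xi>))"
    using card_neighbors h by (intro sum_mono mult_right_mono) auto
  finally show ?thesis by (simp add: sum_distrib_left)
qed

text \<open>At levels coarser than \<open>x\<close> the region of nearness is comparable to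
  \<open>rad n\<close>, so the count does not depend on the level difference.\<close>

lemma card_NR:
  assumes "n \<le> fst x"
  shows "card (NR x n) \<le> Nn * Nc 16"
proof -
  have "real (card (NR x n)) = (\<Sum>e\<in>NR x n. 1)" by simp
  also have "\<dots> \<le> real Nn * (\<Sum>\<xi>\<in>{\<xi>\<in>Xs n. dist (snd x) \<xi> < 8 * (rad (fst x) + rad n)}. 1)"
    by (rule sum_NR_le) simp
  also have "\<dots> \<le> real Nn * real (Nc 16)"
  proof (intro mult_left_mono)
    have "{\<xi>\<in>Xs n. dist (snd x) \<xi> < 8 * (rad (fst x) + rad n)} \<subseteq> {\<xi>\<in>Xs n. dist (snd x) \<xi> < 16 * rad n}"
    proof safe
      fix \<xi> assume "dist (snd x) \<xi> < 8 * (rad (fst x) + rad n)"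
      then show "dist (snd x) \<xi> < 16 * rad n" using rad_mono[OF assms] by argo
    qed
    then have "card {\<xi>\<in>Xs n. dist (snd x) \<xi> < 8 * (rad (fst x) + rad n)} \<le> card {\<xi>\<in>Xs n. dist (snd x) \<xi> < 16 * rad n}"
      by (rule card_mono[OF finite_near_Xs])
    also have "\<dots> \<le> Nc 16" by (rule near_Xs) simp
    finally show "(\<Sum>\<xi>\<in>{\<xi>\<in>Xs n. dist (snd x) \<xi> < 8 * (rad (fst x) + rad n)}. 1) \<le> real (Nc 16)" by simp
  qed simp
  finally have "real (card (NR x n)) \<le> real (Nn * Nc 16)" by simp
  then show ?thesis by (simp only: of_nat_le_iff)
qed

text \<open>Only edges going up one level contribute, so that \<open>\<Sum>ana f e * Psi e\<close> over the edges starting in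
  level \<open>n\<close> telescopes to \<open>Tn (n + 1) f - Tn n f\<close>.\<close>

definition Psi :: "(int \<times> 'z) \<times> (int \<times> 'z) \<Rightarrow> 'z \<Rightarrow> real" where
  "Psi e \<zeta> = (if fst (snd e) = lev e + 1 then psi (fst e) \<zeta> * psi (snd e) \<zeta> else 0)"

abbreviation cPsi :: "(int \<times> 'z) \<times> (int \<times> 'z) \<Rightarrow> 'z \<Rightarrow> complex" where "cPsi e \<zeta> \<equiv> of_real (Psi e \<zeta>)"

lemma EE_vertices: assumes "e \<in> EE" shows "fst e \<in> vertices Xs" "snd e \<in> vertices Xs" "snd e \<in> neighbors Xs (fst e)"
proof -
  have "e \<in> Ed (lev e)" by (rule EE_Ed[OF assms])
  then show "fst e \<in> vertices Xs" "snd e \<in> vertices Xs" "snd e \<in> neighbors Xs (fst e)"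
    using Ed_fst[OF \<open>e \<in> Ed (lev e)\<close>] Ed_snd[OF \<open>e \<in> Ed (lev e)\<close>] by (simp_all add: V_iff neighbors_def)
qed

lemma Psi_nonneg: "0 \<le> Psi e \<zeta>"
  by (simp add: Psi_def psi_nonneg)

lemma Psi_le: assumes "e \<in> EE" shows "Psi e \<zeta> \<le> psi (fst e) \<zeta>"
  using psi_le_1[OF EE_vertices(2)[OF assms], of \<zeta>] psi_nonneg[of "fst e" \<zeta>]
  by (simp add: Psi_def mult_left_le)

lemma Psi_outside: "\<zeta> \<notin> Bx (fst e) \<Longrightarrow> Psi e \<zeta> = 0"
  by (simp add: Psi_def psi_outside)

text \<open>Product rule. The finer vertex has half the radius and hence twice the Lipschitz
  constant, which gives the factor 1 + 2.\<close>

lemma Psi_lipschitz: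
  assumes e: "e \<in> EE"
  shows "\<bar>Psi e \<zeta> - Psi e \<eta>\<bar> \<le> 3 * Lc * (dist \<zeta> \<eta> / rad (lev e))"
proof (cases "fst (snd e) = lev e + 1")
  case True
  let ?d = "dist \<zeta> \<eta> / rad (lev e)"
  have "Psi e \<zeta> - Psi e \<eta> = (psi (fst e) \<zeta> - psi (fst e) \<eta>) * psi (snd e) \<zeta> + psi (fst e) \<eta> * (psi (snd e) \<zeta> - psi (snd e) \<eta>)"
    using True by (simp add: Psi_def algebra_simps)
  moreover have "\<bar>p * q + r * t\<bar> \<le> \<bar>p\<bar> * q + r * \<bar>t\<bar>" if "0 \<le> q" "0 \<le> r" for p q r t :: real
    using that by (intro order_trans[OF abs_triangle_ineq]) (simp add: abs_mult)
  ultimately have "\<bar>Psi e \<zeta> - Psi e \<eta>\<bar> \<le> \<bar>psi (fst e) \<zeta> - psi (fst e) \<eta>\<bar> * psi (snd e) \<zeta> + psi (fst e) \<eta> * \<bar>psi (snd e) \<zeta> - psi (snd e) \<eta>\<bar>"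
    by (simp only: psi_nonneg)
  also have "\<dots> \<le> (Lc * ?d) * 1 + 1 * (Lc * (dist \<zeta> \<eta> / rad (fst (snd e))))"
    using psi_lipschitz[OF EE_vertices(1)[OF e], of \<zeta> \<eta>] psi_lipschitz[OF EE_vertices(2)[OF e], of \<zeta> \<eta>]
      psi_le_1[OF EE_vertices(1)[OF e], of \<eta>] psi_le_1[OF EE_vertices(2)[OF e], of \<zeta>] psi_nonneg Lc_ge
    by (intro add_mono mult_mono) auto
  also have "dist \<zeta> \<eta> / rad (fst (snd e)) = 2 * ?d" unfolding True rad_Suc by simp
  finally show ?thesis by (simp add: algebra_simps)
next
  case False
  then show ?thesis using Lc_ge by (simp add: Psi_def)
qed

lemma cPsi_loc_int: "e \<in> EE \<Longrightarrow> loc_int M (cPsi e)"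
  by (rule loc_int_lipschitz[of _ "3 * Lc / rad (lev e)"])
    (use Psi_lipschitz[of e] in \<open>simp add: of_real_diff[symmetric] del: of_real_diff\<close>)

lemma nn_integral_Psi_le:
  assumes "e \<in> EE"
  shows "(\<integral>\<^sup>+\<zeta>. ennreal (Psi e \<zeta>) \<partial>M) \<le> ennreal (we e)"
proof -
  have "(\<integral>\<^sup>+\<zeta>. ennreal (Psi e \<zeta>) \<partial>M) \<le> (\<integral>\<^sup>+\<zeta>. ennreal (psi (fst e) \<zeta>) \<partial>M)"
    using Psi_le[OF assms] by (intro nn_integral_mono ennreal_leI)
  also have "\<dots> \<le> ennreal (we e)" by (rule nn_integral_psi_le[OF EE_vertices(1)[OF assms]])
  finally show ?thesis .
qed

lemma Pavg_Psi_le: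
  assumes e: "e \<in> EE"
  shows "cmod (Pavg M (cPsi e) x) \<le> we e / wt x"
proof -
  have "ennreal (cmod (Pavg M (cPsi e) x) * wt x) \<le> (\<integral>\<^sup>+\<zeta>\<in>Bx x. ennreal (cmod (cPsi e \<zeta>)) \<partial>M)"
    by (rule Pavg_norm_le[OF cPsi_loc_int[OF e]])
  also have "\<dots> \<le> (\<integral>\<^sup>+\<zeta>. ennreal (Psi e \<zeta>) \<partial>M)"
    by (intro nn_integral_mono) (auto simp: indicator_def Psi_nonneg)
  also have "\<dots> \<le> ennreal (we e)" by (rule nn_integral_Psi_le[OF e])
  finally have "cmod (Pavg M (cPsi e) x) * wt x \<le> we e" by (simp add: ennreal_le_iff vol_nonneg)
  then show ?thesis using wt_pos[of x] by (simp add: field_simps)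
qed

text \<open>Bounds the influence of the edge \<open>e\<close> on the differences of averages at \<open>x\<close>: for edges coarser than \<open>x\<close>
  by the Lipschitz constant of \<open>Psi e\<close>, for finer ones by its integral.\<close>

definition ker :: "int \<times> 'z \<Rightarrow> (int \<times> 'z) \<times> (int \<times> 'z) \<Rightarrow> real" where
  "ker x e = (if near x e then if lev e \<le> fst x then rad (fst x) / rad (lev e) else we e / wt x else 0)"

lemma ker_nonneg: "0 \<le> ker x e"
  using wt_pos[of x] wt_pos[of "fst e"] by (simp add: ker_def)

lemma not_near_Psi:
  assumes nn: "\<not> near x e" and x': "dist (snd x) (snd x') \<le> 3 * rad (fst x)" "rad (fst x') \<le> 2 * rad (fst x)" and z: "\<zeta> \<in> Bx x'"
  shows "Psi e \<zeta> = 0"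
proof (rule Psi_outside, rule notI)
  assume z2: "\<zeta> \<in> Bx (fst e)"
  have "dist (snd x) (snd (fst e)) \<le> dist (snd x) (snd x') + (dist (snd x') \<zeta> + dist (snd (fst e)) \<zeta>)"
    using dist_triangle[of "snd x" "snd (fst e)" "snd x'"] dist_triangle2[of "snd x'" "snd (fst e)" \<zeta>] by linarith
  also have "\<dots> < 8 * (rad (fst x) + rad (lev e))"
  proof -
    have "dist (snd x') \<zeta> < rad (fst x')" "dist (snd (fst e)) \<zeta> < rad (lev e)" using z z2 by (simp_all add: Bx_ball)
    moreover have "0 < rad (fst x)" "0 < rad (lev e)" by simp_all
    moreover have "a + (b + c) < 8 * (r + t)" if "b < r'" "c < t" "0 < r" "0 < t" "a \<le> 3 * r" "r' \<le> 2 * r" for a b c r r' t :: real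
      using that by auto
    ultimately show ?thesis using x' by blast
  qed
  finally show False using nn by (simp add: near_def)
qed

text \<open>Collects the two cases of \<open>Pavg_Psi_diff\<close>: \<open>24 * Lc\<close> for
  coarse edges and \<open>1 + Cw\<close> for fine ones.\<close>

definition Kc :: real where "Kc = 24 * Lc + 1 + Cw"

lemma Kc_pos: "0 < Kc" using Lc_ge Cw_pos by (simp add: Kc_def)

lemma Pavg_zero:
  assumes "\<And>\<zeta>. \<zeta> \<in> Bx x \<Longrightarrow> f \<zeta> = 0" "loc_int M f"
  shows "Pavg M f x = 0"
proof -
  have "cmod (Pavg M f x) \<le> 0" using assms(1) by (intro Pavg_norm_bound[OF assms(2)]) auto
  then show ?thesis by simp
qed

lemma Pavg_osc:
  assumes f: "loc_int M f" and B: "\<And>\<zeta>. \<zeta> \<in> Bx x \<Longrightarrow> cmod (f \<zeta> - c) \<le> B" "0 \<le> B"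
  shows "cmod (Pavg M f x - c) \<le> B"
proof -
  have "Pavg M f x - c = Pavg M (\<lambda>\<zeta>. f \<zeta> - c) x" by (simp add: Pavg_diff[OF f loc_int_const] Pavg_const)
  moreover have "loc_int M (\<lambda>\<zeta>. f \<zeta> - c)" by (intro loc_int_diff f loc_int_const)
  then have "cmod (Pavg M (\<lambda>\<zeta>. f \<zeta> - c) x) \<le> B" using B by (rule Pavg_norm_bound)
  ultimately show ?thesis by simp
qed

lemma Psi_osc:
  assumes e: "e \<in> EE" and d: "dist \<zeta> \<eta> \<le> t * rad n"
  shows "cmod (cPsi e \<zeta> - cPsi e \<eta>) \<le> 3 * Lc * t * (rad n / rad (lev e))"
proof -
  have "cmod (cPsi e \<zeta> - cPsi e \<eta>) = \<bar>Psi e \<zeta> - Psi e \<eta>\<bar>" by (simp add: of_real_diff[symmetric] del: of_real_diff)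
  also have "\<dots> \<le> 3 * Lc * (dist \<zeta> \<eta> / rad (lev e))" by (rule Psi_lipschitz[OF e])
  also have "\<dots> \<le> 3 * Lc * ((t * rad n) / rad (lev e))" using d Lc_ge by (intro mult_left_mono divide_right_mono) auto
  finally show ?thesis by simp
qed

lemma Pavg_Psi_diff:
  assumes e: "e \<in> EE" and x': "x' \<in> neighbors Xs x"
  shows "cmod (Pavg M (cPsi e) x' - Pavg M (cPsi e) x) \<le> Kc * ker x e"
proof (cases "near x e")
  case False
  have d: "dist (snd x) (snd x') \<le> 3 * rad (fst x)" using neighbors_dist[OF x'] neighbors_rad(2)[OF x'] by auto
  have "Pavg M (cPsi e) x' = 0"
  proof (rule Pavg_zero[OF _ cPsi_loc_int[OF e]])
    fix \<zeta> assume "\<zeta> \<in> Bx x'"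
    then have "Psi e \<zeta> = 0" by (rule not_near_Psi[OF False d neighbors_rad(2)[OF x']])
    then show "cPsi e \<zeta> = 0" by simp
  qed
  moreover have "Pavg M (cPsi e) x = 0"
  proof (rule Pavg_zero[OF _ cPsi_loc_int[OF e]])
    fix \<zeta> assume "\<zeta> \<in> Bx x"
    then have "Psi e \<zeta> = 0" by (rule not_near_Psi[OF False, rotated 2]) simp_all
    then show "cPsi e \<zeta> = 0" by simp
  qed
  ultimately show ?thesis using Kc_pos ker_nonneg[of x e] by simp
next
  case True
  show ?thesis
  proof (cases "lev e \<le> fst x")
    case le: True
    \<comment> \<open>Both averages are compared with the value at a common point of the two balls,
      at distance at most \<open>4 * rad (fst x)\<close> from every point of either; two
      oscillations of \<open>3 * Lc * 4\<close> make 24.\<close>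
    obtain \<zeta>0 where z0: "\<zeta>0 \<in> Bx x" "\<zeta>0 \<in> Bx x'" by (rule neighbors_meet[OF x'])
    let ?r = "rad (fst x) / rad (lev e)"
    have r0: "0 \<le> ?r" by simp
    have "cmod (Pavg M (cPsi e) x' - cPsi e \<zeta>0) \<le> 3 * Lc * 4 * ?r"
    proof (rule Pavg_osc[OF cPsi_loc_int[OF e]])
      fix \<zeta> assume "\<zeta> \<in> Bx x'"
      then have "dist \<zeta> \<zeta>0 \<le> 4 * rad (fst x)"
        using z0(2) dist_triangle3[of \<zeta> \<zeta>0 "snd x'"] neighbors_rad(2)[OF x'] by (simp add: Bx_ball)
      then show "cmod (cPsi e \<zeta> - cPsi e \<zeta>0) \<le> 3 * Lc * 4 * ?r" by (rule Psi_osc[OF e])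
    qed (use Lc_ge r0 in simp)
    moreover have "cmod (Pavg M (cPsi e) x - cPsi e \<zeta>0) \<le> 3 * Lc * 4 * ?r"
    proof (rule Pavg_osc[OF cPsi_loc_int[OF e]])
      fix \<zeta> assume "\<zeta> \<in> Bx x"
      then have "dist \<zeta> \<zeta>0 \<le> 4 * rad (fst x)"
      proof -
        assume "\<zeta> \<in> Bx x"
        then have "dist (snd x) \<zeta> < rad (fst x)" "dist (snd x) \<zeta>0 < rad (fst x)" using z0(1) by (simp_all add: Bx_ball)
        moreover have "0 < rad (fst x)" by simp
        ultimately show ?thesis using dist_triangle3[of \<zeta> \<zeta>0 "snd x"] by linarith
      qed
      then show "cmod (cPsi e \<zeta> - cPsi e \<zeta>0) \<le> 3 * Lc * 4 * ?r" by (rule Psi_osc[OF e])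
    qed (use Lc_ge r0 in simp)
    ultimately have "cmod (Pavg M (cPsi e) x' - Pavg M (cPsi e) x) \<le> 24 * Lc * ?r"
      using norm_triangle_ineq4[of "Pavg M (cPsi e) x' - cPsi e \<zeta>0" "Pavg M (cPsi e) x - cPsi e \<zeta>0"] by simp
    also have "\<dots> \<le> Kc * ?r" using Cw_pos r0 by (intro mult_right_mono) (auto simp: Kc_def)
    finally show ?thesis using True le by (simp add: ker_def)
  next
    case gt: False
    have "cmod (Pavg M (cPsi e) x' - Pavg M (cPsi e) x) \<le> we e / wt x' + we e / wt x"
      using norm_triangle_ineq4[of "Pavg M (cPsi e) x'" "Pavg M (cPsi e) x"] Pavg_Psi_le[OF e, of x'] Pavg_Psi_le[OF e, of x] by linarith
    also have "we e / wt x' \<le> Cw * (we e / wt x)"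
    proof -
      have "1 / wt x' \<le> Cw / wt x" using wt_neighbors[OF x'] wt_pos[of x] wt_pos[of x'] by (simp add: field_simps)
      then have "we e * (1 / wt x') \<le> we e * (Cw / wt x)" by (intro mult_left_mono vol_nonneg)
      then show ?thesis by (simp add: mult_ac)
    qed
    also have "Cw * (we e / wt x) + we e / wt x = (Cw + 1) * (we e / wt x)" by (simp only: distrib_right mult_1)
    also have "\<dots> \<le> Kc * (we e / wt x)" using Lc_ge wt_pos[of x] vol_nonneg by (intro mult_right_mono) (auto simp: Kc_def)
    finally show ?thesis using True gt by (simp add: ker_def)
  qed
qed

text \<open>An L1 analogue of the kernel bound for functions recentred by an average over a smaller
  ball. With \<open>x0\<close> the base vertex and \<open>x\<close> a huge ball around it, it yields
  absolute convergence of the synthesis.\<close>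

lemma nn_integral_Psi_const_le:
  assumes e: "e \<in> EE" and x0: "Bx x0 \<subseteq> Bx x"
  shows "(\<integral>\<^sup>+\<zeta>\<in>Bx x. ennreal (cmod (cPsi e \<zeta> - Pavg M (cPsi e) x0)) \<partial>M) \<le> ennreal ((6 * Lc + 1 + wt x / wt x0) * wt x * ker x e)"
    (is "_ \<le> ennreal (?K * wt x * _)")
proof -
  have K: "6 * Lc \<le> ?K" "1 + wt x / wt x0 \<le> ?K" "0 \<le> ?K"
    using wt_pos[of x] wt_pos[of x0] Lc_ge by (auto intro: add_nonneg_nonneg)
  have const: "(\<integral>\<^sup>+\<zeta>\<in>Bx x. ennreal B \<partial>M) = ennreal (B * wt x)" if "0 \<le> B" for B
    using that emeasure_ball[of "snd x" "rad (fst x)"] by (simp add: nn_integral_cmult_indicator Bx_ball ennreal_mult vol_nonneg)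
  show ?thesis
  proof (cases "near x e")
    case False
    have z: "Psi e \<zeta> = 0" if "\<zeta> \<in> Bx x" for \<zeta>
      using that by (rule not_near_Psi[OF False, rotated 2]) simp_all
    then have "Pavg M (cPsi e) x0 = 0" using x0 by (intro Pavg_zero cPsi_loc_int e) auto
    then have "(\<integral>\<^sup>+\<zeta>\<in>Bx x. ennreal (cmod (cPsi e \<zeta> - Pavg M (cPsi e) x0)) \<partial>M) = (\<integral>\<^sup>+\<zeta>. 0 \<partial>M)"
      using z by (intro nn_integral_cong) (auto simp: indicator_def)
    then show ?thesis by simp
  next
    case True
    show ?thesis
    proof (cases "lev e \<le> fst x")
      case le: True
      let ?r = "rad (fst x) / rad (lev e)"
      have "cmod (cPsi e \<zeta> - Pavg M (cPsi e) x0) \<le> ?K * ?r" if z: "\<zeta> \<in> Bx x" for \<zeta>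
      proof -
        have "cmod (Pavg M (cPsi e) x0 - cPsi e \<zeta>) \<le> 3 * Lc * 2 * ?r"
        proof (rule Pavg_osc[OF cPsi_loc_int[OF e]])
          fix \<eta> assume "\<eta> \<in> Bx x0"
          then have "dist \<eta> \<zeta> \<le> 2 * rad (fst x)"
            using x0 z dist_triangle3[of \<eta> \<zeta> "snd x"] by (auto simp: Bx_ball)
          then show "cmod (cPsi e \<eta> - cPsi e \<zeta>) \<le> 3 * Lc * 2 * ?r" by (rule Psi_osc[OF e])
        qed (use Lc_ge in simp)
        also have "\<dots> \<le> ?K * ?r" using K(1) by (intro mult_right_mono) auto
        finally show ?thesis by (simp add: norm_minus_commute)
      qed
      then have "(\<integral>\<^sup>+\<zeta>\<in>Bx x. ennreal (cmod (cPsi e \<zeta> - Pavg M (cPsi e) x0)) \<partial>M) \<le> (\<integral>\<^sup>+\<zeta>\<in>Bx x. ennreal (?K * ?r) \<partial>M)"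
        by (intro nn_integral_mono) (auto simp: indicator_def ennreal_leI)
      also have "\<dots> = ennreal (?K * ?r * wt x)" using K(3) by (intro const) simp
      finally show ?thesis using True le by (simp add: ker_def mult_ac)
    next
      case gt: False
      have [measurable]: "Psi e \<in> borel_measurable M"
        by (rule lipschitz_measurable[of _ "3 * Lc / rad (lev e)"]) (use Psi_lipschitz[OF e] in simp)
      have "(\<integral>\<^sup>+\<zeta>\<in>Bx x. ennreal (cmod (cPsi e \<zeta> - Pavg M (cPsi e) x0)) \<partial>M)
         \<le> (\<integral>\<^sup>+\<zeta>. ennreal (Psi e \<zeta>) + ennreal (we e / wt x0) * indicator (Bx x) \<zeta> \<partial>M)"
      proof (rule nn_integral_mono)
        fix \<zeta>
        have "cmod (cPsi e \<zeta> - Pavg M (cPsi e) x0) \<le> Psi e \<zeta> + we e / wt x0"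
          using norm_triangle_ineq4[of "cPsi e \<zeta>" "Pavg M (cPsi e) x0"] Pavg_Psi_le[OF e, of x0] by (simp add: Psi_nonneg)
        then have "ennreal (cmod (cPsi e \<zeta> - Pavg M (cPsi e) x0)) \<le> ennreal (Psi e \<zeta>) + ennreal (we e / wt x0)"
          using ennreal_plus[OF Psi_nonneg[of e \<zeta>], of "we e / wt x0"] divide_nonneg_nonneg[OF vol_nonneg vol_nonneg]
          by (metis ennreal_leI)
        then show "ennreal (cmod (cPsi e \<zeta> - Pavg M (cPsi e) x0)) * indicator (Bx x) \<zeta>
          \<le> ennreal (Psi e \<zeta>) + ennreal (we e / wt x0) * indicator (Bx x) \<zeta>" by (auto simp: indicator_def)
      qed
      also have "\<dots> = (\<integral>\<^sup>+\<zeta>. ennreal (Psi e \<zeta>) \<partial>M) + (\<integral>\<^sup>+\<zeta>\<in>Bx x. ennreal (we e / wt x0) \<partial>M)"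
        using Bx_sets[of x] by (intro nn_integral_add) auto
      also have "\<dots> \<le> ennreal (we e) + ennreal (we e / wt x0 * wt x)"
        using nn_integral_Psi_le[OF e] const[of "we e / wt x0"] wt_pos[of x0] vol_nonneg by (intro add_mono) auto
      also have "\<dots> = ennreal ((1 + wt x / wt x0) * we e)"
        using wt_pos[of x0] wt_pos[of x] vol_nonneg by (subst ennreal_plus[symmetric]) (auto simp: algebra_simps)
      also have "\<dots> \<le> ennreal (?K * we e)" using K(2) vol_nonneg by (intro ennreal_leI mult_right_mono)
      also have "?K * we e = ?K * wt x * ker x e" using True gt wt_pos[of x] by (simp add: ker_def)
      finally show ?thesis .
    qed
  qed
qed

text \<open>For Lipschitz functions the error is of order \<open>rad n\<close>; these are dense in
  L1 of a ball, and the operators are uniformly bounded there.\<close>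

lemma Tn_tendsto:
  assumes f: "loc_int M f"
  shows "(\<lambda>n::nat. \<integral>\<^sup>+\<zeta>\<in>ball z R. ennreal (cmod (Tn (int n) f \<zeta> - f \<zeta>)) \<partial>M) \<longlonglongrightarrow> 0"
proof -
  let ?B = "ball z (R + 2)"
  \<comment> \<open>The enlarged ball is made into a finite measure in order to use the density of
    Lipschitz functions.\<close>
  define N where "N = density M (\<lambda>x. ennreal (indicat_real ?B x))"
  have N: "finite_measure N" "sets N = sets borel"
  proof
    have "emeasure N (space N) = (\<integral>\<^sup>+x. ennreal (indicat_real ?B x) * indicator (space M) x \<partial>M)"
      unfolding N_def space_density by (intro emeasure_density) (auto intro!: borel_measurable_indicator ball_sets measurable_compose[OF borel_measurable_indicator measurable_ennreal])
    also have "\<dots> = (\<integral>\<^sup>+x. indicator ?B x \<partial>M)" by (intro nn_integral_cong) (auto simp: indicator_def)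
    also have "\<dots> = ennreal (vol z (R + 2))" using emeasure_ball ball_sets by (simp only: nn_integral_indicator)
    finally show "emeasure N (space N) \<noteq> \<infinity>" by simp
  qed (simp add: N_def)
  have ind: "(\<lambda>x. indicat_real ?B x) \<in> borel_measurable M" by (intro borel_measurable_indicator ball_sets)
  have fm: "f \<in> borel_measurable M" by (rule loc_int_measurable[OF f])
  have fN: "integrable N f"
    unfolding N_def using loc_int_ball[OF f, of z "R + 2"] ind fm
    by (subst integrable_density) (auto simp: set_integrable_def)
  have ap: "L1_lipschitz_approx N f" by (rule integrable_imp_L1_lipschitz_approx[OF N fN])
  \<comment> \<open>One unit accounts for \<open>f - g\<close> itself, \<open>Nc 1\<close> for its
    image under \<open>Tn\<close>.\<close>
  define q where "q = real (Nc 1) + 1"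
  have q: "q > 0" by (simp add: q_def)
  have key: "\<exists>n0. \<forall>n\<ge>n0. (\<integral>\<^sup>+\<zeta>\<in>ball z R. ennreal (cmod (Tn (int n) f \<zeta> - f \<zeta>)) \<partial>M) \<le> ennreal (2 * \<epsilon>)" if e: "\<epsilon> > 0" for \<epsilon>
  proof -
    obtain g L' where g: "\<forall>x y. cmod (g x - g y) \<le> L' * dist x y" "integrable N g" "(\<integral>x. cmod (f x - g x) \<partial>N) < \<epsilon> / q"
      using ap e q unfolding L1_lipschitz_approx_def by (meson divide_pos_pos)
    define L where "L = \<bar>L'\<bar>"
    have L: "0 \<le> L" by (simp add: L_def)
    have lip: "cmod (g x - g y) \<le> L * dist x y" for x y
      unfolding L_def by (rule order_trans[OF g(1)[rule_format] mult_right_mono[OF abs_ge_self zero_le_dist]])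
    have gl: "loc_int M g" by (rule loc_int_lipschitz[OF lip])
    have gm: "g \<in> borel_measurable M" by (rule loc_int_measurable[OF gl])
    have dm: "(\<lambda>x. ennreal (cmod (f x - g x))) \<in> borel_measurable M" using fm gm by measurable
    have "(\<integral>\<^sup>+x\<in>?B. ennreal (cmod (f x - g x)) \<partial>M) = (\<integral>\<^sup>+x. ennreal (cmod (f x - g x)) \<partial>N)"
      unfolding N_def using ind dm by (subst nn_integral_density) (auto intro!: nn_integral_cong simp: indicator_def)
    also have "\<dots> = ennreal (\<integral>x. cmod (f x - g x) \<partial>N)"
      using fN g(2) by (intro nn_integral_eq_integral) auto
    also have "\<dots> \<le> ennreal (\<epsilon> / q)" using g(3) by (intro ennreal_leI) simp
    finally have B: "(\<integral>\<^sup>+x\<in>?B. ennreal (cmod (f x - g x)) \<partial>M) \<le> ennreal (\<epsilon> / q)" .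
    have lim: "(\<lambda>n. L * (2 * rad (int n)) * vol z R) \<longlonglongrightarrow> L * (2 * 0) * vol z R"
    proof (intro tendsto_mult tendsto_const)
      have "(\<lambda>n. rad (int n)) = (\<lambda>n. (1/2) ^ n)" using rad_add(1)[of 0] by auto
      then show "(\<lambda>n. rad (int n)) \<longlonglongrightarrow> 0" by (simp only:) (rule LIMSEQ_power_zero, simp)
    qed
    then have "eventually (\<lambda>n. L * (2 * rad (int n)) * vol z R < \<epsilon>) sequentially"
      using order_tendstoD(2)[OF lim, of \<epsilon>] e by simp
    then obtain n0 where n0: "\<And>n. n \<ge> n0 \<Longrightarrow> L * (2 * rad (int n)) * vol z R < \<epsilon>" by (auto simp: eventually_sequentially)
    show ?thesis
    proof (intro exI[of _ n0] allI impI)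
      fix n assume n: "n \<ge> n0"
      let ?c = "L * (2 * rad (int n))"
      have c0: "0 \<le> ?c" using L by simp
      have Tm: "(\<lambda>\<zeta>. ennreal (cmod (Tn (int n) (\<lambda>\<zeta>. f \<zeta> - g \<zeta>) \<zeta>)) * indicator (ball z R) \<zeta>) \<in> borel_measurable M"
        by (intro borel_measurable_times_ennreal borel_measurable_indicator ball_sets measurable_compose[OF Tn_measurable]) auto
      have dm': "(\<lambda>\<zeta>. ennreal (cmod (f \<zeta> - g \<zeta>)) * indicator ?B \<zeta>) \<in> borel_measurable M"
        by (intro borel_measurable_times_ennreal borel_measurable_indicator ball_sets dm)
      have cm: "(\<lambda>\<zeta>. ennreal ?c * indicator (ball z R) \<zeta>) \<in> borel_measurable M"
        by (intro borel_measurable_times_ennreal borel_measurable_indicator ball_sets borel_measurable_const)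
      have "(\<integral>\<^sup>+\<zeta>\<in>ball z R. ennreal (cmod (Tn (int n) f \<zeta> - f \<zeta>)) \<partial>M)
        \<le> (\<integral>\<^sup>+\<zeta>. ennreal (cmod (Tn (int n) (\<lambda>\<zeta>. f \<zeta> - g \<zeta>) \<zeta>)) * indicator (ball z R) \<zeta>
             + (ennreal (cmod (f \<zeta> - g \<zeta>)) * indicator ?B \<zeta> + ennreal ?c * indicator (ball z R) \<zeta>) \<partial>M)"
      proof (rule nn_integral_mono)
        fix \<zeta>
        show "ennreal (cmod (Tn (int n) f \<zeta> - f \<zeta>)) * indicator (ball z R) \<zeta> \<le> ennreal (cmod (Tn (int n) (\<lambda>\<zeta>. f \<zeta> - g \<zeta>) \<zeta>)) * indicator (ball z R) \<zeta>
             + (ennreal (cmod (f \<zeta> - g \<zeta>)) * indicator ?B \<zeta> + ennreal ?c * indicator (ball z R) \<zeta>)"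
        proof (cases "\<zeta> \<in> ball z R")
          case True
          then have inB: "\<zeta> \<in> ?B" by simp
          have "Tn (int n) f \<zeta> - f \<zeta> = Tn (int n) (\<lambda>\<zeta>. f \<zeta> - g \<zeta>) \<zeta> - (f \<zeta> - g \<zeta>) + (Tn (int n) g \<zeta> - g \<zeta>)"
            by (simp add: Tn_diff[OF f gl])
          then have "cmod (Tn (int n) f \<zeta> - f \<zeta>) \<le> cmod (Tn (int n) (\<lambda>\<zeta>. f \<zeta> - g \<zeta>) \<zeta>) + cmod (f \<zeta> - g \<zeta>) + cmod (Tn (int n) g \<zeta> - g \<zeta>)"
            by (metis (no_types, lifting) add_right_mono norm_triangle_ineq norm_triangle_ineq4 order_trans)
          also have "\<dots> \<le> cmod (Tn (int n) (\<lambda>\<zeta>. f \<zeta> - g \<zeta>) \<zeta>) + (cmod (f \<zeta> - g \<zeta>) + ?c)"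
            using Tn_lipschitz_error[OF lip L, of "int n" \<zeta>] by simp
          finally have "ennreal (cmod (Tn (int n) f \<zeta> - f \<zeta>)) \<le> ennreal (cmod (Tn (int n) (\<lambda>\<zeta>. f \<zeta> - g \<zeta>) \<zeta>) + (cmod (f \<zeta> - g \<zeta>) + ?c))"
            by (rule ennreal_leI)
          also have "\<dots> = ennreal (cmod (Tn (int n) (\<lambda>\<zeta>. f \<zeta> - g \<zeta>) \<zeta>)) + (ennreal (cmod (f \<zeta> - g \<zeta>)) + ennreal ?c)"
            using c0 by (simp only: ennreal_plus norm_ge_zero add_nonneg_nonneg)
          finally show ?thesis using True inB by (simp only: indicator_simps mult_1_right)
        next
          case False
          then have "indicator (ball z R) \<zeta> = (0::ennreal)" by (rule indicator_simps(2))
          then show ?thesis by (simp only: mult_zero_right zero_le)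
        qed
      qed
      also have "\<dots> = (\<integral>\<^sup>+\<zeta>\<in>ball z R. ennreal (cmod (Tn (int n) (\<lambda>\<zeta>. f \<zeta> - g \<zeta>) \<zeta>)) \<partial>M)
          + ((\<integral>\<^sup>+x\<in>?B. ennreal (cmod (f x - g x)) \<partial>M) + (\<integral>\<^sup>+\<zeta>\<in>ball z R. ennreal ?c \<partial>M))"
        by (subst nn_integral_add[OF Tm borel_measurable_add[OF dm' cm]], subst nn_integral_add[OF dm' cm]) (rule refl)
      also have "\<dots> \<le> of_nat (Nc 1) * ennreal (\<epsilon> / q) + (ennreal (\<epsilon> / q) + ennreal \<epsilon>)"
      proof (intro add_mono)
        have "(\<integral>\<^sup>+\<zeta>\<in>ball z R. ennreal (cmod (Tn (int n) (\<lambda>\<zeta>. f \<zeta> - g \<zeta>) \<zeta>)) \<partial>M)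
           \<le> of_nat (Nc 1) * (\<integral>\<^sup>+x\<in>?B. ennreal (cmod (f x - g x)) \<partial>M)"
          by (rule nn_integral_Tn_le[OF loc_int_diff[OF f gl]]) simp
        also have "\<dots> \<le> of_nat (Nc 1) * ennreal (\<epsilon> / q)" using B by (intro mult_left_mono) auto
        finally show "(\<integral>\<^sup>+\<zeta>\<in>ball z R. ennreal (cmod (Tn (int n) (\<lambda>\<zeta>. f \<zeta> - g \<zeta>) \<zeta>)) \<partial>M) \<le> of_nat (Nc 1) * ennreal (\<epsilon> / q)" .
        have "(\<integral>\<^sup>+\<zeta>\<in>ball z R. ennreal ?c \<partial>M) = ennreal ?c * emeasure M (ball z R)" by (rule nn_integral_cmult_indicator[OF ball_sets])
        also have "\<dots> = ennreal (?c * vol z R)" unfolding emeasure_ball using c0 vol_nonneg by (simp only: ennreal_mult)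
        also have "\<dots> \<le> ennreal \<epsilon>" using n0[OF n] by (intro ennreal_leI) simp
        finally show "(\<integral>\<^sup>+\<zeta>\<in>ball z R. ennreal ?c \<partial>M) \<le> ennreal \<epsilon>" .
      qed (rule B)
      also have "\<dots> = ennreal (real (Nc 1) * (\<epsilon> / q) + (\<epsilon> / q + \<epsilon>))"
      proof -
        have p: "0 \<le> \<epsilon> / q" "0 \<le> \<epsilon>" "0 \<le> \<epsilon> / q + \<epsilon>" "0 \<le> real (Nc 1) * (\<epsilon> / q)" using e q by simp_all
        show ?thesis unfolding ennreal_of_nat_eq_real_of_nat ennreal_plus[OF p(1,2)] ennreal_plus[OF p(4,3)]
            ennreal_mult[OF of_nat_0_le_iff p(1)] by (rule refl)
      qed
      also have "real (Nc 1) * (\<epsilon> / q) + (\<epsilon> / q + \<epsilon>) = q * (\<epsilon> / q) + \<epsilon>" by (simp only: q_def distrib_right mult_1 add.assoc)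
      also have "\<dots> = 2 * \<epsilon>" using q by simp
      finally show "(\<integral>\<^sup>+\<zeta>\<in>ball z R. ennreal (cmod (Tn (int n) f \<zeta> - f \<zeta>)) \<partial>M) \<le> ennreal (2 * \<epsilon>)" .
    qed
  qed
  show ?thesis
  proof (rule order_tendstoI)
    fix y :: ennreal assume "0 < y"
    then obtain w where w: "0 < w" "w < y" using dense by blast
    then obtain w' where w': "w = ennreal w'" "0 \<le> w'" by (cases w) auto
    then have "0 < w' / 2" using w(1) by simp
    from key[OF this] obtain n0 where "\<forall>n\<ge>n0. (\<integral>\<^sup>+\<zeta>\<in>ball z R. ennreal (cmod (Tn (int n) f \<zeta> - f \<zeta>)) \<partial>M) \<le> ennreal (2 * (w' / 2))" by blast
    then have "\<forall>n\<ge>n0. (\<integral>\<^sup>+\<zeta>\<in>ball z R. ennreal (cmod (Tn (int n) f \<zeta> - f \<zeta>)) \<partial>M) < y"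
      using w w' by (auto intro: le_less_trans)
    then show "\<forall>\<^sub>F n in sequentially. (\<integral>\<^sup>+\<zeta>\<in>ball z R. ennreal (cmod (Tn (int n) f \<zeta> - f \<zeta>)) \<partial>M) < y"
      by (auto simp: eventually_sequentially)
  qed (simp add: not_less[symmetric])
qed


section \<open>The synthesis kernel on mixed sequence spaces\<close>

text \<open>The first factor comes from \<open>sum_vol_le\<close>, the second from shrinking the
  radius \<open>32 * rad m\<close> to \<open>rad m\<close>.\<close>

definition Dc :: real where "Dc = C * 4 powr Q * (C * 32 powr Q)"

lemma Dc_ge: "1 \<le> Dc"
proof -
  have p: "1 \<le> (4::real) powr Q" "1 \<le> (32::real) powr Q" using Q0 by (simp_all add: ge_one_powr_ge_zero)
  have "1 * 1 \<le> C * 4 powr Q" "1 * 1 \<le> C * 32 powr Q" using C1 by (intro mult_mono p; simp)+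
  then have "1 * 1 \<le> (C * 4 powr Q) * (C * 32 powr Q)" by (intro mult_mono) auto
  then show ?thesis by (simp add: Dc_def)
qed

lemma sum_vol_near_le:
  assumes "finite J" "J \<subseteq> Xs n" "n \<ge> m" "\<And>\<xi>. \<xi> \<in> J \<Longrightarrow> dist \<zeta> \<xi> < 16 * rad m"
  shows "(\<Sum>\<xi>\<in>J. vol \<xi> (rad n)) \<le> Dc * vol \<zeta> (rad m)"
proof -
  have r: "rad n \<le> rad m" "0 < rad m" using rad_mono[OF assms(3)] by simp_all
  have "(\<Sum>\<xi>\<in>J. vol \<xi> (rad n)) \<le> C * 4 powr Q * vol \<zeta> (2 * (16 * rad m))"
    by (rule sum_vol_le[OF assms(1,2) _ assms(4)]) (use r in linarith)
  also have "vol \<zeta> (2 * (16 * rad m)) \<le> C * ((2 * (16 * rad m)) / rad m) powr Q * vol \<zeta> (rad m)"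
    by (rule vol_scale) (use r in auto)
  also have "(2 * (16 * rad m)) / rad m = 32" using r by simp
  finally show ?thesis using C1 by (simp add: Dc_def mult_left_mono mult.assoc)
qed

lemma V_snd: "x \<in> V m \<Longrightarrow> snd x \<in> Xs m" and V_fst: "x \<in> V m \<Longrightarrow> fst x = m"
  by (auto simp: V_eq)

lemma inj_snd_V: "J \<subseteq> V m \<Longrightarrow> inj_on snd J"
  by (rule inj_onI) (auto simp: V_eq)

lemma NR_near: "e \<in> NR x n \<Longrightarrow> dist (snd (fst e)) (snd x) < 8 * (rad (fst x) + rad n)"
proof -
  assume e: "e \<in> NR x n"
  then have "e \<in> Ed n" by (simp add: NR_def)
  then have "lev e = n" by (rule Ed_lev)
  then show ?thesis using e by (simp add: NR_def near_def dist_commute)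
qed

lemma NR_Ed: "e \<in> NR x n \<Longrightarrow> e \<in> Ed n" by (simp add: NR_def)

text \<open>Boundedly many coarse edges lie near a vertex, and the fine vertices near one coarse
  edge have total volume at most \<open>Dc\<close> times its weight. The constant does not depend on
  \<open>m - n\<close>.\<close>

lemma bl_coarse:
  assumes a: "0 \<le> a" and n: "n \<le> m" and u: "bl a we (Ed n) u K" and c: "0 \<le> c"
  shows "bl a wt (V m) (\<lambda>x. c * (\<Sum>e\<in>NR x n. \<bar>u e\<bar>)) (c * real (Nn * Nc 16) * Dc powr a * K)"
proof (rule bl_transfer[OF a u])
  show "card (NR x n) \<le> Nn * Nc 16" if "x \<in> V m" for x using n V_fst[OF that] by (intro card_NR) simp
  fix J e assume J: "finite J" "J \<subseteq> V m" and e: "e \<in> Ed n"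
  let ?J = "{x\<in>J. e \<in> NR x n}"
  have "(\<Sum>x\<in>?J. wt x) = (\<Sum>\<xi>\<in>snd ` ?J. vol \<xi> (rad m))"
    by (subst sum.reindex) (use J inj_snd_V[of ?J m] V_fst in \<open>auto intro!: sum.cong\<close>)
  also have "\<dots> \<le> Dc * vol (snd (fst e)) (rad n)"
  proof (rule sum_vol_near_le[OF _ _ n])
    fix \<xi> assume "\<xi> \<in> snd ` ?J"
    then obtain x where x: "x \<in> J" "e \<in> NR x n" "\<xi> = snd x" by auto
    have "fst x = m" using x(1) J(2) V_fst by blast
    then have "dist (snd (fst e)) \<xi> < 8 * (rad m + rad n)" using NR_near[OF x(2)] x(3) by simp
    also have "\<dots> \<le> 16 * rad n" using rad_mono[OF n] by argo
    finally show "dist (snd (fst e)) \<xi> < 16 * rad n" .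
  qed (use J V_snd in auto)
  also have "\<dots> = Dc * we e" using Ed_lev[OF e] by simp
  finally show "(\<Sum>x\<in>?J. wt x) \<le> Dc * we e" .
qed (use c Dc_ge finite_NR NR_Ed in \<open>auto simp: vol_nonneg sum_nonneg abs_mult\<close>)

text \<open>Bounds the ratio of volumes of a ball of level \<open>m\<close> and a nearby ball of
  level \<open>m + j\<close>: distance of the centres plus radius is at most
  \<open>17 * rad m\<close>, and \<open>rad m\<close> is \<open>2 ^ j\<close> times the finer
  radius.\<close>

definition Lf :: "nat \<Rightarrow> real" where "Lf j = C * (17 * 2 ^ j) powr Q"

lemma Lf_ge: "1 \<le> Lf j"
proof -
  have "1 * 1 \<le> C * (17 * 2 ^ j) powr Q"
    using C1 Q0 by (intro mult_mono ge_one_powr_ge_zero) (auto intro: order_trans[OF _ mult_mono[of 1 17 1 "2 ^ j"]])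
  then show ?thesis by (simp add: Lf_def)
qed

text \<open>The number of fine edges near a vertex grows with \<open>j\<close>, but their total
  weight is bounded by that of the vertex. So this is an averaging estimate, whose loss for
  exponents below 1 is a power of the volume ratio \<open>Lf j\<close>.\<close>

lemma bl_fine:
  assumes a: "0 \<le> a" and u: "bl a we (Ed (m + int j)) u K"
  shows "bl a wt (V m) (\<lambda>x. \<Sum>e\<in>NR x (m + int j). \<bar>u e\<bar> * we e / wt x)
    ((real Nn * Dc + 1) * real (Suc (Nc 16)) powr a * Lf j powr max 0 (a - 1) * K)"
proof (rule bl_average[OF a u])
  let ?n = "m + int j"
  have r: "rad ?n \<le> rad m" by (rule rad_mono) simp
  show "NR x ?n \<subseteq> Ed ?n" "finite (NR x ?n)" for x by (rule subsetI, erule NR_Ed, rule finite_NR)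
  show "\<bar>\<Sum>e\<in>NR x ?n. \<bar>u e\<bar> * we e / wt x\<bar> \<le> (\<Sum>e\<in>NR x ?n. \<bar>u e\<bar> * we e / wt x)" for x
  proof -
    have "0 \<le> (\<Sum>e\<in>NR x ?n. \<bar>u e\<bar> * we e / wt x)"
      by (intro sum_nonneg divide_nonneg_nonneg mult_nonneg_nonneg vol_nonneg abs_ge_zero)
    then show ?thesis by (simp only: abs_of_nonneg order_refl)
  qed
  show "1 \<le> real Nn * Dc + 1" using Dc_ge by simp
  show "(\<Sum>e\<in>NR x ?n. we e) \<le> (real Nn * Dc + 1) * wt x" if x: "x \<in> V m" for x
  proof -
    let ?F = "{\<xi>\<in>Xs ?n. dist (snd x) \<xi> < 8 * (rad (fst x) + rad ?n)}"
    have "(\<Sum>e\<in>NR x ?n. we e) \<le> real Nn * (\<Sum>\<xi>\<in>?F. wt (?n, \<xi>))" by (rule sum_NR_le) (rule vol_nonneg)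
    also have "(\<Sum>\<xi>\<in>?F. wt (?n, \<xi>)) = (\<Sum>\<xi>\<in>?F. vol \<xi> (rad ?n))" by simp
    also have "\<dots> \<le> Dc * vol (snd x) (rad m)"
    proof (rule sum_vol_near_le)
      fix \<xi> assume "\<xi> \<in> ?F"
      then have "dist (snd x) \<xi> < 8 * (rad m + rad ?n)" using V_fst[OF x] by simp
      also have "\<dots> \<le> 16 * rad m" using r by argo
      finally show "dist (snd x) \<xi> < 16 * rad m" .
    qed (use finite_near_Xs in auto)
    also have "vol (snd x) (rad m) = wt x" using V_fst[OF x] by simp
    finally have "(\<Sum>e\<in>NR x ?n. we e) \<le> real Nn * (Dc * wt x)" by (simp add: mult_left_mono)
    also have "\<dots> \<le> (real Nn * Dc + 1) * wt x" using vol_nonneg by (simp add: distrib_right)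
    finally show ?thesis .
  qed
  fix J e assume J: "finite J" "J \<subseteq> V m" and e: "e \<in> Ed ?n"
  let ?J = "{x\<in>J. e \<in> NR x ?n}"
  have "card ?J = card (snd ` ?J)" by (rule card_image[symmetric], rule inj_snd_V[of _ m]) (use J in auto)
  also have "\<dots> \<le> card {\<xi>\<in>Xs m. dist (snd (fst e)) \<xi> < 16 * rad m}"
  proof (rule card_mono[OF finite_near_Xs], rule subsetI)
    fix \<xi> assume "\<xi> \<in> snd ` ?J"
    then obtain x where x: "x \<in> J" "e \<in> NR x ?n" "\<xi> = snd x" by auto
    have xm: "x \<in> V m" using x(1) J(2) by auto
    have "dist (snd (fst e)) \<xi> < 8 * (rad m + rad ?n)" using NR_near[OF x(2)] x(3) V_fst[OF xm] by simp
    also have "\<dots> \<le> 16 * rad m" using r by argo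
    finally show "\<xi> \<in> {\<xi>\<in>Xs m. dist (snd (fst e)) \<xi> < 16 * rad m}" using V_snd[OF xm] x(3) by simp
  qed
  also have "\<dots> \<le> Nc 16" by (rule near_Xs) simp
  finally show "card ?J \<le> Nc 16" .
next
  let ?n = "m + int j"
  show "wt x \<le> Lf j * we e" if x: "x \<in> V m" and e: "e \<in> NR x ?n" for x e
  proof -
    have xm: "fst x = m" by (rule V_fst[OF x])
    have le: "lev e = ?n" using NR_Ed[OF e] Ed_lev by blast
    have r: "rad ?n \<le> rad m" by (rule rad_mono) simp
    have "dist (snd x) (snd (fst e)) < 8 * (rad m + rad ?n)" using NR_near[OF e] xm by (simp add: dist_commute)
    then have d: "dist (snd x) (snd (fst e)) + rad m \<le> 17 * rad m" using r by argo
    have "wt x \<le> C * ((17 * rad m) / rad ?n) powr Q * vol (snd (fst e)) (rad ?n)"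
    proof -
      have "0 < rad ?n" "0 < rad m" by simp_all
      moreover from this r have "rad ?n \<le> 17 * rad m" by linarith
      ultimately show ?thesis unfolding xm using d by (intro vol_compare)
    qed
    also have "(17 * rad m) / rad ?n = 17 * 2 ^ j" unfolding rad_add(1) by (simp add: power_one_over)
    finally show ?thesis by (simp add: Lf_def le)
  qed
qed (use Lf_ge wt_pos in auto)

text \<open>The kernel is decomposed by the level difference \<open>j\<close>. For coarser edges the
  kernel gives \<open>2^(-j)\<close> and the shift of the smoothness weight costs
  \<open>2^(j*s)\<close>, so the ratio is \<open>t1\<close>; for finer edges the shift gains
  \<open>2^(-j*s)\<close> and averaging loses \<open>2^(j*Q*\<kappa>)\<close>, so the ratio is
  \<open>t2\<close>. Both ratios are below 1, and the pieces are added by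
  \<open>mixed_geometric_sum\<close>. Finite sets \<open>F\<close> express convergence of the sum
  over all edges.\<close>

lemma kernel_sum:
  assumes ab: "0 \<le> a" "0 \<le> b" and s: "0 < s" "s < 1" and as: "Q * (a - 1) < s"
  shows "\<exists>c>0. \<forall>u K. mixed Ed we a b s u K \<longrightarrow>
    (\<exists>v. mixed V wt a b s v (c * K) \<and> (\<forall>x\<in>vertices Xs. \<forall>F. finite F \<longrightarrow> F \<subseteq> EE \<longrightarrow> (\<Sum>e\<in>F. \<bar>u e\<bar> * ker x e) \<le> v x))"
proof -
  define \<kappa> where "\<kappa> = max 0 (a - 1)"
  define t1 :: real where "t1 = 2 powr (s - 1)"
  define t2 :: real where "t2 = 2 powr (Q * \<kappa> - s)"
  have t1: "0 < t1" "t1 < 1" using s by (auto simp: t1_def intro: powr_less_one)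
  have "Q * \<kappa> < s" using as s Q0 by (auto simp: \<kappa>_def max_def)
  then have t2: "0 < t2" "t2 < 1" by (auto simp: t2_def intro: powr_less_one)
  define c1 where "c1 = real (Nn * Nc 16) * Dc powr a"
  define c2 where "c2 = (real Nn * Dc + 1) * real (Suc (Nc 16)) powr a"
  have c10: "0 \<le> c1" by (simp add: c1_def)
  have c20: "0 \<le> c2" using Dc_ge by (simp add: c2_def)
  \<comment> \<open>Fine edges start at level difference 1 for \<open>j = 0\<close>: the extra step
    turns 17 into 34 in \<open>Lf (Suc j)\<close> and contributes
    \<open>2 powr (- s)\<close>.\<close>
  define c2' where "c2' = c2 * ((C * 34 powr Q) powr \<kappa> * 2 powr (- s))"
  have c2'0: "0 \<le> c2'" using c20 by (simp add: c2'_def)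
  obtain g1 where g1: "g1 > 0" "\<forall>I (w::int \<times> 'z \<Rightarrow> real) s v V K. (\<forall>n. \<forall>i\<in>I n. 0 < w i) \<longrightarrow> (\<forall>j n. bl a w (I n) (v j) (V j n)) \<longrightarrow>
       (\<forall>j. bl b (\<lambda>_. 1) UNIV (\<lambda>n. 2 powr (of_int n * s) * V j n) (t1 ^ j * K)) \<longrightarrow>
       (\<forall>n. \<forall>i\<in>I n. summable (\<lambda>j. \<bar>v j i\<bar>)) \<and> mixed I w a b s (\<lambda>i. \<Sum>j. \<bar>v j i\<bar>) (g1 * K)"
    using mixed_geometric_sum[OF ab t1] by (elim exE conjE) (rule that)
  obtain g2 where g2: "g2 > 0" "\<forall>I (w::int \<times> 'z \<Rightarrow> real) s v V K. (\<forall>n. \<forall>i\<in>I n. 0 < w i) \<longrightarrow> (\<forall>j n. bl a w (I n) (v j) (V j n)) \<longrightarrow>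
       (\<forall>j. bl b (\<lambda>_. 1) UNIV (\<lambda>n. 2 powr (of_int n * s) * V j n) (t2 ^ j * K)) \<longrightarrow>
       (\<forall>n. \<forall>i\<in>I n. summable (\<lambda>j. \<bar>v j i\<bar>)) \<and> mixed I w a b s (\<lambda>i. \<Sum>j. \<bar>v j i\<bar>) (g2 * K)"
    using mixed_geometric_sum[OF ab t2] by (elim exE conjE) (rule that)
  obtain g3 where g3: "g3 > 0" "\<forall>I (w::int \<times> 'z \<Rightarrow> real) s u v K L. (\<forall>n. \<forall>i\<in>I n. 0 < w i) \<longrightarrow> mixed I w a b s u K \<longrightarrow> mixed I w a b s v L \<longrightarrow>
       mixed I w a b s (\<lambda>i. \<bar>u i\<bar> + \<bar>v i\<bar>) (g3 * (K + L))"
    using mixed_add[OF ab] by (elim exE conjE) (rule that)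
  have Vpos: "\<forall>n. \<forall>x\<in>V n. 0 < wt x" using wt_pos by blast
  show ?thesis
  proof (intro exI[of _ "g3 * (g1 * c1 + g2 * c2') + 1"] conjI[of "0 < _"] allI impI)
    have nn: "0 \<le> g3 * (g1 * c1 + g2 * c2')" using g1 g2 g3 c10 c2'0 by simp
    then show "0 < g3 * (g1 * c1 + g2 * c2') + 1" by linarith
    fix u K assume u: "mixed Ed we a b s u K"
    obtain U where U: "\<And>n. bl a we (Ed n) u (U n)" "bl b (\<lambda>_. 1) UNIV (\<lambda>n. 2 powr (of_int n * s) * U n) K"
      using u by (auto simp: mixed_def)
    have K0: "0 \<le> K" by (rule mixed_nonneg[OF u])
    define v1 where "v1 j x = (1/2) ^ j * (\<Sum>e\<in>NR x (fst x - int j). \<bar>u e\<bar>)" for j x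
    \<comment> \<open>Starting at \<open>Suc j\<close> leaves the level of \<open>x\<close> itself
      to the coarse part, as in the case distinction of \<open>ker\<close>.\<close>
    define v2 where "v2 j x = (\<Sum>e\<in>NR x (fst x + int (Suc j)). \<bar>u e\<bar> * we e / wt x)" for j x
    define V1 where "V1 j m = (1/2) ^ j * real (Nn * Nc 16) * Dc powr a * U (m - int j)" for j m
    define V2 where "V2 j m = (real Nn * Dc + 1) * real (Suc (Nc 16)) powr a * Lf (Suc j) powr \<kappa> * U (m + int (Suc j))" for j m
    have v10: "0 \<le> v1 j x" for j x unfolding v1_def by (intro mult_nonneg_nonneg sum_nonneg) auto
    have v20: "0 \<le> v2 j x" for j x unfolding v2_def by (intro sum_nonneg divide_nonneg_nonneg mult_nonneg_nonneg vol_nonneg) auto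
    have B1: "bl a wt (V m) (v1 j) (V1 j m)" for j m
    proof -
      have "bl a wt (V m) (\<lambda>x. (1/2) ^ j * (\<Sum>e\<in>NR x (m - int j). \<bar>u e\<bar>)) (V1 j m)"
        unfolding V1_def by (rule bl_coarse[OF ab(1) _ U(1)]) auto
      then show ?thesis
        by (rule bl_mono) (use ab V_fst in \<open>auto simp: v1_def vol_nonneg\<close>)
    qed
    have B2: "bl a wt (V m) (v2 j) (V2 j m)" for j m
    proof -
      have "bl a wt (V m) (\<lambda>x. \<Sum>e\<in>NR x (m + int (Suc j)). \<bar>u e\<bar> * we e / wt x) (V2 j m)"
        unfolding V2_def \<kappa>_def by (rule bl_fine[OF ab(1) U(1)])
      then show ?thesis
        by (rule bl_mono) (use ab V_fst in \<open>auto simp: v2_def vol_nonneg\<close>)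
    qed
    have S1: "bl b (\<lambda>_. 1) UNIV (\<lambda>m. 2 powr (of_int m * s) * V1 j m) (t1 ^ j * (c1 * K))" for j
    proof -
      have "bl b (\<lambda>_. 1) UNIV (\<lambda>m. (t1 ^ j * c1) * (2 powr (of_int (m + - int j) * s) * U (m + - int j))) ((t1 ^ j * c1) * K)"
        using t1 c10 by (intro bl_scale bl_shift[OF U(2)]) simp
      moreover have "(t1 ^ j * c1) * (2 powr (of_int (m + - int j) * s) * U (m + - int j)) = 2 powr (of_int m * s) * V1 j m" for m
      proof -
        have "t1 ^ j = 2 powr ((s - 1) * real j)" by (simp add: t1_def powr_realpow[symmetric] powr_powr)
        moreover have "(1/2) ^ j = 2 powr (- real j)" by (simp add: powr_minus powr_realpow power_one_over inverse_eq_divide)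
        ultimately have "t1 ^ j * 2 powr (of_int (m + - int j) * s) = 2 powr (of_int m * s) * (1/2) ^ j"
          by (simp add: powr_add[symmetric] algebra_simps)
        then show ?thesis by (simp add: V1_def c1_def)
      qed
      ultimately show ?thesis by (simp only: mult.assoc)
    qed
    have S2: "bl b (\<lambda>_. 1) UNIV (\<lambda>m. 2 powr (of_int m * s) * V2 j m) (t2 ^ j * (c2' * K))" for j
    proof -
      have "bl b (\<lambda>_. 1) UNIV (\<lambda>m. (t2 ^ j * c2') * (2 powr (of_int (m + int (Suc j)) * s) * U (m + int (Suc j)))) ((t2 ^ j * c2') * K)"
        using t2 c2'0 by (intro bl_scale bl_shift[OF U(2)]) simp
      moreover have "(t2 ^ j * c2') * (2 powr (of_int (m + int (Suc j)) * s) * U (m + int (Suc j))) = 2 powr (of_int m * s) * V2 j m" for m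
      proof -
        have L: "Lf (Suc j) powr \<kappa> = (C * 34 powr Q) powr \<kappa> * 2 powr (Q * \<kappa> * real j)"
        proof -
          have "(17::real) * 2 ^ Suc j = 34 * 2 ^ j" by simp
          then have "Lf (Suc j) = C * (34 * 2 ^ j) powr Q" by (simp only: Lf_def)
          also have "\<dots> = (C * 34 powr Q) * (2 ^ j) powr Q" by (simp only: powr_mult mult.assoc)
          finally have "Lf (Suc j) powr \<kappa> = (C * 34 powr Q) powr \<kappa> * ((2 ^ j) powr Q) powr \<kappa>" by (simp only: powr_mult)
          also have "((2 ^ j) powr Q) powr \<kappa> = 2 powr (Q * \<kappa> * real j)" by (simp add: powr_realpow[symmetric] powr_powr mult_ac)
          finally show ?thesis .
        qed
        have t: "t2 ^ j = 2 powr ((Q * \<kappa> - s) * real j)" by (simp add: t2_def powr_realpow[symmetric] powr_powr)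
        have "t2 ^ j * 2 powr (- s) * 2 powr (of_int (m + int (Suc j)) * s) = 2 powr (of_int m * s) * 2 powr (Q * \<kappa> * real j)"
          unfolding t powr_add[symmetric] by (simp add: algebra_simps)
        then have "(t2 ^ j * 2 powr (- s) * 2 powr (of_int (m + int (Suc j)) * s)) * (c2 * (C * 34 powr Q) powr \<kappa> * U (m + int (Suc j)))
          = (2 powr (of_int m * s) * 2 powr (Q * \<kappa> * real j)) * (c2 * (C * 34 powr Q) powr \<kappa> * U (m + int (Suc j)))" by (simp only:)
        then show ?thesis unfolding V2_def L c2'_def c2_def by (simp only: mult_ac)
      qed
      ultimately show ?thesis by (simp only: mult.assoc)
    qed
    have R1: "(\<forall>n. \<forall>x\<in>V n. summable (\<lambda>j. \<bar>v1 j x\<bar>)) \<and> mixed V wt a b s (\<lambda>x. \<Sum>j. \<bar>v1 j x\<bar>) (g1 * (c1 * K))"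
      by (rule g1(2)[rule_format, OF _ B1 S1]) (rule wt_pos)
    have R2: "(\<forall>n. \<forall>x\<in>V n. summable (\<lambda>j. \<bar>v2 j x\<bar>)) \<and> mixed V wt a b s (\<lambda>x. \<Sum>j. \<bar>v2 j x\<bar>) (g2 * (c2' * K))"
      by (rule g2(2)[rule_format, OF _ B2 S2]) (rule wt_pos)
    define v where "v x = \<bar>\<Sum>j. \<bar>v1 j x\<bar>\<bar> + \<bar>\<Sum>j. \<bar>v2 j x\<bar>\<bar>" for x
    have "mixed V wt a b s v (g3 * (g1 * (c1 * K) + g2 * (c2' * K)))"
      unfolding v_def by (rule g3(2)[rule_format, OF _ conjunct2[OF R1] conjunct2[OF R2]]) (rule wt_pos)
    then have vm: "mixed V wt a b s v ((g3 * (g1 * c1 + g2 * c2') + 1) * K)"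
      by (rule mixed_mono) (use ab K0 vol_nonneg in \<open>auto simp: algebra_simps\<close>)
    have "(\<Sum>e\<in>F. \<bar>u e\<bar> * ker x e) \<le> v x" if x: "x \<in> vertices Xs" and F: "finite F" "F \<subseteq> EE" for x F
    proof -
      have xV: "x \<in> V (fst x)" using x by (simp add: V_iff)
      \<comment> \<open>A finite set of edges meets only levels at distance less than
        \<open>N\<close> from that of \<open>x\<close>, so partial sums up to \<open>N\<close> cover
        its contribution.\<close>
      define N where "N = Suc (Max (insert 0 ((\<lambda>e. nat \<bar>lev e - fst x\<bar>) ` F)))"
      have Nb: "nat \<bar>lev e - fst x\<bar> < N" if "e \<in> F" for e
        unfolding N_def less_Suc_eq_le using F that by (intro Max_ge) auto
      define G1 where "G1 = (\<Union>j\<in>{..<N}. NR x (fst x - int j))"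
      define G2 where "G2 = (\<Union>j\<in>{..<N}. NR x (fst x + int (Suc j)))"
      have levNR: "lev e = n" if "e \<in> NR x n" for e n using NR_Ed[OF that] by (rule Ed_lev)
      have disj: "NR x n \<inter> NR x n' = {}" if "n \<noteq> n'" for n n' using levNR that by blast
      have fG: "finite G1" "finite G2" by (auto simp: G1_def G2_def finite_NR)
      have G12: "G1 \<inter> G2 = {}"
      proof (rule equals0I)
        fix e assume "e \<in> G1 \<inter> G2"
        then obtain i j where ij: "e \<in> NR x (fst x - int i)" "e \<in> NR x (fst x + int (Suc j))" unfolding G1_def G2_def by blast
        show False using levNR[OF ij(1)] levNR[OF ij(2)] by linarith
      qed
      have "(\<Sum>e\<in>F. \<bar>u e\<bar> * ker x e) = (\<Sum>e\<in>{e\<in>F. near x e}. \<bar>u e\<bar> * ker x e)"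
        using F by (intro sum.mono_neutral_right) (auto simp: ker_def)
      also have "\<dots> \<le> (\<Sum>e\<in>G1 \<union> G2. \<bar>u e\<bar> * ker x e)"
      proof (rule sum_mono2)
        show "{e\<in>F. near x e} \<subseteq> G1 \<union> G2"
        proof
          fix e assume "e \<in> {e\<in>F. near x e}"
          then have e: "e \<in> F" "near x e" "e \<in> EE" using F by auto
          have eN: "e \<in> NR x (lev e)" using EE_Ed[OF e(3)] e(2) by (simp add: NR_def)
          show "e \<in> G1 \<union> G2"
          proof (cases "lev e \<le> fst x")
            case True
            define j where "j = nat (fst x - lev e)"
            have "lev e = fst x - int j" using True by (simp add: j_def)
            moreover have "j < N" using Nb[OF e(1)] True unfolding j_def by linarith
            ultimately show ?thesis using eN unfolding G1_def by auto
          next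
            case False
            define j where "j = nat (lev e - fst x - 1)"
            have "lev e = fst x + int (Suc j)" using False by (simp add: j_def)
            moreover have "j < N" using Nb[OF e(1)] False unfolding j_def by linarith
            ultimately show ?thesis using eN unfolding G2_def by auto
          qed
        qed
      qed (use fG ker_nonneg in auto)
      also have "\<dots> = (\<Sum>e\<in>G1. \<bar>u e\<bar> * ker x e) + (\<Sum>e\<in>G2. \<bar>u e\<bar> * ker x e)"
        by (rule sum.union_disjoint[OF fG G12])
      also have "(\<Sum>e\<in>G1. \<bar>u e\<bar> * ker x e) = (\<Sum>j<N. v1 j x)"
      proof -
        have "(\<Sum>e\<in>G1. \<bar>u e\<bar> * ker x e) = (\<Sum>j<N. \<Sum>e\<in>NR x (fst x - int j). \<bar>u e\<bar> * ker x e)"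
          unfolding G1_def by (rule sum.UNION_disjoint) (auto simp: finite_NR intro!: disj)
        also have "\<dots> = (\<Sum>j<N. v1 j x)"
        proof (rule sum.cong[OF refl])
          fix j
          have "ker x e = (1/2) ^ j" if e: "e \<in> NR x (fst x - int j)" for e
          proof -
            have "near x e" using e by (simp add: NR_def)
            moreover have "rad (fst x) / rad (fst x - int j) = (1/2) ^ j" unfolding rad_add(2) by (simp add: power_one_over)
            ultimately show ?thesis unfolding ker_def levNR[OF e] by simp
          qed
          then show "(\<Sum>e\<in>NR x (fst x - int j). \<bar>u e\<bar> * ker x e) = v1 j x"
            by (simp add: v1_def sum_distrib_left mult.commute)
        qed
        finally show ?thesis .
      qed
      also have "(\<Sum>e\<in>G2. \<bar>u e\<bar> * ker x e) = (\<Sum>j<N. v2 j x)"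
      proof -
        have "(\<Sum>e\<in>G2. \<bar>u e\<bar> * ker x e) = (\<Sum>j<N. \<Sum>e\<in>NR x (fst x + int (Suc j)). \<bar>u e\<bar> * ker x e)"
          unfolding G2_def by (rule sum.UNION_disjoint) (auto simp: finite_NR intro!: disj)
        also have "\<dots> = (\<Sum>j<N. v2 j x)"
        proof (rule sum.cong[OF refl])
          fix j
          have "ker x e = we e / wt x" if e: "e \<in> NR x (fst x + int (Suc j))" for e
          proof -
            have "near x e" using e by (simp add: NR_def)
            then show ?thesis using levNR[OF e] by (simp add: ker_def)
          qed
          then show "(\<Sum>e\<in>NR x (fst x + int (Suc j)). \<bar>u e\<bar> * ker x e) = v2 j x"
            by (simp add: v2_def)
        qed
        finally show ?thesis .
      qed
      also have "(\<Sum>j<N. v1 j x) \<le> \<bar>\<Sum>j. \<bar>v1 j x\<bar>\<bar>"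
      proof -
        have "summable (\<lambda>j. \<bar>v1 j x\<bar>)" using R1 xV by blast
        then have "(\<Sum>j<N. \<bar>v1 j x\<bar>) \<le> (\<Sum>j. \<bar>v1 j x\<bar>)" by (intro sum_le_suminf) auto
        then show ?thesis using v10 by simp
      qed
      also have "(\<Sum>j<N. v2 j x) \<le> \<bar>\<Sum>j. \<bar>v2 j x\<bar>\<bar>"
      proof -
        have "summable (\<lambda>j. \<bar>v2 j x\<bar>)" using R2 xV by blast
        then have "(\<Sum>j<N. \<bar>v2 j x\<bar>) \<le> (\<Sum>j. \<bar>v2 j x\<bar>)" by (intro sum_le_suminf) auto
        then show ?thesis using v20 by simp
      qed
      finally show ?thesis by (simp add: v_def)
    qed
    then show "\<exists>v. mixed V wt a b s v ((g3 * (g1 * c1 + g2 * c2') + 1) * K) \<and>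
      (\<forall>x\<in>vertices Xs. \<forall>F. finite F \<longrightarrow> F \<subseteq> EE \<longrightarrow> (\<Sum>e\<in>F. \<bar>u e\<bar> * ker x e) \<le> v x)"
      using vm by blast
  qed
qed

end

section \<open>Synthesis\<close>

lemma nn_integral_count_space_le:
  fixes f :: "'i \<Rightarrow> ennreal"
  assumes A: "countable A" and le: "\<And>F. finite F \<Longrightarrow> F \<subseteq> A \<Longrightarrow> (\<Sum>i\<in>F. f i) \<le> c"
  shows "(\<integral>\<^sup>+i. f i \<partial>count_space A) \<le> c"
proof (cases "finite A")
  case True
  then show ?thesis using le[of A] by (simp add: nn_integral_count_space_finite)
next
  case False
  have bij: "bij_betw (from_nat_into A) UNIV A" by (rule bij_betw_from_nat_into[OF A False])
  have "(\<integral>\<^sup>+i. f i \<partial>count_space A) = (\<integral>\<^sup>+n. f (from_nat_into A n) \<partial>count_space UNIV)"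
    by (rule nn_integral_bij_count_space[OF bij, symmetric])
  also have "\<dots> = (\<Sum>n. f (from_nat_into A n))" by (rule nn_integral_count_space_nat)
  also have "\<dots> \<le> c"
  proof (rule suminf_le_const)
    fix n
    have "(\<Sum>i<n. f (from_nat_into A i)) = (\<Sum>i\<in>from_nat_into A ` {..<n}. f i)"
      using bij by (subst sum.reindex) (auto simp: bij_betw_def intro: inj_on_subset)
    also have "\<dots> \<le> c" using bij by (intro le) (auto simp: bij_betw_def)
    finally show "(\<Sum>i<n. f (from_nat_into A i)) \<le> c" .
  qed simp
  finally show ?thesis .
qed

lemma sum_le_nn_integral_count_space:
  fixes f :: "'i \<Rightarrow> ennreal"
  assumes "finite F" "F \<subseteq> A"
  shows "(\<Sum>i\<in>F. f i) \<le> (\<integral>\<^sup>+i. f i \<partial>count_space A)"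
proof -
  have "(\<Sum>i\<in>F. f i) = (\<integral>\<^sup>+i. f i * indicator F i \<partial>count_space A)"
    using assms by (subst nn_integral_count_space'[of F]) (auto simp: indicator_def intro!: sum.cong)
  also have "\<dots> \<le> (\<integral>\<^sup>+i. f i \<partial>count_space A)" by (intro nn_integral_mono) (auto simp: indicator_def)
  finally show ?thesis .
qed

context filling
begin

definition bas :: "int \<times> 'z" where "bas = (0, SOME \<xi>. \<xi> \<in> Xs 0)"

lemma bas: "bas \<in> vertices Xs" "fst bas = 0"
proof -
  have "\<exists>\<xi>. \<xi> \<in> Xs 0" using Xs_cover by blast
  then have "(SOME \<xi>. \<xi> \<in> Xs 0) \<in> Xs 0" by (rule someI_ex)
  then show "bas \<in> vertices Xs" "fst bas = 0" by (auto simp: bas_def vertices_def)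
qed

abbreviation z0 :: 'z where "z0 \<equiv> snd bas"

text \<open>Subtracting the average over a fixed base ball makes the contributions of the coarse levels
  summable on bounded sets; it changes a synthesized function only by a constant.\<close>

definition tPsi :: "(int \<times> 'z) \<times> (int \<times> 'z) \<Rightarrow> 'z \<Rightarrow> complex" where
  "tPsi e \<zeta> = cPsi e \<zeta> - Pavg M (cPsi e) bas"

lemma tPsi_loc_int: "e \<in> EE \<Longrightarrow> loc_int M (tPsi e)"
  unfolding tPsi_def by (intro loc_int_diff cPsi_loc_int loc_int_const)

text \<open>Absolute convergence in L1 on every ball around the base point, which is the
  integrability that Fubini's theorem asks for on edges times points.\<close>

definition synthable :: "((int \<times> 'z) \<times> (int \<times> 'z) \<Rightarrow> complex) \<Rightarrow> bool" where
  "synthable u \<longleftrightarrow> (\<forall>R. (\<integral>\<^sup>+e. ennreal (cmod (u e)) * (\<integral>\<^sup>+\<zeta>\<in>ball z0 R. ennreal (cmod (tPsi e \<zeta>)) \<partial>M) \<partial>count_space EE) < \<infinity>)"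

text \<open>An integral for counting measure, hence an absolutely convergent sum. Where absolute
  convergence fails the value is 0; for synthable coefficients this is a null set, so additivity
  holds only almost everywhere.\<close>

definition synth :: "((int \<times> 'z) \<times> (int \<times> 'z) \<Rightarrow> complex) \<Rightarrow> 'z \<Rightarrow> complex" where
  "synth u \<zeta> = (\<integral>e. u e * tPsi e \<zeta> \<partial>count_space EE)"

lemma countable_EE: "countable EE"
proof -
  have "EE \<subseteq> vertices Xs \<times> vertices Xs" using EE_vertices by (force simp: mem_Times_iff)
  then show ?thesis by (rule countable_subset) (intro countable_SIGMA countable_vertices)
qed

lemma sigma_finite_M: "sigma_finite_measure M"
proof
  show "\<exists>A. countable A \<and> A \<subseteq> sets M \<and> \<Union>A = space M \<and> (\<forall>a\<in>A. emeasure M a \<noteq> \<infinity>)"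
  proof (intro exI[of _ "range (\<lambda>k::nat. ball z0 (real k))"] conjI ballI)
    show "\<Union>(range (\<lambda>k::nat. ball z0 (real k))) = space M"
      using reals_Archimedean2 by (auto simp: space_M)
    fix a assume "a \<in> range (\<lambda>k::nat. ball z0 (real k))"
    then show "emeasure M a \<noteq> \<infinity>" by (auto simp: emeasure_ball)
  qed (auto simp: ball_sets)
qed

lemma psf: "pair_sigma_finite (count_space EE) M"
  by (intro pair_sigma_finite.intro sigma_finite_measure_count_space_countable countable_EE sigma_finite_M)

lemma synthable_mono:
  assumes "synthable u" "\<And>e. e \<in> EE \<Longrightarrow> cmod (v e) \<le> cmod (u e)"
  shows "synthable v"
  unfolding synthable_def
proof
  fix R :: real
  have "(\<integral>\<^sup>+e. ennreal (cmod (v e)) * (\<integral>\<^sup>+\<zeta>\<in>ball z0 R. ennreal (cmod (tPsi e \<zeta>)) \<partial>M) \<partial>count_space EE)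
     \<le> (\<integral>\<^sup>+e. ennreal (cmod (u e)) * (\<integral>\<^sup>+\<zeta>\<in>ball z0 R. ennreal (cmod (tPsi e \<zeta>)) \<partial>M) \<partial>count_space EE)"
    using assms(2) by (intro nn_integral_mono mult_right_mono ennreal_leI) auto
  also have "\<dots> < \<infinity>" using assms(1) by (simp add: synthable_def)
  finally show "(\<integral>\<^sup>+e. ennreal (cmod (v e)) * (\<integral>\<^sup>+\<zeta>\<in>ball z0 R. ennreal (cmod (tPsi e \<zeta>)) \<partial>M) \<partial>count_space EE) < \<infinity>" .
qed

lemma synthable_add:
  assumes "synthable u" "synthable v" "\<And>e. e \<in> EE \<Longrightarrow> cmod (w e) \<le> cmod (u e) + cmod (v e)"
  shows "synthable w"
  unfolding synthable_def
proof
  fix R :: real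
  let ?g = "\<lambda>e. (\<integral>\<^sup>+\<zeta>\<in>ball z0 R. ennreal (cmod (tPsi e \<zeta>)) \<partial>M)"
  have "(\<integral>\<^sup>+e. ennreal (cmod (w e)) * ?g e \<partial>count_space EE) \<le> (\<integral>\<^sup>+e. ennreal (cmod (u e)) * ?g e + ennreal (cmod (v e)) * ?g e \<partial>count_space EE)"
  proof (rule nn_integral_mono)
    fix e assume "e \<in> space (count_space EE)"
    then have "ennreal (cmod (w e)) \<le> ennreal (cmod (u e) + cmod (v e))" using assms(3) by (intro ennreal_leI) simp
    also have "\<dots> = ennreal (cmod (u e)) + ennreal (cmod (v e))" by (rule ennreal_plus) auto
    finally have "ennreal (cmod (w e)) * ?g e \<le> (ennreal (cmod (u e)) + ennreal (cmod (v e))) * ?g e" by (intro mult_right_mono) auto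
    then show "ennreal (cmod (w e)) * ?g e \<le> ennreal (cmod (u e)) * ?g e + ennreal (cmod (v e)) * ?g e" by (simp only: distrib_right)
  qed
  also have "\<dots> = (\<integral>\<^sup>+e. ennreal (cmod (u e)) * ?g e \<partial>count_space EE) + (\<integral>\<^sup>+e. ennreal (cmod (v e)) * ?g e \<partial>count_space EE)"
    by (rule nn_integral_add) auto
  also have "\<dots> < \<infinity>" using assms(1,2) by (simp add: synthable_def)
  finally show "(\<integral>\<^sup>+e. ennreal (cmod (w e)) * ?g e \<partial>count_space EE) < \<infinity>" .
qed

text \<open>Some centre of level \<open>- k\<close> is within half a radius of \<open>z0\<close>;
  the other half has to accommodate both \<open>R\<close> and the unit base ball.\<close>

lemma big_vertex:
  assumes k: "2 * (\<bar>R\<bar> + 1) \<le> 2 ^ k"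
  shows "\<exists>x\<in>vertices Xs. Bx bas \<subseteq> Bx x \<and> ball z0 R \<subseteq> Bx x \<and> fst x = - int k"
proof -
  have rk: "rad (- int k) = 2 ^ k" by (simp add: powr_realpow)
  obtain \<xi> where x: "\<xi> \<in> Xs (- int k)" "dist z0 \<xi> < rad (- int k) / 2" using Xs_cover by blast
  have "ball z0 R \<subseteq> Bx (- int k, \<xi>)" unfolding Bx_ball fst_conv snd_conv
  proof (rule ball_subset)
    have "2 * \<bar>R\<bar> + 2 \<le> rad (- int k)" using k unfolding rk by simp
    then show "dist z0 \<xi> + R \<le> rad (- int k)" using x(2) by linarith
  qed
  moreover have "Bx bas \<subseteq> Bx (- int k, \<xi>)" unfolding Bx_ball fst_conv snd_conv bas(2)
  proof (rule ball_subset)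
    have "2 * \<bar>R\<bar> + 2 \<le> rad (- int k)" using k unfolding rk by simp
    moreover have "rad 0 = 1" by simp
    ultimately show "dist z0 \<xi> + rad 0 \<le> rad (- int k)" using x(2) by linarith
  qed
  ultimately show ?thesis using vertexI[OF x(1)] by (intro bexI[of _ "(- int k, \<xi>)"]) auto
qed

text \<open>On a ball around \<open>z0\<close> the recentred functions are controlled by the kernel
  at one large vertex, so it is enough that the kernel sum at each single vertex is finite.\<close>

lemma synthable_kernel:
  assumes v: "\<And>x F. x \<in> vertices Xs \<Longrightarrow> finite F \<Longrightarrow> F \<subseteq> EE \<Longrightarrow> (\<Sum>e\<in>F. cmod (u e) * ker x e) \<le> v x"
  shows "synthable u"
  unfolding synthable_def
proof
  fix R :: real
  obtain k where k: "2 * (\<bar>R\<bar> + 1) < 2 ^ k" using real_arch_pow[of 2 "2 * (\<bar>R\<bar> + 1)"] by auto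
  from big_vertex[OF less_imp_le[OF this]]
  obtain x where x: "x \<in> vertices Xs" "Bx bas \<subseteq> Bx x" "ball z0 R \<subseteq> Bx x" by blast
  define K where "K = (6 * Lc + 1 + wt x / wt bas) * wt x"
  have K0: "0 \<le> K" using Lc_ge vol_nonneg unfolding K_def by (intro mult_nonneg_nonneg add_nonneg_nonneg divide_nonneg_nonneg) auto
  have "(\<integral>\<^sup>+e. ennreal (cmod (u e)) * (\<integral>\<^sup>+\<zeta>\<in>ball z0 R. ennreal (cmod (tPsi e \<zeta>)) \<partial>M) \<partial>count_space EE)
     \<le> (\<integral>\<^sup>+e. ennreal K * ennreal (cmod (u e) * ker x e) \<partial>count_space EE)"
  proof (rule nn_integral_mono)
    fix e assume "e \<in> space (count_space EE)"
    then have e: "e \<in> EE" by simp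
    have "(\<integral>\<^sup>+\<zeta>\<in>ball z0 R. ennreal (cmod (tPsi e \<zeta>)) \<partial>M) \<le> (\<integral>\<^sup>+\<zeta>\<in>Bx x. ennreal (cmod (tPsi e \<zeta>)) \<partial>M)"
      using x(3) by (intro nn_integral_mono mult_left_mono) (auto simp: indicator_def)
    also have "\<dots> \<le> ennreal (K * ker x e)" unfolding tPsi_def K_def by (rule nn_integral_Psi_const_le[OF e x(2)])
    finally have "ennreal (cmod (u e)) * (\<integral>\<^sup>+\<zeta>\<in>ball z0 R. ennreal (cmod (tPsi e \<zeta>)) \<partial>M) \<le> ennreal (cmod (u e)) * ennreal (K * ker x e)"
      by (intro mult_left_mono) auto
    also have "\<dots> = ennreal K * ennreal (cmod (u e) * ker x e)"
      using K0 ker_nonneg[of x e] by (simp add: ennreal_mult mult_ac)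
    finally show "ennreal (cmod (u e)) * (\<integral>\<^sup>+\<zeta>\<in>ball z0 R. ennreal (cmod (tPsi e \<zeta>)) \<partial>M) \<le> ennreal K * ennreal (cmod (u e) * ker x e)" .
  qed
  also have "\<dots> = ennreal K * (\<integral>\<^sup>+e. ennreal (cmod (u e) * ker x e) \<partial>count_space EE)" by (rule nn_integral_cmult) auto
  also have "\<dots> \<le> ennreal K * ennreal (v x)"
  proof (intro mult_left_mono nn_integral_count_space_le[OF countable_EE])
    fix F assume F: "finite F" "F \<subseteq> EE"
    have "(\<Sum>e\<in>F. ennreal (cmod (u e) * ker x e)) = ennreal (\<Sum>e\<in>F. cmod (u e) * ker x e)"
      by (rule sum_ennreal) (simp add: ker_nonneg)
    also have "\<dots> \<le> ennreal (v x)" by (intro ennreal_leI v x(1) F)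
    finally show "(\<Sum>e\<in>F. ennreal (cmod (u e) * ker x e)) \<le> ennreal (v x)" .
  qed auto
  also have "\<dots> < \<infinity>" by (simp add: ennreal_mult_less_top)
  finally show "(\<integral>\<^sup>+e. ennreal (cmod (u e)) * (\<integral>\<^sup>+\<zeta>\<in>ball z0 R. ennreal (cmod (tPsi e \<zeta>)) \<partial>M) \<partial>count_space EE) < \<infinity>" .
qed

lemma synth_product_integrable:
  assumes u: "synthable u" and B: "B \<in> sets M" "B \<subseteq> ball z0 R"
  shows "integrable (count_space EE \<Otimes>\<^sub>M M) (\<lambda>(e, \<zeta>). indicator B \<zeta> *\<^sub>R (u e * tPsi e \<zeta>))"
proof (rule integrableI_bounded)
  have tm: "tPsi e \<in> borel_measurable M" if "e \<in> EE" for e by (rule loc_int_measurable[OF tPsi_loc_int[OF that]])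
  show m: "(\<lambda>(e, \<zeta>). indicat_real B \<zeta> *\<^sub>R (u e * tPsi e \<zeta>)) \<in> borel_measurable (count_space EE \<Otimes>\<^sub>M M)"
  proof (rule measurable_pair_measure_countable1[OF countable_EE])
    fix e assume e: "e \<in> EE"
    show "(\<lambda>y. (case (e, y) of (e, \<zeta>) \<Rightarrow> indicat_real B \<zeta> *\<^sub>R (u e * tPsi e \<zeta>))) \<in> borel_measurable M"
      unfolding prod.case by (intro borel_measurable_scaleR borel_measurable_indicator B borel_measurable_times borel_measurable_const tm e)
  qed
  have "(\<integral>\<^sup>+p. ennreal (norm (case p of (e, \<zeta>) \<Rightarrow> indicat_real B \<zeta> *\<^sub>R (u e * tPsi e \<zeta>))) \<partial>(count_space EE \<Otimes>\<^sub>M M))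
    = (\<integral>\<^sup>+e. (\<integral>\<^sup>+\<zeta>. ennreal (norm (indicat_real B \<zeta> *\<^sub>R (u e * tPsi e \<zeta>))) \<partial>M) \<partial>count_space EE)"
  proof -
    have "(\<lambda>p. ennreal (norm (case p of (e, \<zeta>) \<Rightarrow> indicat_real B \<zeta> *\<^sub>R (u e * tPsi e \<zeta>)))) \<in> borel_measurable (count_space EE \<Otimes>\<^sub>M M)"
      using m by measurable
    from sigma_finite_measure.nn_integral_fst[OF sigma_finite_M this, symmetric] show ?thesis by (simp only: prod.case)
  qed
  also have "\<dots> \<le> (\<integral>\<^sup>+e. ennreal (cmod (u e)) * (\<integral>\<^sup>+\<zeta>\<in>ball z0 R. ennreal (cmod (tPsi e \<zeta>)) \<partial>M) \<partial>count_space EE)"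
  proof (rule nn_integral_mono)
    fix e assume "e \<in> space (count_space EE)"
    then have e: "e \<in> EE" by simp
    have "(\<integral>\<^sup>+\<zeta>. ennreal (norm (indicat_real B \<zeta> *\<^sub>R (u e * tPsi e \<zeta>))) \<partial>M)
       \<le> (\<integral>\<^sup>+\<zeta>. ennreal (cmod (u e)) * (ennreal (cmod (tPsi e \<zeta>)) * indicator (ball z0 R) \<zeta>) \<partial>M)"
    proof (rule nn_integral_mono)
      fix \<zeta>
      show "ennreal (norm (indicat_real B \<zeta> *\<^sub>R (u e * tPsi e \<zeta>))) \<le> ennreal (cmod (u e)) * (ennreal (cmod (tPsi e \<zeta>)) * indicator (ball z0 R) \<zeta>)"
      proof (cases "\<zeta> \<in> B")
        case True
        then have i: "indicat_real B \<zeta> = 1" "indicator (ball z0 R) \<zeta> = (1::ennreal)" using B(2) by (auto intro: indicator_simps(1))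
        show ?thesis unfolding i by (simp add: norm_mult ennreal_mult)
      qed simp
    qed
    also have "\<dots> = ennreal (cmod (u e)) * (\<integral>\<^sup>+\<zeta>\<in>ball z0 R. ennreal (cmod (tPsi e \<zeta>)) \<partial>M)"
      using tm[OF e] by (intro nn_integral_cmult borel_measurable_times_ennreal borel_measurable_indicator ball_sets) auto
    finally show "(\<integral>\<^sup>+\<zeta>. ennreal (norm (indicat_real B \<zeta> *\<^sub>R (u e * tPsi e \<zeta>))) \<partial>M)
      \<le> ennreal (cmod (u e)) * (\<integral>\<^sup>+\<zeta>\<in>ball z0 R. ennreal (cmod (tPsi e \<zeta>)) \<partial>M)" .
  qed
  also have "\<dots> < \<infinity>" using u by (simp add: synthable_def)
  finally show "(\<integral>\<^sup>+p. ennreal (norm (case p of (e, \<zeta>) \<Rightarrow> indicat_real B \<zeta> *\<^sub>R (u e * tPsi e \<zeta>))) \<partial>(count_space EE \<Otimes>\<^sub>M M)) < \<infinity>" .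
qed

lemma synth_set:
  assumes u: "synthable u" and B: "B \<in> sets M" "B \<subseteq> ball z0 R"
  shows "set_integrable M B (synth u)"
    and "(LINT \<zeta>:B|M. synth u \<zeta>) = (\<integral>e. u e * (LINT \<zeta>:B|M. tPsi e \<zeta>) \<partial>count_space EE)"
    and "integrable (count_space EE) (\<lambda>e. u e * (LINT \<zeta>:B|M. tPsi e \<zeta>))"
    and "AE \<zeta> in M. \<zeta> \<in> B \<longrightarrow> integrable (count_space EE) (\<lambda>e. u e * tPsi e \<zeta>)"
proof -
  interpret P: pair_sigma_finite "count_space EE" M by (rule psf)
  let ?H = "\<lambda>e \<zeta>. indicat_real B \<zeta> *\<^sub>R (u e * tPsi e \<zeta>)"
  have I: "integrable (count_space EE \<Otimes>\<^sub>M M) (case_prod ?H)" by (rule synth_product_integrable[OF u B])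
  have in1: "(\<integral>e. ?H e \<zeta> \<partial>count_space EE) = indicat_real B \<zeta> *\<^sub>R synth u \<zeta>" for \<zeta>
    unfolding synth_def by (rule integral_scaleR_right) 
  have in2: "(\<integral>\<zeta>. ?H e \<zeta> \<partial>M) = u e * (LINT \<zeta>:B|M. tPsi e \<zeta>)" for e
  proof -
    have "(\<lambda>\<zeta>. ?H e \<zeta>) = (\<lambda>\<zeta>. u e * (indicat_real B \<zeta> *\<^sub>R tPsi e \<zeta>))" by (simp add: scaleR_conv_of_real mult_ac)
    then show ?thesis unfolding set_lebesgue_integral_def by (simp only: integral_mult_right_zero)
  qed
  show "set_integrable M B (synth u)" unfolding set_integrable_def using P.integrable_snd[OF I] by (simp only: in1)
  show "integrable (count_space EE) (\<lambda>e. u e * (LINT \<zeta>:B|M. tPsi e \<zeta>))" using P.integrable_fst[OF I] by (simp only: in2)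
  have "(\<integral>\<zeta>. (\<integral>e. ?H e \<zeta> \<partial>count_space EE) \<partial>M) = (\<integral>e. (\<integral>\<zeta>. ?H e \<zeta> \<partial>M) \<partial>count_space EE)"
    by (rule P.Fubini_integral[OF I])
  then show "(LINT \<zeta>:B|M. synth u \<zeta>) = (\<integral>e. u e * (LINT \<zeta>:B|M. tPsi e \<zeta>) \<partial>count_space EE)"
    unfolding in1 in2 set_lebesgue_integral_def[of M B "synth u"] .
  have "AE \<zeta> in M. integrable (count_space EE) (\<lambda>e. ?H e \<zeta>)" by (rule P.AE_integrable_snd[OF I])
  then show "AE \<zeta> in M. \<zeta> \<in> B \<longrightarrow> integrable (count_space EE) (\<lambda>e. u e * tPsi e \<zeta>)"
  proof (rule AE_mp, intro AE_I2 impI)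
    fix \<zeta> assume I: "integrable (count_space EE) (\<lambda>e. ?H e \<zeta>)" and z: "\<zeta> \<in> B"
    have "indicat_real B \<zeta> = 1" using z by simp
    then show "integrable (count_space EE) (\<lambda>e. u e * tPsi e \<zeta>)" using I by (simp only: scaleR_one)
  qed
qed

lemma synth_AE:
  assumes u: "synthable u"
  shows "AE \<zeta> in M. integrable (count_space EE) (\<lambda>e. u e * tPsi e \<zeta>)"
proof -
  have "AE \<zeta> in M. \<forall>k::nat. \<zeta> \<in> ball z0 (real k) \<longrightarrow> integrable (count_space EE) (\<lambda>e. u e * tPsi e \<zeta>)"
    unfolding AE_all_countable using synth_set(4)[OF u ball_sets order_refl] by blast
  then show ?thesis
  proof (rule AE_mp, intro AE_I2 impI)
    fix \<zeta> assume a: "\<forall>k::nat. \<zeta> \<in> ball z0 (real k) \<longrightarrow> integrable (count_space EE) (\<lambda>e. u e * tPsi e \<zeta>)"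
    obtain k :: nat where "dist z0 \<zeta> < real k" using reals_Archimedean2 by blast
    then have "\<zeta> \<in> ball z0 (real k)" by simp
    then show "integrable (count_space EE) (\<lambda>e. u e * tPsi e \<zeta>)" by (rule a[rule_format])
  qed
qed

lemma synth_loc_int:
  assumes u: "synthable u"
  shows "loc_int M (synth u)"
proof (rule loc_intI)
  show "set_integrable M (ball z0 r) (synth u)" for r by (rule synth_set(1)[OF u ball_sets order_refl])
  show "synth u \<in> borel_measurable M"
  proof (rule borel_measurable_LIMSEQ_metric)
    show "(\<lambda>\<zeta>. indicat_real (ball z0 (real k)) \<zeta> *\<^sub>R synth u \<zeta>) \<in> borel_measurable M" for k :: nat
      using synth_set(1)[OF u ball_sets order_refl, of "real k"] unfolding set_integrable_def by (rule borel_measurable_integrable)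
    fix \<zeta> assume "\<zeta> \<in> space M"
    obtain k0 :: nat where k0: "dist z0 \<zeta> < real k0" using reals_Archimedean2 by blast
    show "(\<lambda>k. indicat_real (ball z0 (real k)) \<zeta> *\<^sub>R synth u \<zeta>) \<longlonglongrightarrow> synth u \<zeta>"
    proof (rule tendsto_eventually, rule eventually_sequentiallyI[of k0])
      fix k assume "k0 \<le> k"
      then have "\<zeta> \<in> ball z0 (real k)" using k0 by simp
      then have "indicat_real (ball z0 (real k)) \<zeta> = 1" by (rule indicator_simps(1))
      then show "indicat_real (ball z0 (real k)) \<zeta> *\<^sub>R synth u \<zeta> = synth u \<zeta>" by (simp only: scaleR_one)
    qed
  qed
qed

lemma synth_add_AE:
  assumes "synthable u" "synthable v"
  shows "AE \<zeta> in M. synth (\<lambda>e. u e + v e) \<zeta> = synth u \<zeta> + synth v \<zeta>"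
proof -
  have "AE \<zeta> in M. integrable (count_space EE) (\<lambda>e. u e * tPsi e \<zeta>) \<and> integrable (count_space EE) (\<lambda>e. v e * tPsi e \<zeta>)"
    using synth_AE[OF assms(1)] synth_AE[OF assms(2)] by (rule AE_conjI)
  then show ?thesis
  proof (rule AE_mp, intro AE_I2 impI, elim conjE)
    fix \<zeta> assume I: "integrable (count_space EE) (\<lambda>e. u e * tPsi e \<zeta>)" "integrable (count_space EE) (\<lambda>e. v e * tPsi e \<zeta>)"
    have "synth (\<lambda>e. u e + v e) \<zeta> = (\<integral>e. u e * tPsi e \<zeta> + v e * tPsi e \<zeta> \<partial>count_space EE)"
      unfolding synth_def by (simp only: distrib_right)
    also have "\<dots> = synth u \<zeta> + synth v \<zeta>" unfolding synth_def by (rule Bochner_Integration.integral_add[OF I])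
    finally show "synth (\<lambda>e. u e + v e) \<zeta> = synth u \<zeta> + synth v \<zeta>" .
  qed
qed

lemma synth_cmult: "synth (\<lambda>e. k * u e) \<zeta> = k * synth u \<zeta>"
  unfolding synth_def by (simp only: mult.assoc integral_mult_right_zero)

lemma Bx_in_ball: "Bx x \<subseteq> ball z0 (dist z0 (snd x) + rad (fst x))"
  unfolding Bx_ball by (rule ball_subset) (simp add: dist_commute)

lemma Pavg_synth:
  assumes u: "synthable u"
  shows "Pavg M (synth u) x = (\<integral>e. u e * Pavg M (tPsi e) x \<partial>count_space EE)"
    and "integrable (count_space EE) (\<lambda>e. u e * Pavg M (tPsi e) x)"
proof -
  have eq: "u e * Pavg M (tPsi e) x = (u e * (LINT \<zeta>:Bx x|M. tPsi e \<zeta>)) / of_real (measure M (Bx x))" for e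
    by (simp add: Pavg_def)
  show "Pavg M (synth u) x = (\<integral>e. u e * Pavg M (tPsi e) x \<partial>count_space EE)"
    unfolding eq integral_divide_zero Pavg_def[of M "synth u"] synth_set(2)[OF u Bx_sets Bx_in_ball] by (rule refl)
  show "integrable (count_space EE) (\<lambda>e. u e * Pavg M (tPsi e) x)"
    unfolding eq by (intro integrable_divide_zero impI synth_set(3)[OF u Bx_sets Bx_in_ball])
qed

text \<open>The base averages subtracted in \<open>tPsi\<close> cancel in the difference, and the
  kernel bound applies to each term.\<close>

lemma Pavg_synth_diff_le:
  assumes u: "synthable u" and x': "x' \<in> neighbors Xs x"
    and v: "\<And>F. finite F \<Longrightarrow> F \<subseteq> EE \<Longrightarrow> (\<Sum>e\<in>F. cmod (u e) * ker x e) \<le> v"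
  shows "cmod (Pavg M (synth u) x' - Pavg M (synth u) x) \<le> Kc * v"
proof -
  have v0: "0 \<le> v" using v[of "{}"] by simp
  have I: "integrable (count_space EE) (\<lambda>e. u e * Pavg M (tPsi e) x' - u e * Pavg M (tPsi e) x)"
    by (intro Bochner_Integration.integrable_diff Pavg_synth(2) u)
  have "Pavg M (synth u) x' - Pavg M (synth u) x = (\<integral>e. u e * Pavg M (tPsi e) x' - u e * Pavg M (tPsi e) x \<partial>count_space EE)"
    unfolding Pavg_synth(1)[OF u] by (intro Bochner_Integration.integral_diff[symmetric] Pavg_synth(2) u)
  then have "ennreal (cmod (Pavg M (synth u) x' - Pavg M (synth u) x))
     \<le> (\<integral>\<^sup>+e. ennreal (cmod (u e * Pavg M (tPsi e) x' - u e * Pavg M (tPsi e) x)) \<partial>count_space EE)"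
    using integral_norm_bound_ennreal[OF I] by simp
  also have "\<dots> \<le> (\<integral>\<^sup>+e. ennreal Kc * ennreal (cmod (u e) * ker x e) \<partial>count_space EE)"
  proof (rule nn_integral_mono)
    fix e assume "e \<in> space (count_space EE)"
    then have e: "e \<in> EE" by simp
    have P: "Pavg M (tPsi e) y = Pavg M (cPsi e) y - Pavg M (cPsi e) bas" for y
      unfolding tPsi_def Pavg_diff[OF cPsi_loc_int[OF e] loc_int_const] Pavg_const by (rule refl)
    have "u e * Pavg M (tPsi e) x' - u e * Pavg M (tPsi e) x = u e * (Pavg M (cPsi e) x' - Pavg M (cPsi e) x)"
      unfolding P by (simp add: algebra_simps)
    then have "cmod (u e * Pavg M (tPsi e) x' - u e * Pavg M (tPsi e) x) = cmod (u e) * cmod (Pavg M (cPsi e) x' - Pavg M (cPsi e) x)"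
      by (simp only: norm_mult)
    also have "\<dots> \<le> cmod (u e) * (Kc * ker x e)" by (intro mult_left_mono Pavg_Psi_diff[OF e x'] norm_ge_zero)
    finally have "ennreal (cmod (u e * Pavg M (tPsi e) x' - u e * Pavg M (tPsi e) x)) \<le> ennreal (Kc * (cmod (u e) * ker x e))"
      by (intro ennreal_leI) (simp only: mult_ac)
    also have "\<dots> = ennreal Kc * ennreal (cmod (u e) * ker x e)"
      using Kc_pos ker_nonneg[of x e] by (intro ennreal_mult) auto
    finally show "ennreal (cmod (u e * Pavg M (tPsi e) x' - u e * Pavg M (tPsi e) x)) \<le> ennreal Kc * ennreal (cmod (u e) * ker x e)" .
  qed
  also have "\<dots> = ennreal Kc * (\<integral>\<^sup>+e. ennreal (cmod (u e) * ker x e) \<partial>count_space EE)" by (rule nn_integral_cmult) auto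
  also have "\<dots> \<le> ennreal Kc * ennreal v"
  proof (intro mult_left_mono nn_integral_count_space_le[OF countable_EE])
    fix F assume F: "finite F" "F \<subseteq> EE"
    have "(\<Sum>e\<in>F. ennreal (cmod (u e) * ker x e)) = ennreal (\<Sum>e\<in>F. cmod (u e) * ker x e)"
      by (rule sum_ennreal) (simp add: ker_nonneg)
    also have "\<dots> \<le> ennreal v" by (intro ennreal_leI v F)
    finally show "(\<Sum>e\<in>F. ennreal (cmod (u e) * ker x e)) \<le> ennreal v" .
  qed auto
  also have "\<dots> = ennreal (Kc * v)" using Kc_pos v0 by (intro ennreal_mult[symmetric]) auto
  finally show ?thesis using Kc_pos v0 by (simp add: ennreal_le_iff)
qed


section \<open>Reconstruction from edge differences\<close>

text \<open>Valid for arbitrary coefficients, since \<open>synth\<close> takes the value 0 at points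
  of divergence.\<close>

lemma nn_integral_synth_le:
  "(\<integral>\<^sup>+\<zeta>\<in>ball z0 R. ennreal (cmod (synth u \<zeta>)) \<partial>M)
    \<le> (\<integral>\<^sup>+e. ennreal (cmod (u e)) * (\<integral>\<^sup>+\<zeta>\<in>ball z0 R. ennreal (cmod (tPsi e \<zeta>)) \<partial>M) \<partial>count_space EE)"
proof -
  interpret P: pair_sigma_finite "count_space EE" M by (rule psf)
  have tm: "tPsi e \<in> borel_measurable M" if "e \<in> EE" for e by (rule loc_int_measurable[OF tPsi_loc_int[OF that]])
  let ?f = "\<lambda>e \<zeta>. ennreal (cmod (u e)) * (ennreal (cmod (tPsi e \<zeta>)) * indicator (ball z0 R) \<zeta>)"
  have fm1: "?f e \<in> borel_measurable M" if "e \<in> EE" for e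
  proof (intro borel_measurable_times_ennreal borel_measurable_const borel_measurable_indicator ball_sets)
    show "(\<lambda>\<zeta>. ennreal (cmod (tPsi e \<zeta>))) \<in> borel_measurable M" using tm[OF that] by measurable
  qed
  have m: "case_prod ?f \<in> borel_measurable (count_space EE \<Otimes>\<^sub>M M)"
    by (rule measurable_pair_measure_countable1[OF countable_EE]) (simp only: prod.case fm1)
  have "(\<integral>\<^sup>+\<zeta>\<in>ball z0 R. ennreal (cmod (synth u \<zeta>)) \<partial>M) \<le> (\<integral>\<^sup>+\<zeta>. (\<integral>\<^sup>+e. ?f e \<zeta> \<partial>count_space EE) \<partial>M)"
  proof (rule nn_integral_mono)
    fix \<zeta>
    have le: "ennreal (cmod (synth u \<zeta>)) \<le> (\<integral>\<^sup>+e. ennreal (cmod (u e)) * ennreal (cmod (tPsi e \<zeta>)) \<partial>count_space EE)"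
    proof (cases "integrable (count_space EE) (\<lambda>e. u e * tPsi e \<zeta>)")
      case True
      then show ?thesis unfolding synth_def
        by (rule order_trans[OF integral_norm_bound_ennreal]) (simp add: norm_mult ennreal_mult)
    next
      case False
      then show ?thesis by (simp add: synth_def not_integrable_integral_eq)
    qed
    show "ennreal (cmod (synth u \<zeta>)) * indicator (ball z0 R) \<zeta> \<le> (\<integral>\<^sup>+e. ?f e \<zeta> \<partial>count_space EE)"
    proof (cases "\<zeta> \<in> ball z0 R")
      case True
      then have i: "indicator (ball z0 R) \<zeta> = (1::ennreal)" by (rule indicator_simps(1))
      show ?thesis unfolding i mult_1_right by (rule le)
    next
      case False
      then have i: "indicator (ball z0 R) \<zeta> = (0::ennreal)" by (rule indicator_simps(2))
      show ?thesis unfolding i by simp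
    qed
  qed
  also have "\<dots> = (\<integral>\<^sup>+e. (\<integral>\<^sup>+\<zeta>. ?f e \<zeta> \<partial>M) \<partial>count_space EE)" by (rule P.Fubini'[OF m])
  also have "\<dots> = (\<integral>\<^sup>+e. ennreal (cmod (u e)) * (\<integral>\<^sup>+\<zeta>\<in>ball z0 R. ennreal (cmod (tPsi e \<zeta>)) \<partial>M) \<partial>count_space EE)"
  proof (rule nn_integral_cong)
    fix e assume "e \<in> space (count_space EE)"
    then have e: "e \<in> EE" by simp
    have "(\<lambda>\<zeta>. ennreal (cmod (tPsi e \<zeta>)) * indicator (ball z0 R) \<zeta>) \<in> borel_measurable M"
    proof (intro borel_measurable_times_ennreal borel_measurable_indicator ball_sets)
      show "(\<lambda>\<zeta>. ennreal (cmod (tPsi e \<zeta>))) \<in> borel_measurable M" using tm[OF e] by measurable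
    qed
    then show "(\<integral>\<^sup>+\<zeta>. ?f e \<zeta> \<partial>M) = ennreal (cmod (u e)) * (\<integral>\<^sup>+\<zeta>\<in>ball z0 R. ennreal (cmod (tPsi e \<zeta>)) \<partial>M)"
      by (rule nn_integral_cmult)
  qed
  finally show ?thesis .
qed

definition ana :: "('z \<Rightarrow> complex) \<Rightarrow> (int \<times> 'z) \<times> (int \<times> 'z) \<Rightarrow> complex" where
  "ana f e = Pavg M f (snd e) - Pavg M f (fst e)"

text \<open>Vertex pairs of consecutive levels whose balls both contain \<zeta>. The common point
  makes them edges, and no other edge of level \<open>n\<close> has \<open>Psi e \<zeta>\<close>
  different from 0.\<close>

definition pairs :: "int \<Rightarrow> 'z \<Rightarrow> ((int \<times> 'z) \<times> (int \<times> 'z)) set" where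
  "pairs n \<zeta> = Pair n ` act n \<zeta> \<times> Pair (n + 1) ` act (n + 1) \<zeta>"

lemma finite_pairs: "finite (pairs n \<zeta>)" by (simp add: pairs_def)

lemma pairs_Ed: "pairs n \<zeta> \<subseteq> Ed n"
  by (auto simp: pairs_def act_def Ed_def V_eq neighbors_def vertices_def)

lemma Psi_not_pairs: "e \<in> Ed n \<Longrightarrow> e \<notin> pairs n \<zeta> \<Longrightarrow> Psi e \<zeta> = 0"
proof (rule ccontr)
  assume e: "e \<in> Ed n" "e \<notin> pairs n \<zeta>" and z: "Psi e \<zeta> \<noteq> 0"
  have l: "lev e = n" by (rule Ed_lev[OF e(1)])
  from z have s: "fst (snd e) = n + 1" "psi (fst e) \<zeta> \<noteq> 0" "psi (snd e) \<zeta> \<noteq> 0"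
    unfolding Psi_def l by (auto split: if_splits)
  then have "\<zeta> \<in> Bx (fst e)" "\<zeta> \<in> Bx (snd e)" using psi_outside by blast+
  moreover have "snd (fst e) \<in> Xs n" "snd (snd e) \<in> Xs (n + 1)"
    using Ed_fst[OF e(1)] Ed_snd[OF e(1)] s(1) by (auto simp: V_eq neighbors_def vertices_def)
  ultimately have "snd (fst e) \<in> act n \<zeta>" "snd (snd e) \<in> act (n + 1) \<zeta>"
    using l s(1) unfolding act_def by (metis (no_types, lifting) mem_Collect_eq prod.collapse)+
  then have "e \<in> pairs n \<zeta>" unfolding pairs_def
    using l s(1) by (metis (no_types, lifting) image_eqI mem_Sigma_iff prod.collapse)
  then show False using e(2) by simp
qed

text \<open>The product of the two partitions of unity: summing out one index, whose bumps add up to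
  1, leaves the smoothing on the other level.\<close>

lemma Tn_step: "(\<Sum>e\<in>pairs n \<zeta>. ana f e * cPsi e \<zeta>) = Tn (n + 1) f \<zeta> - Tn n f \<zeta>"
proof -
  let ?p = "\<lambda>n \<xi>. complex_of_real (psi (n, \<xi>) \<zeta>)"
  have one: "(\<Sum>\<xi>\<in>act n \<zeta>. ?p n \<xi>) = 1" for n
    using sum_psi[of n \<zeta>] by (simp add: of_real_sum[symmetric] del: of_real_sum)
  have "(\<Sum>e\<in>pairs n \<zeta>. ana f e * cPsi e \<zeta>) = (\<Sum>x\<in>Pair n ` act n \<zeta>. \<Sum>y\<in>Pair (n + 1) ` act (n + 1) \<zeta>. ana f (x, y) * cPsi (x, y) \<zeta>)"
    unfolding pairs_def by (simp add: sum.cartesian_product case_prod_unfold)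
  also have "\<dots> = (\<Sum>\<xi>\<in>act n \<zeta>. \<Sum>\<eta>\<in>act (n + 1) \<zeta>. ana f ((n, \<xi>), (n + 1, \<eta>)) * cPsi ((n, \<xi>), (n + 1, \<eta>)) \<zeta>)"
    by (subst sum.reindex, simp add: inj_on_def, subst sum.reindex) (simp_all add: inj_on_def)
  also have "\<dots> = (\<Sum>\<xi>\<in>act n \<zeta>. \<Sum>\<eta>\<in>act (n + 1) \<zeta>. ?p n \<xi> * (Pavg M f (n + 1, \<eta>) * ?p (n + 1) \<eta>) - (Pavg M f (n, \<xi>) * ?p n \<xi>) * ?p (n + 1) \<eta>)"
    by (intro sum.cong refl) (simp add: ana_def Psi_def algebra_simps)
  also have "\<dots> = (\<Sum>\<xi>\<in>act n \<zeta>. ?p n \<xi> * Tn (n + 1) f \<zeta> - (Pavg M f (n, \<xi>) * ?p n \<xi>) * 1)"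
    unfolding sum_subtractf sum_distrib_left[symmetric] one Tn_def[of "n + 1"] by (rule refl)
  also have "\<dots> = Tn (n + 1) f \<zeta> - Tn n f \<zeta>"
    unfolding sum_subtractf sum_distrib_right[symmetric] one Tn_def[of n] by simp
  finally show ?thesis .
qed

text \<open>The upper end is excluded because the step at level \<open>n\<close> leads to level
  \<open>n + 1\<close>; the \<open>2 * N\<close> remaining steps go from \<open>- N\<close> to
  \<open>N\<close>.\<close>

definition cutoff :: "nat \<Rightarrow> ((int \<times> 'z) \<times> (int \<times> 'z) \<Rightarrow> complex) \<Rightarrow> (int \<times> 'z) \<times> (int \<times> 'z) \<Rightarrow> complex" where
  "cutoff N u e = (if - int N \<le> lev e \<and> lev e < int N then u e else 0)"

lemma Pavg_Psi_bas_zero: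
  assumes e: "e \<in> Ed n" "e \<notin> NR bas n"
  shows "Pavg M (cPsi e) bas = 0"
proof (rule Pavg_zero)
  have "e \<in> EE" using e(1) by (auto simp: EE_def)
  then show "loc_int M (cPsi e)" by (rule cPsi_loc_int)
  fix \<zeta> assume "\<zeta> \<in> Bx bas"
  moreover have "\<not> near bas e" using e by (simp add: NR_def)
  ultimately have "Psi e \<zeta> = 0" by (intro not_near_Psi[of bas e bas]) simp_all
  then show "cPsi e \<zeta> = 0" by simp
qed

text \<open>At a fixed point only the edges in \<open>pairs\<close> contribute through
  \<open>Psi\<close>, and only those near the base vertex through the subtracted average. The former
  telescope, the latter form a finite sum that is the constant \<open>k\<close>.\<close>

lemma synth_cutoff:
  "\<exists>k. \<forall>\<zeta>. synth (cutoff N (ana f)) \<zeta> = Tn (int N) f \<zeta> - Tn (- int N) f \<zeta> - k"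
proof (intro exI allI)
  fix \<zeta>
  let ?I = "{..<2 * N}"
  define l where "l i = - int N + int i" for i
  define G where "G = (\<Union>i\<in>?I. pairs (l i) \<zeta> \<union> NR bas (l i))"
  have injl: "l i = l j \<Longrightarrow> i = j" for i j by (simp add: l_def)
  have Ed_disj: "Ed (l i) \<inter> Ed (l j) = {}" if "i \<noteq> j" for i j
  proof (rule equals0I)
    fix e assume "e \<in> Ed (l i) \<inter> Ed (l j)"
    then have "lev e = l i" "lev e = l j" using Ed_lev[of e "l i"] Ed_lev[of e "l j"] by simp_all
    then show False using injl[of i j] that by simp
  qed
  have fG: "finite G" by (simp add: G_def finite_pairs finite_NR)
  have GE: "G \<subseteq> EE"
  proof
    fix e assume "e \<in> G"
    then obtain i where "e \<in> pairs (l i) \<zeta> \<or> e \<in> NR bas (l i)" unfolding G_def by blast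
    then have "e \<in> Ed (l i)" using pairs_Ed[of "l i" \<zeta>] NR_Ed[of e bas "l i"] by blast
    then show "e \<in> EE" unfolding EE_def by blast
  qed
  let ?w = "cutoff N (ana f)"
  have lev_l: "\<exists>i\<in>?I. lev e = l i" if "- int N \<le> lev e" "lev e < int N" for e
    using that by (intro bexI[of _ "nat (lev e + int N)"]) (auto simp: l_def)
  have l_cut: "?w e = ana f e" if "e \<in> Ed (l i)" "i \<in> ?I" for e i
  proof -
    have "lev e = l i" by (rule Ed_lev[OF that(1)])
    then show ?thesis using that(2) by (simp add: cutoff_def l_def)
  qed
  have zero: "?w e * tPsi e \<zeta> = 0" if e: "e \<in> EE - G" for e
  proof (cases "- int N \<le> lev e \<and> lev e < int N")
    case True
    then obtain i where i: "i \<in> ?I" "lev e = l i" using lev_l[of e] by blast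
    have eE: "e \<in> Ed (l i)" using EE_Ed[of e] e i(2) by simp
    then have "Psi e \<zeta> = 0" "Pavg M (cPsi e) bas = 0"
      using e i(1) Psi_not_pairs[OF eE] Pavg_Psi_bas_zero[OF eE] unfolding G_def by blast+
    then show ?thesis by (simp add: tPsi_def)
  qed (auto simp: cutoff_def)
  have "synth ?w \<zeta> = (\<Sum>e\<in>{e\<in>EE. ?w e * tPsi e \<zeta> \<noteq> 0}. ?w e * tPsi e \<zeta>)"
    unfolding synth_def
    by (rule lebesgue_integral_count_space_finite_support) (rule finite_subset[OF _ fG], use zero in blast)
  also have "\<dots> = (\<Sum>e\<in>G. ?w e * tPsi e \<zeta>)"
  proof (rule sum.mono_neutral_left[OF fG])
    show "{e\<in>EE. ?w e * tPsi e \<zeta> \<noteq> 0} \<subseteq> G" using zero by blast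
    show "\<forall>e\<in>G - {e\<in>EE. ?w e * tPsi e \<zeta> \<noteq> 0}. ?w e * tPsi e \<zeta> = 0" using GE by blast
  qed
  also have "\<dots> = (\<Sum>e\<in>G. ?w e * cPsi e \<zeta>) - (\<Sum>e\<in>G. ?w e * Pavg M (cPsi e) bas)"
    by (simp add: tPsi_def right_diff_distrib sum_subtractf)
  also have "(\<Sum>e\<in>G. ?w e * cPsi e \<zeta>) = (\<Sum>e\<in>(\<Union>i\<in>?I. pairs (l i) \<zeta>). ?w e * cPsi e \<zeta>)"
  proof (rule sum.mono_neutral_right[OF fG])
    show "(\<Union>i\<in>?I. pairs (l i) \<zeta>) \<subseteq> G" by (auto simp: G_def)
    show "\<forall>e\<in>G - (\<Union>i\<in>?I. pairs (l i) \<zeta>). ?w e * cPsi e \<zeta> = 0"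
    proof
      fix e assume e: "e \<in> G - (\<Union>i\<in>?I. pairs (l i) \<zeta>)"
      then obtain i where i: "i \<in> ?I" "e \<in> NR bas (l i)" by (auto simp: G_def)
      then have "Psi e \<zeta> = 0" using e NR_Ed[OF i(2)] by (intro Psi_not_pairs[of e "l i"]) auto
      then show "?w e * cPsi e \<zeta> = 0" by simp
    qed
  qed
  also have "\<dots> = (\<Sum>i\<in>?I. \<Sum>e\<in>pairs (l i) \<zeta>. ?w e * cPsi e \<zeta>)"
  proof (rule sum.UNION_disjoint)
    show "\<forall>i\<in>?I. \<forall>j\<in>?I. i \<noteq> j \<longrightarrow> pairs (l i) \<zeta> \<inter> pairs (l j) \<zeta> = {}"
    proof (intro ballI impI)
      fix i j :: nat assume "i \<noteq> j"
      then show "pairs (l i) \<zeta> \<inter> pairs (l j) \<zeta> = {}"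
        using Ed_disj[of i j] pairs_Ed[of "l i" \<zeta>] pairs_Ed[of "l j" \<zeta>] by blast
    qed
  qed (auto simp: finite_pairs)
  also have "\<dots> = (\<Sum>i\<in>?I. Tn (l (Suc i)) f \<zeta> - Tn (l i) f \<zeta>)"
  proof (rule sum.cong[OF refl])
    fix i assume i: "i \<in> ?I"
    have "(\<Sum>e\<in>pairs (l i) \<zeta>. ?w e * cPsi e \<zeta>) = (\<Sum>e\<in>pairs (l i) \<zeta>. ana f e * cPsi e \<zeta>)"
    proof (rule sum.cong[OF refl])
      fix e assume "e \<in> pairs (l i) \<zeta>"
      then have "e \<in> Ed (l i)" using pairs_Ed[of "l i" \<zeta>] by blast
      then show "?w e * cPsi e \<zeta> = ana f e * cPsi e \<zeta>" by (simp only: l_cut[OF _ i])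
    qed
    also have "\<dots> = Tn (l i + 1) f \<zeta> - Tn (l i) f \<zeta>" by (rule Tn_step)
    also have "l i + 1 = l (Suc i)" by (simp add: l_def)
    finally show "(\<Sum>e\<in>pairs (l i) \<zeta>. ?w e * cPsi e \<zeta>) = Tn (l (Suc i)) f \<zeta> - Tn (l i) f \<zeta>" .
  qed
  also have "\<dots> = Tn (l (2 * N)) f \<zeta> - Tn (l 0) f \<zeta>" by (rule sum_lessThan_telescope)
  also have "l (2 * N) = int N" by (simp add: l_def)
  also have "l 0 = - int N" by (simp add: l_def)
  \<comment> \<open>The set \<open>G\<close> depends on \<zeta>; cutting it down to the edges near
    the base vertex makes the constant independent of the point.\<close>
  also have "(\<Sum>e\<in>G. ?w e * Pavg M (cPsi e) bas) = (\<Sum>e\<in>(\<Union>i\<in>{..<2 * N}. NR bas (- int N + int i)). ?w e * Pavg M (cPsi e) bas)"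
  proof (rule sum.mono_neutral_right[OF fG])
    show "(\<Union>i\<in>{..<2 * N}. NR bas (- int N + int i)) \<subseteq> G" by (auto simp: G_def l_def)
    show "\<forall>e\<in>G - (\<Union>i\<in>{..<2 * N}. NR bas (- int N + int i)). ?w e * Pavg M (cPsi e) bas = 0"
    proof
      fix e assume e: "e \<in> G - (\<Union>i\<in>{..<2 * N}. NR bas (- int N + int i))"
      then obtain i where i: "i \<in> ?I" "e \<in> pairs (l i) \<zeta>" by (auto simp: G_def l_def)
      have "e \<in> Ed (l i)" using i(2) pairs_Ed[of "l i" \<zeta>] by blast
      moreover have "e \<notin> NR bas (l i)" using e i(1) by (auto simp: l_def)
      ultimately have "Pavg M (cPsi e) bas = 0" by (rule Pavg_Psi_bas_zero)
      then show "?w e * Pavg M (cPsi e) bas = 0" by simp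
    qed
  qed
  finally show "synth ?w \<zeta> = Tn (int N) f \<zeta> - Tn (- int N) f \<zeta>
    - (\<Sum>e\<in>(\<Union>i\<in>{..<2 * N}. NR bas (- int N + int i)). ?w e * Pavg M (cPsi e) bas)" .
qed

text \<open>Dominated convergence over the edges, with the integrand of \<open>synthable\<close> as
  majorant.\<close>

lemma cutoff_tendsto:
  assumes u: "synthable u"
  shows "(\<lambda>N. \<integral>\<^sup>+\<zeta>\<in>ball z0 R. ennreal (cmod (synth u \<zeta> - synth (cutoff N u) \<zeta>)) \<partial>M) \<longlonglongrightarrow> 0"
proof (rule tendsto_sandwich[OF _ _ tendsto_const])
  let ?g = "\<lambda>e. (\<integral>\<^sup>+\<zeta>\<in>ball z0 R. ennreal (cmod (tPsi e \<zeta>)) \<partial>M)"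
  define r where "r N e = u e - cutoff N u e" for N e
  have rle: "cmod (r N e) \<le> cmod (u e)" for N e by (simp add: r_def cutoff_def)
  have cle: "cmod (cutoff N u e) \<le> cmod (u e)" for N e by (simp add: cutoff_def)
  show "\<forall>\<^sub>F N in sequentially. 0 \<le> (\<integral>\<^sup>+\<zeta>\<in>ball z0 R. ennreal (cmod (synth u \<zeta> - synth (cutoff N u) \<zeta>)) \<partial>M)" by simp
  show "\<forall>\<^sub>F N in sequentially. (\<integral>\<^sup>+\<zeta>\<in>ball z0 R. ennreal (cmod (synth u \<zeta> - synth (cutoff N u) \<zeta>)) \<partial>M)
    \<le> (\<integral>\<^sup>+e. ennreal (cmod (r N e)) * ?g e \<partial>count_space EE)"
  proof (intro always_eventually allI)
    fix N
    have "AE \<zeta> in M. synth (\<lambda>e. cutoff N u e + r N e) \<zeta> = synth (cutoff N u) \<zeta> + synth (r N) \<zeta>"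
      using synthable_mono[OF u cle] synthable_mono[OF u rle] by (rule synth_add_AE)
    moreover have "(\<lambda>e. cutoff N u e + r N e) = u" by (simp add: r_def)
    ultimately have AE: "AE \<zeta> in M. synth u \<zeta> = synth (cutoff N u) \<zeta> + synth (r N) \<zeta>" by simp
    have "(\<integral>\<^sup>+\<zeta>\<in>ball z0 R. ennreal (cmod (synth u \<zeta> - synth (cutoff N u) \<zeta>)) \<partial>M) = (\<integral>\<^sup>+\<zeta>\<in>ball z0 R. ennreal (cmod (synth (r N) \<zeta>)) \<partial>M)"
    proof (rule nn_integral_cong_AE)
      show "AE \<zeta> in M. ennreal (cmod (synth u \<zeta> - synth (cutoff N u) \<zeta>)) * indicator (ball z0 R) \<zeta> = ennreal (cmod (synth (r N) \<zeta>)) * indicator (ball z0 R) \<zeta>"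
        using AE by (rule AE_mp) (intro AE_I2 impI, simp only: add_diff_cancel_left')
    qed
    also have "\<dots> \<le> (\<integral>\<^sup>+e. ennreal (cmod (r N e)) * ?g e \<partial>count_space EE)" by (rule nn_integral_synth_le)
    finally show "(\<integral>\<^sup>+\<zeta>\<in>ball z0 R. ennreal (cmod (synth u \<zeta> - synth (cutoff N u) \<zeta>)) \<partial>M)
      \<le> (\<integral>\<^sup>+e. ennreal (cmod (r N e)) * ?g e \<partial>count_space EE)" .
  qed
  have "(\<lambda>N. \<integral>\<^sup>+e. ennreal (cmod (r N e)) * ?g e \<partial>count_space EE) \<longlonglongrightarrow> (\<integral>\<^sup>+e. 0 \<partial>count_space EE)"
  proof (rule nn_integral_dominated_convergence[where w = "\<lambda>e. ennreal (cmod (u e)) * ?g e"])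
    show "(\<integral>\<^sup>+e. ennreal (cmod (u e)) * ?g e \<partial>count_space EE) < \<infinity>" using u by (simp add: synthable_def)
    show "AE e in count_space EE. ennreal (cmod (r N e)) * ?g e \<le> ennreal (cmod (u e)) * ?g e" for N
      by (intro AE_I2 mult_right_mono ennreal_leI rle) simp
    show "AE e in count_space EE. (\<lambda>N. ennreal (cmod (r N e)) * ?g e) \<longlonglongrightarrow> 0"
    proof (intro AE_I2 tendsto_eventually)
      fix e
      show "\<forall>\<^sub>F N in sequentially. ennreal (cmod (r N e)) * ?g e = 0"
      proof (rule eventually_sequentiallyI)
        fix N assume "nat \<bar>lev e\<bar> + 1 \<le> N"
        then have "- int N \<le> lev e \<and> lev e < int N" by linarith
        then have "r N e = 0" by (simp add: r_def cutoff_def)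
        then show "ennreal (cmod (r N e)) * ?g e = 0" by simp
      qed
    qed
  qed auto
  then show "(\<lambda>N. \<integral>\<^sup>+e. ennreal (cmod (r N e)) * ?g e \<partial>count_space EE) \<longlonglongrightarrow> 0" by simp
qed


text \<open>At level \<open>- (N + 1)\<close> every ball that contains \<zeta> or \<open>z0\<close>
  meets the ball of one vertex \<open>x1\<close>, so its average differs from that of
  \<open>x1\<close> by a difference along a horizontal edge, of order
  \<open>2 powr ((N + 1) * s)\<close>. The bumps vary by at most
  \<open>Lc * \<bar>R\<bar> / rad n\<close>, and the product decays for
  \<open>s < 1\<close>.\<close>

lemma Tn_low_osc:
  assumes bd: "\<And>e. e \<in> EE \<Longrightarrow> cmod (ana f e) \<le> we e powr (- a) * 2 powr (- (of_int (lev e) * s)) * K"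
    and a: "0 \<le> a" and K: "0 \<le> K" and R: "\<bar>R\<bar> + 1 \<le> 2 ^ N" and z: "\<zeta> \<in> ball z0 R"
  shows "cmod (Tn (- int (Suc N)) f \<zeta> - Tn (- int (Suc N)) f z0)
    \<le> 2 * real (Nc 1) * Lc * \<bar>R\<bar> * (vol z0 (1/2) powr (- a)) * K * (2 powr (s - 1)) ^ Suc N"
proof -
  define n where "n = - int (Suc N)"
  have rn: "rad n = 2 ^ Suc N"
  proof -
    have "rad n = 2 powr real (Suc N)" by (simp add: n_def add.commute)
    also have "\<dots> = 2 ^ Suc N" by (rule powr_realpow) simp
    finally show ?thesis .
  qed
  obtain x1 where x1: "x1 \<in> Xs n" "dist z0 x1 < rad n / 2" using Xs_cover by blast
  have sub: "ball z0 (rad n / 2) \<subseteq> Bx (n, x1)" unfolding Bx_ball fst_conv snd_conv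
    using x1(2) by (intro ball_subset) simp
  have "R < rad n / 2" "0 < rad n / 2" using R unfolding rn by auto
  then have in1: "\<zeta> \<in> Bx (n, x1)" "z0 \<in> Bx (n, x1)" using sub z by auto
  have "1 \<le> rad n" unfolding rn by (rule one_le_power) simp
  then have "ball z0 (1/2) \<subseteq> ball z0 (rad n / 2)" by (intro subset_ball) simp
  \<comment> \<open>A lower bound for the volume that is independent of the level; it keeps the
    factor \<open>wt (n, x1) powr (- a)\<close> bounded.\<close>
  then have "vol z0 (1/2) \<le> wt (n, x1)" unfolding fst_conv snd_conv using sub unfolding Bx_ball fst_conv snd_conv
    by (intro vol_mono) blast
  then have wle: "wt (n, x1) powr (- a) \<le> vol z0 (1/2) powr (- a)"
    using vol_pos[of "1/2" z0] a by (intro powr_mono2') auto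
  define D where "D = vol z0 (1/2) powr (- a) * 2 powr (- (of_int n * s)) * K"
  have D0: "0 \<le> D" using K by (simp add: D_def)
  let ?A = "act n \<zeta> \<union> act n z0"
  have Pd: "cmod (Pavg M f (n, \<xi>) - Pavg M f (n, x1)) \<le> D" if x: "\<xi> \<in> ?A" for \<xi>
  proof (cases "\<xi> = x1")
    case True
    then show ?thesis using D0 by simp
  next
    case False
    have xX: "\<xi> \<in> Xs n" "\<zeta> \<in> Bx (n, \<xi>) \<or> z0 \<in> Bx (n, \<xi>)" using x by (auto simp: act_def)
    have "(n, \<xi>) \<in> neighbors Xs (n, x1)"
      unfolding neighbors_def using xX in1 False by (auto simp: vertices_def)
    then have e: "((n, x1), (n, \<xi>)) \<in> EE" using x1(1) by (auto simp: EE_def Ed_def V_eq)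
    have "cmod (ana f ((n, x1), (n, \<xi>))) \<le> wt (n, x1) powr (- a) * 2 powr (- (of_int n * s)) * K"
      using bd[OF e] by simp
    also have "\<dots> \<le> D" unfolding D_def by (intro mult_right_mono wle K) simp
    finally show ?thesis by (simp add: ana_def)
  qed
  have one: "(\<Sum>\<xi>\<in>act n y. complex_of_real (psi (n, \<xi>) y)) = 1" for y
    using sum_psi[of n y] by (simp add: of_real_sum[symmetric] del: of_real_sum)
  have ext: "Tn n f y - Pavg M f (n, x1) = (\<Sum>\<xi>\<in>?A. (Pavg M f (n, \<xi>) - Pavg M f (n, x1)) * of_real (psi (n, \<xi>) y))"
    if y: "y = \<zeta> \<or> y = z0" for y
  proof -
    have "Tn n f y - Pavg M f (n, x1) = (\<Sum>\<xi>\<in>act n y. (Pavg M f (n, \<xi>) - Pavg M f (n, x1)) * of_real (psi (n, \<xi>) y))"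
      unfolding left_diff_distrib sum_subtractf sum_distrib_left[symmetric] one Tn_def by simp
    also have "\<dots> = (\<Sum>\<xi>\<in>?A. (Pavg M f (n, \<xi>) - Pavg M f (n, x1)) * of_real (psi (n, \<xi>) y))"
    proof (rule sum.mono_neutral_left)
      show "\<forall>\<xi>\<in>?A - act n y. (Pavg M f (n, \<xi>) - Pavg M f (n, x1)) * of_real (psi (n, \<xi>) y) = 0"
      proof
        fix \<xi> assume "\<xi> \<in> ?A - act n y"
        then have "y \<notin> Bx (n, \<xi>)" unfolding act_def by blast
        then have "psi (n, \<xi>) y = 0" by (rule psi_outside)
        then show "(Pavg M f (n, \<xi>) - Pavg M f (n, x1)) * of_real (psi (n, \<xi>) y) = 0" by simp
      qed
      show "act n y \<subseteq> ?A" using y by auto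
    qed simp
    finally show ?thesis .
  qed
  have "Tn n f \<zeta> - Tn n f z0 = (Tn n f \<zeta> - Pavg M f (n, x1)) - (Tn n f z0 - Pavg M f (n, x1))" by simp
  also have "\<dots> = (\<Sum>\<xi>\<in>?A. (Pavg M f (n, \<xi>) - Pavg M f (n, x1)) * of_real (psi (n, \<xi>) \<zeta> - psi (n, \<xi>) z0))"
    using ext[of \<zeta>] ext[of z0] by (simp add: sum_subtractf[symmetric] right_diff_distrib)
  also have "cmod \<dots> \<le> (\<Sum>\<xi>\<in>?A. D * (Lc * (\<bar>R\<bar> / rad n)))"
  proof (rule order_trans[OF norm_sum sum_mono])
    fix \<xi> assume x: "\<xi> \<in> ?A"
    have v: "(n, \<xi>) \<in> vertices Xs" using x by (auto simp: act_def vertices_def)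
    have "\<bar>psi (n, \<xi>) \<zeta> - psi (n, \<xi>) z0\<bar> \<le> Lc * (dist \<zeta> z0 / rad n)" using psi_lipschitz[OF v, of \<zeta> z0] by simp
    also have "\<dots> \<le> Lc * (\<bar>R\<bar> / rad n)" using z Lc_ge by (intro mult_left_mono divide_right_mono) (auto simp: dist_commute)
    finally have p: "\<bar>psi (n, \<xi>) \<zeta> - psi (n, \<xi>) z0\<bar> \<le> Lc * (\<bar>R\<bar> / rad n)" .
    show "cmod ((Pavg M f (n, \<xi>) - Pavg M f (n, x1)) * of_real (psi (n, \<xi>) \<zeta> - psi (n, \<xi>) z0)) \<le> D * (Lc * (\<bar>R\<bar> / rad n))"
      unfolding norm_mult norm_of_real by (intro mult_mono Pd x p D0) auto
  qed
  also have "\<dots> = real (card ?A) * (D * (Lc * (\<bar>R\<bar> / rad n)))" by simp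
  also have "\<dots> \<le> (2 * real (Nc 1)) * (D * (Lc * (\<bar>R\<bar> / rad n)))"
  proof (rule mult_right_mono)
    have "card ?A \<le> card (act n \<zeta>) + card (act n z0)" by (rule card_Un_le)
    also have "\<dots> \<le> Nc 1 + Nc 1" by (intro add_mono card_act)
    finally show "real (card ?A) \<le> 2 * real (Nc 1)" by linarith
    show "0 \<le> D * (Lc * (\<bar>R\<bar> / rad n))" using D0 Lc_ge by simp
  qed
  also have "\<dots> = 2 * real (Nc 1) * Lc * \<bar>R\<bar> * (vol z0 (1/2) powr (- a)) * K * (2 powr (- (of_int n * s)) / rad n)"
    unfolding D_def by (simp add: mult_ac)
  also have "2 powr (- (of_int n * s)) / rad n = (2 powr (s - 1)) ^ Suc N"
  proof -
    have "2 powr (- (of_int n * s)) / rad n = 2 powr (- (of_int n * s) - (- of_int n))" by (rule powr_diff[symmetric])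
    also have "\<dots> = 2 powr ((s - 1) * real (Suc N))" by (simp add: n_def algebra_simps)
    also have "\<dots> = (2 powr (s - 1)) ^ Suc N" by (simp only: powr_powr[symmetric] powr_realpow powr_gt_zero)
    finally show ?thesis .
  qed
  finally show ?thesis unfolding n_def .
qed

text \<open>By telescoping, \<open>h\<close> differs from a constant \<open>d N\<close> by the
  cutoff error, the error of \<open>Tn\<close> at the fine end and the oscillation of
  \<open>Tn\<close> at the coarse end, and all three tend to 0 in L1 on balls. Hence
  \<open>h\<close> is the limit of constants.\<close>

lemma synth_ana:
  assumes f: "loc_int M f" and u: "synthable (ana f)"
    and bd: "\<And>e. e \<in> EE \<Longrightarrow> cmod (ana f e) \<le> we e powr (- a) * 2 powr (- (of_int (lev e) * s)) * K"
    and a: "0 \<le> a" and K: "0 \<le> K" and s: "s < 1"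
  shows "ae_const M (\<lambda>\<zeta>. synth (ana f) \<zeta> - f \<zeta>)"
proof -
  define h where "h \<zeta> = synth (ana f) \<zeta> - f \<zeta>" for \<zeta>
  have hl: "loc_int M h" unfolding h_def by (intro loc_int_diff synth_loc_int u f)
  have "\<forall>N. \<exists>k. \<forall>\<zeta>. synth (cutoff N (ana f)) \<zeta> = Tn (int N) f \<zeta> - Tn (- int N) f \<zeta> - k"
    using synth_cutoff by blast
  from choice[OF this] obtain k where k: "\<And>N \<zeta>. synth (cutoff N (ana f)) \<zeta> = Tn (int N) f \<zeta> - Tn (- int N) f \<zeta> - k N" by blast
  \<comment> \<open>The value at \<open>z0\<close> stands in for the coarse smoothing, whose
    oscillation tends to 0 although it need not converge itself.\<close>
  define d where "d N = - (Tn (- int (Suc N)) f z0 + k (Suc N))" for N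
  define t where "t = 2 powr (s - 1)"
  have t: "0 < t" "t < 1" using s by (auto simp: t_def intro: powr_less_one)
  have lim: "(\<lambda>N. \<integral>\<^sup>+\<zeta>\<in>ball z0 R. ennreal (cmod (h \<zeta> - d N)) \<partial>M) \<longlonglongrightarrow> 0" for R
  proof -
    define W where "W = 2 * real (Nc 1) * Lc * \<bar>R\<bar> * (vol z0 (1/2) powr (- a)) * K"
    have W0: "0 \<le> W" using Lc_ge K by (simp add: W_def)
    define X where "X N = (\<integral>\<^sup>+\<zeta>\<in>ball z0 R. ennreal (cmod (synth (ana f) \<zeta> - synth (cutoff N (ana f)) \<zeta>)) \<partial>M)" for N
    define Y where "Y N = (\<integral>\<^sup>+\<zeta>\<in>ball z0 R. ennreal (cmod (Tn (int N) f \<zeta> - f \<zeta>)) \<partial>M)" for N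
    have XY: "X \<longlonglongrightarrow> 0" "Y \<longlonglongrightarrow> 0"
      unfolding X_def Y_def by (rule cutoff_tendsto[OF u], rule Tn_tendsto[OF f])
    have "(\<lambda>N. X (Suc N) + Y (Suc N) + ennreal (W * t ^ Suc N * vol z0 R)) \<longlonglongrightarrow> 0 + 0 + ennreal (W * 0 * vol z0 R)"
    proof (intro tendsto_add tendsto_ennrealI tendsto_mult tendsto_const)
      show "(\<lambda>N. X (Suc N)) \<longlonglongrightarrow> 0" "(\<lambda>N. Y (Suc N)) \<longlonglongrightarrow> 0" using XY by (auto intro: LIMSEQ_Suc)
      show "(\<lambda>N. t ^ Suc N) \<longlonglongrightarrow> 0" using t by (intro LIMSEQ_Suc LIMSEQ_power_zero) simp
    qed
    then have up: "(\<lambda>N. X (Suc N) + Y (Suc N) + ennreal (W * t ^ Suc N * vol z0 R)) \<longlonglongrightarrow> 0" by simp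
    obtain N0 where N0: "\<bar>R\<bar> + 1 < 2 ^ N0" using real_arch_pow[of 2 "\<bar>R\<bar> + 1"] by auto
    show ?thesis
    proof (rule tendsto_sandwich[OF _ _ tendsto_const up])
      show "\<forall>\<^sub>F N in sequentially. (\<integral>\<^sup>+\<zeta>\<in>ball z0 R. ennreal (cmod (h \<zeta> - d N)) \<partial>M)
         \<le> X (Suc N) + Y (Suc N) + ennreal (W * t ^ Suc N * vol z0 R)"
      proof (rule eventually_sequentiallyI)
        fix N assume "N0 \<le> N"
        then have "(2::real) ^ N0 \<le> 2 ^ N" by (intro power_increasing) auto
        then have RN: "\<bar>R\<bar> + 1 \<le> 2 ^ N" using N0 by linarith
        let ?c = "W * t ^ Suc N"
        have c0: "0 \<le> ?c" using W0 t by simp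
        let ?p = "\<lambda>\<zeta>. ennreal (cmod (synth (ana f) \<zeta> - synth (cutoff (Suc N) (ana f)) \<zeta>)) * indicator (ball z0 R) \<zeta>"
        let ?q = "\<lambda>\<zeta>. ennreal (cmod (Tn (int (Suc N)) f \<zeta> - f \<zeta>)) * indicator (ball z0 R) \<zeta>"
        let ?r = "\<lambda>\<zeta>. ennreal ?c * indicator (ball z0 R) \<zeta>"
        have cm: "synth (cutoff (Suc N) (ana f)) \<in> borel_measurable M"
          by (rule loc_int_measurable[OF synth_loc_int[OF synthable_mono[OF u]]]) (simp add: cutoff_def)
        have pm: "?p \<in> borel_measurable M"
        proof (intro borel_measurable_times_ennreal borel_measurable_indicator ball_sets)
          show "(\<lambda>\<zeta>. ennreal (cmod (synth (ana f) \<zeta> - synth (cutoff (Suc N) (ana f)) \<zeta>))) \<in> borel_measurable M"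
            using cm loc_int_measurable[OF synth_loc_int[OF u]] by measurable
        qed
        have qm: "?q \<in> borel_measurable M"
        proof (intro borel_measurable_times_ennreal borel_measurable_indicator ball_sets)
          show "(\<lambda>\<zeta>. ennreal (cmod (Tn (int (Suc N)) f \<zeta> - f \<zeta>))) \<in> borel_measurable M"
            using Tn_measurable[of "int (Suc N)" f] loc_int_measurable[OF f] by measurable
        qed
        have rm: "?r \<in> borel_measurable M"
          by (intro borel_measurable_times_ennreal borel_measurable_const borel_measurable_indicator ball_sets)
        have "(\<integral>\<^sup>+\<zeta>\<in>ball z0 R. ennreal (cmod (h \<zeta> - d N)) \<partial>M) \<le> (\<integral>\<^sup>+\<zeta>. ?p \<zeta> + ?q \<zeta> + ?r \<zeta> \<partial>M)"
        proof (rule nn_integral_mono)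
          fix \<zeta>
          show "ennreal (cmod (h \<zeta> - d N)) * indicator (ball z0 R) \<zeta> \<le> ?p \<zeta> + ?q \<zeta> + ?r \<zeta>"
          proof (cases "\<zeta> \<in> ball z0 R")
            case True
            then have i: "indicator (ball z0 R) \<zeta> = (1::ennreal)" by (rule indicator_simps(1))
            let ?P = "synth (ana f) \<zeta> - synth (cutoff (Suc N) (ana f)) \<zeta>" and ?Q = "Tn (int (Suc N)) f \<zeta> - f \<zeta>"
              and ?S = "Tn (- int (Suc N)) f \<zeta> - Tn (- int (Suc N)) f z0"
            have "h \<zeta> - d N = ?P + ?Q - ?S" unfolding h_def d_def k by simp
            then have "cmod (h \<zeta> - d N) \<le> cmod (?P + ?Q) + cmod ?S" by (metis norm_triangle_ineq4)
            also have "\<dots> \<le> cmod ?P + cmod ?Q + ?c"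
              using norm_triangle_ineq[of ?P ?Q] Tn_low_osc[OF bd a K RN True] unfolding W_def t_def by linarith
            finally have "ennreal (cmod (h \<zeta> - d N)) \<le> ennreal (cmod ?P + cmod ?Q + ?c)" by (rule ennreal_leI)
            also have "\<dots> = ennreal (cmod ?P) + ennreal (cmod ?Q) + ennreal ?c"
              using c0 by (simp only: ennreal_plus norm_ge_zero add_nonneg_nonneg)
            finally show ?thesis unfolding i mult_1_right .
          next
            case False
            then have i: "indicator (ball z0 R) \<zeta> = (0::ennreal)" by (rule indicator_simps(2))
            show ?thesis unfolding i by simp
          qed
        qed
        also have "\<dots> = X (Suc N) + Y (Suc N) + (\<integral>\<^sup>+\<zeta>. ?r \<zeta> \<partial>M)"
          unfolding X_def Y_def
          by (subst nn_integral_add[OF borel_measurable_add[OF pm qm] rm], subst nn_integral_add[OF pm qm]) (rule refl)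
        also have "(\<integral>\<^sup>+\<zeta>. ?r \<zeta> \<partial>M) = ennreal ?c * emeasure M (ball z0 R)" by (rule nn_integral_cmult_indicator[OF ball_sets])
        also have "\<dots> = ennreal (?c * vol z0 R)" unfolding emeasure_ball using c0 vol_nonneg by (simp only: ennreal_mult)
        finally show "(\<integral>\<^sup>+\<zeta>\<in>ball z0 R. ennreal (cmod (h \<zeta> - d N)) \<partial>M) \<le> X (Suc N) + Y (Suc N) + ennreal (?c * vol z0 R)" .
      qed
    qed simp
  qed
  \<comment> \<open>The constants \<open>d N\<close> converge to this number, since L1 convergence
    on the base ball carries over to the average over it.\<close>
  define m where "m = Pavg M h bas"
  have dm: "(\<lambda>N. ennreal (cmod (d N - m))) \<longlonglongrightarrow> 0"
  proof (rule tendsto_sandwich[OF _ _ tendsto_const])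
    have "(\<lambda>N. ennreal (1 / wt bas) * (\<integral>\<^sup>+\<zeta>\<in>ball z0 1. ennreal (cmod (h \<zeta> - d N)) \<partial>M)) \<longlonglongrightarrow> ennreal (1 / wt bas) * 0"
      by (rule tendsto_mult_ennreal[OF tendsto_const lim]) simp
    then show "(\<lambda>N. ennreal (1 / wt bas) * (\<integral>\<^sup>+\<zeta>\<in>ball z0 1. ennreal (cmod (h \<zeta> - d N)) \<partial>M)) \<longlonglongrightarrow> 0" by simp
    show "\<forall>\<^sub>F N in sequentially. ennreal (cmod (d N - m)) \<le> ennreal (1 / wt bas) * (\<integral>\<^sup>+\<zeta>\<in>ball z0 1. ennreal (cmod (h \<zeta> - d N)) \<partial>M)"
    proof (intro always_eventually allI)
      fix N
      have B: "Bx bas = ball z0 1" unfolding Bx_ball bas(2) by simp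
      have "Pavg M (\<lambda>\<zeta>. h \<zeta> - d N) bas = m - d N" unfolding m_def Pavg_diff[OF hl loc_int_const] Pavg_const by (rule refl)
      then have "ennreal (cmod (d N - m) * wt bas) \<le> (\<integral>\<^sup>+\<zeta>\<in>ball z0 1. ennreal (cmod (h \<zeta> - d N)) \<partial>M)"
        using Pavg_norm_le[OF loc_int_diff[OF hl loc_int_const[of "d N"]], of bas] unfolding B by (simp add: norm_minus_commute)
      then have "ennreal (1 / wt bas) * ennreal (cmod (d N - m) * wt bas) \<le> ennreal (1 / wt bas) * (\<integral>\<^sup>+\<zeta>\<in>ball z0 1. ennreal (cmod (h \<zeta> - d N)) \<partial>M)"
        by (intro mult_left_mono) auto
      moreover have "ennreal (1 / wt bas) * ennreal (cmod (d N - m) * wt bas) = ennreal (cmod (d N - m))"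
        using wt_pos[of bas] by (subst ennreal_mult[symmetric]) (auto simp: vol_nonneg)
      ultimately show "ennreal (cmod (d N - m)) \<le> ennreal (1 / wt bas) * (\<integral>\<^sup>+\<zeta>\<in>ball z0 1. ennreal (cmod (h \<zeta> - d N)) \<partial>M)" by simp
    qed
  qed simp
  have zero: "(\<integral>\<^sup>+\<zeta>\<in>ball z0 R. ennreal (cmod (h \<zeta> - m)) \<partial>M) = 0" for R
  proof -
    let ?L = "(\<integral>\<^sup>+\<zeta>\<in>ball z0 R. ennreal (cmod (h \<zeta> - m)) \<partial>M)"
    have le: "?L \<le> (\<integral>\<^sup>+\<zeta>\<in>ball z0 R. ennreal (cmod (h \<zeta> - d N)) \<partial>M) + ennreal (cmod (d N - m)) * ennreal (vol z0 R)" for N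
    proof -
      have hm: "(\<lambda>\<zeta>. ennreal (cmod (h \<zeta> - d N)) * indicator (ball z0 R) \<zeta>) \<in> borel_measurable M"
      proof (intro borel_measurable_times_ennreal borel_measurable_indicator ball_sets)
        show "(\<lambda>\<zeta>. ennreal (cmod (h \<zeta> - d N))) \<in> borel_measurable M" using loc_int_measurable[OF hl] by measurable
      qed
      have cm: "(\<lambda>\<zeta>. ennreal (cmod (d N - m)) * indicator (ball z0 R) \<zeta>) \<in> borel_measurable M"
        by (intro borel_measurable_times_ennreal borel_measurable_const borel_measurable_indicator ball_sets)
      have "?L \<le> (\<integral>\<^sup>+\<zeta>. ennreal (cmod (h \<zeta> - d N)) * indicator (ball z0 R) \<zeta> + ennreal (cmod (d N - m)) * indicator (ball z0 R) \<zeta> \<partial>M)"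
      proof (rule nn_integral_mono)
        fix \<zeta>
        have "cmod (h \<zeta> - m) \<le> cmod (h \<zeta> - d N) + cmod (d N - m)" using norm_triangle_ineq[of "h \<zeta> - d N" "d N - m"] by simp
        then have "ennreal (cmod (h \<zeta> - m)) \<le> ennreal (cmod (h \<zeta> - d N) + cmod (d N - m))" by (rule ennreal_leI)
        also have "\<dots> = ennreal (cmod (h \<zeta> - d N)) + ennreal (cmod (d N - m))" by (rule ennreal_plus) auto
        finally have "ennreal (cmod (h \<zeta> - m)) * indicator (ball z0 R) \<zeta> \<le> (ennreal (cmod (h \<zeta> - d N)) + ennreal (cmod (d N - m))) * indicator (ball z0 R) \<zeta>"
          by (intro mult_right_mono) auto
        then show "ennreal (cmod (h \<zeta> - m)) * indicator (ball z0 R) \<zeta>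
           \<le> ennreal (cmod (h \<zeta> - d N)) * indicator (ball z0 R) \<zeta> + ennreal (cmod (d N - m)) * indicator (ball z0 R) \<zeta>"
          by (simp only: distrib_right)
      qed
      also have "\<dots> = (\<integral>\<^sup>+\<zeta>\<in>ball z0 R. ennreal (cmod (h \<zeta> - d N)) \<partial>M) + (\<integral>\<^sup>+\<zeta>. ennreal (cmod (d N - m)) * indicator (ball z0 R) \<zeta> \<partial>M)"
        by (rule nn_integral_add[OF hm cm])
      also have "(\<integral>\<^sup>+\<zeta>. ennreal (cmod (d N - m)) * indicator (ball z0 R) \<zeta> \<partial>M) = ennreal (cmod (d N - m)) * ennreal (vol z0 R)"
        unfolding nn_integral_cmult_indicator[OF ball_sets] emeasure_ball by (rule refl)
      finally show ?thesis .
    qed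
    have "(\<lambda>N. (\<integral>\<^sup>+\<zeta>\<in>ball z0 R. ennreal (cmod (h \<zeta> - d N)) \<partial>M) + ennreal (cmod (d N - m)) * ennreal (vol z0 R)) \<longlonglongrightarrow> 0 + 0 * ennreal (vol z0 R)"
      by (intro tendsto_add lim tendsto_mult_ennreal dm tendsto_const) simp
    then have "?L \<le> 0 + 0 * ennreal (vol z0 R)" by (rule LIMSEQ_le_const) (use le in blast)
    then show ?thesis by simp
  qed
  have "AE \<zeta> in M. \<forall>j::nat. \<zeta> \<in> ball z0 (real j) \<longrightarrow> h \<zeta> = m"
    unfolding AE_all_countable
  proof
    fix j :: nat
    have "(\<lambda>\<zeta>. ennreal (cmod (h \<zeta> - m)) * indicator (ball z0 (real j)) \<zeta>) \<in> borel_measurable M"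
    proof (intro borel_measurable_times_ennreal borel_measurable_indicator ball_sets)
      show "(\<lambda>\<zeta>. ennreal (cmod (h \<zeta> - m))) \<in> borel_measurable M" using loc_int_measurable[OF hl] by measurable
    qed
    from nn_integral_0_iff_AE[OF this] zero[of "real j"]
    have "AE \<zeta> in M. ennreal (cmod (h \<zeta> - m)) * indicator (ball z0 (real j)) \<zeta> = 0" by simp
    then show "AE \<zeta> in M. \<zeta> \<in> ball z0 (real j) \<longrightarrow> h \<zeta> = m"
    proof (rule AE_mp, intro AE_I2 impI)
      fix \<zeta> assume e: "ennreal (cmod (h \<zeta> - m)) * indicator (ball z0 (real j)) \<zeta> = 0" and "\<zeta> \<in> ball z0 (real j)"
      then have i: "indicator (ball z0 (real j)) \<zeta> = (1::ennreal)" by (intro indicator_simps(1))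
      have "ennreal (cmod (h \<zeta> - m)) = 0" using e unfolding i mult_1_right .
      then show "h \<zeta> = m" by simp
    qed
  qed
  then have "AE \<zeta> in M. h \<zeta> = m"
  proof (rule AE_mp, intro AE_I2 impI)
    fix \<zeta> assume a: "\<forall>j::nat. \<zeta> \<in> ball z0 (real j) \<longrightarrow> h \<zeta> = m"
    obtain j :: nat where "dist z0 \<zeta> < real j" using reals_Archimedean2 by blast
    then have "\<zeta> \<in> ball z0 (real j)" by simp
    then show "h \<zeta> = m" by (rule a[rule_format])
  qed
  then show ?thesis unfolding ae_const_def h_def by blast
qed

end

section \<open>Besov quasi-norms as mixed sequence quasi-norms\<close>

lemma mixed_level:
  assumes u: "mixed I w a b s u K" and c: "0 \<le> c"
    and T: "\<And>n U. bl a w (I n) u U \<Longrightarrow> bl a w' (I' n) v (c * U)"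
  shows "mixed I' w' a b s v (c * K)"
proof -
  obtain U where U: "\<And>n. bl a w (I n) u (U n)" "bl b (\<lambda>_. 1) UNIV (\<lambda>n. 2 powr (of_int n * s) * U n) K"
    using u by (auto simp: mixed_def)
  have "bl b (\<lambda>_. 1) UNIV (\<lambda>n. c * (2 powr (of_int n * s) * U n)) (c * K)" by (rule bl_scale[OF U(2) c])
  then have "bl b (\<lambda>_. 1) UNIV (\<lambda>n. 2 powr (of_int n * s) * (c * U n)) (c * K)" by (simp only: mult_ac)
  then show ?thesis unfolding mixed_def using T[OF U(1)] by (intro exI[of _ "\<lambda>n. c * U n"]) auto
qed

lemma epowr_mono: "x \<le> y \<Longrightarrow> 0 \<le> a \<Longrightarrow> epowr x a \<le> epowr y a"
  unfolding epowr_def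
  by (auto intro!: ennreal_leI powr_mono2 enn2real_mono simp: less_top top_unique)

lemma epowr_ennreal: "0 \<le> x \<Longrightarrow> epowr (ennreal x) a = ennreal (x powr a)"
  by (simp add: epowr_def)

lemma epowr_le_D:
  assumes "epowr X (1 / r) \<le> ennreal U" "0 < r" "0 \<le> U"
  shows "X \<le> ennreal (U powr r)"
proof (cases X)
  case (real x)
  then have "ennreal (x powr (1/r)) \<le> ennreal U" using assms by (simp add: epowr_ennreal)
  then have "x powr (1/r) \<le> U" using assms by (simp add: ennreal_le_iff)
  then have "(x powr (1/r)) powr r \<le> U powr r" using assms by (intro powr_mono2) auto
  then show ?thesis using real assms by (simp add: powr_powr ennreal_leI)
next
  case top
  then show ?thesis using assms(1) by (simp add: epowr_def top_unique)
qed

lemma epowr_le_I: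
  assumes "X \<le> ennreal (U powr r)" "0 < r" "0 \<le> U"
  shows "epowr X (1 / r) \<le> ennreal U"
proof -
  have "epowr X (1 / r) \<le> epowr (ennreal (U powr r)) (1 / r)" using assms by (intro epowr_mono) auto
  also have "\<dots> = ennreal U" using assms by (simp add: epowr_ennreal powr_powr)
  finally show ?thesis .
qed

text \<open>Translates exponents into the inverse parametrization of \<open>bl\<close>: infinity
  corresponds to 0, a positive real \<open>r\<close> to \<open>1 / r\<close>.\<close>

lemma exponent_cases:
  fixes p :: ennreal
  assumes "0 < p"
  obtains "p = \<infinity>" "enn2real (inverse p) = 0" | r where "0 < r" "p = ennreal r" "p \<noteq> \<infinity>" "enn2real p = r" "enn2real (inverse p) = 1 / r"
proof (cases p)
  case (real r)
  then have "0 < r" using assms by simp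
  then show thesis using that(2)[of r] real by (simp add: inverse_ennreal divide_inverse)
next
  case top
  then show thesis using that(1) by simp
qed

lemma I_qnorm_le:
  assumes q: "0 < q" and c: "0 \<le> c" and L: "\<And>k. Lp_qnorm M p (layer Xs u k) \<le> ennreal (c * U k)"
    and U: "\<And>k. 0 \<le> U k" "bl (enn2real (inverse q)) (\<lambda>_. 1) UNIV (\<lambda>n. 2 powr (of_int n * s) * U n) K"
  shows "I_qnorm M Xs s p q u \<le> ennreal (c * K)"
proof -
  have K0: "0 \<le> K" using bl_nonneg[OF U(2)] .
  have le: "ennreal (2 powr (of_int k * s)) * Lp_qnorm M p (layer Xs u k) \<le> ennreal (c * (2 powr (of_int k * s) * U k))" for k
  proof -
    have "ennreal (2 powr (of_int k * s)) * Lp_qnorm M p (layer Xs u k) \<le> ennreal (2 powr (of_int k * s)) * ennreal (c * U k)"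
      by (intro mult_left_mono L) simp
    also have "\<dots> = ennreal (c * (2 powr (of_int k * s) * U k))" using c U(1)[of k] by (simp add: ennreal_mult[symmetric] mult_ac)
    finally show ?thesis .
  qed
  show ?thesis
    using q
  proof (cases rule: exponent_cases)
    case 1
    have "ennreal (c * (2 powr (of_int k * s) * U k)) \<le> ennreal (c * K)" for k
      using bl_zeroD[OF U(2)[unfolded 1(2)], of k] U(1)[of k] c by (intro ennreal_leI mult_left_mono) auto
    then show ?thesis using 1 le by (auto simp: I_qnorm_def intro!: SUP_least intro: order_trans)
  next
    case (2 r)
    have "(\<integral>\<^sup>+k. epowr (ennreal (2 powr (of_int k * s)) * Lp_qnorm M p (layer Xs u k)) r \<partial>count_space UNIV) \<le> ennreal ((c * K) powr r)"
    proof (rule nn_integral_count_space_le)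
      fix F :: "int set" assume F: "finite F"
      have "(\<Sum>k\<in>F. epowr (ennreal (2 powr (of_int k * s)) * Lp_qnorm M p (layer Xs u k)) r)
         \<le> (\<Sum>k\<in>F. ennreal ((c * (2 powr (of_int k * s) * U k)) powr r))"
      proof (rule sum_mono)
        fix k
        have "epowr (ennreal (2 powr (of_int k * s)) * Lp_qnorm M p (layer Xs u k)) r \<le> epowr (ennreal (c * (2 powr (of_int k * s) * U k))) r"
          using 2 by (intro epowr_mono le) simp
        also have "\<dots> = ennreal ((c * (2 powr (of_int k * s) * U k)) powr r)" using c U(1)[of k] by (intro epowr_ennreal) simp
        finally show "epowr (ennreal (2 powr (of_int k * s)) * Lp_qnorm M p (layer Xs u k)) r \<le> ennreal ((c * (2 powr (of_int k * s) * U k)) powr r)" .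
      qed
      also have "\<dots> = ennreal (\<Sum>k\<in>F. (c * (2 powr (of_int k * s) * U k)) powr r)" by (rule sum_ennreal) simp
      also have "(\<Sum>k\<in>F. (c * (2 powr (of_int k * s) * U k)) powr r) = c powr r * (\<Sum>k\<in>F. 1 * \<bar>2 powr (of_int k * s) * U k\<bar> powr r)"
        using U(1) by (simp add: sum_distrib_left powr_mult)
      also have "\<dots> \<le> c powr r * K powr r"
        using bl_posD[OF U(2) _ F] 2 by (intro mult_left_mono) auto
      also have "\<dots> = (c * K) powr r" by (simp add: powr_mult)
      finally show "(\<Sum>k\<in>F. epowr (ennreal (2 powr (of_int k * s)) * Lp_qnorm M p (layer Xs u k)) r) \<le> ennreal ((c * K) powr r)"
        by (simp add: ennreal_leI)
    qed simp
    then show ?thesis using 2 c K0 by (simp add: I_qnorm_def epowr_le_I)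
  qed
qed

lemma I_qnorm_D:
  assumes q: "0 < q" and I: "I_qnorm M Xs s p q u \<le> ennreal K" and K: "0 \<le> K"
  shows "\<exists>U. (\<forall>k. 0 \<le> U k \<and> Lp_qnorm M p (layer Xs u k) \<le> ennreal (U k)) \<and> bl (enn2real (inverse q)) (\<lambda>_. 1) UNIV (\<lambda>n. 2 powr (of_int n * s) * U n) K"
proof -
  let ?X = "\<lambda>k. ennreal (2 powr (of_int k * s)) * Lp_qnorm M p (layer Xs u k)"
  define U where "U k = enn2real (Lp_qnorm M p (layer Xs u k))" for k
  have U0: "0 \<le> U k" for k by (simp add: U_def)
  have fin: "Lp_qnorm M p (layer Xs u k) < \<infinity>" if "?X k < \<infinity>" for k
    using that by (auto simp: ennreal_mult_less_top less_top)
  have XU: "?X k = ennreal (2 powr (of_int k * s) * U k)" and LU: "Lp_qnorm M p (layer Xs u k) = ennreal (U k)" if "?X k < \<infinity>" for k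
  proof -
    show L: "Lp_qnorm M p (layer Xs u k) = ennreal (U k)" using fin[OF that] by (simp add: U_def)
    show "?X k = ennreal (2 powr (of_int k * s) * U k)" unfolding L using U0 by (simp add: ennreal_mult)
  qed
  show ?thesis
    using q
  proof (cases rule: exponent_cases)
    case 1
    have "?X k \<le> ennreal K" for k using I 1 unfolding I_qnorm_def by (auto simp: SUP_le_iff)
    note X = this le_less_trans[OF this ennreal_less_top, folded infinity_ennreal_def]
    have "2 powr (of_int k * s) * U k \<le> K" for k using X(1)[of k] XU[OF X(2)] K by simp
    then have "bl 0 (\<lambda>_. 1) UNIV (\<lambda>n. 2 powr (of_int n * s) * U n) K" using K U0 by (simp add: bl_def)
    then show ?thesis using LU[OF X(2)] U0 unfolding 1(2) by (intro exI[of _ U]) auto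
  next
    case (2 r)
    have J: "(\<integral>\<^sup>+k. epowr (?X k) r \<partial>count_space UNIV) \<le> ennreal (K powr r)"
      using I 2 K unfolding I_qnorm_def by (simp add: epowr_le_D)
    have S: "(\<Sum>k\<in>F. epowr (?X k) r) \<le> ennreal (K powr r)" if "finite F" for F
      using sum_le_nn_integral_count_space[OF that, of UNIV "\<lambda>k. epowr (?X k) r"] J by (auto intro: order_trans)
    \<comment> \<open>A level of infinite quasi-norm would already make one term of the sum
      infinite; hence the reals \<open>U k\<close> represent all levels faithfully.\<close>
    have X: "?X k < \<infinity>" for k
    proof -
      have le: "epowr (?X k) r \<le> ennreal (K powr r)" using S[of "{k}"] by simp
      show ?thesis
      proof (rule ccontr)
        assume "\<not> ?X k < \<infinity>"
        then have t: "?X k = top" by (simp only: infinity_ennreal_def not_less top_unique)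
        have "epowr (top::ennreal) r = top" by (simp add: epowr_def)
        then have "top \<le> ennreal (K powr r)" using le unfolding t by (simp only:)
        then show False by (simp only: top_unique ennreal_neq_top)
      qed
    qed
    have "(\<Sum>k\<in>F. 1 * \<bar>2 powr (of_int k * s) * U k\<bar> powr r) \<le> K powr r" if F: "finite F" for F
    proof -
      have "ennreal (\<Sum>k\<in>F. 1 * \<bar>2 powr (of_int k * s) * U k\<bar> powr r) = (\<Sum>k\<in>F. epowr (?X k) r)"
      proof -
        have "epowr (?X k) r = ennreal (1 * \<bar>2 powr (of_int k * s) * U k\<bar> powr r)" for k
        proof -
          have "0 \<le> 2 powr (of_int k * s) * U k" using U0 by simp
          then show ?thesis unfolding XU[OF X] by (simp only: epowr_ennreal abs_of_nonneg mult_1)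
        qed
        then have "(\<Sum>k\<in>F. epowr (?X k) r) = (\<Sum>k\<in>F. ennreal (1 * \<bar>2 powr (of_int k * s) * U k\<bar> powr r))" by (simp only:)
        also have "\<dots> = ennreal (\<Sum>k\<in>F. 1 * \<bar>2 powr (of_int k * s) * U k\<bar> powr r)" by (rule sum_ennreal) simp
        finally show ?thesis by (rule sym)
      qed
      also have "\<dots> \<le> ennreal (K powr r)" by (rule S[OF F])
      finally show ?thesis by (simp add: ennreal_le_iff)
    qed
    then have "bl (1/r) (\<lambda>_. 1) UNIV (\<lambda>n. 2 powr (of_int n * s) * U n) K" using K 2 by (simp add: bl_def)
    then show ?thesis using LU[OF X] U0 unfolding 2(5) by (intro exI[of _ U]) auto
  qed
qed

context filling
begin

lemma layer_eq: "layer Xs u k \<zeta> = (\<Sum>\<xi>\<in>act k \<zeta>. \<bar>u (k, \<xi>)\<bar>)"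
  by (simp add: layer_def act_def)

text \<open>Writing the locally finite sum as an integral over the fixed set \<open>Xs k\<close>
  gives access to Fubini's theorem and to the measurability of integrals with a parameter.\<close>

lemma ennreal_sum_act:
  fixes g :: "'z \<Rightarrow> real"
  assumes "\<And>\<xi>. 0 \<le> g \<xi>"
  shows "ennreal (\<Sum>\<xi>\<in>act k \<zeta>. g \<xi>) = (\<integral>\<^sup>+\<xi>. ennreal (g \<xi>) * indicator (Bx (k, \<xi>)) \<zeta> \<partial>count_space (Xs k))"
proof -
  have "(\<integral>\<^sup>+\<xi>. ennreal (g \<xi>) * indicator (Bx (k, \<xi>)) \<zeta> \<partial>count_space (Xs k)) = (\<Sum>\<xi>\<in>act k \<zeta>. ennreal (g \<xi>) * indicator (Bx (k, \<xi>)) \<zeta>)"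
    by (rule nn_integral_count_space'[OF finite_act]) (auto simp: act_def)
  also have "\<dots> = (\<Sum>\<xi>\<in>act k \<zeta>. ennreal (g \<xi>))" by (intro sum.cong refl) (simp add: act_def)
  finally show ?thesis using assms by (simp add: sum_ennreal)
qed

lemma sum_act_measurable:
  fixes g :: "'z \<Rightarrow> real"
  assumes "\<And>\<xi>. 0 \<le> g \<xi>"
  shows "(\<lambda>\<zeta>. \<Sum>\<xi>\<in>act k \<zeta>. g \<xi>) \<in> borel_measurable M"
proof -
  have m: "(\<lambda>(\<xi>, \<zeta>). ennreal (g \<xi>) * indicator (Bx (k, \<xi>)) \<zeta>) \<in> borel_measurable (count_space (Xs k) \<Otimes>\<^sub>M M)"
  proof (rule measurable_pair_measure_countable1[OF countable_Xs])
    fix \<xi>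
    show "(\<lambda>\<zeta>. case (\<xi>, \<zeta>) of (\<xi>, \<zeta>) \<Rightarrow> ennreal (g \<xi>) * indicator (Bx (k, \<xi>)) \<zeta>) \<in> borel_measurable M"
      unfolding prod.case by (intro borel_measurable_times_ennreal borel_measurable_const borel_measurable_indicator Bx_sets)
  qed
  have "(\<lambda>\<zeta>. \<integral>\<^sup>+\<xi>. ennreal (g \<xi>) * indicator (Bx (k, \<xi>)) \<zeta> \<partial>count_space (Xs k)) \<in> borel_measurable M"
  proof (rule sigma_finite_measure.borel_measurable_nn_integral)
    show "sigma_finite_measure (count_space (Xs k))" by (rule sigma_finite_measure_count_space_countable[OF countable_Xs])
    show "(\<lambda>(\<zeta>, \<xi>). ennreal (g \<xi>) * indicator (Bx (k, \<xi>)) \<zeta>) \<in> borel_measurable (M \<Otimes>\<^sub>M count_space (Xs k))"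
      using measurable_pair_swap[OF m] by (simp add: case_prod_unfold)
  qed
  then have "(\<lambda>\<zeta>. enn2real (ennreal (\<Sum>\<xi>\<in>act k \<zeta>. g \<xi>))) \<in> borel_measurable M"
    unfolding ennreal_sum_act[OF assms] by measurable
  then show ?thesis using assms by (simp add: sum_nonneg)
qed

lemma nn_integral_sum_act:
  fixes g :: "'z \<Rightarrow> real"
  assumes "\<And>\<xi>. 0 \<le> g \<xi>"
  shows "(\<integral>\<^sup>+\<zeta>. ennreal (\<Sum>\<xi>\<in>act k \<zeta>. g \<xi>) \<partial>M) = (\<integral>\<^sup>+\<xi>. ennreal (g \<xi> * wt (k, \<xi>)) \<partial>count_space (Xs k))"
proof -
  have m: "(\<lambda>(\<xi>, \<zeta>). ennreal (g \<xi>) * indicator (Bx (k, \<xi>)) \<zeta>) \<in> borel_measurable (count_space (Xs k) \<Otimes>\<^sub>M M)"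
  proof (rule measurable_pair_measure_countable1[OF countable_Xs])
    fix \<xi>
    show "(\<lambda>\<zeta>. case (\<xi>, \<zeta>) of (\<xi>, \<zeta>) \<Rightarrow> ennreal (g \<xi>) * indicator (Bx (k, \<xi>)) \<zeta>) \<in> borel_measurable M"
      unfolding prod.case by (intro borel_measurable_times_ennreal borel_measurable_const borel_measurable_indicator Bx_sets)
  qed
  interpret P: pair_sigma_finite "count_space (Xs k)" M
    by (intro pair_sigma_finite.intro sigma_finite_measure_count_space_countable countable_Xs sigma_finite_M)
  have "(\<integral>\<^sup>+\<zeta>. ennreal (\<Sum>\<xi>\<in>act k \<zeta>. g \<xi>) \<partial>M) = (\<integral>\<^sup>+\<xi>. (\<integral>\<^sup>+\<zeta>. ennreal (g \<xi>) * indicator (Bx (k, \<xi>)) \<zeta> \<partial>M) \<partial>count_space (Xs k))"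
    unfolding ennreal_sum_act[OF assms] by (rule P.Fubini'[OF m])
  also have "\<dots> = (\<integral>\<^sup>+\<xi>. ennreal (g \<xi> * wt (k, \<xi>)) \<partial>count_space (Xs k))"
  proof (rule nn_integral_cong)
    fix \<xi>
    have "(\<integral>\<^sup>+\<zeta>. ennreal (g \<xi>) * indicator (Bx (k, \<xi>)) \<zeta> \<partial>M) = ennreal (g \<xi>) * emeasure M (Bx (k, \<xi>))"
      by (rule nn_integral_cmult_indicator[OF Bx_sets])
    also have "\<dots> = ennreal (g \<xi> * wt (k, \<xi>))" unfolding Bx_ball emeasure_ball using assms vol_nonneg by (simp add: ennreal_mult)
    finally show "(\<integral>\<^sup>+\<zeta>. ennreal (g \<xi>) * indicator (Bx (k, \<xi>)) \<zeta> \<partial>M) = ennreal (g \<xi> * wt (k, \<xi>))" .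
  qed
  finally show ?thesis .
qed

text \<open>At most \<open>Nc 1\<close> balls of a level overlap, so powers of the layer function
  are controlled by sums of powers, whose integral is a sum weighted by volumes.\<close>

lemma Lp_layer_le:
  assumes p: "0 < p" and u: "bl (enn2real (inverse p)) wt (V k) u U"
  shows "Lp_qnorm M p (layer Xs u k) \<le> ennreal (real (Nc 1) * U)"
proof -
  have U0: "0 \<le> U" by (rule bl_nonneg[OF u])
  have actV: "(k, \<xi>) \<in> V k" if "\<xi> \<in> act k \<zeta>" for \<xi> \<zeta> using that by (auto simp: act_def V_eq)
  show ?thesis
    using p
  proof (cases rule: exponent_cases)
    case 1
    have le: "layer Xs u k \<zeta> \<le> real (Nc 1) * U" for \<zeta>
    proof -
      have "layer Xs u k \<zeta> \<le> (\<Sum>\<xi>\<in>act k \<zeta>. U)" unfolding layer_eq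
        by (intro sum_mono bl_zeroD[OF u[unfolded 1(2)]] actV)
      also have "\<dots> \<le> real (Nc 1) * U" using card_act U0 by (simp add: mult_right_mono)
      finally show ?thesis .
    qed
    have "(\<lambda>\<zeta>. ennreal (layer Xs u k \<zeta>)) \<in> borel_measurable M"
      unfolding layer_eq using sum_act_measurable[of "\<lambda>\<xi>. \<bar>u (k, \<xi>)\<bar>" k] by measurable
    then have "esssup M (\<lambda>\<zeta>. ennreal (layer Xs u k \<zeta>)) \<le> ennreal (real (Nc 1) * U)"
      using le by (intro esssup_I AE_I2 ennreal_leI)
    then show ?thesis using 1 by (simp add: Lp_qnorm_def)
  next
    case (2 r)
    have "(\<integral>\<^sup>+\<zeta>. ennreal (layer Xs u k \<zeta> powr r) \<partial>M) \<le> (\<integral>\<^sup>+\<zeta>. ennreal (real (Nc 1) powr r) * ennreal (\<Sum>\<xi>\<in>act k \<zeta>. \<bar>u (k, \<xi>)\<bar> powr r) \<partial>M)"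
    proof (rule nn_integral_mono)
      fix \<zeta>
      have "layer Xs u k \<zeta> powr r \<le> real (Nc 1) powr r * (\<Sum>\<xi>\<in>act k \<zeta>. \<bar>u (k, \<xi>)\<bar> powr r)"
        unfolding layer_eq using 2 by (intro sum_powr_le_card finite_act card_act) simp
      then show "ennreal (layer Xs u k \<zeta> powr r) \<le> ennreal (real (Nc 1) powr r) * ennreal (\<Sum>\<xi>\<in>act k \<zeta>. \<bar>u (k, \<xi>)\<bar> powr r)"
        by (subst ennreal_mult[symmetric]) (auto intro: sum_nonneg ennreal_leI)
    qed
    also have "\<dots> = ennreal (real (Nc 1) powr r) * (\<integral>\<^sup>+\<zeta>. ennreal (\<Sum>\<xi>\<in>act k \<zeta>. \<bar>u (k, \<xi>)\<bar> powr r) \<partial>M)"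
      using sum_act_measurable[of "\<lambda>\<xi>. \<bar>u (k, \<xi>)\<bar> powr r" k] by (intro nn_integral_cmult) simp
    also have "(\<integral>\<^sup>+\<zeta>. ennreal (\<Sum>\<xi>\<in>act k \<zeta>. \<bar>u (k, \<xi>)\<bar> powr r) \<partial>M) = (\<integral>\<^sup>+\<xi>. ennreal (\<bar>u (k, \<xi>)\<bar> powr r * wt (k, \<xi>)) \<partial>count_space (Xs k))"
      by (rule nn_integral_sum_act) simp
    also have "\<dots> \<le> ennreal (U powr r)"
    proof (rule nn_integral_count_space_le[OF countable_Xs])
      fix F assume F: "finite F" "F \<subseteq> Xs k"
      have "(\<Sum>\<xi>\<in>F. \<bar>u (k, \<xi>)\<bar> powr r * wt (k, \<xi>)) = (\<Sum>x\<in>Pair k ` F. wt x * \<bar>u x\<bar> powr (1 / (1 / r)))"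
        by (subst sum.reindex) (auto simp: inj_on_def mult.commute)
      also have "\<dots> \<le> U powr (1 / (1 / r))" using F 2 by (intro bl_posD[OF u[unfolded 2(5)]]) (auto simp: V_eq)
      finally have "(\<Sum>\<xi>\<in>F. \<bar>u (k, \<xi>)\<bar> powr r * wt (k, \<xi>)) \<le> U powr r" by simp
      then show "(\<Sum>\<xi>\<in>F. ennreal (\<bar>u (k, \<xi>)\<bar> powr r * wt (k, \<xi>))) \<le> ennreal (U powr r)"
        by (subst sum_ennreal) (auto simp: vol_nonneg intro: ennreal_leI)
    qed
    finally have "(\<integral>\<^sup>+\<zeta>. ennreal (layer Xs u k \<zeta> powr r) \<partial>M) \<le> ennreal (real (Nc 1) powr r) * ennreal (U powr r)"
      by (simp add: mult_left_mono)
    also have "\<dots> = ennreal ((real (Nc 1) * U) powr r)" by (simp add: ennreal_mult powr_mult)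
    finally show ?thesis using 2 U0 by (simp add: Lp_qnorm_def epowr_le_I)
  qed
qed

text \<open>On its own ball each \<open>\<bar>u (k, \<xi>)\<bar>\<close> is below the layer
  function, and bounded overlap controls the sum of the integrals. For the infinite exponent the
  positive measure of every ball turns the essential bound into a bound at every vertex.\<close>

lemma Lp_layer_D:
  assumes p: "0 < p" and L: "Lp_qnorm M p (layer Xs u k) \<le> ennreal U" and U: "0 \<le> U"
  shows "bl (enn2real (inverse p)) wt (V k) u (real (Suc (Nc 1)) powr (enn2real (inverse p)) * U)"
proof -
  have one: "\<bar>u (k, \<xi>)\<bar> \<le> layer Xs u k \<zeta>" if "\<xi> \<in> act k \<zeta>" for \<xi> \<zeta>
    unfolding layer_eq using that by (intro member_le_sum[of \<xi> _ "\<lambda>\<xi>. \<bar>u (k, \<xi>)\<bar>"]) auto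
  show ?thesis
    using p
  proof (cases rule: exponent_cases)
    case 1
    have AE: "AE \<zeta> in M. ennreal (layer Xs u k \<zeta>) \<le> ennreal U"
    proof -
      have "AE \<zeta> in M. ennreal (layer Xs u k \<zeta>) \<le> esssup M (\<lambda>\<zeta>. ennreal (layer Xs u k \<zeta>))" by (rule esssup_AE)
      then show ?thesis
        by (rule AE_mp) (use L 1 in \<open>auto simp: Lp_qnorm_def intro: order_trans\<close>)
    qed
    have "\<bar>u x\<bar> \<le> U" if x: "x \<in> V k" for x
    proof (rule ccontr)
      assume n: "\<not> \<bar>u x\<bar> \<le> U"
      obtain \<xi> where \<xi>: "x = (k, \<xi>)" "\<xi> \<in> Xs k" using x by (auto simp: V_eq)
      have "AE \<zeta> in M. \<zeta> \<notin> Bx x"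
        using AE
      proof (rule AE_mp, intro AE_I2 impI notI)
        fix \<zeta> assume l: "ennreal (layer Xs u k \<zeta>) \<le> ennreal U" and z: "\<zeta> \<in> Bx x"
        have "\<xi> \<in> act k \<zeta>" using z \<xi> by (simp add: act_def)
        then have "\<bar>u x\<bar> \<le> layer Xs u k \<zeta>" using one \<xi> by simp
        moreover have "layer Xs u k \<zeta> \<le> U" using l U by (simp add: ennreal_le_iff)
        ultimately show False using n by simp
      qed
      then have "emeasure M (Bx x) = 0" using Bx_sets[of x] by (subst (asm) AE_iff_measurable[of "Bx x"]) auto
      then show False using wt_pos[of x] by (simp add: Bx_ball emeasure_ball)
    qed
    then show ?thesis using U unfolding 1(2) by (simp add: bl_def)
  next
    case (2 r)
    have I: "(\<integral>\<^sup>+\<zeta>. ennreal (layer Xs u k \<zeta> powr r) \<partial>M) \<le> ennreal (U powr r)"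
      using L 2 U by (simp add: Lp_qnorm_def epowr_le_D)
    have "(\<Sum>x\<in>J. wt x * \<bar>u x\<bar> powr r) \<le> real (Suc (Nc 1)) * U powr r" if J: "finite J" "J \<subseteq> V k" for J
    proof -
      have "ennreal (\<Sum>x\<in>J. wt x * \<bar>u x\<bar> powr r) = (\<Sum>x\<in>J. ennreal (\<bar>u x\<bar> powr r) * emeasure M (Bx x))"
      proof -
        have "ennreal (\<Sum>x\<in>J. wt x * \<bar>u x\<bar> powr r) = (\<Sum>x\<in>J. ennreal (wt x * \<bar>u x\<bar> powr r))"
          by (rule sum_ennreal[symmetric]) (simp add: vol_nonneg)
        also have "\<dots> = (\<Sum>x\<in>J. ennreal (\<bar>u x\<bar> powr r) * emeasure M (Bx x))"
          unfolding Bx_ball emeasure_ball by (intro sum.cong refl) (simp add: ennreal_mult vol_nonneg mult.commute)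
        finally show ?thesis .
      qed
      also have "\<dots> = (\<Sum>x\<in>J. \<integral>\<^sup>+\<zeta>. ennreal (\<bar>u x\<bar> powr r) * indicator (Bx x) \<zeta> \<partial>M)"
        using nn_integral_cmult_indicator[OF Bx_sets] by simp
      also have "\<dots> = (\<integral>\<^sup>+\<zeta>. (\<Sum>x\<in>J. ennreal (\<bar>u x\<bar> powr r) * indicator (Bx x) \<zeta>) \<partial>M)"
        by (intro nn_integral_sum[symmetric] borel_measurable_times_ennreal borel_measurable_const borel_measurable_indicator Bx_sets)
      also have "\<dots> \<le> (\<integral>\<^sup>+\<zeta>. ennreal (real (Suc (Nc 1))) * ennreal (layer Xs u k \<zeta> powr r) \<partial>M)"
      proof (rule nn_integral_mono)
        fix \<zeta>
        let ?J = "{x\<in>J. \<zeta> \<in> Bx x}"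
        have sJ: "snd ` ?J \<subseteq> act k \<zeta>" using J by (auto simp: act_def V_eq)
        have "card ?J = card (snd ` ?J)" by (rule card_image[symmetric], rule inj_snd_V[of _ k]) (use J in auto)
        also have "\<dots> \<le> card (act k \<zeta>)" by (rule card_mono[OF finite_act sJ])
        also have "\<dots> \<le> Nc 1" by (rule card_act)
        finally have cJ: "card ?J \<le> Nc 1" .
        have "(\<Sum>x\<in>J. ennreal (\<bar>u x\<bar> powr r) * indicator (Bx x) \<zeta>) = (\<Sum>x\<in>?J. ennreal (\<bar>u x\<bar> powr r))"
          using J by (intro sum.mono_neutral_cong_right) (auto simp: indicator_def)
        also have "\<dots> \<le> (\<Sum>x\<in>?J. ennreal (layer Xs u k \<zeta> powr r))"
        proof (rule sum_mono)
          fix x assume x: "x \<in> ?J"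
          then have "x = (k, snd x)" "snd x \<in> act k \<zeta>" using J sJ by (auto simp: V_eq)
          then have "\<bar>u x\<bar> \<le> layer Xs u k \<zeta>" using one by metis
          then show "ennreal (\<bar>u x\<bar> powr r) \<le> ennreal (layer Xs u k \<zeta> powr r)" using 2 by (intro ennreal_leI powr_mono2) auto
        qed
        also have "\<dots> = of_nat (card ?J) * ennreal (layer Xs u k \<zeta> powr r)" by simp
        also have "\<dots> \<le> ennreal (real (Suc (Nc 1))) * ennreal (layer Xs u k \<zeta> powr r)"
          unfolding ennreal_of_nat_eq_real_of_nat using cJ by (intro mult_right_mono ennreal_leI) auto
        finally show "(\<Sum>x\<in>J. ennreal (\<bar>u x\<bar> powr r) * indicator (Bx x) \<zeta>) \<le> ennreal (real (Suc (Nc 1))) * ennreal (layer Xs u k \<zeta> powr r)" .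
      qed
      also have "\<dots> = ennreal (real (Suc (Nc 1))) * (\<integral>\<^sup>+\<zeta>. ennreal (layer Xs u k \<zeta> powr r) \<partial>M)"
      proof (rule nn_integral_cmult)
        show "(\<lambda>\<zeta>. ennreal (layer Xs u k \<zeta> powr r)) \<in> borel_measurable M"
          unfolding layer_eq using sum_act_measurable[of "\<lambda>\<xi>. \<bar>u (k, \<xi>)\<bar>" k] by measurable
      qed
      also have "\<dots> \<le> ennreal (real (Suc (Nc 1))) * ennreal (U powr r)" by (intro mult_left_mono I) simp
      also have "\<dots> = ennreal (real (Suc (Nc 1)) * U powr r)" by (rule ennreal_mult[symmetric]) auto
      finally show ?thesis using U by (subst (asm) ennreal_le_iff) auto
    qed
    moreover have "real (Suc (Nc 1)) * U powr r = (real (Suc (Nc 1)) powr (1/r) * U) powr r"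
      using 2 by (simp only: powr_mult powr_powr) simp
    ultimately show ?thesis using 2 U unfolding 2(5) by (simp add: bl_def)
  qed
qed

lemma besov_le:
  assumes "0 < p" "0 < q" "mixed V wt (enn2real (inverse p)) (enn2real (inverse q)) s (absd Xs (Pavg M f)) K"
  shows "besov_qnorm M Xs s p q f \<le> ennreal (real (Nc 1) * K)"
proof -
  let ?u = "absd Xs (Pavg M f)"
  obtain U where U: "\<And>n. bl (enn2real (inverse p)) wt (V n) ?u (U n)"
    "bl (enn2real (inverse q)) (\<lambda>_. 1) UNIV (\<lambda>n. 2 powr (of_int n * s) * U n) K"
    using assms(3) by (auto simp: mixed_def)
  show ?thesis unfolding besov_qnorm_def
    by (rule I_qnorm_le[OF assms(2) _ Lp_layer_le[OF assms(1) U(1)] bl_nonneg[OF U(1)] U(2)]) simp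
qed

lemma besov_D:
  assumes p: "0 < p" "0 < q" and B: "besov_qnorm M Xs s p q f \<le> ennreal K" "0 \<le> K"
  shows "mixed V wt (enn2real (inverse p)) (enn2real (inverse q)) s (absd Xs (Pavg M f)) (real (Suc (Nc 1)) powr (enn2real (inverse p)) * K)"
proof -
  let ?c = "real (Suc (Nc 1)) powr (enn2real (inverse p))"
  obtain U where U: "\<And>k. 0 \<le> U k" "\<And>k. Lp_qnorm M p (layer Xs (absd Xs (Pavg M f)) k) \<le> ennreal (U k)"
    "bl (enn2real (inverse q)) (\<lambda>_. 1) UNIV (\<lambda>n. 2 powr (of_int n * s) * U n) K"
    using I_qnorm_D[OF p(2) B[unfolded besov_qnorm_def]] by blast
  have "bl (enn2real (inverse q)) (\<lambda>_. 1) UNIV (\<lambda>n. ?c * (2 powr (of_int n * s) * U n)) (?c * K)"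
    by (rule bl_scale[OF U(3)]) simp
  then have "bl (enn2real (inverse q)) (\<lambda>_. 1) UNIV (\<lambda>n. 2 powr (of_int n * s) * (?c * U n)) (?c * K)"
    by (simp only: mult.left_commute)
  then show ?thesis unfolding mixed_def
    using Lp_layer_D[OF p(1) U(2,1)] by (intro exI[of _ "\<lambda>n. ?c * U n"]) auto
qed

section \<open>The square function at a vertex and the differences along its edges\<close>

lemma absd_eq: "absd Xs (Pavg M f) x = L2_set (\<lambda>x'. cmod (ana f (x, x'))) (neighbors Xs x)"
  by (simp add: absd_def L2_set_def ana_def)

lemma absd_le: "absd Xs (Pavg M f) x \<le> (\<Sum>x'\<in>neighbors Xs x. cmod (ana f (x, x')))"
  unfolding absd_eq by (rule L2_set_le_sum) simp

lemma absd_ge: "x' \<in> neighbors Xs x \<Longrightarrow> cmod (ana f (x, x')) \<le> absd Xs (Pavg M f) x"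
  unfolding absd_eq using finite_neighbors by (rule member_le_L2_set)

lemma absd_nonneg: "0 \<le> absd Xs u x" by (simp add: absd_def sum_nonneg)

text \<open>The square function at \<open>x\<close> is at most the sum over its at most
  \<open>Nn\<close> outgoing edges, and every oriented edge belongs to one vertex.\<close>

lemma mixed_ana_absd:
  assumes a: "0 \<le> a" and m: "mixed Ed we a b s (\<lambda>e. cmod (ana f e)) K"
  shows "mixed V wt a b s (absd Xs (Pavg M f)) (real Nn * K)"
proof (rule mixed_level[OF m])
  fix n U assume U: "bl a we (Ed n) (\<lambda>e. cmod (ana f e)) U"
  have "bl a wt (V n) (absd Xs (Pavg M f)) (1 * real Nn * 1 powr a * U)"
  proof (rule bl_transfer[OF a U, where R = "\<lambda>x. Pair x ` neighbors Xs x"])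
    fix x assume x: "x \<in> V n"
    show "finite (Pair x ` neighbors Xs x)" using finite_neighbors by simp
    show "Pair x ` neighbors Xs x \<subseteq> Ed n" using x by (auto simp: Ed_def)
    show "card (Pair x ` neighbors Xs x) \<le> Nn" using card_neighbors by (simp add: card_image inj_on_def)
    have "(\<Sum>e\<in>Pair x ` neighbors Xs x. \<bar>cmod (ana f e)\<bar>) = (\<Sum>x'\<in>neighbors Xs x. cmod (ana f (x, x')))"
      by (subst sum.reindex) (auto simp: inj_on_def)
    then show "\<bar>absd Xs (Pavg M f) x\<bar> \<le> 1 * (\<Sum>e\<in>Pair x ` neighbors Xs x. \<bar>cmod (ana f e)\<bar>)"
      using absd_le[of f x] absd_nonneg[of "Pavg M f" x] by simp
  next
    fix J e assume J: "finite J" "J \<subseteq> V n"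
    have "(\<Sum>x\<in>{x\<in>J. e \<in> Pair x ` neighbors Xs x}. wt x) \<le> (\<Sum>x\<in>{fst e}. wt x)"
      by (rule sum_mono2) (auto simp: vol_nonneg)
    then show "(\<Sum>x\<in>{x\<in>J. e \<in> Pair x ` neighbors Xs x}. wt x) \<le> 1 * we e" by simp
  qed (auto simp: vol_nonneg)
  then show "bl a wt (V n) (absd Xs (Pavg M f)) (real Nn * U)" by simp
qed simp

text \<open>Each difference is below the square function at the first vertex, which is shared by at
  most \<open>Nn\<close> edges.\<close>

lemma mixed_absd_ana:
  assumes a: "0 \<le> a" and m: "mixed V wt a b s (absd Xs (Pavg M f)) K"
  shows "mixed Ed we a b s (\<lambda>e. cmod (ana f e)) (real (Suc Nn) powr a * K)"
proof (rule mixed_level[OF m])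
  fix n U assume U: "bl a wt (V n) (absd Xs (Pavg M f)) U"
  have "bl a we (Ed n) (\<lambda>e. cmod (ana f e)) (1 * real 1 * real (Suc Nn) powr a * U)"
  proof (rule bl_transfer[OF a U, where R = "\<lambda>e. {fst e}"])
    fix e assume e: "e \<in> Ed n"
    show "{fst e} \<subseteq> V n" using Ed_fst[OF e] by simp
    have "cmod (ana f (fst e, snd e)) \<le> absd Xs (Pavg M f) (fst e)" by (rule absd_ge[OF Ed_snd[OF e]])
    then show "\<bar>cmod (ana f e)\<bar> \<le> 1 * (\<Sum>x\<in>{fst e}. \<bar>absd Xs (Pavg M f) x\<bar>)" by simp
  next
    fix J x assume J: "finite J" "J \<subseteq> Ed n"
    have "(\<Sum>e\<in>{e\<in>J. x \<in> {fst e}}. we e) \<le> (\<Sum>e\<in>Pair x ` neighbors Xs x. we e)"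
    proof (rule sum_mono2)
      show "{e\<in>J. x \<in> {fst e}} \<subseteq> Pair x ` neighbors Xs x" using J by (auto simp: Ed_def)
    qed (auto simp: vol_nonneg finite_neighbors)
    also have "\<dots> = real (card (neighbors Xs x)) * wt x" by (subst sum.reindex) (auto simp: inj_on_def)
    also have "\<dots> \<le> real (Suc Nn) * wt x" using card_neighbors[of x] vol_nonneg by (intro mult_right_mono) auto
    finally show "(\<Sum>e\<in>{e\<in>J. x \<in> {fst e}}. we e) \<le> real (Suc Nn) * wt x" .
  qed (auto simp: vol_nonneg)
  then show "bl a we (Ed n) (\<lambda>e. cmod (ana f e)) (real (Suc Nn) powr a * U)" by simp
qed simp

end

section \<open>The inclusion of the interpolation space in the Besov space\<close>

lemma ennreal_le_mult_INF:
  fixes X :: ennreal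
  assumes c: "0 < c" and le: "\<And>x. x \<in> A \<Longrightarrow> X \<le> ennreal c * f x"
  shows "X \<le> ennreal c * (INF x\<in>A. f x)"
proof -
  have inv: "ennreal (1 / c) * ennreal c = 1" "ennreal c * ennreal (1 / c) = 1"
    using c by (simp_all add: ennreal_mult[symmetric])
  have "ennreal (1 / c) * X \<le> (INF x\<in>A. f x)"
  proof (rule INF_greatest)
    fix x assume "x \<in> A"
    then have "ennreal (1 / c) * X \<le> ennreal (1 / c) * (ennreal c * f x)" by (intro mult_left_mono le) auto
    then show "ennreal (1 / c) * X \<le> f x" by (simp only: mult.assoc[symmetric] inv mult_1)
  qed
  then have "ennreal c * (ennreal (1 / c) * X) \<le> ennreal c * (INF x\<in>A. f x)" by (intro mult_left_mono) auto
  then show ?thesis by (simp only: mult.assoc[symmetric] inv mult_1)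
qed

context filling
begin

lemma besov_mixed:
  assumes p: "0 < p" "0 < q"
  shows "\<exists>c>0. \<forall>f K. 0 \<le> K \<longrightarrow> besov_qnorm M Xs s p q f \<le> ennreal K \<longrightarrow>
    mixed Ed we (enn2real (inverse p)) (enn2real (inverse q)) s (\<lambda>e. cmod (ana f e)) (c * K)"
proof (intro exI conjI allI impI)
  let ?a = "enn2real (inverse p)"
  show "0 < real (Suc Nn) powr ?a * real (Suc (Nc 1)) powr ?a" by simp
  fix f K assume "0 \<le> K" "besov_qnorm M Xs s p q f \<le> ennreal K"
  from mixed_absd_ana[OF _ besov_D[OF p this(2,1)]]
  show "mixed Ed we ?a (enn2real (inverse q)) s (\<lambda>e. cmod (ana f e)) (real (Suc Nn) powr ?a * real (Suc (Nc 1)) powr ?a * K)"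
    by (simp only: mult.assoc enn2real_nonneg)
qed

lemma mixed_besov:
  assumes p: "0 < p" "0 < q" and m: "mixed Ed we (enn2real (inverse p)) (enn2real (inverse q)) s (\<lambda>e. cmod (ana f e)) K"
  shows "besov_qnorm M Xs s p q f \<le> ennreal (real (Nc 1) * (real Nn * K))"
  by (rule besov_le[OF p mixed_ana_absd[OF enn2real_nonneg m]])

lemma ana_diff: "loc_int M f \<Longrightarrow> loc_int M g \<Longrightarrow> ana (\<lambda>\<zeta>. f \<zeta> - g \<zeta>) e = ana f e - ana g e"
  by (simp add: ana_def Pavg_diff)

lemma ana_add: "loc_int M f \<Longrightarrow> loc_int M g \<Longrightarrow> ana (\<lambda>\<zeta>. f \<zeta> + g \<zeta>) e = ana f e + ana g e"
  by (simp add: ana_def Pavg_add)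

lemma ana_cmult: "ana (\<lambda>\<zeta>. k * f \<zeta>) e = k * ana f e"
  by (simp add: ana_def Pavg_cmult right_diff_distrib)

lemma ana_sum: "(\<And>i. i \<in> A \<Longrightarrow> loc_int M (f i)) \<Longrightarrow> ana (\<lambda>\<zeta>. \<Sum>i\<in>A. f i \<zeta>) e = (\<Sum>i\<in>A. ana (f i) e)"
  by (simp add: ana_def Pavg_sum sum_subtractf)

lemma ana_ae_const:
  assumes f: "loc_int M f" and g: "loc_int M g" and ae: "ae_const M (\<lambda>\<zeta>. f \<zeta> - g \<zeta>)"
  shows "ana f e = ana g e"
proof -
  obtain k where k: "AE \<zeta> in M. f \<zeta> - g \<zeta> = k" using ae by (auto simp: ae_const_def)
  have "Pavg M f x = Pavg M g x + k" for x
  proof -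
    have "Pavg M (\<lambda>\<zeta>. f \<zeta> - g \<zeta>) x = Pavg M (\<lambda>_. k) x"
      using loc_int_measurable[OF loc_int_diff[OF f g]] k by (intro Pavg_cong_AE) auto
    then have "Pavg M f x - Pavg M g x = k" unfolding Pavg_diff[OF f g] Pavg_const .
    then show ?thesis by (simp add: algebra_simps)
  qed
  then show ?thesis by (simp add: ana_def)
qed

text \<open>An edge difference is a bounded functional, by evaluating the sequence quasi-norm at one
  index; the constant depends on the edge.\<close>

lemma ana_besov_le:
  assumes p: "0 < p" "0 < q" and e: "e \<in> EE"
  shows "\<exists>c>0. \<forall>f. ennreal (cmod (ana f e)) \<le> ennreal c * besov_qnorm M Xs s p q f"
proof -
  let ?a = "enn2real (inverse p)" and ?b = "enn2real (inverse q)"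
  obtain c0 where c0: "c0 > 0" "\<forall>f K. 0 \<le> K \<longrightarrow> besov_qnorm M Xs s p q f \<le> ennreal K \<longrightarrow>
    mixed Ed we ?a ?b s (\<lambda>e. cmod (ana f e)) (c0 * K)" using besov_mixed[OF p, where s = s] by (elim exE conjE) (rule that)
  define c where "c = we e powr (- ?a) * 2 powr (- (of_int (lev e) * s)) * c0"
  have c: "c > 0" using c0(1) wt_pos[of "fst e"] unfolding c_def by (intro mult_pos_pos) auto
  show ?thesis
  proof (intro exI[of _ c] conjI c allI)
    fix f
    show "ennreal (cmod (ana f e)) \<le> ennreal c * besov_qnorm M Xs s p q f"
    proof (cases "besov_qnorm M Xs s p q f")
      case (real K)
      then have "mixed Ed we ?a ?b s (\<lambda>e. cmod (ana f e)) (c0 * K)" using c0(2) by simp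
      from mixed_pointwise[OF this enn2real_nonneg enn2real_nonneg EE_Ed[OF e] wt_pos]
      have "cmod (ana f e) \<le> c * K" by (simp add: c_def mult.assoc)
      then have "ennreal (cmod (ana f e)) \<le> ennreal (c * K)" by (rule ennreal_leI)
      then show ?thesis using c real by (simp add: ennreal_mult)
    next
      case top
      then show ?thesis using c by (simp add: ennreal_mult_top)
    qed
  qed
qed

lemma ana_sum_qnorm_le:
  assumes p: "0 < p0" "0 < q0" "0 < p1" "0 < q1" and e: "e \<in> EE"
  shows "\<exists>c>0. \<forall>h. ennreal (cmod (ana h e)) \<le> ennreal c * sum_qnorm M (besov_qnorm M Xs s0 p0 q0) (besov_qnorm M Xs s1 p1 q1) h"
proof -
  obtain c0 where c0: "c0 > 0" "\<forall>f. ennreal (cmod (ana f e)) \<le> ennreal c0 * besov_qnorm M Xs s0 p0 q0 f"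
    using ana_besov_le[OF p(1,2) e, where s = s0] by (elim exE conjE) (rule that)
  obtain c1 where c1: "c1 > 0" "\<forall>f. ennreal (cmod (ana f e)) \<le> ennreal c1 * besov_qnorm M Xs s1 p1 q1 f"
    using ana_besov_le[OF p(3,4) e, where s = s1] by (elim exE conjE) (rule that)
  define c where "c = max c0 c1"
  have c: "c > 0" using c0(1) by (simp add: c_def)
  show ?thesis
  proof (intro exI[of _ c] conjI c allI)
    fix h
    show "ennreal (cmod (ana h e)) \<le> ennreal c * sum_qnorm M (besov_qnorm M Xs s0 p0 q0) (besov_qnorm M Xs s1 p1 q1) h"
      unfolding sum_qnorm_def
    proof (rule ennreal_le_mult_INF[OF c])
      fix g assume "g \<in> {g. loc_int M (fst g) \<and> loc_int M (snd g) \<and> (\<forall>\<zeta>. h \<zeta> = fst g \<zeta> + snd g \<zeta>)}"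
      then have g: "loc_int M (fst g)" "loc_int M (snd g)" and h: "h = (\<lambda>\<zeta>. fst g \<zeta> + snd g \<zeta>)" by auto
      have "cmod (ana h e) \<le> cmod (ana (fst g) e) + cmod (ana (snd g) e)"
        unfolding h ana_add[OF g] by (rule norm_triangle_ineq)
      then have "ennreal (cmod (ana h e)) \<le> ennreal (cmod (ana (fst g) e) + cmod (ana (snd g) e))" by (rule ennreal_leI)
      also have "\<dots> = ennreal (cmod (ana (fst g) e)) + ennreal (cmod (ana (snd g) e))" by (rule ennreal_plus) auto
      also have "\<dots> \<le> ennreal c * besov_qnorm M Xs s0 p0 q0 (fst g) + ennreal c * besov_qnorm M Xs s1 p1 q1 (snd g)"
      proof (rule add_mono)
        show "ennreal (cmod (ana (fst g) e)) \<le> ennreal c * besov_qnorm M Xs s0 p0 q0 (fst g)"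
          by (rule order_trans[OF c0(2)[rule_format]], intro mult_right_mono ennreal_leI) (simp_all add: c_def)
        show "ennreal (cmod (ana (snd g) e)) \<le> ennreal c * besov_qnorm M Xs s1 p1 q1 (snd g)"
          by (rule order_trans[OF c1(2)[rule_format]], intro mult_right_mono ennreal_leI) (simp_all add: c_def)
      qed
      finally show "ennreal (cmod (ana h e)) \<le> ennreal c * (besov_qnorm M Xs s0 p0 q0 (fst g) + besov_qnorm M Xs s1 p1 q1 (snd g))"
        by (simp only: distrib_left)
    qed
  qed
qed

text \<open>The infimum over an empty set of decompositions is infinite.\<close>

lemma sum_qnorm_finite_loc_int:
  assumes "sum_qnorm M n0 n1 h < \<infinity>"
  shows "loc_int M h"
proof -
  have "{g. loc_int M (fst g) \<and> loc_int M (snd g) \<and> (\<forall>\<zeta>. h \<zeta> = fst g \<zeta> + snd g \<zeta>)} \<noteq> {}"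
  proof
    assume "{g. loc_int M (fst g) \<and> loc_int M (snd g) \<and> (\<forall>\<zeta>. h \<zeta> = fst g \<zeta> + snd g \<zeta>)} = {}"
    then have "sum_qnorm M n0 n1 h = top" unfolding sum_qnorm_def by (simp only: image_empty Inf_empty)
    then show False using assms by simp
  qed
  then obtain g where g: "loc_int M (fst g)" "loc_int M (snd g)" and "\<forall>\<zeta>. h \<zeta> = fst g \<zeta> + snd g \<zeta>" by blast
  then have "h = (\<lambda>\<zeta>. fst g \<zeta> + snd g \<zeta>)" by auto
  then show ?thesis using loc_int_add[OF g] by simp
qed

text \<open>A functional bounded on the sum space turns analyticity and continuity in its quasi-norm
  into the scalar notions: near each point the function is a uniform limit of polynomials.\<close>

lemma admissible_ana:
  assumes p: "0 < p0" "0 < q0" "0 < p1" "0 < q1" and e: "e \<in> EE"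
    and adm: "admissible M (besov_qnorm M Xs s0 p0 q0) (besov_qnorm M Xs s1 p1 q1) F"
  shows "(\<lambda>z. ana (F z) e) holomorphic_on strip" "continuous_on cstrip (\<lambda>z. ana (F z) e)"
    "\<exists>T. \<forall>z\<in>cstrip. cmod (ana (F z) e) \<le> T"
proof -
  let ?N = "sum_qnorm M (besov_qnorm M Xs s0 p0 q0) (besov_qnorm M Xs s1 p1 q1)"
  obtain c where c: "c > 0" "\<forall>h. ennreal (cmod (ana h e)) \<le> ennreal c * ?N h"
    using ana_sum_qnorm_le[OF p e, where ?s0.0 = s0 and ?s1.0 = s1] by (elim exE conjE) (rule that)
  have Fl: "loc_int M (F z)" if "z \<in> cstrip" for z using adm that by (simp add: admissible_def)
  have sub: "strip \<subseteq> cstrip" by (auto simp: strip_def cstrip_def)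
  show "\<exists>T. \<forall>z\<in>cstrip. cmod (ana (F z) e) \<le> T"
  proof -
    have "(SUP z\<in>cstrip. ?N (F z)) < \<infinity>" using adm by (simp add: admissible_def)
    then obtain B where B: "(SUP z\<in>cstrip. ?N (F z)) = ennreal B" "0 \<le> B" by (cases "SUP z\<in>cstrip. ?N (F z)") auto
    have "cmod (ana (F z) e) \<le> c * B" if z: "z \<in> cstrip" for z
    proof -
      have "?N (F z) \<le> ennreal B" unfolding B(1)[symmetric] using z by (rule SUP_upper)
      then have "ennreal c * ?N (F z) \<le> ennreal c * ennreal B" by (intro mult_left_mono) auto
      with c(2) have "ennreal (cmod (ana (F z) e)) \<le> ennreal c * ennreal B" by (meson order_trans)
      then show ?thesis using c(1) B(2) by (simp add: ennreal_mult[symmetric] ennreal_le_iff)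
    qed
    then show ?thesis by blast
  qed
  have small: "((\<lambda>w. cmod (G w)) \<longlongrightarrow> 0) Fi" if G: "\<And>w. ennreal (cmod (G w)) \<le> ennreal c * X w" and X: "(X \<longlongrightarrow> 0) Fi" for G :: "'w \<Rightarrow> complex" and X Fi
  proof -
    have "((\<lambda>w. ennreal c * X w) \<longlongrightarrow> ennreal c * 0) Fi" by (rule tendsto_mult_ennreal[OF tendsto_const X]) simp
    then have up: "((\<lambda>w. ennreal c * X w) \<longlongrightarrow> 0) Fi" by simp
    have "((\<lambda>w. ennreal (cmod (G w))) \<longlongrightarrow> ennreal 0) Fi"
      unfolding ennreal_0 by (rule tendsto_sandwich[OF _ _ tendsto_const up]) (auto intro: always_eventually G)
    then show ?thesis by (rule tendsto_ennrealD) auto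
  qed
  show "continuous_on cstrip (\<lambda>z. ana (F z) e)"
    unfolding continuous_on_def
  proof
    fix z assume z: "z \<in> cstrip"
    have "((\<lambda>w. ?N (\<lambda>\<zeta>. F w \<zeta> - F z \<zeta>)) \<longlongrightarrow> 0) (at z within cstrip)"
      using adm z by (simp add: admissible_def qcontinuous_on_def)
    from small[OF c(2)[rule_format] this]
    have "((\<lambda>w. cmod (ana (\<lambda>\<zeta>. F w \<zeta> - F z \<zeta>) e)) \<longlongrightarrow> 0) (at z within cstrip)" .
    \<comment> \<open>The differences are additive only for locally integrable functions, that is
      for \<open>w\<close> in the closed strip.\<close>
    moreover have "eventually (\<lambda>w. cmod (ana (\<lambda>\<zeta>. F w \<zeta> - F z \<zeta>) e) = cmod (ana (F w) e - ana (F z) e)) (at z within cstrip)"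
      unfolding eventually_at_filter by (intro always_eventually allI impI) (simp only: ana_diff[OF Fl Fl[OF z]])
    ultimately have "((\<lambda>w. cmod (ana (F w) e - ana (F z) e)) \<longlongrightarrow> 0) (at z within cstrip)" by (rule Lim_transform_eventually)
    then have "((\<lambda>w. ana (F w) e - ana (F z) e) \<longlongrightarrow> 0) (at z within cstrip)" by (rule tendsto_norm_zero_cancel)
    then show "((\<lambda>w. ana (F w) e) \<longlongrightarrow> ana (F z) e) (at z within cstrip)" by (simp add: LIM_zero_iff)
  qed
  show "(\<lambda>z. ana (F z) e) holomorphic_on strip"
    unfolding holomorphic_on_def
  proof
    fix z1 assume z1: "z1 \<in> strip"
    have "qanalytic_on ?N F strip" using adm by (simp add: admissible_def)
    then obtain r a where r: "r > 0" and a: "\<And>k::nat. ?N (a k) < \<infinity>" and br: "ball z1 r \<subseteq> strip"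
      and lim: "(\<lambda>m. SUP z\<in>ball z1 r. ?N (\<lambda>\<zeta>. F z \<zeta> - (\<Sum>k<m. (z - z1) ^ k * a k \<zeta>))) \<longlonglongrightarrow> 0"
      using z1 unfolding qanalytic_on_def by blast
    have al: "loc_int M (a k)" for k by (rule sum_qnorm_finite_loc_int[OF a])
    define P where "P m z = (\<Sum>k<m. (z - z1) ^ k * ana (a k) e)" for m z
    have anaP: "ana (\<lambda>\<zeta>. F z \<zeta> - (\<Sum>k<m. (z - z1) ^ k * a k \<zeta>)) e = ana (F z) e - P m z" if z: "z \<in> ball z1 r" for z m
    proof -
      have Fz: "loc_int M (F z)" using z br sub by (intro Fl) auto
      have S: "loc_int M (\<lambda>\<zeta>. \<Sum>k<m. (z - z1) ^ k * a k \<zeta>)" by (intro loc_int_sum loc_int_cmult al)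
      show ?thesis unfolding ana_diff[OF Fz S] P_def
        by (subst ana_sum) (auto intro: loc_int_cmult al simp: ana_cmult)
    qed
    have unif: "uniform_limit (ball z1 r) P (\<lambda>z. ana (F z) e) sequentially"
    proof (rule uniform_limitI)
      fix \<epsilon> :: real assume eps: "0 < \<epsilon>"
      let ?S = "\<lambda>m. SUP z\<in>ball z1 r. ?N (\<lambda>\<zeta>. F z \<zeta> - (\<Sum>k<m. (z - z1) ^ k * a k \<zeta>))"
      have "(\<lambda>m. ennreal c * ?S m) \<longlonglongrightarrow> ennreal c * 0" by (rule tendsto_mult_ennreal[OF tendsto_const lim]) simp
      then have "eventually (\<lambda>m. ennreal c * ?S m < ennreal \<epsilon>) sequentially"
        by (rule order_tendstoD(2)) (use eps in simp)
      then show "\<forall>\<^sub>F m in sequentially. \<forall>z\<in>ball z1 r. dist (P m z) (ana (F z) e) < \<epsilon>"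
      proof (rule eventually_mono)
        fix m assume m: "ennreal c * ?S m < ennreal \<epsilon>"
        show "\<forall>z\<in>ball z1 r. dist (P m z) (ana (F z) e) < \<epsilon>"
        proof
          fix z assume z: "z \<in> ball z1 r"
          have "ennreal (cmod (ana (F z) e - P m z)) \<le> ennreal c * ?N (\<lambda>\<zeta>. F z \<zeta> - (\<Sum>k<m. (z - z1) ^ k * a k \<zeta>))"
            unfolding anaP[OF z, symmetric] by (rule c(2)[rule_format])
          also have "\<dots> \<le> ennreal c * ?S m" using z by (intro mult_left_mono SUP_upper) auto
          also note m
          finally show "dist (P m z) (ana (F z) e) < \<epsilon>" using eps by (simp add: dist_norm norm_minus_commute ennreal_less_iff)
        qed
      qed
    qed
    have "(\<lambda>z. ana (F z) e) holomorphic_on ball z1 r"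
    proof (rule holomorphic_uniform_sequence[OF open_ball])
      show "P m holomorphic_on ball z1 r" for m unfolding P_def by (intro holomorphic_intros)
      fix x assume "x \<in> ball z1 r"
      then obtain d where d: "d > 0" "cball x d \<subseteq> ball z1 r" using open_contains_cball open_ball by blast
      then show "\<exists>d>0. cball x d \<subseteq> ball z1 r \<and> uniform_limit (cball x d) P (\<lambda>z. ana (F z) e) sequentially"
        using uniform_limit_on_subset[OF unif d(2)] by blast
    qed
    then have "(\<lambda>z. ana (F z) e) field_differentiable (at z1)"
      using r by (intro holomorphic_on_imp_differentiable_at[OF _ open_ball]) auto
    then show "(\<lambda>z. ana (F z) e) field_differentiable (at z1 within strip)" by (rule field_differentiable_at_within)
  qed
qed

text \<open>The differences of an admissible \<open>F\<close> satisfy the hypotheses of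
  \<open>mixed_stein\<close>, both boundary bounds being given by its quasi-norm, and those of
  \<open>F (of_real \<theta>)\<close> are the differences of \<open>f\<close>, because averages of a
  constant cancel.\<close>

lemma besov_le_cinterp:
  assumes p: "0 < p0" "0 < q0" "0 < p1" "0 < q1" and pq: "0 < p" "0 < q" and th: "0 < \<theta>" "\<theta> < 1"
    and a: "enn2real (inverse p) = (1 - \<theta>) * enn2real (inverse p0) + \<theta> * enn2real (inverse p1)" "0 < enn2real (inverse p)"
    and b: "enn2real (inverse q) = (1 - \<theta>) * enn2real (inverse q0) + \<theta> * enn2real (inverse q1)" "0 < enn2real (inverse q)"
    and s: "s = (1 - \<theta>) * s0 + \<theta> * s1"
  shows "\<exists>c>0. \<forall>f. loc_int M f \<longrightarrow> besov_qnorm M Xs s p q f \<le>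
    ennreal c * cinterp_qnorm M (besov_qnorm M Xs s0 p0 q0) (besov_qnorm M Xs s1 p1 q1) \<theta> f"
proof -
  let ?n0 = "besov_qnorm M Xs s0 p0 q0" and ?n1 = "besov_qnorm M Xs s1 p1 q1"
  obtain c0 where c0: "c0 > 0" "\<forall>f K. 0 \<le> K \<longrightarrow> ?n0 f \<le> ennreal K \<longrightarrow>
    mixed Ed we (enn2real (inverse p0)) (enn2real (inverse q0)) s0 (\<lambda>e. cmod (ana f e)) (c0 * K)"
    using besov_mixed[OF p(1,2), where s = s0] by (elim exE conjE) (rule that)
  obtain c1 where c1: "c1 > 0" "\<forall>f K. 0 \<le> K \<longrightarrow> ?n1 f \<le> ennreal K \<longrightarrow>
    mixed Ed we (enn2real (inverse p1)) (enn2real (inverse q1)) s1 (\<lambda>e. cmod (ana f e)) (c1 * K)"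
    using besov_mixed[OF p(3,4), where s = s1] by (elim exE conjE) (rule that)
  define c where "c = real (Nc 1) * (real Nn * (2 powr enn2real (inverse p) * max c0 c1)) + 1"
  have c: "c > 0" using c0(1) by (simp add: c_def add_nonneg_pos)
  show ?thesis
  proof (intro exI[of _ c] conjI c allI impI)
    fix f assume f: "loc_int M f"
    show "besov_qnorm M Xs s p q f \<le> ennreal c * cinterp_qnorm M ?n0 ?n1 \<theta> f"
      unfolding cinterp_qnorm_def
    proof (rule ennreal_le_mult_INF[OF c])
      fix F assume "F \<in> {F. admissible M ?n0 ?n1 F \<and> ae_const M (\<lambda>\<zeta>. F (complex_of_real \<theta>) \<zeta> - f \<zeta>)}"
      then have adm: "admissible M ?n0 ?n1 F" and ae: "ae_const M (\<lambda>\<zeta>. F (complex_of_real \<theta>) \<zeta> - f \<zeta>)" by auto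
      have thc: "complex_of_real \<theta> \<in> cstrip" using th by (simp add: cstrip_def)
      have Fl: "loc_int M (F (complex_of_real \<theta>))" using adm thc by (simp add: admissible_def)
      show "besov_qnorm M Xs s p q f \<le> ennreal c * adm_qnorm ?n0 ?n1 F"
      proof (cases "adm_qnorm ?n0 ?n1 F")
        case (real K)
        have b0: "?n0 (F (\<i> * of_real t)) \<le> ennreal K" for t
          unfolding real(2)[symmetric] adm_qnorm_def by (rule max.coboundedI1) (rule SUP_upper, simp)
        have b1: "?n1 (F (1 + \<i> * of_real t)) \<le> ennreal K" for t
          unfolding real(2)[symmetric] adm_qnorm_def by (rule max.coboundedI2) (rule SUP_upper, simp)
        have m: "mixed Ed we (enn2real (inverse p)) (enn2real (inverse q)) s (\<lambda>e. cmod (ana (F (of_real \<theta>)) e))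
          (2 powr enn2real (inverse p) * (max c0 c1 * K))"
        proof (rule mixed_stein[OF th enn2real_nonneg enn2real_nonneg enn2real_nonneg enn2real_nonneg a b s, where u = "\<lambda>e z. ana (F z) e" and lvl = lev])
          show "0 < we e" for e by (rule wt_pos)
          show "lev e = n" if "e \<in> Ed n" for e n by (rule Ed_lev[OF that])
          have E: "e \<in> EE" if "e \<in> Ed n" for e n using that by (auto simp: EE_def)
          show "(\<lambda>z. ana (F z) e) holomorphic_on strip" if "e \<in> Ed n" for e n by (rule admissible_ana(1)[OF p E[OF that] adm])
          show "continuous_on cstrip (\<lambda>z. ana (F z) e)" if "e \<in> Ed n" for e n by (rule admissible_ana(2)[OF p E[OF that] adm])
          show "\<exists>T. \<forall>z\<in>cstrip. cmod (ana (F z) e) \<le> T" if "e \<in> Ed n" for e n by (rule admissible_ana(3)[OF p E[OF that] adm])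
          fix t
          have "mixed Ed we (enn2real (inverse p0)) (enn2real (inverse q0)) s0 (\<lambda>e. cmod (ana (F (\<i> * of_real t)) e)) (c0 * K)"
            using c0(2) b0 real(1) by blast
          then show "mixed Ed we (enn2real (inverse p0)) (enn2real (inverse q0)) s0 (\<lambda>e. cmod (ana (F (\<i> * of_real t)) e)) (max c0 c1 * K)"
            by (rule mixed_mono) (use real(1) in \<open>auto simp: vol_nonneg intro: mult_right_mono\<close>)
          have "mixed Ed we (enn2real (inverse p1)) (enn2real (inverse q1)) s1 (\<lambda>e. cmod (ana (F (1 + \<i> * of_real t)) e)) (c1 * K)"
            using c1(2) b1 real(1) by blast
          then show "mixed Ed we (enn2real (inverse p1)) (enn2real (inverse q1)) s1 (\<lambda>e. cmod (ana (F (1 + \<i> * of_real t)) e)) (max c0 c1 * K)"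
            by (rule mixed_mono) (use real(1) in \<open>auto simp: vol_nonneg intro: mult_right_mono\<close>)
        qed
        have "(\<lambda>e. cmod (ana (F (of_real \<theta>)) e)) = (\<lambda>e. cmod (ana f e))"
          by (simp only: ana_ae_const[OF Fl f ae])
        from mixed_besov[OF pq m[unfolded this]]
        have "besov_qnorm M Xs s p q f \<le> ennreal (real (Nc 1) * (real Nn * (2 powr enn2real (inverse p) * (max c0 c1 * K))))" .
        also have "\<dots> \<le> ennreal (c * K)"
          using real(1) by (intro ennreal_leI) (simp add: c_def algebra_simps)
        also have "\<dots> = ennreal c * ennreal K" using c real(1) by (intro ennreal_mult) auto
        finally show ?thesis unfolding real(2) .
      next
        case top
        then show ?thesis using c by (simp add: ennreal_mult_top)
      qed
    qed
  qed
qed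

end

section \<open>The inclusion of the Besov space in the interpolation space\<close>

text \<open>The product of \<sigma> with the holomorphic powers \<open>1 - z\<close> of
  \<open>m0\<close> and \<open>z\<close> of \<open>m1\<close>; the value 0 when one of the factors
  vanishes keeps it entire in \<open>z\<close>.\<close>

definition interpolant :: "complex \<Rightarrow> real \<Rightarrow> real \<Rightarrow> complex \<Rightarrow> complex" where
  "interpolant \<sigma> m0 m1 z = (if m0 = 0 \<or> m1 = 0 then 0
     else \<sigma> * exp ((1 - z) * of_real (ln m0) + z * of_real (ln m1)))"

lemma continuous_interpolant: "continuous_on S (interpolant \<sigma> m0 m1)"
proof (cases "m0 = 0 \<or> m1 = 0")
  case True
  then have "interpolant \<sigma> m0 m1 = (\<lambda>_. 0)" by (auto simp: interpolant_def)
  then show ?thesis by simp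
next
  case False
  then have "interpolant \<sigma> m0 m1 = (\<lambda>z. \<sigma> * exp ((1 - z) * of_real (ln m0) + z * of_real (ln m1)))"
    by (auto simp: interpolant_def)
  then show ?thesis by (auto intro!: continuous_intros)
qed

lemma interpolant_shift: "interpolant \<sigma> m0 m1 (z + t) = interpolant \<sigma> m0 m1 z * exp (t * of_real (ln m1 - ln m0))"
  by (simp add: interpolant_def exp_add[symmetric] algebra_simps)

lemma interpolant_norm_le:
  assumes "0 \<le> m0" "0 \<le> m1" "cmod \<sigma> \<le> 1" "m0 \<noteq> 0" "m1 \<noteq> 0"
  shows "cmod (interpolant \<sigma> m0 m1 z) \<le> exp ((1 - Re z) * ln m0 + Re z * ln m1)"
proof -
  have "cmod (interpolant \<sigma> m0 m1 z) = cmod \<sigma> * exp ((1 - Re z) * ln m0 + Re z * ln m1)"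
    using assms by (simp add: interpolant_def norm_mult)
  also have "\<dots> \<le> 1 * exp ((1 - Re z) * ln m0 + Re z * ln m1)" using assms by (intro mult_right_mono) auto
  finally show ?thesis by simp
qed

lemma interpolant_bounds:
  assumes m: "0 \<le> m0" "0 \<le> m1" and \<sigma>: "cmod \<sigma> \<le> 1"
  shows "z \<in> cstrip \<Longrightarrow> cmod (interpolant \<sigma> m0 m1 z) \<le> max m0 m1"
    and "Re z = 0 \<Longrightarrow> cmod (interpolant \<sigma> m0 m1 z) \<le> m0"
    and "Re z = 1 \<Longrightarrow> cmod (interpolant \<sigma> m0 m1 z) \<le> m1"
proof -
  have zero: "interpolant \<sigma> m0 m1 z = 0" if "m0 = 0 \<or> m1 = 0" using that by (simp add: interpolant_def)
  note le = interpolant_norm_le[OF m \<sigma>]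
  show "cmod (interpolant \<sigma> m0 m1 z) \<le> m0" if "Re z = 0"
    using that zero le[of z] m by (cases "m0 = 0 \<or> m1 = 0") auto
  show "cmod (interpolant \<sigma> m0 m1 z) \<le> m1" if "Re z = 1"
    using that zero le[of z] m by (cases "m0 = 0 \<or> m1 = 0") auto
  show "cmod (interpolant \<sigma> m0 m1 z) \<le> max m0 m1" if z: "z \<in> cstrip"
  proof (cases "m0 = 0 \<or> m1 = 0")
    case True
    then show ?thesis using zero m by auto
  next
    case False
    let ?M = "max m0 m1"
    have M: "ln m0 \<le> ln ?M" "ln m1 \<le> ln ?M" "0 < ?M" using False m by auto
    have "(1 - Re z) * ln m0 + Re z * ln m1 \<le> (1 - Re z) * ln ?M + Re z * ln ?M"
      using z M by (intro add_mono mult_left_mono) (auto simp: cstrip_def)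
    also have "\<dots> = ln ?M" by (simp add: algebra_simps)
    finally have "exp ((1 - Re z) * ln m0 + Re z * ln m1) \<le> exp (ln ?M)" by (rule exp_le_cancel_iff[THEN iffD2])
    also have "\<dots> = ?M" using M(3) by simp
    finally show ?thesis using le[of z] False by (auto intro: order_trans)
  qed
qed

text \<open>Up to a factor the function is an exponential with rate
  \<open>L = ln m1 - ln m0\<close>, and \<open>L\<close> may be unbounded over the edges. Moving
  from \<open>z1\<close> by \<open>r\<close> in the direction of growth stays in the closed strip,
  so the value at \<open>z1\<close> times \<open>exp (\<bar>L\<bar> * r)\<close> is still at most
  \<open>max m0 m1\<close>. This bounds all coefficients uniformly in \<open>L\<close>.\<close>

lemma interpolant_taylor:
  assumes m: "0 \<le> m0" "0 \<le> m1" and \<sigma>: "cmod \<sigma> \<le> 1"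
    and r: "0 < r" "r \<le> Re z1" "r \<le> 1 - Re z1"
  defines "coef \<equiv> \<lambda>k::nat. interpolant \<sigma> m0 m1 z1 * of_real ((ln m1 - ln m0) ^ k / fact k)"
  shows "r ^ k * cmod (coef k) \<le> max m0 m1"
    and "cmod (z - z1) < r / 2 \<Longrightarrow> cmod (interpolant \<sigma> m0 m1 z - (\<Sum>k<j. (z - z1) ^ k * coef k)) \<le> 2 * (1/2) ^ j * max m0 m1"
proof -
  define L where "L = ln m1 - ln m0"
  have shift: "cmod (interpolant \<sigma> m0 m1 z1) * exp (\<bar>L\<bar> * r) \<le> max m0 m1"
  proof (cases "0 \<le> L")
    case True
    have "cmod (interpolant \<sigma> m0 m1 z1) * exp (\<bar>L\<bar> * r) = cmod (interpolant \<sigma> m0 m1 (z1 + of_real r))"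
      unfolding interpolant_shift norm_mult L_def[symmetric] using True by (simp add: mult.commute)
    also have "\<dots> \<le> max m0 m1" using r by (intro interpolant_bounds(1)[OF m \<sigma>]) (simp add: cstrip_def)
    finally show ?thesis .
  next
    case False
    have "cmod (interpolant \<sigma> m0 m1 z1) * exp (\<bar>L\<bar> * r) = cmod (interpolant \<sigma> m0 m1 (z1 + of_real (- r)))"
      unfolding interpolant_shift norm_mult L_def[symmetric] using False by (simp add: mult.commute)
    also have "\<dots> \<le> max m0 m1" using r by (intro interpolant_bounds(1)[OF m \<sigma>]) (simp add: cstrip_def)
    finally show ?thesis .
  qed
  show le: "r ^ k * cmod (coef k) \<le> max m0 m1" for k
  proof -
    have "(\<bar>L\<bar> * r) ^ k / fact k \<le> exp (\<bar>L\<bar> * r)"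
    proof -
      have s: "(\<lambda>n. (\<bar>L\<bar> * r) ^ n /\<^sub>R fact n) sums exp (\<bar>L\<bar> * r)" by (rule exp_converges)
      have "(\<Sum>n\<in>{k}. (\<bar>L\<bar> * r) ^ n /\<^sub>R fact n) \<le> (\<Sum>n. (\<bar>L\<bar> * r) ^ n /\<^sub>R fact n)"
        by (rule sum_le_suminf[OF sums_summable[OF s]]) (use r in auto)
      then show ?thesis using sums_unique[OF s] by (simp add: divide_inverse mult.commute)
    qed
    then have "cmod (interpolant \<sigma> m0 m1 z1) * ((\<bar>L\<bar> * r) ^ k / fact k) \<le> cmod (interpolant \<sigma> m0 m1 z1) * exp (\<bar>L\<bar> * r)"
      by (rule mult_left_mono) simp
    moreover have "r ^ k * cmod (coef k) = cmod (interpolant \<sigma> m0 m1 z1) * ((\<bar>L\<bar> * r) ^ k / fact k)"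
      unfolding coef_def norm_mult norm_of_real L_def[symmetric] by (simp add: power_mult_distrib power_abs)
    ultimately show ?thesis using shift by linarith
  qed
  show "cmod (interpolant \<sigma> m0 m1 z - (\<Sum>k<j. (z - z1) ^ k * coef k)) \<le> 2 * (1/2) ^ j * max m0 m1" if z: "cmod (z - z1) < r / 2"
  proof -
    let ?f = "\<lambda>k. (z - z1) ^ k * coef k"
    have "(\<lambda>k. ((z - z1) * of_real L) ^ k /\<^sub>R fact k) sums exp ((z - z1) * of_real L)" by (rule exp_converges)
    then have "(\<lambda>k. interpolant \<sigma> m0 m1 z1 * (((z - z1) * of_real L) ^ k /\<^sub>R fact k)) sums (interpolant \<sigma> m0 m1 z1 * exp ((z - z1) * of_real L))"
      by (rule sums_mult)
    moreover have "interpolant \<sigma> m0 m1 z1 * (((z - z1) * of_real L) ^ k /\<^sub>R fact k) = ?f k" for k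
      unfolding coef_def L_def[symmetric] power_mult_distrib by (simp add: scaleR_conv_of_real divide_inverse mult_ac)
    moreover have "interpolant \<sigma> m0 m1 z1 * exp ((z - z1) * of_real L) = interpolant \<sigma> m0 m1 z"
      using interpolant_shift[of \<sigma> m0 m1 z1 "z - z1"] by (simp add: L_def)
    ultimately have "?f sums interpolant \<sigma> m0 m1 z" by simp
    then have f: "(\<lambda>k. ?f (k + j)) sums (interpolant \<sigma> m0 m1 z - (\<Sum>k<j. ?f k))" by (rule sums_split_initial_segment)
    \<comment> \<open>On half the radius the coefficient bounds leave a geometric series of ratio
      1/2, whose tail bounds the remainder.\<close>
    have "(\<lambda>k. (1/2) ^ k) sums (1 / (1 - 1/2 :: real))" by (rule geometric_sums) simp
    from sums_mult[OF this, of "(1/2) ^ j * max m0 m1"]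
    have g: "(\<lambda>k. (1/2) ^ j * max m0 m1 * (1/2) ^ k) sums (2 * (1/2) ^ j * max m0 m1)" by (simp add: mult_ac)
    show ?thesis
    proof (rule norm_sums_le[OF f g])
      fix k
      have "cmod (?f (k + j)) \<le> (r / 2) ^ (k + j) * cmod (coef (k + j))"
        unfolding norm_mult norm_power using z by (intro mult_right_mono power_mono) auto
      also have "\<dots> = (1/2) ^ (k + j) * (r ^ (k + j) * cmod (coef (k + j)))" by (simp add: power_divide)
      also have "\<dots> \<le> (1/2) ^ (k + j) * max m0 m1" by (intro mult_left_mono le) simp
      finally show "cmod (?f (k + j)) \<le> (1/2) ^ j * max m0 m1 * (1/2) ^ k" by (simp add: power_add mult_ac)
    qed
  qed
qed

text \<open>Dividing both factors by \<open>v\<close> divides their geometric mean by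
  \<open>v\<close>, as the exponents add up to 1.\<close>

lemma interpolant_value:
  assumes m: "0 \<le> m0" "0 \<le> m1" and v: "0 < v" and th: "0 < \<theta>" "\<theta> < 1"
    and eq: "cmod a * v = m0 powr (1 - \<theta>) * m1 powr \<theta>"
  shows "interpolant (sgn a) (m0 / v) (m1 / v) (of_real \<theta>) = a"
proof (cases "m0 = 0 \<or> m1 = 0")
  case True
  then have "cmod a * v = 0" using eq th by auto
  then show ?thesis using True v by (auto simp: interpolant_def)
next
  case False
  then have p: "0 < m0" "0 < m1" using m by auto
  have vv: "v powr (1 - \<theta>) * v powr \<theta> = v" using v by (simp add: powr_add[symmetric])
  have "exp ((1 - complex_of_real \<theta>) * of_real (ln (m0 / v)) + of_real \<theta> * of_real (ln (m1 / v)))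
     = of_real (exp ((1 - \<theta>) * ln (m0 / v) + \<theta> * ln (m1 / v)))" by (simp add: exp_of_real[symmetric])
  also have "exp ((1 - \<theta>) * ln (m0 / v) + \<theta> * ln (m1 / v)) = (m0 / v) powr (1 - \<theta>) * (m1 / v) powr \<theta>"
    using p v by (simp add: powr_def exp_add)
  also have "\<dots> = m0 powr (1 - \<theta>) * m1 powr \<theta> / (v powr (1 - \<theta>) * v powr \<theta>)" using p v by (simp add: powr_divide)
  also have "\<dots> = cmod a" unfolding eq[symmetric] vv using v by simp
  finally have "exp ((1 - complex_of_real \<theta>) * of_real (ln (m0 / v)) + of_real \<theta> * of_real (ln (m1 / v))) = of_real (cmod a)" .
  moreover have "sgn a * of_real (cmod a) = a" by (cases "a = 0") (simp_all add: sgn_div_norm scaleR_conv_of_real)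
  ultimately show ?thesis using False v by (simp add: interpolant_def)
qed

text \<open>Only finitely many indices have \<open>v e < 2 / \<eta>\<close>, and for these
  continuity of each function suffices; for all others the two values together are at most
  \<open>2 * B e / v e \<le> \<eta> * B e\<close>.\<close>

lemma weighted_equicontinuous:
  fixes g :: "'e \<Rightarrow> 'b::topological_space \<Rightarrow> complex" and v :: "'e \<Rightarrow> real"
  assumes fin: "\<And>k. finite {e\<in>E. v e < k}" and v: "\<And>e. 1 \<le> v e" and B: "\<And>e. 0 \<le> B e"
    and bd: "\<And>e w. e \<in> E \<Longrightarrow> w \<in> S \<Longrightarrow> cmod (g e w) \<le> B e / v e"
    and cont: "\<And>e. e \<in> E \<Longrightarrow> continuous_on S (g e)" and z: "z \<in> S" and \<eta>: "0 < \<eta>"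
  shows "eventually (\<lambda>w. w \<in> S \<and> (\<forall>e\<in>E. cmod (g e w - g e z) \<le> \<eta> * B e)) (at z within S)"
proof -
  let ?P = "{e\<in>E. v e < 2 / \<eta>}"
  have "eventually (\<lambda>w. \<forall>e\<in>?P. w \<in> S \<longrightarrow> cmod (g e w - g e z) \<le> \<eta> * B e) (at z within S)"
  proof (rule eventually_ball_finite[OF fin], rule ballI)
    fix e assume "e \<in> ?P"
    then have e: "e \<in> E" by simp
    show "eventually (\<lambda>w. w \<in> S \<longrightarrow> cmod (g e w - g e z) \<le> \<eta> * B e) (at z within S)"
    proof (cases "B e = 0")
      case True
      then have "g e w = 0" if "w \<in> S" for w using bd[OF e that] by simp
      then show ?thesis using z True by (intro always_eventually) auto
    next
      case False
      then have "0 < \<eta> * B e" using B[of e] \<eta> by simp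
      moreover have "(g e \<longlongrightarrow> g e z) (at z within S)" using cont[OF e] z by (simp add: continuous_on_def)
      ultimately have "eventually (\<lambda>w. dist (g e w) (g e z) < \<eta> * B e) (at z within S)" by (rule tendstoD[rotated])
      then show ?thesis by (rule eventually_mono) (simp add: dist_norm)
    qed
  qed
  moreover have "eventually (\<lambda>w. w \<in> S) (at z within S)" by (simp add: eventually_at_filter)
  ultimately show ?thesis
  proof eventually_elim
    case (elim w)
    have "cmod (g e w - g e z) \<le> \<eta> * B e" if e: "e \<in> E" for e
    proof (cases "v e < 2 / \<eta>")
      case True
      then show ?thesis using elim e by auto
    next
      case False
      then have "2 \<le> \<eta> * v e" using \<eta> by (simp add: field_simps)
      then have "2 * B e \<le> \<eta> * v e * B e" using B by (intro mult_right_mono) auto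
      then have "2 * (B e / v e) \<le> \<eta> * B e" using v[of e] by (simp add: field_simps)
      then show ?thesis using norm_triangle_ineq4[of "g e w" "g e z"] bd[OF e, of w] bd[OF e z] elim by auto
    qed
    then show ?case using elim by blast
  qed
qed

context filling
begin

section \<open>Synthesis of dominated coefficients\<close>

text \<open>One majorant \<open>m\<close> serves all coefficient families below its multiples. The
  quantifier over all \<open>h\<close> that agree with the synthesis almost everywhere accommodates
  identities that fail on null sets, \<open>N\<close> being an arbitrary functional.\<close>

definition synth_bound :: "(('z \<Rightarrow> complex) \<Rightarrow> ennreal) \<Rightarrow> ((int \<times> 'z) \<times> (int \<times> 'z) \<Rightarrow> real) \<Rightarrow> real \<Rightarrow> bool" where
  "synth_bound N m c \<longleftrightarrow> 0 \<le> c \<and> (\<forall>e. 0 \<le> m e) \<and> (\<forall>a \<kappa>. 0 \<le> \<kappa> \<longrightarrow> (\<forall>e\<in>EE. cmod (a e) \<le> \<kappa> * m e) \<longrightarrow>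
     synthable a \<and> (\<forall>h. loc_int M h \<longrightarrow> (AE \<zeta> in M. h \<zeta> = synth a \<zeta>) \<longrightarrow> N h \<le> ennreal (\<kappa> * c)))"

lemma synth_boundD:
  assumes "synth_bound N m c" "0 \<le> \<kappa>" "\<forall>e\<in>EE. cmod (a e) \<le> \<kappa> * m e"
  shows "synthable a" "loc_int M h \<Longrightarrow> AE \<zeta> in M. h \<zeta> = synth a \<zeta> \<Longrightarrow> N h \<le> ennreal (\<kappa> * c)"
proof -
  have "\<forall>a \<kappa>. 0 \<le> \<kappa> \<longrightarrow> (\<forall>e\<in>EE. cmod (a e) \<le> \<kappa> * m e) \<longrightarrow>
     synthable a \<and> (\<forall>h. loc_int M h \<longrightarrow> (AE \<zeta> in M. h \<zeta> = synth a \<zeta>) \<longrightarrow> N h \<le> ennreal (\<kappa> * c))"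
    using assms(1) unfolding synth_bound_def by (elim conjE)
  from this assms(2,3)
  have *: "synthable a \<and> (\<forall>h. loc_int M h \<longrightarrow> (AE \<zeta> in M. h \<zeta> = synth a \<zeta>) \<longrightarrow> N h \<le> ennreal (\<kappa> * c))" by blast
  show "synthable a" using * by simp
  show "loc_int M h \<Longrightarrow> AE \<zeta> in M. h \<zeta> = synth a \<zeta> \<Longrightarrow> N h \<le> ennreal (\<kappa> * c)" using * by simp
qed

lemma synth_boundI:
  assumes "0 \<le> c" "\<And>e. 0 \<le> m e"
    "\<And>a \<kappa>. 0 \<le> \<kappa> \<Longrightarrow> \<forall>e\<in>EE. cmod (a e) \<le> \<kappa> * m e \<Longrightarrow> synthable a"
    "\<And>a \<kappa> h. 0 \<le> \<kappa> \<Longrightarrow> \<forall>e\<in>EE. cmod (a e) \<le> \<kappa> * m e \<Longrightarrow> synthable a \<Longrightarrow> loc_int M h \<Longrightarrow>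
      AE \<zeta> in M. h \<zeta> = synth a \<zeta> \<Longrightarrow> N h \<le> ennreal (\<kappa> * c)"
  shows "synth_bound N m c"
  unfolding synth_bound_def
proof (intro conjI assms(1) allI assms(2) impI)
  fix a \<kappa> assume k: "0 \<le> \<kappa>" and a: "\<forall>e\<in>EE. cmod (a e) \<le> \<kappa> * m e"
  show S: "synthable a" by (rule assms(3)[OF k a])
  fix h assume "loc_int M h" "AE \<zeta> in M. h \<zeta> = synth a \<zeta>"
  then show "N h \<le> ennreal (\<kappa> * c)" by (rule assms(4)[OF k a S])
qed

lemma synth_boundD0: "synth_bound N m c \<Longrightarrow> 0 \<le> c" "synth_bound N m c \<Longrightarrow> 0 \<le> m e"
  unfolding synth_bound_def by blast+

text \<open>The kernel sum of the coefficients plays a double part: it makes the synthesis converge,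
  and it dominates the differences of its averages and hence the square function.\<close>

lemma synth_bound_besov:
  assumes p: "0 < p" "0 < q" and s: "0 < s" "s < 1" and as: "Q * (enn2real (inverse p) - 1) < s"
  shows "\<exists>c>0. \<forall>m K. (\<forall>e. 0 \<le> m e) \<longrightarrow> mixed Ed we (enn2real (inverse p)) (enn2real (inverse q)) s m K \<longrightarrow>
    synth_bound (besov_qnorm M Xs s p q) m (c * K)"
proof -
  let ?a = "enn2real (inverse p)" and ?b = "enn2real (inverse q)"
  obtain c0 where c0: "c0 > 0" "\<forall>u K. mixed Ed we ?a ?b s u K \<longrightarrow>
    (\<exists>v. mixed V wt ?a ?b s v (c0 * K) \<and> (\<forall>x\<in>vertices Xs. \<forall>F. finite F \<longrightarrow> F \<subseteq> EE \<longrightarrow> (\<Sum>e\<in>F. \<bar>u e\<bar> * ker x e) \<le> v x))"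
    using kernel_sum[where b = ?b, OF enn2real_nonneg enn2real_nonneg s as] by (elim exE conjE) (rule that)
  define c where "c = real (Nc 1) * (real Nn * Kc * c0)"
  have c: "0 \<le> c" using c0(1) Kc_pos by (simp add: c_def)
  show ?thesis
  proof (intro exI[of _ "c + 1"] conjI allI impI)
    show "0 < c + 1" using c by simp
    fix m K assume m0: "\<forall>e. 0 \<le> m e" and m: "mixed Ed we ?a ?b s m K"
    have K: "0 \<le> K" by (rule mixed_nonneg[OF m])
    have ker: "\<exists>v. mixed V wt ?a ?b s v (c0 * (\<kappa> * K)) \<and> (\<forall>x\<in>vertices Xs. \<forall>F. finite F \<longrightarrow> F \<subseteq> EE \<longrightarrow> (\<Sum>e\<in>F. cmod (a e) * ker x e) \<le> v x)"
      if k: "0 \<le> \<kappa>" and a: "\<forall>e\<in>EE. cmod (a e) \<le> \<kappa> * m e" for a \<kappa>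
    proof -
      have "mixed Ed we ?a ?b s (\<lambda>e. cmod (a e)) (\<kappa> * K)"
      proof (rule mixed_mono[OF mixed_scale[OF m k] enn2real_nonneg enn2real_nonneg order_refl])
        fix n e assume "e \<in> Ed n"
        then have "e \<in> EE" by (auto simp: EE_def)
        then have "cmod (a e) \<le> \<kappa> * m e" using a by blast
        then show "\<bar>cmod (a e)\<bar> \<le> \<bar>\<kappa> * m e\<bar>" by simp
      qed (rule vol_nonneg)
      from c0(2)[rule_format, OF this] show ?thesis by simp
    qed
    show "synth_bound (besov_qnorm M Xs s p q) m ((c + 1) * K)"
    proof (rule synth_boundI)
      show "0 \<le> (c + 1) * K" using c K by simp
      show "0 \<le> m e" for e by (rule m0[rule_format])
      fix a and \<kappa> :: real assume k: "0 \<le> \<kappa>" and a: "\<forall>e\<in>EE. cmod (a e) \<le> \<kappa> * m e"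
      obtain v where v: "mixed V wt ?a ?b s v (c0 * (\<kappa> * K))"
        "\<And>x F. x \<in> vertices Xs \<Longrightarrow> finite F \<Longrightarrow> F \<subseteq> EE \<Longrightarrow> (\<Sum>e\<in>F. cmod (a e) * ker x e) \<le> v x"
        using ker[OF k a] by blast
      show "synthable a" by (rule synthable_kernel[OF v(2)])
      fix h assume S: "synthable a" and h: "loc_int M h" "AE \<zeta> in M. h \<zeta> = synth a \<zeta>"
      have P: "Pavg M h x = Pavg M (synth a) x" for x
        by (rule Pavg_cong_AE[OF loc_int_measurable[OF h(1)] loc_int_measurable[OF synth_loc_int[OF S]] h(2)])
      have v0: "0 \<le> v x" if "x \<in> vertices Xs" for x using v(2)[OF that, of "{}"] by simp
      have le: "absd Xs (Pavg M h) x \<le> real Nn * Kc * v x" if x: "x \<in> vertices Xs" for x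
      proof -
        have "absd Xs (Pavg M h) x \<le> (\<Sum>x'\<in>neighbors Xs x. cmod (ana h (x, x')))" by (rule absd_le)
        also have "\<dots> \<le> (\<Sum>x'\<in>neighbors Xs x. Kc * v x)"
        proof (rule sum_mono)
          fix x' assume "x' \<in> neighbors Xs x"
          from Pavg_synth_diff_le[OF S this v(2)[OF x]]
          show "cmod (ana h (x, x')) \<le> Kc * v x" by (simp add: ana_def P)
        qed
        also have "\<dots> = real (card (neighbors Xs x)) * (Kc * v x)" by simp
        also have "\<dots> \<le> real Nn * (Kc * v x)"
          using card_neighbors v0[OF x] Kc_pos by (intro mult_right_mono) auto
        finally show ?thesis by (simp add: mult.assoc)
      qed
      have NK: "0 \<le> real Nn * Kc" using Kc_pos by simp
      have "mixed V wt ?a ?b s (absd Xs (Pavg M h)) (real Nn * Kc * (c0 * (\<kappa> * K)))"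
      proof (rule mixed_mono[OF mixed_scale[OF v(1) NK] enn2real_nonneg enn2real_nonneg order_refl])
        fix n x assume "x \<in> V n"
        then have x: "x \<in> vertices Xs" by (simp add: V_iff)
        show "\<bar>absd Xs (Pavg M h) x\<bar> \<le> \<bar>real Nn * Kc * v x\<bar>"
          using le[OF x] v0[OF x] NK absd_nonneg[of "Pavg M h" x] by (simp add: abs_of_nonneg)
      qed (rule vol_nonneg)
      from besov_le[OF p this] have "besov_qnorm M Xs s p q h \<le> ennreal (real (Nc 1) * (real Nn * Kc * (c0 * (\<kappa> * K))))" .
      also have "\<dots> \<le> ennreal (\<kappa> * ((c + 1) * K))"
        using k K by (intro ennreal_leI) (simp add: c_def algebra_simps)
      finally show "besov_qnorm M Xs s p q h \<le> ennreal (\<kappa> * ((c + 1) * K))" .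
    qed
  qed
qed

lemma synth_diff_AE:
  assumes u: "synthable u" and v: "synthable v"
  shows "AE \<zeta> in M. synth u \<zeta> - synth v \<zeta> = synth (\<lambda>e. u e - v e) \<zeta>"
proof -
  have "synthable (\<lambda>e. u e - v e)" by (rule synthable_add[OF u v]) (rule norm_triangle_ineq4)
  from synth_add_AE[OF this v] show ?thesis by eventually_elim simp
qed

lemma synth_sum:
  assumes "\<And>k::nat. synthable (u k)"
  shows "synthable (\<lambda>e. \<Sum>k<m. u k e)" "AE \<zeta> in M. (\<Sum>k<m. synth (u k) \<zeta>) = synth (\<lambda>e. \<Sum>k<m. u k e) \<zeta>"
proof (induction m)
  case 0
  {
    case 1
    show ?case by (simp add: synthable_def)
  next
    case 2
    show ?case by (simp add: synth_def)
  }
next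
  case (Suc m)
  {
    case 1
    show ?case by (rule synthable_add[OF Suc.IH(1) assms[of m]]) (simp add: norm_triangle_ineq)
  next
    case 2
    from synth_add_AE[OF Suc.IH(1) assms[of m]] Suc.IH(2) show ?case by eventually_elim simp
  }
qed

text \<open>A family below \<open>max (m0 e) (m1 e)\<close> is split according to which of the two
  majorants is larger, one part for each space.\<close>

lemma synth_bound_sum_qnorm:
  assumes B0: "synth_bound n0 m0 c0" and B1: "synth_bound n1 m1 c1"
  shows "synth_bound (sum_qnorm M n0 n1) (\<lambda>e. max (m0 e) (m1 e)) (c0 + c1)"
proof (rule synth_boundI)
  note c = synth_boundD0(1)[OF B0] synth_boundD0(1)[OF B1]
  show "0 \<le> c0 + c1" using c by simp
  show "0 \<le> max (m0 e) (m1 e)" for e using synth_boundD0(2)[OF B0] by (simp add: le_max_iff_disj)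
  fix a and \<kappa> :: real assume k: "0 \<le> \<kappa>" and a: "\<forall>e\<in>EE. cmod (a e) \<le> \<kappa> * max (m0 e) (m1 e)"
  define a0 where "a0 e = (if m1 e \<le> m0 e then a e else 0)" for e
  define a1 where "a1 e = (if m1 e \<le> m0 e then 0 else a e)" for e
  have le0: "\<forall>e\<in>EE. cmod (a0 e) \<le> \<kappa> * m0 e"
  proof
    fix e assume "e \<in> EE"
    then have "cmod (a e) \<le> \<kappa> * max (m0 e) (m1 e)" using a by blast
    then show "cmod (a0 e) \<le> \<kappa> * m0 e"
      using k synth_boundD0(2)[OF B0, of e] by (cases "m1 e \<le> m0 e") (simp_all add: a0_def max_absorb1)
  qed
  have le1: "\<forall>e\<in>EE. cmod (a1 e) \<le> \<kappa> * m1 e"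
  proof
    fix e assume "e \<in> EE"
    then have "cmod (a e) \<le> \<kappa> * max (m0 e) (m1 e)" using a by blast
    then show "cmod (a1 e) \<le> \<kappa> * m1 e"
      using k synth_boundD0(2)[OF B1, of e] by (cases "m1 e \<le> m0 e") (simp_all add: a1_def max_absorb2)
  qed
  have aa: "a = (\<lambda>e. a0 e + a1 e)" by (auto simp: a0_def a1_def)
  have S: "synthable a0" "synthable a1" by (rule synth_boundD(1)[OF B0 k le0], rule synth_boundD(1)[OF B1 k le1])
  show "synthable a" by (rule synthable_add[OF S]) (simp add: aa norm_triangle_ineq)
  fix h assume h: "loc_int M h" "AE \<zeta> in M. h \<zeta> = synth a \<zeta>"
  let ?g = "synth a0"
  have g: "loc_int M ?g" by (rule synth_loc_int[OF S(1)])
  \<comment> \<open>A decomposition in \<open>sum_qnorm\<close> must hold at every point, so the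
    second summand is \<open>h\<close> minus the synthesis of \<open>a0\<close>; it agrees with that
    of \<open>a1\<close> only almost everywhere.\<close>
  have hg: "loc_int M (\<lambda>\<zeta>. h \<zeta> - ?g \<zeta>)" by (rule loc_int_diff[OF h(1) g])
  have "AE \<zeta> in M. h \<zeta> - ?g \<zeta> = synth a1 \<zeta>"
    using h(2) synth_add_AE[OF S] unfolding aa by eventually_elim simp
  from synth_boundD(2)[OF B1 k le1 hg this] have n1: "n1 (\<lambda>\<zeta>. h \<zeta> - ?g \<zeta>) \<le> ennreal (\<kappa> * c1)" by simp
  have "AE \<zeta> in M. ?g \<zeta> = synth a0 \<zeta>" by simp
  from synth_boundD(2)[OF B0 k le0 g this] have n0: "n0 ?g \<le> ennreal (\<kappa> * c0)" by simp
  have "sum_qnorm M n0 n1 h \<le> n0 (fst (?g, \<lambda>\<zeta>. h \<zeta> - ?g \<zeta>)) + n1 (snd (?g, \<lambda>\<zeta>. h \<zeta> - ?g \<zeta>))"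
    unfolding sum_qnorm_def by (rule INF_lower) (simp add: g hg)
  also have "\<dots> \<le> ennreal (\<kappa> * c0) + ennreal (\<kappa> * c1)" unfolding fst_conv snd_conv by (rule add_mono[OF n0 n1])
  also have "\<dots> = ennreal (\<kappa> * (c0 + c1))" using k c by (simp add: distrib_left)
  finally show "sum_qnorm M n0 n1 h \<le> ennreal (\<kappa> * (c0 + c1))" .
qed

lemma synth_bound_synth:
  assumes B: "synth_bound N m c" and k: "0 \<le> \<kappa>" and a: "\<forall>e\<in>EE. cmod (a e) \<le> \<kappa> * m e"
  shows "N (synth a) \<le> ennreal (\<kappa> * c)"
  by (rule synth_boundD(2)[OF B k a synth_loc_int[OF synth_boundD(1)[OF B k a]]]) auto

text \<open>The weight makes the coefficients continuous relative to the majorant, uniformly over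
  all edges, and a relative error \<eta> becomes an error \<open>\<eta> * c\<close> in
  \<open>N\<close>.\<close>

lemma synth_qcontinuous:
  fixes g :: "(int \<times> 'z) \<times> (int \<times> 'z) \<Rightarrow> 'b::topological_space \<Rightarrow> complex"
  assumes B: "synth_bound N m c"
    and fin: "\<And>k. finite {e\<in>EE. v e < k}" and v: "\<And>e. 1 \<le> v e"
    and bd: "\<And>e w. e \<in> EE \<Longrightarrow> w \<in> S \<Longrightarrow> cmod (g e w) \<le> m e / v e"
    and cont: "\<And>e. e \<in> EE \<Longrightarrow> continuous_on S (g e)"
  shows "qcontinuous_on N (\<lambda>w. synth (\<lambda>e. g e w)) S"
  unfolding qcontinuous_on_def
proof
  fix z assume z: "z \<in> S"
  note m0 = synth_boundD0(2)[OF B] and c0 = synth_boundD0(1)[OF B]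
  have bd1: "cmod (g e w) \<le> 1 * m e" if "e \<in> EE" "w \<in> S" for e w
  proof -
    have "m e / v e \<le> m e / 1" using m0 v[of e] by (intro divide_left_mono) auto
    then show ?thesis using bd[OF that] by simp
  qed
  have S1: "synthable (\<lambda>e. g e w)" if "w \<in> S" for w by (rule synth_boundD(1)[OF B zero_le_one]) (use bd1 that in blast)
  show "((\<lambda>w. N (\<lambda>\<zeta>. synth (\<lambda>e. g e w) \<zeta> - synth (\<lambda>e. g e z) \<zeta>)) \<longlongrightarrow> 0) (at z within S)"
  proof (rule order_tendstoI)
    fix y :: ennreal assume "0 < y"
    obtain r where r: "0 < r" "ennreal r < y"
    proof (cases y)
      case (real x)
      then show thesis using that[of "x / 2"] \<open>0 < y\<close> by (simp add: ennreal_less_iff)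
    next
      case top
      then show thesis using that[of 1] by simp
    qed
    \<comment> \<open>Dividing by \<open>c + 1\<close> also covers the case
      \<open>c = 0\<close>.\<close>
    define \<eta> where "\<eta> = r / (c + 1)"
    have \<eta>: "0 < \<eta>" "\<eta> * c \<le> r" using r c0 by (auto simp: \<eta>_def field_simps)
    show "eventually (\<lambda>w. N (\<lambda>\<zeta>. synth (\<lambda>e. g e w) \<zeta> - synth (\<lambda>e. g e z) \<zeta>) < y) (at z within S)"
    proof (rule eventually_mono)
      show "eventually (\<lambda>w. w \<in> S \<and> (\<forall>e\<in>EE. cmod (g e w - g e z) \<le> \<eta> * m e)) (at z within S)"
        by (rule weighted_equicontinuous[OF fin v m0 bd cont z \<eta>(1)])
      fix w assume "w \<in> S \<and> (\<forall>e\<in>EE. cmod (g e w - g e z) \<le> \<eta> * m e)"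
      then have w: "w \<in> S" and d: "\<forall>e\<in>EE. cmod (g e w - g e z) \<le> \<eta> * m e" by auto
      have "N (\<lambda>\<zeta>. synth (\<lambda>e. g e w) \<zeta> - synth (\<lambda>e. g e z) \<zeta>) \<le> ennreal (\<eta> * c)"
        by (rule synth_boundD(2)[OF B less_imp_le[OF \<eta>(1)] d loc_int_diff[OF synth_loc_int[OF S1[OF w]] synth_loc_int[OF S1[OF z]]] synth_diff_AE[OF S1[OF w] S1[OF z]]])
      also have "\<dots> \<le> ennreal r" by (rule ennreal_leI[OF \<eta>(2)])
      also note r(2)
      finally show "N (\<lambda>\<zeta>. synth (\<lambda>e. g e w) \<zeta> - synth (\<lambda>e. g e z) \<zeta>) < y" .
    qed
  qed simp
qed

text \<open>Taylor coefficients and remainders that are bounded relative to the majorant synthesize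
  to coefficients and remainders in the space.\<close>

lemma synth_qanalytic:
  assumes B: "synth_bound N m c"
    and ex: "\<And>z1. z1 \<in> U \<Longrightarrow> \<exists>r>0. \<exists>coef. ball z1 r \<subseteq> U \<and> (\<forall>k. \<exists>\<kappa>\<ge>0. \<forall>e\<in>EE. cmod (coef k e) \<le> \<kappa> * m e) \<and>
      (\<forall>j. \<forall>z\<in>ball z1 r. \<forall>e\<in>EE. cmod (g e z - (\<Sum>k<j. (z - z1) ^ k * coef k e)) \<le> (2 * (1/2) ^ j) * m e)"
  shows "qanalytic_on N (\<lambda>z. synth (\<lambda>e. g e z)) U"
  unfolding qanalytic_on_def
proof
  fix z1 assume "z1 \<in> U"
  from ex[OF this] obtain r coef where r: "r > 0" "ball z1 r \<subseteq> U"
    and coef: "\<forall>k. \<exists>\<kappa>\<ge>0. \<forall>e\<in>EE. cmod (coef k e) \<le> \<kappa> * m e"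
    and rem: "\<forall>j. \<forall>z\<in>ball z1 r. \<forall>e\<in>EE. cmod (g e z - (\<Sum>k<j. (z - z1) ^ k * coef k e)) \<le> (2 * (1/2) ^ j) * m e"
    by blast
  \<comment> \<open>The remainder bound for \<open>j = 0\<close> is a bound for \<open>g e z\<close>
    itself, with the constant 2.\<close>
  have Sg: "synthable (\<lambda>e. g e z)" if z: "z \<in> ball z1 r" for z
    by (rule synth_boundD(1)[OF B, of 2]) (use rem[rule_format, OF z, of _ 0] in auto)
  have Sc: "synthable (coef k)" and Nc: "N (synth (coef k)) < \<infinity>" for k
  proof -
    obtain \<kappa> where k: "0 \<le> \<kappa>" "\<forall>e\<in>EE. cmod (coef k e) \<le> \<kappa> * m e" using coef by blast
    show "synthable (coef k)" by (rule synth_boundD(1)[OF B k])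
    show "N (synth (coef k)) < \<infinity>" using synth_bound_synth[OF B k] by (simp add: order_le_less_trans)
  qed
  have St: "synthable (\<lambda>e. x * coef k e)" for k x
  proof -
    obtain \<kappa> where k: "0 \<le> \<kappa>" "\<forall>e\<in>EE. cmod (coef k e) \<le> \<kappa> * m e" using coef by blast
    show ?thesis
    proof (rule synth_boundD(1)[OF B])
      show "0 \<le> cmod x * \<kappa>" using k by simp
      show "\<forall>e\<in>EE. cmod (x * coef k e) \<le> cmod x * \<kappa> * m e"
        unfolding norm_mult mult.assoc using k(2) by (intro ballI mult_left_mono) auto
    qed
  qed
  show "\<exists>r>0. \<exists>a. (\<forall>k. N (a k) < \<infinity>) \<and> ball z1 r \<subseteq> U \<and>
    (\<lambda>j. SUP z\<in>ball z1 r. N (\<lambda>\<zeta>. synth (\<lambda>e. g e z) \<zeta> - (\<Sum>k<j. (z - z1) ^ k * a k \<zeta>))) \<longlonglongrightarrow> 0"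
  proof (intro exI[of _ r] exI[of _ "\<lambda>k. synth (coef k)"] conjI r allI Nc)
    have "(\<lambda>j. ennreal (2 * (1/2) ^ j * c)) \<longlonglongrightarrow> ennreal (2 * 0 * c)"
      by (intro tendsto_ennrealI tendsto_mult tendsto_const LIMSEQ_power_zero) simp
    then have up: "(\<lambda>j. ennreal (2 * (1/2) ^ j * c)) \<longlonglongrightarrow> 0" by simp
    show "(\<lambda>j. SUP z\<in>ball z1 r. N (\<lambda>\<zeta>. synth (\<lambda>e. g e z) \<zeta> - (\<Sum>k<j. (z - z1) ^ k * synth (coef k) \<zeta>))) \<longlonglongrightarrow> 0"
    proof (rule tendsto_sandwich[OF _ _ tendsto_const up])
      show "\<forall>\<^sub>F j in sequentially. (SUP z\<in>ball z1 r. N (\<lambda>\<zeta>. synth (\<lambda>e. g e z) \<zeta> - (\<Sum>k<j. (z - z1) ^ k * synth (coef k) \<zeta>))) \<le> ennreal (2 * (1/2) ^ j * c)"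
      proof (intro always_eventually allI SUP_least)
        fix j z assume z: "z \<in> ball z1 r"
        let ?u = "\<lambda>k e. (z - z1) ^ k * coef k e"
        have Su: "synthable (\<lambda>e. \<Sum>k<j. ?u k e)" and AEu: "AE \<zeta> in M. (\<Sum>k<j. (z - z1) ^ k * synth (coef k) \<zeta>) = synth (\<lambda>e. \<Sum>k<j. ?u k e) \<zeta>"
          using synth_sum[of ?u j] St by (simp_all add: synth_cmult)
        have h: "loc_int M (\<lambda>\<zeta>. synth (\<lambda>e. g e z) \<zeta> - (\<Sum>k<j. (z - z1) ^ k * synth (coef k) \<zeta>))"
          by (intro loc_int_diff loc_int_sum loc_int_cmult synth_loc_int Sg z Sc)
        have ae: "AE \<zeta> in M. synth (\<lambda>e. g e z) \<zeta> - (\<Sum>k<j. (z - z1) ^ k * synth (coef k) \<zeta>) = synth (\<lambda>e. g e z - (\<Sum>k<j. ?u k e)) \<zeta>"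
          using AEu synth_diff_AE[OF Sg[OF z] Su] by eventually_elim simp
        show "N (\<lambda>\<zeta>. synth (\<lambda>e. g e z) \<zeta> - (\<Sum>k<j. (z - z1) ^ k * synth (coef k) \<zeta>)) \<le> ennreal (2 * (1/2) ^ j * c)"
          by (rule synth_boundD(2)[OF B _ _ h ae]) (use rem z in auto)
      qed
    qed simp
  qed
qed


text \<open>The coefficients lie below \<open>m0 / v\<close> and \<open>m1 / v\<close> on the two
  boundary lines and below the larger of the two inside. The size bounds use
  \<open>v \<ge> 1\<close>; the growth of \<open>v\<close> supplies continuity.\<close>

lemma admissible_synth_interpolant:
  assumes B0: "synth_bound n0 m0 c0" and B1: "synth_bound n1 m1 c1"
    and fin: "\<And>k. finite {e\<in>EE. v e < k}" and v: "\<And>e. 1 \<le> v e" and \<sigma>: "\<And>e. cmod (\<sigma> e) \<le> 1"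
  defines "F \<equiv> \<lambda>z. synth (\<lambda>e. interpolant (\<sigma> e) (m0 e / v e) (m1 e / v e) z)"
  shows "admissible M n0 n1 F" "adm_qnorm n0 n1 F \<le> ennreal (max c0 c1)"
    "z \<in> cstrip \<Longrightarrow> synthable (\<lambda>e. interpolant (\<sigma> e) (m0 e / v e) (m1 e / v e) z)"
proof -
  let ?m = "\<lambda>e. max (m0 e) (m1 e)"
  define g where "g e z = interpolant (\<sigma> e) (m0 e / v e) (m1 e / v e) z" for e z
  have F: "F = (\<lambda>z. synth (\<lambda>e. g e z))" by (simp add: F_def g_def)
  have m: "0 \<le> m0 e / v e" "0 \<le> m1 e / v e" "m0 e / v e \<le> m0 e" "m1 e / v e \<le> m1 e" for e
    using synth_boundD0(2)[OF B0, of e] synth_boundD0(2)[OF B1, of e] v[of e]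
      mult_left_mono[of 1 "v e" "m0 e"] mult_left_mono[of 1 "v e" "m1 e"] by (auto simp: divide_le_eq)
  have mx: "max (m0 e / v e) (m1 e / v e) = ?m e / v e" for e
    using v[of e] by (simp add: max_divide_distrib_right)
  have mle: "?m e / v e \<le> ?m e" for e unfolding mx[symmetric] using m[of e] by auto
  have B: "synth_bound (sum_qnorm M n0 n1) ?m (c0 + c1)" by (rule synth_bound_sum_qnorm[OF B0 B1])
  have g: "cmod (g e z) \<le> ?m e / v e" if "z \<in> cstrip" for e z
    unfolding mx[symmetric] g_def by (rule interpolant_bounds(1)[OF m(1,2) \<sigma> that])
  have g': "\<forall>e\<in>EE. cmod (g e z) \<le> 1 * ?m e" if "z \<in> cstrip" for z
    unfolding mult_1 by (intro ballI order_trans[OF g[OF that] mle])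
  have S: "synthable (\<lambda>e. g e z)" if "z \<in> cstrip" for z by (rule synth_boundD(1)[OF B zero_le_one g'[OF that]])
  then show "z \<in> cstrip \<Longrightarrow> synthable (\<lambda>e. interpolant (\<sigma> e) (m0 e / v e) (m1 e / v e) z)" by (simp add: g_def)
  have g0: "cmod (g e (\<i> * of_real t)) \<le> m0 e / v e" for e t
    unfolding g_def by (rule interpolant_bounds(2)[OF m(1,2) \<sigma>]) simp
  have g1: "cmod (g e (1 + \<i> * of_real t)) \<le> m1 e / v e" for e t
    unfolding g_def by (rule interpolant_bounds(3)[OF m(1,2) \<sigma>]) simp
  have n0: "n0 (F (\<i> * of_real t)) \<le> ennreal c0" for t
  proof -
    have "\<forall>e\<in>EE. cmod (g e (\<i> * of_real t)) \<le> 1 * m0 e" unfolding mult_1 by (intro ballI order_trans[OF g0 m(3)])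
    from synth_bound_synth[OF B0 zero_le_one this] show ?thesis by (simp add: F)
  qed
  have n1: "n1 (F (1 + \<i> * of_real t)) \<le> ennreal c1" for t
  proof -
    have "\<forall>e\<in>EE. cmod (g e (1 + \<i> * of_real t)) \<le> 1 * m1 e" unfolding mult_1 by (intro ballI order_trans[OF g1 m(4)])
    from synth_bound_synth[OF B1 zero_le_one this] show ?thesis by (simp add: F)
  qed
  have s0: "(SUP t. n0 (F (\<i> * complex_of_real t))) \<le> ennreal c0" by (rule SUP_least) (rule n0)
  have s1: "(SUP t. n1 (F (1 + \<i> * complex_of_real t))) \<le> ennreal c1" by (rule SUP_least) (rule n1)
  show "adm_qnorm n0 n1 F \<le> ennreal (max c0 c1)"
    unfolding adm_qnorm_def by (intro max.boundedI order_trans[OF s0] order_trans[OF s1] ennreal_leI) auto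
  have gc: "continuous_on A (g e)" for A e
    using continuous_interpolant[of A "\<sigma> e" "m0 e / v e" "m1 e / v e"] by (simp add: g_def[abs_def])
  show "admissible M n0 n1 F"
    unfolding admissible_def
  proof (intro conjI ballI)
    show "loc_int M (F z)" if "z \<in> cstrip" for z unfolding F by (rule synth_loc_int[OF S[OF that]])
    have "sum_qnorm M n0 n1 (F z) \<le> ennreal (c0 + c1)" if "z \<in> cstrip" for z
      using synth_bound_synth[OF B zero_le_one g'[OF that]] by (simp add: F)
    then have "(SUP z\<in>cstrip. sum_qnorm M n0 n1 (F z)) \<le> ennreal (c0 + c1)" by (rule SUP_least)
    then show "(SUP z\<in>cstrip. sum_qnorm M n0 n1 (F z)) < \<infinity>" by (rule order_le_less_trans) simp
    show "(SUP t. n0 (F (\<i> * complex_of_real t))) < \<infinity>" using s0 by (rule order_le_less_trans) simp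
    show "(SUP t. n1 (F (1 + \<i> * complex_of_real t))) < \<infinity>" using s1 by (rule order_le_less_trans) simp
    show "qcontinuous_on (sum_qnorm M n0 n1) F cstrip" unfolding F by (rule synth_qcontinuous[OF B fin v g gc])
    show "qcontinuous_on n0 (\<lambda>t::real. F (\<i> * complex_of_real t)) UNIV"
      unfolding F by (rule synth_qcontinuous[OF B0 fin v g0]) (auto intro!: continuous_on_compose2[OF gc[of UNIV]] continuous_intros)
    show "qcontinuous_on n1 (\<lambda>t::real. F (1 + \<i> * complex_of_real t)) UNIV"
      unfolding F by (rule synth_qcontinuous[OF B1 fin v g1]) (auto intro!: continuous_on_compose2[OF gc[of UNIV]] continuous_intros)
    show "qanalytic_on (sum_qnorm M n0 n1) F strip"
      unfolding F
    proof (rule synth_qanalytic[OF B])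
      fix z1 assume z1: "z1 \<in> strip"
      \<comment> \<open>The distance to the boundary of the strip: the Taylor estimates translate
        \<open>z1\<close> horizontally by \<open>r\<close> and hold on the ball of half this
        radius.\<close>
      define r where "r = min (Re z1) (1 - Re z1)"
      have r: "0 < r" "r \<le> Re z1" "r \<le> 1 - Re z1" using z1 by (auto simp: r_def strip_def)
      define coef where "coef k e = g e z1 * of_real ((ln (m1 e / v e) - ln (m0 e / v e)) ^ k / fact k)" for k :: nat and e
      have T1: "r ^ k * cmod (coef k e) \<le> ?m e / v e" for k e
        using interpolant_taylor(1)[OF m(1)[of e] m(2)[of e] \<sigma>[of e] r, of k] unfolding mx coef_def g_def .
      have T2: "cmod (g e z - (\<Sum>k<j. (z - z1) ^ k * coef k e)) \<le> 2 * (1/2) ^ j * (?m e / v e)" if "cmod (z - z1) < r / 2" for e z j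
        using interpolant_taylor(2)[OF m(1)[of e] m(2)[of e] \<sigma>[of e] r that, of j] unfolding mx coef_def g_def .
      show "\<exists>r>0. \<exists>coef. ball z1 r \<subseteq> strip \<and> (\<forall>k. \<exists>\<kappa>\<ge>0. \<forall>e\<in>EE. cmod (coef k e) \<le> \<kappa> * ?m e) \<and>
        (\<forall>j. \<forall>z\<in>ball z1 r. \<forall>e\<in>EE. cmod (g e z - (\<Sum>k<j. (z - z1) ^ k * coef k e)) \<le> (2 * (1/2) ^ j) * ?m e)"
      proof (intro exI[of _ "r / 2"] exI[of _ coef] conjI)
        show "0 < r / 2" using r by simp
        show "ball z1 (r / 2) \<subseteq> strip"
        proof
          fix z assume "z \<in> ball z1 (r / 2)"
          then have "\<bar>Re z1 - Re z\<bar> < r / 2" using abs_Re_le_cmod[of "z1 - z"] by (simp add: dist_norm)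
          then have "Re z1 - r / 2 < Re z" "Re z < Re z1 + r / 2" by linarith+
          then show "z \<in> strip" using r by (auto simp: strip_def)
        qed
        show "\<forall>k. \<exists>\<kappa>\<ge>0. \<forall>e\<in>EE. cmod (coef k e) \<le> \<kappa> * ?m e"
        proof
          fix k
          have "cmod (coef k e) \<le> 1 / r ^ k * ?m e" for e
          proof -
            have "r ^ k * cmod (coef k e) \<le> ?m e" using T1 mle by (rule order_trans)
            then show ?thesis using r by (simp add: field_simps)
          qed
          then show "\<exists>\<kappa>\<ge>0. \<forall>e\<in>EE. cmod (coef k e) \<le> \<kappa> * ?m e" using r by (intro exI[of _ "1 / r ^ k"]) simp
        qed
        show "\<forall>j. \<forall>z\<in>ball z1 (r / 2). \<forall>e\<in>EE. cmod (g e z - (\<Sum>k<j. (z - z1) ^ k * coef k e)) \<le> (2 * (1/2) ^ j) * ?m e"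
        proof (intro allI ballI)
          fix j z e assume "z \<in> ball z1 (r / 2)"
          then have "cmod (z - z1) < r / 2" by (simp add: dist_norm norm_minus_commute)
          then have "cmod (g e z - (\<Sum>k<j. (z - z1) ^ k * coef k e)) \<le> 2 * (1/2) ^ j * (?m e / v e)" by (rule T2)
          also have "\<dots> \<le> 2 * (1/2) ^ j * ?m e" by (intro mult_left_mono mle) simp
          finally show "cmod (g e z - (\<Sum>k<j. (z - z1) ^ k * coef k e)) \<le> 2 * (1/2) ^ j * ?m e" .
        qed
      qed
    qed
  qed
qed

lemma cinterp_le_besov:
  assumes p: "0 < p0" "0 < q0" "0 < p1" "0 < q1" and pq: "0 < p" "0 < q" and th: "0 < \<theta>" "\<theta> < 1"
    and a: "enn2real (inverse p) = (1 - \<theta>) * enn2real (inverse p0) + \<theta> * enn2real (inverse p1)" "0 < enn2real (inverse p)"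
    and b: "enn2real (inverse q) = (1 - \<theta>) * enn2real (inverse q0) + \<theta> * enn2real (inverse q1)" "0 < enn2real (inverse q)"
    and s: "s = (1 - \<theta>) * s0 + \<theta> * s1"
    and s0: "0 < s0" "s0 < 1" "Q * (enn2real (inverse p0) - 1) < s0"
    and s1: "0 < s1" "s1 < 1" "Q * (enn2real (inverse p1) - 1) < s1"
  shows "\<exists>c>0. \<forall>f. loc_int M f \<longrightarrow>
    cinterp_qnorm M (besov_qnorm M Xs s0 p0 q0) (besov_qnorm M Xs s1 p1 q1) \<theta> f \<le> ennreal c * besov_qnorm M Xs s p q f"
proof -
  let ?n0 = "besov_qnorm M Xs s0 p0 q0" and ?n1 = "besov_qnorm M Xs s1 p1 q1"
  let ?a = "enn2real (inverse p)" and ?b = "enn2real (inverse q)"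
  obtain c where c: "c > 0" "\<forall>f K. 0 \<le> K \<longrightarrow> besov_qnorm M Xs s p q f \<le> ennreal K \<longrightarrow>
    mixed Ed we ?a ?b s (\<lambda>e. cmod (ana f e)) (c * K)"
    using besov_mixed[OF pq, where s = s] by (elim exE conjE) (rule that)
  obtain c0 where c0: "c0 > 0" "\<forall>m K. (\<forall>e. 0 \<le> m e) \<longrightarrow> mixed Ed we (enn2real (inverse p0)) (enn2real (inverse q0)) s0 m K \<longrightarrow>
    synth_bound ?n0 m (c0 * K)" using synth_bound_besov[OF p(1,2) s0] by (elim exE conjE) (rule that)
  obtain c1 where c1: "c1 > 0" "\<forall>m K. (\<forall>e. 0 \<le> m e) \<longrightarrow> mixed Ed we (enn2real (inverse p1)) (enn2real (inverse q1)) s1 m K \<longrightarrow>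
    synth_bound ?n1 m (c1 * K)" using synth_bound_besov[OF p(3,4) s1] by (elim exE conjE) (rule that)
  \<comment> \<open>Synthesis at the endpoints, the cost of the weight, and the passage from the
    Besov quasi-norm to edge differences.\<close>
  define d where "d = max c0 c1 * (2 powr (?a + ?b) * c)"
  have d: "d > 0" using c(1) c0(1) by (simp add: d_def)
  \<comment> \<open>Required for reconstruction, where the coarse smoothings have to flatten
    out.\<close>
  have s': "s < 1"
  proof -
    have "s < (1 - \<theta>) * 1 + \<theta> * 1" unfolding s using th s0 s1 by (intro add_strict_mono mult_strict_left_mono) auto
    then show ?thesis by simp
  qed
  show ?thesis
  proof (intro exI[of _ d] conjI d allI impI)
    fix f assume f: "loc_int M f"
    show "cinterp_qnorm M ?n0 ?n1 \<theta> f \<le> ennreal d * besov_qnorm M Xs s p q f"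
    proof (cases "besov_qnorm M Xs s p q f")
      case top
      then show ?thesis using d by (simp add: ennreal_mult_top)
    next
      case (real K)
      then have "besov_qnorm M Xs s p q f \<le> ennreal K" by simp
      with c(2) real(1) have mx: "mixed Ed we ?a ?b s (\<lambda>e. cmod (ana f e)) (c * K)" by blast
      have cE: "countable (Ed n)" for n by (rule countable_subset[OF _ countable_EE]) (auto simp: EE_def)
      obtain v where v: "\<And>e. 1 \<le> v e" "\<And>k::real. finite {e\<in>(\<Union>n. Ed n). v e < k}"
        "mixed Ed we ?a ?b s (\<lambda>e. cmod (ana f e) * v e) (2 powr (?a + ?b) * (c * K))"
      proof (rule mixed_weight[OF a(2) b(2) cE _ _ mx])
        show "0 < we e" for e by (rule wt_pos)
        show "e \<in> Ed n \<Longrightarrow> lev e = n" for n e by (rule Ed_lev)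
      qed (rule that)
      have fin: "\<And>k. finite {e\<in>EE. v e < k}" using v(2) unfolding EE_def .
      define K2 where "K2 = 2 powr (?a + ?b) * (c * K)"
      have K2: "0 \<le> K2" using real(1) c(1) by (simp add: K2_def)
      obtain m0 m1 where m: "\<And>e. 0 \<le> m0 e" "\<And>e. 0 \<le> m1 e"
        "\<And>n e. e \<in> Ed n \<Longrightarrow> \<bar>cmod (ana f e) * v e\<bar> = m0 e powr (1 - \<theta>) * m1 e powr \<theta>"
        "mixed Ed we (enn2real (inverse p0)) (enn2real (inverse q0)) s0 m0 K2"
        "mixed Ed we (enn2real (inverse p1)) (enn2real (inverse q1)) s1 m1 K2"
      proof (rule mixed_factorization[OF th enn2real_nonneg enn2real_nonneg enn2real_nonneg enn2real_nonneg a b s _ _ v(3)[folded K2_def]])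
        show "0 < we e" for e by (rule wt_pos)
        show "e \<in> Ed n \<Longrightarrow> lev e = n" for n e by (rule Ed_lev)
      qed (rule that)
      have B0: "synth_bound ?n0 m0 (c0 * K2)" using c0(2) m(1,4) by blast
      have B1: "synth_bound ?n1 m1 (c1 * K2)" using c1(2) m(2,5) by blast
      have \<sigma>: "cmod (sgn (ana f e)) \<le> 1" for e by (simp add: norm_sgn)
      define F where "F z = synth (\<lambda>e. interpolant (sgn (ana f e)) (m0 e / v e) (m1 e / v e) z)" for z
      note adm = admissible_synth_interpolant[where \<sigma> = "\<lambda>e. sgn (ana f e)", OF B0 B1 fin v(1) \<sigma>, folded F_def]
      have thc: "complex_of_real \<theta> \<in> cstrip" using th by (simp add: cstrip_def)
      have val: "interpolant (sgn (ana f e)) (m0 e / v e) (m1 e / v e) (of_real \<theta>) = ana f e" if e: "e \<in> EE" for e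
      proof (rule interpolant_value[OF m(1,2) _ th])
        show "0 < v e" using v(1)[of e] by linarith
        then show "cmod (ana f e) * v e = m0 e powr (1 - \<theta>) * m1 e powr \<theta>" using m(3)[OF EE_Ed[OF e]] by (simp add: abs_mult)
      qed
      have "synthable (ana f)" by (rule synthable_mono[OF adm(3)[OF thc]]) (simp add: val)
      moreover have "cmod (ana f e) \<le> we e powr (- ?a) * 2 powr (- (of_int (lev e) * s)) * (c * K)" if e: "e \<in> EE" for e
        using mixed_pointwise[OF mx enn2real_nonneg enn2real_nonneg EE_Ed[OF e] wt_pos] by simp
      moreover have "0 \<le> c * K" using c(1) real(1) by simp
      ultimately have "ae_const M (\<lambda>\<zeta>. synth (ana f) \<zeta> - f \<zeta>)" using synth_ana[OF f _ _ enn2real_nonneg _ s'] by blast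
      moreover have "F (of_real \<theta>) = synth (ana f)"
        unfolding F_def synth_def by (intro ext Bochner_Integration.integral_cong) (simp_all add: val)
      ultimately have "ae_const M (\<lambda>\<zeta>. F (of_real \<theta>) \<zeta> - f \<zeta>)" by simp
      then have "cinterp_qnorm M ?n0 ?n1 \<theta> f \<le> adm_qnorm ?n0 ?n1 F"
        unfolding cinterp_qnorm_def using adm(1) by (intro INF_lower) simp
      also have "\<dots> \<le> ennreal (max (c0 * K2) (c1 * K2))" by (rule adm(2))
      also have "max (c0 * K2) (c1 * K2) = d * K" 
      proof -
        have "max (c0 * K2) (c1 * K2) = max c0 c1 * K2" using K2 by (simp add: max_mult_distrib_right)
        then show ?thesis by (simp add: d_def K2_def mult.assoc)
      qed
      also have "ennreal (d * K) = ennreal d * ennreal K" using d real(1) by (intro ennreal_mult) auto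
      finally show ?thesis unfolding real(2) .
    qed
  qed
qed

end

section \<open>Exponents and conclusion\<close>

lemma inverse_eq_ennreal:
  fixes p :: ennreal
  assumes "0 < p"
  shows "inverse p = ennreal (enn2real (inverse p))"
proof (cases p)
  case (real r)
  then show ?thesis using assms by (simp add: inverse_ennreal)
qed simp

text \<open>An infinite exponent has inverse 0; finiteness of one of the two makes the combined
  inverse positive, which both inclusions rely on.\<close>

lemma interpolated_exponent:
  fixes p0 p1 :: ennreal
  assumes p: "0 < p0" "0 < p1" "min p0 p1 < \<infinity>" and th: "0 < \<theta>" "\<theta> < 1"
  defines "p \<equiv> inverse (ennreal (1 - \<theta>) * inverse p0 + ennreal \<theta> * inverse p1)"
  shows "0 < p" "enn2real (inverse p) = (1 - \<theta>) * enn2real (inverse p0) + \<theta> * enn2real (inverse p1)"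
    "0 < enn2real (inverse p)"
proof -
  let ?a0 = "enn2real (inverse p0)" and ?a1 = "enn2real (inverse p1)"
  define a where "a = (1 - \<theta>) * ?a0 + \<theta> * ?a1"
  have "0 < ?a0 \<or> 0 < ?a1"
    using p(3) by (cases rule: exponent_cases[OF p(1)]; cases rule: exponent_cases[OF p(2)]) auto
  then have a: "0 < a" using th by (auto simp: a_def intro: add_pos_nonneg add_nonneg_pos)
  have "ennreal (1 - \<theta>) * inverse p0 + ennreal \<theta> * inverse p1 = ennreal (1 - \<theta>) * ennreal ?a0 + ennreal \<theta> * ennreal ?a1"
    by (simp only: inverse_eq_ennreal[OF p(1), symmetric] inverse_eq_ennreal[OF p(2), symmetric])
  also have "\<dots> = ennreal a" using th by (simp add: a_def ennreal_mult)
  finally have "p = inverse (ennreal a)" by (simp add: p_def)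
  then have P: "p = ennreal (inverse a)" using a by (simp add: inverse_ennreal)
  show "0 < p" using a by (simp add: P)
  show "enn2real (inverse p) = (1 - \<theta>) * ?a0 + \<theta> * ?a1" "0 < enn2real (inverse p)"
    using a by (simp_all add: P inverse_ennreal a_def[symmetric])
qed

text \<open>Rewrites the lower bound on the exponent as the decay condition for the fine part of the
  synthesis kernel.\<close>

lemma exponent_lower_bound:
  assumes Q: "0 < Q" and s: "0 < s" and p: "ennreal (Q / (Q + s)) < p"
  shows "0 < p" "Q * (enn2real (inverse p) - 1) < s"
proof -
  show p0: "0 < p" using p by (rule le_less_trans[rotated]) simp
  from p0 show "Q * (enn2real (inverse p) - 1) < s"
  proof (cases rule: exponent_cases)
    case 1
    then show ?thesis using Q s by simp
  next
    case (2 r)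
    then have "Q / (Q + s) < r" using p Q s by (simp add: ennreal_less_iff)
    then have "Q < r * (Q + s)" using Q s by (simp add: field_simps)
    then have "Q * (1 / r - 1) < s" using 2(1) by (simp add: field_simps)
    then show ?thesis unfolding 2(5) .
  qed
qed

theorem theorem4p2:
  fixes M :: "'z::metric_space measure" and cd C Q :: real
    and Xs :: "int \<Rightarrow> 'z set"
    and s0 s1 \<theta> :: real and p0 p1 q0 q1 :: ennreal
  assumes "doubling_mms M cd" and "dim_const M C Q" and "hyp_filling Xs"
    and "0 < s0" "s0 < 1" "0 < s1" "s1 < 1"
    and "ennreal (Q / (Q + s0)) < p0" and "ennreal (Q / (Q + s1)) < p1"
    and "0 < q0" and "0 < q1"
    and "min p0 p1 < \<infinity>" and "min q0 q1 < \<infinity>"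
    and "0 < \<theta>" and "\<theta> < 1"
  shows "\<exists>c>0. \<forall>f. loc_int M f \<longrightarrow>
     (let p = inverse (ennreal (1 - \<theta>) * inverse p0 + ennreal \<theta> * inverse p1);
          q = inverse (ennreal (1 - \<theta>) * inverse q0 + ennreal \<theta> * inverse q1);
          s = (1 - \<theta>) * s0 + \<theta> * s1;
          nI = cinterp_qnorm M (besov_qnorm M Xs s0 p0 q0) (besov_qnorm M Xs s1 p1 q1) \<theta> f;
          nB = besov_qnorm M Xs s p q f
      in nI \<le> ennreal c * nB \<and> nB \<le> ennreal c * nI)"
proof -
  interpret filling M cd C Q Xs using assms(1-3) by unfold_locales
  note P0 = exponent_lower_bound[OF Q0 assms(4,8)] and P1 = exponent_lower_bound[OF Q0 assms(6,9)]
  note p = interpolated_exponent[OF P0(1) P1(1) assms(12,14,15)]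
  note q = interpolated_exponent[OF assms(10,11,13,14,15)]
  define s where "s = (1 - \<theta>) * s0 + \<theta> * s1"
  let ?p = "inverse (ennreal (1 - \<theta>) * inverse p0 + ennreal \<theta> * inverse p1)"
  let ?q = "inverse (ennreal (1 - \<theta>) * inverse q0 + ennreal \<theta> * inverse q1)"
  let ?I = "cinterp_qnorm M (besov_qnorm M Xs s0 p0 q0) (besov_qnorm M Xs s1 p1 q1) \<theta>"
  let ?B = "besov_qnorm M Xs s ?p ?q"
  obtain c1 where c1: "c1 > 0" "\<forall>f. loc_int M f \<longrightarrow> ?B f \<le> ennreal c1 * ?I f"
    using besov_le_cinterp[OF P0(1) assms(10) P1(1) assms(11) p(1) q(1) assms(14,15) p(2,3) q(2,3) s_def]
    by (elim exE conjE) (rule that)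
  obtain c2 where c2: "c2 > 0" "\<forall>f. loc_int M f \<longrightarrow> ?I f \<le> ennreal c2 * ?B f"
    using cinterp_le_besov[OF P0(1) assms(10) P1(1) assms(11) p(1) q(1) assms(14,15) p(2,3) q(2,3) s_def
      assms(4,5) P0(2) assms(6,7) P1(2)] by (elim exE conjE) (rule that)
  show ?thesis
    unfolding Let_def s_def[symmetric]
  proof (intro exI[of _ "max c1 c2"] conjI allI impI)
    show "0 < max c1 c2" using c1(1) by simp
    fix f assume f: "loc_int M f"
    show "?I f \<le> ennreal (max c1 c2) * ?B f"
      by (rule order_trans[OF c2(2)[rule_format, OF f]]) (intro mult_right_mono ennreal_leI, simp_all)
    show "?B f \<le> ennreal (max c1 c2) * ?I f"
      by (rule order_trans[OF c1(2)[rule_format, OF f]]) (intro mult_right_mono ennreal_leI, simp_all)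
  qed
qed

end
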